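(* Let $T>0$ and let $L$ be the cylindrical Lévy process in a separable Banach space $V$ defined by $$L(t)v^*:=W(\ell(t))v^*\qquad\text{for all }v^*\in V^*,\ t\ge0,$$ where $W$ denotes a cylindrical Wiener process in $V$ with covariance operator $C$ and $\ell$ is a real valued subordinator, independent of $W$, with characteristics $(0,0,\rho)$. Let $E\subseteq V$ be a subspace which, with a norm $\|\cdot\|_E$, is a separable Banach space of type $p\in[1,2]$, and let $(T(t))_{t\in[0,T]}$ be a strongly continuous semigroup on $V$ with $T(t)(V)\subseteq E$ for almost all $t>0$. If the semigroup $(T(t))_{t\in[0,T]}$ is weakly in $\mathcal G([0,T];V^* )$ and the mapping $T(t)\circ i_C$ is in $R(H_C,E)$ for almost all $t\in[0,T]$, then $$\int_0^\infty\int_0^T\Big(|r|^{p/2}\,\|T(s)\circ i_C\|_{R_p(H_C,E)}^p\wedge1\Big)\,ds\,\rho(dr)<\infty$$ implies that the semigroup $(T(t))_{t\in[0,T]}$ is stochastically integrable with respect to $L$ and the stochastic integral is $E$-valued.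
   Context: Type is Rademacher type. $H_C$ is the reproducing kernel Hilbert space of $C:V^*\to V$ with embedding $i_C:H_C\to V$, $C=i_Ci_C^*$. $R(H_C,E)$ is the space of $\gamma$-radonifying operators $g:H_C\to E$, and for $g\in R(H_C,E)$, $p\in[1,\infty)$, $\|g\|_{R_p(H_C,E)}^p:=E\big[\|\sum_{k=1}^\infty\gamma_kgh_k\|_E^p\big]$ (the outer $E$ being expectation), where $(\gamma_k)$ are independent real standard normal random variables and $(h_k)$ is an orthonormal basis of $H_C$. A subordinator with characteristics $(0,0,\rho)$ is an increasing real Lévy process with $E[e^{-\beta\ell(t)}]=\exp(-t\int_0^\infty(1-e^{-\beta s})\rho(ds))$, $\beta>0$. Cylindrical objects. $\langle\cdot,\cdot\rangle$ is the dual pairing of $V$ and $V^*$; $B_{\mathbb R}=[-1,1]$; $(\Omega,\mathcal A,P)$ is a probability space; $L^0_P(\Omega;\cdot)$ denotes (classes of) random variables with the topology of convergence in probability. Cylindrical sets are sets $\{v\in V:(\langle v,v_1^*\rangle,\dots,\langle v,v_n^*\rangle)\in B\}$, $v_i^*\in V^*$, $B\in\mathcal B(\mathbb R^n)$; they form the algebra $\mathcal Z(V)$. A cylindrical measure on $\mathcal Z(V)$ is a map $\mathcal Z(V)\to[0,\infty]$ whose restriction to the $\sigma$-algebra generated by the cylindrical sets with $v_i^*\in\Gamma$ is a measure for every finite $\Gamma\subseteq V^*$. It is a cylindrical Lévy measure if $\int_V(\langle v,v^*\rangle^2\wedge1)\mu(dv)<\infty$ for all $v^*$. A cylindrical random variable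 in $V$ is a linear continuous map $V^*\to L^0_P(\Omega;\mathbb R)$. A family $(L(t):t\ge0)$ of cylindrical random variables is a cylindrical Lévy process in $V$ if $((L(t)v_1^*,\dots,L(t)v_n^* ):t\ge0)$ is a Lévy process in $\mathbb R^n$ for all $v_1^*,\dots,v_n^*\in V^*$, $n\in\mathbb N$. Then $E[e^{iL(t)v^*}]=e^{t\Psi(v^* )}$, where $\Psi(v^* )=ia(v^* )-\tfrac12\langle v^*,Qv^*\rangle+\int_V(e^{i\langle v,v^*\rangle}-1-i\langle v,v^*\rangle1_{B_{\mathbb R}}(\langle v,v^*\rangle))\mu(dv)$; $(a,Q,\mu)$ are the cylindrical characteristics, with $\mu$ a cylindrical Lévy measure. A cylindrical Wiener process with covariance operator $C$ is a cylindrical Lévy process with characteristics $(0,C,0)$. Stochastic integrability. $\mathcal G([0,T];V^* )$ is the space of regulated functions $g:[0,T]\to V^*$ (one-sided limits exist everywhere), with supremum norm. $f:[0,T]\to\mathcal L(V,V)$ (bounded linear operators) is weakly in $\mathcal G([0,T];V^* )$ if $f^*(\cdot)v^*\in\mathcal G([0,T];V^* )$ for each $v^*\in V^*$, where $f^*(s)$ is the adjoint of $f(s)$. For a simple function $g$ with value $v_k^*$ on $(t_k,t_{k+1})$, $0=t_0\le\dots\le t_m=T$, put $J(g)=\sum_{k=0}^{m-1}(L(t_{k+1})-L(t_k))v_k^*$. $J$ is extended to $\mathcal G([0,T];V^* )$ by continuity: $J(g)=\lim_nJ(g_n)$ in probability for simple $g_n\to g$ uniformly. As part of the setting it is asserted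 that $\tau g\in\mathcal G([0,T];V^* )$ for every bounded measurable $\tau:[0,T]\to\mathbb R$ and $g\in\mathcal G([0,T];V^* )$; accordingly $1_A(\cdot)f^*(\cdot)v^*$ is taken as an element of $\mathcal G([0,T];V^* )$ for each $A\in\mathcal B([0,T])$. The cylindrical integral of $f$ on $A$ is $Z_A:V^*\to L^0_P(\Omega;\mathbb R)$, $Z_Av^*=J(1_A(\cdot)f^*(\cdot)v^* )$; it is a cylindrical random variable with $E[e^{iZ_Av^*}]=\exp(\int_A\Psi(f^*(s)v^* )ds)$. $f$ is stochastically integrable w.r.t. $L$ if it is weakly in $\mathcal G([0,T];V^* )$ and for each $A\in\mathcal B([0,T])$ there is $I_A\in L^0_P(\Omega;V)$ with $\langle I_A,v^*\rangle=Z_Av^*$ for all $v^*\in V^*$; then $\int_Af(s)\,dL(s):=I_A$. The semigroup is stochastically integrable if $f(t)=T(t)$ is.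
   Formalization: E is taken to be continuously embedded in V (the claim fails otherwise); since 1_A f*v* need not be regulated for Borel A, J is extended to it by limits in probability along uniformly bounded, a.e. convergent sequences of regulated functions. *)

theory Defs
  imports "HOL-Probability.Probability"
begin

type_synonym 'v dual = "'v \<Rightarrow>\<^sub>L real"

text \<open>
  Elements of \<open>L\<^sup>0\<close> are represented by random variables; equality of classes
  is almost sure equality.
\<close>

definition conv_in_prob :: "'w measure \<Rightarrow> (nat \<Rightarrow> 'w \<Rightarrow> real) \<Rightarrow> ('w \<Rightarrow> real) \<Rightarrow> bool" where
  "conv_in_prob M X Y \<longleftrightarrow>
     (\<forall>e>0. (\<lambda>n. measure M {w \<in> space M. e < \<bar>X n w - Y w\<bar>}) \<longlonglongrightarrow> 0)"

definition generated_sigma :: "'w measure \<Rightarrow> 'i set \<Rightarrow> ('i \<Rightarrow> 'w \<Rightarrow> real) \<Rightarrow> 'w set set" where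
  "generated_sigma M J X =
     sigma_sets (space M) {X i -` B \<inter> space M | i B. i \<in> J \<and> B \<in> sets borel}"


subsection \<open>Levy processes and subordinators\<close>

text \<open>
  A process in \<open>\<real>\<^sup>n\<close> is a family \<open>X t w i\<close> with coordinates \<open>i < n\<close>; coordinates
  \<open>i \<ge> n\<close> are irrelevant. Paths are almost surely right-continuous with left limits.
\<close>

definition levy_process :: "'w measure \<Rightarrow> nat \<Rightarrow> (real \<Rightarrow> 'w \<Rightarrow> nat \<Rightarrow> real) \<Rightarrow> bool" where
  "levy_process M n X \<longleftrightarrow>
     (\<forall>t\<ge>0. \<forall>i<n. (\<lambda>w. X t w i) \<in> borel_measurable M) \<and>
     (AE w in M. \<forall>i<n. X 0 w i = 0) \<and>
     (\<forall>(m::nat) t. 0 \<le> t 0 \<and> (\<forall>k<m. t k \<le> t (Suc k)) \<longrightarrow>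
        prob_space.indep_vars M (\<lambda>_. Pi\<^sub>M {..<n} (\<lambda>_. borel))
          (\<lambda>k w. \<lambda>i\<in>{..<n}. X (t (Suc k)) w i - X (t k) w i) {..<m}) \<and>
     (\<forall>s t. 0 \<le> s \<and> s \<le> t \<longrightarrow>
        distr M (Pi\<^sub>M {..<n} (\<lambda>_. borel)) (\<lambda>w. \<lambda>i\<in>{..<n}. X t w i - X s w i) =
        distr M (Pi\<^sub>M {..<n} (\<lambda>_. borel)) (\<lambda>w. \<lambda>i\<in>{..<n}. X (t - s) w i)) \<and>
     (\<forall>s\<ge>0. \<forall>u. (\<forall>k. 0 \<le> u k) \<and> u \<longlonglongrightarrow> s \<longrightarrow>
        (\<forall>i<n. conv_in_prob M (\<lambda>k w. X (u k) w i) (\<lambda>w. X s w i))) \<and>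
     (AE w in M. \<forall>i<n. \<forall>t\<ge>0.
        ((\<lambda>s. X s w i) \<longlongrightarrow> X t w i) (at_right t) \<and>
        (0 < t \<longrightarrow> (\<exists>l. ((\<lambda>s. X s w i) \<longlongrightarrow> l) (at_left t))))"

text \<open>
  Subordinator with characteristics \<open>(0, 0, \<rho>)\<close>. The measure \<open>\<rho>\<close> lives on \<open>(0, \<infinity>)\<close>;
  finiteness of \<open>\<integral> (s \<and> 1) \<rho>(ds)\<close> makes the Laplace exponent a genuine
  (not defaulted) Bochner integral.
\<close>

definition subordinator :: "'w measure \<Rightarrow> real measure \<Rightarrow> (real \<Rightarrow> 'w \<Rightarrow> real) \<Rightarrow> bool" where
  "subordinator M \<rho> l \<longleftrightarrow>
     levy_process M 1 (\<lambda>t w _. l t w) \<and>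
     (AE w in M. \<forall>s t. 0 \<le> s \<and> s \<le> t \<longrightarrow> l s w \<le> l t w) \<and>
     sets \<rho> = sets borel \<and> emeasure \<rho> {..0} = 0 \<and>
     (\<integral>\<^sup>+s\<in>{0<..}. ennreal (min s 1) \<partial>\<rho>) < \<infinity> \<and>
     (\<forall>t\<ge>0. \<forall>\<beta>>0. (\<integral>w. exp (- \<beta> * l t w) \<partial>M) =
        exp (- t * (LINT s:{0<..}|\<rho>. 1 - exp (- \<beta> * s))))"


subsection \<open>Cylindrical objects\<close>

text \<open>The \<open>\<sigma>\<close>-algebra generated by the cylindrical sets with functionals in \<open>G\<close>.\<close>

definition cyl_sigma :: "'v::real_normed_vector dual set \<Rightarrow> 'v set set" where
  "cyl_sigma G = sigma_sets UNIV {blinfun_apply v -` B | v B. v \<in> G \<and> B \<in> sets borel}"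

definition cylindrical_measure :: "('v::real_normed_vector set \<Rightarrow> ennreal) \<Rightarrow> bool" where
  "cylindrical_measure \<mu> \<longleftrightarrow> (\<forall>G. finite G \<longrightarrow> measure_space UNIV (cyl_sigma G) \<mu>)"

definition cylindrical_levy_measure :: "('v::real_normed_vector set \<Rightarrow> ennreal) \<Rightarrow> bool" where
  "cylindrical_levy_measure \<mu> \<longleftrightarrow> cylindrical_measure \<mu> \<and>
     (\<forall>v. (\<integral>\<^sup>+x. ennreal (min ((blinfun_apply v x)\<^sup>2) 1) \<partial>measure_of UNIV (cyl_sigma {v}) \<mu>) < \<infinity>)"

definition cylindrical_rv ::
  "'w measure \<Rightarrow> ('v::real_normed_vector dual \<Rightarrow> 'w \<Rightarrow> real) \<Rightarrow> bool" where
  "cylindrical_rv M X \<longleftrightarrow>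
     (\<forall>v. X v \<in> borel_measurable M) \<and>
     (\<forall>a b u v. AE w in M. X (a *\<^sub>R u + b *\<^sub>R v) w = a * X u w + b * X v w) \<and>
     (\<forall>u v. u \<longlonglongrightarrow> v \<longrightarrow> conv_in_prob M (\<lambda>n. X (u n)) (X v))"

definition cylindrical_levy_process ::
  "'w measure \<Rightarrow> (real \<Rightarrow> 'v::real_normed_vector dual \<Rightarrow> 'w \<Rightarrow> real) \<Rightarrow> bool" where
  "cylindrical_levy_process M L \<longleftrightarrow>
     (\<forall>t\<ge>0. cylindrical_rv M (L t)) \<and>
     (\<forall>n v. levy_process M n (\<lambda>t w i. L t (v i) w))"

definition levy_symbol ::
  "('v::real_normed_vector dual \<Rightarrow> real) \<Rightarrow> ('v dual \<Rightarrow> 'v) \<Rightarrow> ('v set \<Rightarrow> ennreal) \<Rightarrow> 'v dual \<Rightarrow> complex"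
  where
  "levy_symbol a Q \<mu> v =
     \<i> * complex_of_real (a v) - complex_of_real (blinfun_apply v (Q v) / 2) +
     (\<integral>x. iexp (blinfun_apply v x) - 1
            - \<i> * complex_of_real (blinfun_apply v x * indicator {-1..1} (blinfun_apply v x))
        \<partial>measure_of UNIV (cyl_sigma {v}) \<mu>)"

definition has_cyl_characteristics ::
  "'w measure \<Rightarrow> (real \<Rightarrow> 'v::real_normed_vector dual \<Rightarrow> 'w \<Rightarrow> real) \<Rightarrow>
     ('v dual \<Rightarrow> real) \<Rightarrow> ('v dual \<Rightarrow> 'v) \<Rightarrow> ('v set \<Rightarrow> ennreal) \<Rightarrow> bool" where
  "has_cyl_characteristics M L a Q \<mu> \<longleftrightarrow>
     cylindrical_levy_measure \<mu> \<and>
     (\<forall>t\<ge>0. \<forall>v. (\<integral>w. iexp (L t v w) \<partial>M) = exp (complex_of_real t * levy_symbol a Q \<mu> v))"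

definition cylindrical_wiener ::
  "'w measure \<Rightarrow> ('v::real_normed_vector dual \<Rightarrow> 'v) \<Rightarrow> (real \<Rightarrow> 'v dual \<Rightarrow> 'w \<Rightarrow> real) \<Rightarrow> bool" where
  "cylindrical_wiener M C W \<longleftrightarrow>
     cylindrical_levy_process M W \<and> has_cyl_characteristics M W (\<lambda>_. 0) C (\<lambda>_. 0)"


subsection \<open>Reproducing kernel Hilbert space and radonifying operators\<close>

text \<open>
  The Hilbert space \<open>'h\<close> with embedding \<open>i\<close> is the reproducing kernel Hilbert space of \<open>C\<close>:
  \<open>C = i i\<^sup>*\<close>, with \<open>H\<close> identified with its dual. These conditions determine the pair
  up to an isometric isomorphism.
\<close>

definition is_rkhs ::
  "('v::real_normed_vector dual \<Rightarrow> 'v) \<Rightarrow> ('h::{real_inner, complete_space} \<Rightarrow>\<^sub>L 'v) \<Rightarrow> bool" where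
  "is_rkhs C i \<longleftrightarrow> inj (blinfun_apply i) \<and>
     (\<exists>i_star. (\<forall>v x. inner (i_star v) x = blinfun_apply v (blinfun_apply i x)) \<and>
               (\<forall>v. C v = blinfun_apply i (i_star v)))"

text \<open>
  Zero entries are allowed so that a finite orthonormal basis (of a finite-dimensional space)
  is also a sequence; they do not contribute to the Gaussian series.
\<close>

definition orthonormal_basis :: "(nat \<Rightarrow> 'h::real_inner) \<Rightarrow> bool" where
  "orthonormal_basis h \<longleftrightarrow>
     (\<forall>j k. j \<noteq> k \<longrightarrow> inner (h j) (h k) = 0) \<and>
     (\<forall>k. h k = 0 \<or> norm (h k) = 1) \<and>
     closure (span (range h)) = UNIV"

text \<open>The coordinates under this measure are independent standard normal variables.\<close>

definition gauss_space :: "(nat \<Rightarrow> real) measure" where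
  "gauss_space = Pi\<^sub>M UNIV (\<lambda>_. std_normal_distribution)"

text \<open>\<open>X = \<Sum>k. \<gamma>\<^sub>k g h\<^sub>k\<close>, with convergence in \<open>L\<^sup>2\<close>.\<close>

definition gaussian_series ::
  "(nat \<Rightarrow> 'h::real_inner) \<Rightarrow> ('h \<Rightarrow> 'e::real_normed_vector) \<Rightarrow> ((nat \<Rightarrow> real) \<Rightarrow> 'e) \<Rightarrow> bool" where
  "gaussian_series h g X \<longleftrightarrow> X \<in> borel_measurable gauss_space \<and>
     (\<lambda>n. \<integral>\<^sup>+\<gamma>. ennreal ((norm ((\<Sum>k<n. \<gamma> k *\<^sub>R g (h k)) - X \<gamma>))\<^sup>2) \<partial>gauss_space)
       \<longlonglongrightarrow> 0"

text \<open>Neither of the following notions depends on the choice of the orthonormal basis \<open>h\<close>.\<close>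

definition gamma_radonifying ::
  "(nat \<Rightarrow> 'h::real_inner) \<Rightarrow> ('h \<Rightarrow> 'e::real_normed_vector) \<Rightarrow> bool" where
  "gamma_radonifying h g \<longleftrightarrow> bounded_linear g \<and> (\<exists>X. gaussian_series h g X)"

text \<open>The \<open>p\<close>-th power of the norm in \<open>R\<^sub>p\<close>; the limit \<open>X\<close> is almost surely unique.\<close>

definition R_norm_pow ::
  "real \<Rightarrow> (nat \<Rightarrow> 'h::real_inner) \<Rightarrow> ('h \<Rightarrow> 'e::real_normed_vector) \<Rightarrow> ennreal" where
  "R_norm_pow p h g =
     (\<integral>\<^sup>+\<gamma>. ennreal (norm ((SOME X. gaussian_series h g X) \<gamma>) powr p) \<partial>gauss_space)"

text \<open>Under the product measure the coordinates are independent Rademacher variables.\<close>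

definition rademacher_type :: "'e::real_normed_vector itself \<Rightarrow> real \<Rightarrow> bool" where
  "rademacher_type _ p \<longleftrightarrow>
     (\<exists>K. \<forall>n (x :: nat \<Rightarrow> 'e).
        measure_pmf.expectation (Pi_pmf {..<n} 0 (\<lambda>_. pmf_of_set {-1, 1}))
          (\<lambda>\<epsilon>. norm (\<Sum>k<n. \<epsilon> k *\<^sub>R x k) powr p)
        \<le> K * (\<Sum>k<n. norm (x k) powr p))"


subsection \<open>Stochastic integration\<close>

definition regulated :: "real \<Rightarrow> (real \<Rightarrow> 'b::topological_space) \<Rightarrow> bool" where
  "regulated T g \<longleftrightarrow>
     (\<forall>t. 0 \<le> t \<and> t < T \<longrightarrow> (\<exists>l. (g \<longlongrightarrow> l) (at_right t))) \<and>
     (\<forall>t. 0 < t \<and> t \<le> T \<longrightarrow> (\<exists>l. (g \<longlongrightarrow> l) (at_left t)))"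

definition adjoint_apply ::
  "('v::real_normed_vector \<Rightarrow>\<^sub>L 'v) \<Rightarrow> 'v dual \<Rightarrow> 'v dual" where
  "adjoint_apply F v = v o\<^sub>L F"

definition weakly_regulated ::
  "real \<Rightarrow> (real \<Rightarrow> 'v::real_normed_vector \<Rightarrow>\<^sub>L 'v) \<Rightarrow> bool" where
  "weakly_regulated T f \<longleftrightarrow> (\<forall>v. regulated T (\<lambda>s. adjoint_apply (f s) v))"

text \<open>
  \<open>(m, t, v)\<close> represents the simple function \<open>g\<close>; the values of \<open>g\<close> at the partition
  points are unrestricted.
\<close>

definition represents_simple ::
  "real \<Rightarrow> (real \<Rightarrow> 'b) \<Rightarrow> nat \<Rightarrow> (nat \<Rightarrow> real) \<Rightarrow> (nat \<Rightarrow> 'b) \<Rightarrow> bool" where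
  "represents_simple T g m t v \<longleftrightarrow> t 0 = 0 \<and> t m = T \<and>
     (\<forall>k<m. t k \<le> t (Suc k) \<and> (\<forall>s\<in>{t k<..<t (Suc k)}. g s = v k))"

definition simple_integral ::
  "(real \<Rightarrow> 'v::real_normed_vector dual \<Rightarrow> 'w \<Rightarrow> real) \<Rightarrow> nat \<Rightarrow> (nat \<Rightarrow> real) \<Rightarrow> (nat \<Rightarrow> 'v dual) \<Rightarrow> 'w \<Rightarrow> real"
  where
  "simple_integral L m t v w = (\<Sum>k<m. L (t (Suc k)) (v k) w - L (t k) (v k) w)"

text \<open>
  \<open>X\<close> is a version of \<open>J(g)\<close> for regulated \<open>g\<close>: it is the limit in probability of the integrals
  of every sequence of simple functions that converges uniformly to \<open>g\<close>.
\<close>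

definition is_J ::
  "'w measure \<Rightarrow> (real \<Rightarrow> 'v::real_normed_vector dual \<Rightarrow> 'w \<Rightarrow> real) \<Rightarrow> real \<Rightarrow>
     (real \<Rightarrow> 'v dual) \<Rightarrow> ('w \<Rightarrow> real) \<Rightarrow> bool" where
  "is_J M L T g X \<longleftrightarrow> X \<in> borel_measurable M \<and>
     (\<exists>\<phi> m t v. (\<forall>n. represents_simple T (\<phi> n) (m n) (t n) (v n)) \<and>
                uniform_limit {0..T} \<phi> g sequentially) \<and>
     (\<forall>\<phi> m t v. (\<forall>n::nat. represents_simple T (\<phi> n) (m n) (t n) (v n)) \<and>
                uniform_limit {0..T} \<phi> g sequentially \<longrightarrow>
        conv_in_prob M (\<lambda>n. simple_integral L (m n) (t n) (v n)) X)"

text \<open>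
  For a general Borel set \<open>A\<close> the function \<open>1\<^sub>A g\<close> with \<open>g\<close> regulated need not be regulated,
  so it need not be a uniform limit of simple functions. The map \<open>J\<close> is therefore extended once
  more, along uniformly bounded sequences of regulated functions that converge Lebesgue-almost
  everywhere. If \<open>h\<close> is itself regulated, the constant sequence shows that nothing changes.
\<close>

definition bounded_ae_approx ::
  "real \<Rightarrow> (nat \<Rightarrow> real \<Rightarrow> 'b::real_normed_vector) \<Rightarrow> (real \<Rightarrow> 'b) \<Rightarrow> bool" where
  "bounded_ae_approx T g h \<longleftrightarrow>
     (\<forall>n. regulated T (g n)) \<and>
     (\<exists>K. \<forall>n. \<forall>s\<in>{0..T}. norm (g n s) \<le> K) \<and>
     (AE s in lborel. s \<in> {0..T} \<longrightarrow> (\<lambda>n. g n s) \<longlonglongrightarrow> h s)"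

definition is_J_ext ::
  "'w measure \<Rightarrow> (real \<Rightarrow> 'v::real_normed_vector dual \<Rightarrow> 'w \<Rightarrow> real) \<Rightarrow> real \<Rightarrow>
     (real \<Rightarrow> 'v dual) \<Rightarrow> ('w \<Rightarrow> real) \<Rightarrow> bool" where
  "is_J_ext M L T h X \<longleftrightarrow> X \<in> borel_measurable M \<and>
     (\<exists>g Y. bounded_ae_approx T g h \<and> (\<forall>n. is_J M L T (g n) (Y n))) \<and>
     (\<forall>g Y. bounded_ae_approx T g h \<and> (\<forall>n. is_J M L T (g n) (Y n)) \<longrightarrow> conv_in_prob M Y X)"

text \<open>\<open>Z\<close> is a version of the cylindrical integral \<open>Z\<^sub>A v\<close> of \<open>f\<close> on \<open>A\<close>.\<close>

definition is_cyl_integral ::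
  "'w measure \<Rightarrow> (real \<Rightarrow> 'v::real_normed_vector dual \<Rightarrow> 'w \<Rightarrow> real) \<Rightarrow> real \<Rightarrow>
     (real \<Rightarrow> 'v \<Rightarrow>\<^sub>L 'v) \<Rightarrow> real set \<Rightarrow> 'v dual \<Rightarrow> ('w \<Rightarrow> real) \<Rightarrow> bool" where
  "is_cyl_integral M L T f A v Z \<longleftrightarrow>
     is_J_ext M L T (\<lambda>s. indicator A s *\<^sub>R adjoint_apply (f s) v) Z"

definition has_stoch_integral ::
  "'w measure \<Rightarrow> (real \<Rightarrow> 'v::real_normed_vector dual \<Rightarrow> 'w \<Rightarrow> real) \<Rightarrow> real \<Rightarrow>
     (real \<Rightarrow> 'v \<Rightarrow>\<^sub>L 'v) \<Rightarrow> real set \<Rightarrow> ('w \<Rightarrow> 'v) \<Rightarrow> bool" where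
  "has_stoch_integral M L T f A I \<longleftrightarrow> I \<in> borel_measurable M \<and>
     (\<forall>v. is_cyl_integral M L T f A v (\<lambda>w. blinfun_apply v (I w)))"

definition stochastically_integrable ::
  "'w measure \<Rightarrow> (real \<Rightarrow> 'v::real_normed_vector dual \<Rightarrow> 'w \<Rightarrow> real) \<Rightarrow> real \<Rightarrow>
     (real \<Rightarrow> 'v \<Rightarrow>\<^sub>L 'v) \<Rightarrow> bool" where
  "stochastically_integrable M L T f \<longleftrightarrow> weakly_regulated T f \<and>
     (\<forall>A\<in>sets borel. A \<subseteq> {0..T} \<longrightarrow> (\<exists>I. has_stoch_integral M L T f A I))"

definition c0_semigroup_on :: "real \<Rightarrow> (real \<Rightarrow> 'v::real_normed_vector \<Rightarrow>\<^sub>L 'v) \<Rightarrow> bool" where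
  "c0_semigroup_on T S \<longleftrightarrow> S 0 = id_blinfun \<and>
     (\<forall>s t. 0 \<le> s \<and> 0 \<le> t \<and> s + t \<le> T \<longrightarrow> S (s + t) = S s o\<^sub>L S t) \<and>
     (\<forall>x. continuous_on {0..T} (\<lambda>t. blinfun_apply (S t) x))"

text \<open>
  A continuously embedded subspace \<open>E\<close> of \<open>V\<close> with its own norm is a type \<open>'e\<close> together with
  an injective bounded linear \<open>j : 'e \<rightarrow> V\<close>, \<open>E = range j\<close>. The following is \<open>T(t) \<circ> i\<^sub>C\<close>
  as a map into \<open>E\<close>; it is meaningful when \<open>S t\<close> maps \<open>V\<close> into \<open>range j\<close>.
\<close>

definition into_subspace ::
  "('e::real_normed_vector \<Rightarrow>\<^sub>L 'v::real_normed_vector) \<Rightarrow> ('v \<Rightarrow>\<^sub>L 'v) \<Rightarrow> ('h::real_normed_vector \<Rightarrow>\<^sub>L 'v) \<Rightarrow> 'h \<Rightarrow> 'e"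
  where
  "into_subspace j F i x = inv_into UNIV (blinfun_apply j) (blinfun_apply F (blinfun_apply i x))"

end

(*
  Conditionally on the subordinator, the integral of a deterministic weakly measurable function
  g : [0,T] -> H_C is Gaussian, so its characteristic function is exp(-energy g) with
  energy g = integral over s of phi(|g s|^2 / 2), where phi is the Laplace exponent of l. Hence the
  scalar integral extends by continuity in the energy, and it agrees with the regulated-function
  integral J.

  For an E-valued step function with Gaussian coefficients, the same formula shows that the integral
  has the law of a sum over the steps of sqrt(increment of l) times independent Gaussian vectors.
  Flipping the signs of the summands preserves this law, so type p bounds E[1 min |Y|^p] by the
  p/2-th moments of the increments truncated at 1, and these are controlled by rho through a
  subordination formula for x^(p/2). Approximating s -> T(s) i_C by step functions with values in a
  countable family, chosen to be nearly optimal in the Gaussian p-norm at each time, the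
  hypothesis dominates all error terms; the step integrals are Cauchy in probability in E, and
  testing their limit with functionals identifies it as the stochastic integral.
*)
theory Submission
  imports Defs
begin

text \<open>Two measurability problems shape the argument. The orbit s -> T(s) i h_k lies in E for
  almost every s, but it is continuous only for the topology of V; its Borel measurability as an
  E-valued map needs a separation argument of Lusin for images under the injection \<open>j\<close>.
  The R_p norm is defined through a chosen limit of the Gaussian series, and its measurability in s
  is not known; the limsup of the Gaussian norms of partial sums, which is measurable and at most
  four times the p-th power of that norm, is used in its place, and the hypothesis enters by
  monotonicity alone. Since the subordinator may have no moments, every quantity is truncated at 1.
  What ties the scalar theory to the hypothesis is 1 - exp(-d^2 r/2) <= min 1 (r^(p/2) d^p), valid
  because p <= 2: up to constants, the energy of an error and the E-valued moment are bounded by the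
  same double integral. Finally, L(t)v is only a version of W(l(t))v for fixed t and v, so relations
  between increments hold outside null sets that must be kept countable in number; hence W is
  sampled at dyadic times just above l(t).\<close>

section \<open>Norming functionals and countable separating families\<close>

lemma hahn_banach_norm:
  fixes x :: "'v::real_normed_vector"
  obtains v :: "'v \<Rightarrow>\<^sub>L real" where "norm v \<le> 1" "blinfun_apply v x = norm x"
proof -
  \<comment> \<open>Zorn's lemma is applied to graphs of partial functionals, as subspaces of the
    product with the reals. Domination by the norm makes such a graph single-valued: the difference
    of two values over one point is dominated by the norm of 0.\<close>
  define \<A> where "\<A> = {G :: ('v \<times> real) set. subspace G \<and> (x, norm x) \<in> G \<and> (\<forall>(y, a)\<in>G. a \<le> norm y)}"
  have "\<exists>G\<in>\<A>. \<forall>X\<in>\<A>. G \<subseteq> X \<longrightarrow> X = G"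
  proof (rule subset_Zorn_nonempty)
    have "c * norm x \<le> \<bar>c\<bar> * norm x" for c
      by (simp add: mult_right_mono)
    then have "\<forall>(y, a)\<in>span {(x, norm x)}. a \<le> norm y"
      by (auto simp: span_singleton)
    then have "span {(x, norm x)} \<in> \<A>"
      unfolding \<A>_def by (simp add: span_base)
    then show "\<A> \<noteq> {}" by auto
  next
    fix \<C> assume ne: "\<C> \<noteq> {}" and ch: "subset.chain \<A> \<C>"
    have sub: "\<C> \<subseteq> \<A>" using ch by (simp add: subset_chain_def)
    have "subspace (\<Union>\<C>)"
      unfolding subspace_def
    proof (intro conjI ballI allI)
      obtain X where "X \<in> \<C>" using ne by blast
      then show "0 \<in> \<Union>\<C>" using sub subspace_0[of X] by (auto simp: \<A>_def)
    next
      fix a b assume "a \<in> \<Union>\<C>" "b \<in> \<Union>\<C>"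
      then obtain A B where AB: "A \<in> \<C>" "B \<in> \<C>" "a \<in> A" "b \<in> B" by auto
      then have "A \<subseteq> B \<or> B \<subseteq> A" using ch by (auto simp: subset_chain_def)
      then obtain D where "D \<in> \<C>" "a \<in> D" "b \<in> D" using AB by auto
      moreover from this have "subspace D" using sub by (auto simp: \<A>_def)
      ultimately show "a + b \<in> \<Union>\<C>" using subspace_add[of D a b] by blast
    next
      fix c a assume "a \<in> \<Union>\<C>"
      then obtain D where D: "D \<in> \<C>" "a \<in> D" by blast
      then have "subspace D" using sub by (auto simp: \<A>_def)
      then show "c *\<^sub>R a \<in> \<Union>\<C>" using subspace_scale[of D a c] D by blast
    qed
    then show "\<Union>\<C> \<in> \<A>" using sub ne unfolding \<A>_def by auto
  qed
  then obtain G where G: "G \<in> \<A>" and max: "\<And>X. X \<in> \<A> \<Longrightarrow> G \<subseteq> X \<Longrightarrow> X = G" by blast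
  have sG: "subspace G" and xG: "(x, norm x) \<in> G" and bG: "\<And>y a. (y, a) \<in> G \<Longrightarrow> a \<le> norm y"
    using G by (auto simp: \<A>_def)
  have addG: "(y + y', a + a') \<in> G" if "(y, a) \<in> G" "(y', a') \<in> G" for y a y' a'
    using subspace_add[OF sG that] by simp
  have scG: "(c *\<^sub>R y, c * a) \<in> G" if "(y, a) \<in> G" for c y a
    using subspace_scale[OF sG that, of c] by simp
  have zG: "(0, 0) \<in> G" using subspace_0[OF sG] by (simp add: zero_prod_def)
  have tot: "\<exists>a. (z, a) \<in> G" for z
  proof -
    \<comment> \<open>The value given to \<open>z\<close> may be any number between the supremum of
      \<open>a - norm (y - z)\<close> and the infimum of \<open>norm (y + z) - a\<close>;
      \<open>cross\<close> shows that such a number exists. There is no case distinction on whether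
      \<open>z\<close> lies in the domain: maximality gives \<open>G' = G\<close> in either
      case.\<close>
    define c where "c = (SUP (y, a)\<in>G. a - norm (y - z))"
    have cross: "a - norm (y - z) \<le> norm (y' + z) - a'" if "(y, a) \<in> G" "(y', a') \<in> G" for y a y' a'
      using bG[OF addG[OF that]] norm_triangle_ineq[of "y - z" "y' + z"] by simp
    have bdd: "bdd_above ((\<lambda>(y, a). a - norm (y - z)) ` G)"
      using cross[OF _ zG] by (intro bdd_aboveI2[where M="norm (0 + z) - 0"]) auto
    have c1: "a - norm (y - z) \<le> c" if "(y, a) \<in> G" for y a
      unfolding c_def using cSUP_upper[OF that bdd] by simp
    have c2: "c \<le> norm (y + z) - a" if "(y, a) \<in> G" for y a
      unfolding c_def using zG cross[OF _ that] by (intro cSUP_least) auto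
    define G' where "G' = {(y + t *\<^sub>R z, a + t * c) | y a t. (y, a) \<in> G}"
    have "subspace G'"
      unfolding subspace_def
    proof (intro conjI ballI allI)
      have "0 = (0 + 0 *\<^sub>R z, 0 + 0 * c)" by (simp add: zero_prod_def)
      then show "0 \<in> G'" unfolding G'_def using zG by blast
    next
      fix u w assume "u \<in> G'" "w \<in> G'"
      then obtain y a t y' a' t' where *: "u = (y + t *\<^sub>R z, a + t * c)" "w = (y' + t' *\<^sub>R z, a' + t' * c)"
        "(y, a) \<in> G" "(y', a') \<in> G" unfolding G'_def by blast
      have "u + w = ((y + y') + (t + t') *\<^sub>R z, (a + a') + (t + t') * c)"
        using * by (simp add: algebra_simps)
      then show "u + w \<in> G'" unfolding G'_def using addG[OF *(3,4)] by blast
    next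
      fix k u assume "u \<in> G'"
      then obtain y a t where *: "u = (y + t *\<^sub>R z, a + t * c)" "(y, a) \<in> G" unfolding G'_def by blast
      have "k *\<^sub>R u = (k *\<^sub>R y + (k * t) *\<^sub>R z, k * a + (k * t) * c)"
        using * by (simp add: algebra_simps)
      then show "k *\<^sub>R u \<in> G'" unfolding G'_def using scG[OF *(2)] by blast
    qed
    moreover have GG': "G \<subseteq> G'"
    proof
      fix u assume "u \<in> G"
      moreover obtain y a where "u = (y, a)" by (cases u)
      ultimately have "u = (y + 0 *\<^sub>R z, a + 0 * c)" "(y, a) \<in> G" by auto
      then show "u \<in> G'" unfolding G'_def by blast
    qed
    moreover have "a + t * c \<le> norm (y + t *\<^sub>R z)" if yG: "(y, a) \<in> G" for y a t
    proof (cases t "0::real" rule: linorder_cases)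
      case less
      have "(- inverse t) * a - norm ((- inverse t) *\<^sub>R y - z) \<le> c" by (rule c1[OF scG[OF yG]])
      then have "(-t) * ((- inverse t) * a - norm ((- inverse t) *\<^sub>R y - z)) \<le> (-t) * c"
        using less by (intro mult_left_mono) auto
      moreover have "(-t) * norm ((- inverse t) *\<^sub>R y - z) = norm ((-t) *\<^sub>R ((- inverse t) *\<^sub>R y - z))"
        using less by simp
      moreover have "(-t) *\<^sub>R ((- inverse t) *\<^sub>R y - z) = y + t *\<^sub>R z" using less by (simp add: algebra_simps)
      ultimately show ?thesis using less by (simp add: algebra_simps)
    next
      case equal
      then show ?thesis using bG[OF yG] by simp
    next
      case greater
      have "c \<le> norm (inverse t *\<^sub>R y + z) - inverse t * a" by (rule c2[OF scG[OF yG]])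
      then have "t * c \<le> t * (norm (inverse t *\<^sub>R y + z) - inverse t * a)"
        using greater by (intro mult_left_mono) auto
      moreover have "t * norm (inverse t *\<^sub>R y + z) = norm (t *\<^sub>R (inverse t *\<^sub>R y + z))"
        using greater by simp
      moreover have "t *\<^sub>R (inverse t *\<^sub>R y + z) = y + t *\<^sub>R z" using greater by (simp add: algebra_simps)
      ultimately show ?thesis using greater by (simp add: algebra_simps)
    qed
    ultimately have "subspace G'" and "(x, norm x) \<in> G'" and "\<forall>(y, a)\<in>G'. a \<le> norm y"
      using xG unfolding G'_def by blast+
    then have "G' \<in> \<A>" unfolding \<A>_def by blast
    then have "G' = G" using max GG' by blast
    moreover have "(z, c) \<in> G'"
    proof -
      have "(z, c) = (0 + 1 *\<^sub>R z, 0 + 1 * c)" by simp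
      then show ?thesis unfolding G'_def using zG by blast
    qed
    ultimately show ?thesis by auto
  qed
  have uniq: "a = b" if "(y, a) \<in> G" "(y, b) \<in> G" for y a b
    using bG[OF addG[OF that(1) scG[OF that(2), of "-1"]]] bG[OF addG[OF that(2) scG[OF that(1), of "-1"]]]
    by simp
  define f where "f z = (THE a. (z, a) \<in> G)" for z
  have fG: "(z, f z) \<in> G" for z
    unfolding f_def using tot[of z] uniq by (metis theI)
  have f_eq: "f z = a" if "(z, a) \<in> G" for z a using uniq fG that by blast
  have fle: "\<bar>f z\<bar> \<le> norm z" for z
    using bG[OF fG[of z]] bG[OF scG[OF fG[of z], of "-1"]] by simp
  have bl: "bounded_linear f"
    by (rule bounded_linear_intro[where K=1]) (auto intro!: f_eq addG scG fG simp: fle)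
  show ?thesis
  proof (rule that[of "Blinfun f"])
    show "norm (Blinfun f) \<le> 1"
      by (rule norm_blinfun_bound) (auto simp: bounded_linear_Blinfun_apply[OF bl] fle)
    show "blinfun_apply (Blinfun f) x = norm x"
      by (simp add: bounded_linear_Blinfun_apply[OF bl] f_eq[OF xG])
  qed
qed

text \<open>The norming functionals of a countable dense set separate points: if they all vanish at
  x, each dense d has norm d = N d (d - x) <= norm (d - x), which fails for d close to a nonzero
  x.\<close>

lemma dual_separates_countable:
  obtains vs :: "nat \<Rightarrow> 'v::{real_normed_vector, second_countable_topology} \<Rightarrow>\<^sub>L real"
  where "\<And>x. (\<And>n. blinfun_apply (vs n) x = 0) \<Longrightarrow> x = 0"
proof -
  obtain D :: "'v set" where D: "countable D" "\<And>X. open X \<Longrightarrow> X \<noteq> {} \<Longrightarrow> \<exists>d\<in>D. d \<in> X"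
    using countable_dense_setE by blast
  have ne: "D \<noteq> {}" using D(2)[of UNIV] by auto
  have "\<exists>v :: 'v \<Rightarrow>\<^sub>L real. norm v \<le> 1 \<and> blinfun_apply v x = norm x" for x
    by (metis hahn_banach_norm)
  then obtain N where N: "\<And>x. norm (N x :: 'v \<Rightarrow>\<^sub>L real) \<le> 1" "\<And>x. blinfun_apply (N x) x = norm x"
    by metis
  show ?thesis
  proof (rule that[of "\<lambda>n. N (from_nat_into D n)"])
    fix x assume *: "\<And>n. blinfun_apply (N (from_nat_into D n)) x = 0"
    show "x = 0"
    proof (rule ccontr)
      assume "x \<noteq> 0"
      then obtain d where d: "d \<in> D" "d \<in> ball x (norm x / 2)"
        using D(2)[of "ball x (norm x / 2)"] by auto
      obtain n where n: "d = from_nat_into D n" using d(1) D(1) by (metis from_nat_into_surj)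
      have "norm d = blinfun_apply (N d) (d - x)" using * n N(2) by (simp add: blinfun.diff_right)
      also have "\<dots> \<le> norm (N d) * norm (d - x)" by (metis abs_le_D1 norm_blinfun real_norm_def)
      also have "\<dots> \<le> 1 * norm (d - x)" using N(1) by (intro mult_right_mono) auto
      finally have "norm d \<le> norm (d - x)" by simp
      moreover have "norm (x - d) < norm x / 2" using d(2) by (simp add: dist_norm)
      ultimately show False using norm_triangle_ineq2[of x d] by (simp add: norm_minus_commute)
    qed
  qed
qed

subsection \<open>Measurability of inverses of injective continuous maps\<close>

text \<open>Lusin's separation argument: if two closed sets had inseparable images, repeated subdivision
  would produce shrinking pieces with inseparable images around two points.\<close>

lemma disjoint_closed_images_separable:
  fixes j :: "'a::{complete_space, second_countable_topology} \<Rightarrow> 'b::t2_space"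
  assumes cont: "continuous_on UNIV j" and inj: "inj j"
    and A: "closed A" and B: "closed B" and AB: "A \<inter> B = {}"
  obtains D where "D \<in> sets borel" "j ` A \<subseteq> D" "D \<inter> j ` B = {}"
proof -
  define sep where "sep A B \<longleftrightarrow> (\<exists>D\<in>sets borel. j ` A \<subseteq> D \<and> D \<inter> j ` B = {})" for A B
  \<comment> \<open>Separability passes to countable unions, by unions of intersections of the
    individual separators. Contrapositively, an inseparable pair covered by countably many pieces
    contains an inseparable pair of pieces.\<close>
  have sep_UN: "sep A B" if *: "A \<subseteq> (\<Union>n. A' n)" "B \<subseteq> (\<Union>n. B' n)" "\<And>n m. sep (A' n) (B' m)"
    for A B and A' B' :: "nat \<Rightarrow> 'a set"
  proof -
    obtain D where D: "\<And>n m. D n m \<in> sets borel" "\<And>n m. j ` A' n \<subseteq> D n m" "\<And>n m. D n m \<inter> j ` B' m = {}"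
      using *(3) unfolding sep_def by metis
    have "(\<Union>n. \<Inter>m. D n m) \<in> sets borel" using D(1) by auto
    moreover have "j ` A \<subseteq> (\<Union>n. \<Inter>m. D n m)" using *(1) D(2) by fastforce
    moreover have "(\<Union>n. \<Inter>m. D n m) \<inter> j ` B = {}"
    proof -
      have False if "x \<in> B" "\<And>m. j x \<in> D n m" for x n
        using *(2) D(3)[of n] that by blast
      then show ?thesis by blast
    qed
    ultimately show ?thesis unfolding sep_def by blast
  qed
  obtain S :: "'a set" where S: "countable S" "\<And>X. open X \<Longrightarrow> X \<noteq> {} \<Longrightarrow> \<exists>d\<in>S. d \<in> X"
    using countable_dense_setE by blast
  define c where "c = from_nat_into S"
  have cov: "\<exists>n. x \<in> cball (c n) e" if e: "e > 0" for x e
  proof -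
    obtain d where "d \<in> S" "d \<in> ball x e" using S(2)[of "ball x e"] e by auto
    then obtain n where "d = c n" unfolding c_def using S(1) by (metis from_nat_into_surj)
    then show ?thesis using \<open>d \<in> ball x e\<close> by (auto simp: dist_commute intro!: exI[of _ n])
  qed
  have step: "\<exists>n m. \<not> sep (A \<inter> cball (c n) e) (B \<inter> cball (c m) e)" if "\<not> sep A B" "e > 0" for A B e
  proof (rule ccontr)
    assume *: "\<not> ?thesis"
    have "sep A B"
      by (rule sep_UN[of A "\<lambda>n. A \<inter> cball (c n) e" B "\<lambda>n. B \<inter> cball (c n) e"])
        (use cov[OF that(2)] * in \<open>blast+\<close>)
    then show False using that by simp
  qed
  have "sep A B"
  proof (rule ccontr)
    assume ns: "\<not> sep A B"
    \<comment> \<open>The radius bound is imposed only from stage 1 on, so that the given sets can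
      serve as stage 0.\<close>
    define P where "P n X \<longleftrightarrow> (case X of (U, V) \<Rightarrow> closed U \<and> closed V \<and> U \<subseteq> A \<and> V \<subseteq> B \<and> \<not> sep U V \<and>
      (n > 0 \<longrightarrow> (\<exists>a. U \<subseteq> cball a (1 / real n)) \<and> (\<exists>b. V \<subseteq> cball b (1 / real n))))" for n :: nat and X
    have "\<exists>X. P 0 X" using ns A B by (auto simp: P_def)
    moreover have "\<exists>Y. P (Suc n) Y \<and> fst Y \<subseteq> fst X \<and> snd Y \<subseteq> snd X" if PX: "P n X" for n X
    proof -
      obtain U V where X: "X = (U, V)" by (cases X)
      with PX have *: "closed U" "closed V" "U \<subseteq> A" "V \<subseteq> B" "\<not> sep U V" by (auto simp: P_def)
      obtain k l where kl: "\<not> sep (U \<inter> cball (c k) (1 / real (Suc n))) (V \<inter> cball (c l) (1 / real (Suc n)))"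
        using step[OF *(5), of "1 / real (Suc n)"] by auto
      have "P (Suc n) (U \<inter> cball (c k) (1 / real (Suc n)), V \<inter> cball (c l) (1 / real (Suc n)))"
        unfolding P_def using * kl by (auto intro!: closed_Int)
      then show ?thesis using X by (metis Int_lower1 fst_conv snd_conv)
    qed
    ultimately obtain f where f: "\<And>n. P n (f n)" "\<And>n. fst (f (Suc n)) \<subseteq> fst (f n) \<and> snd (f (Suc n)) \<subseteq> snd (f n)"
      using dependent_nat_choice[of P "\<lambda>n X Y. fst Y \<subseteq> fst X \<and> snd Y \<subseteq> snd X"] by blast
    define U where "U n = fst (f n)" for n
    define V where "V n = snd (f n)" for n
    have UV: "closed (U n)" "closed (V n)" "U n \<subseteq> A" "V n \<subseteq> B" "\<not> sep (U n) (V n)" for n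
      using f(1)[of n] by (auto simp: P_def U_def V_def split: prod.splits)
    have ball: "\<exists>a. U n \<subseteq> cball a (1 / real n)" "\<exists>a. V n \<subseteq> cball a (1 / real n)" if "n > 0" for n
      using f(1)[of n] that by (auto simp: P_def U_def V_def split: prod.splits)
    have mono: "m \<le> n \<Longrightarrow> U n \<subseteq> U m" "m \<le> n \<Longrightarrow> V n \<subseteq> V m" for m n
      using f(2) by (auto simp: U_def V_def intro: lift_Suc_antimono_le[of "\<lambda>n. fst (f n)"]
         lift_Suc_antimono_le[of "\<lambda>n. snd (f n)"] del: subsetI)
    have neU: "U n \<noteq> {}" for n using UV(5)[of n] unfolding sep_def by (metis empty_subsetI image_empty inf_bot_left sets.empty_sets)
    have neV: "V n \<noteq> {}" for n using UV(5)[of n] unfolding sep_def by (metis Int_empty_right image_empty sets.top space_borel subset_UNIV)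
    have small: "\<exists>n. \<forall>x\<in>W n. \<forall>y\<in>W n. dist x y < e"
      if Wb: "\<And>n. n > 0 \<Longrightarrow> \<exists>a. W n \<subseteq> cball a (1 / real n)" and e: "e > 0" for W :: "nat \<Rightarrow> 'a set" and e
    proof -
      obtain n where n: "n > 0" "1 / real n < e / 2"
        using real_arch_inverse[of "e/2"] e by (auto simp: inverse_eq_divide)
      obtain a where a: "W n \<subseteq> cball a (1 / real n)" using Wb[OF n(1)] by auto
      have "dist x y < e" if "x \<in> W n" "y \<in> W n" for x y
      proof -
        have "dist a x \<le> 1 / real n" "dist a y \<le> 1 / real n" using that a by auto
        then show ?thesis using n(2) dist_triangle2[of x y a] by (simp add: dist_commute)
      qed
      then show ?thesis by blast
    qed
    obtain a where a: "\<And>n. a \<in> U n"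
      by (rule decreasing_closed_nest[of U]) (use UV(1) neU mono(1) small[OF ball(1)] in \<open>blast+\<close>)
    obtain b where b: "\<And>n. b \<in> V n"
      by (rule decreasing_closed_nest[of V]) (use UV(2) neV mono(2) small[OF ball(2)] in \<open>blast+\<close>)
    \<comment> \<open>Here disjointness of A and B enters. Hausdorff separation of
      \<open>j a\<close> and \<open>j b\<close> together with continuity puts a late pair of pieces
      into disjoint open sets, and an open set is a Borel separator.\<close>
    have "a \<noteq> b" using a[of 0] b[of 0] UV(3,4) AB by blast
    then have "j a \<noteq> j b" using inj by (simp add: inj_eq)
    then obtain Oa Ob where O: "open Oa" "open Ob" "j a \<in> Oa" "j b \<in> Ob" "Oa \<inter> Ob = {}"
      using hausdorff by metis
    have "open (j -` Oa)" "open (j -` Ob)" using cont O by (auto intro: open_vimage)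
    then obtain e where e: "e > 0" "ball a e \<subseteq> j -` Oa" "ball b e \<subseteq> j -` Ob"
    proof -
      obtain e1 where "e1 > 0" "ball a e1 \<subseteq> j -` Oa" using \<open>open (j -` Oa)\<close> O(3) by (meson open_contains_ball vimageI2)
      moreover obtain e2 where "e2 > 0" "ball b e2 \<subseteq> j -` Ob" using \<open>open (j -` Ob)\<close> O(4) by (meson open_contains_ball vimageI2)
      ultimately show ?thesis by (intro that[of "min e1 e2"]) auto
    qed
    obtain n1 where n1: "\<forall>x\<in>U n1. \<forall>y\<in>U n1. dist x y < e" using small[of U] ball(1) e(1) by blast
    obtain n2 where n2: "\<forall>x\<in>V n2. \<forall>y\<in>V n2. dist x y < e" using small[of V] ball(2) e(1) by blast
    define n where "n = max n1 n2"
    have "U n \<subseteq> ball a e" using n1 a mono(1)[of n1 n] by (auto simp: n_def)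
    moreover have "V n \<subseteq> ball b e" using n2 b mono(2)[of n2 n] by (auto simp: n_def)
    ultimately have *: "U n \<subseteq> j -` Oa" "V n \<subseteq> j -` Ob" using e(2,3) by auto
    have "j ` U n \<subseteq> Oa" using *(1) by auto
    moreover have "Oa \<inter> j ` V n = {}" using *(2) O(5) by auto
    ultimately have "sep (U n) (V n)" unfolding sep_def using O(1) by (intro bexI[of _ Oa]) auto
    then show False using UV(5) by blast
  qed
  then show ?thesis using that unfolding sep_def by blast
qed

text \<open>An open set U is a countable union of closed sets, and the image of each is separated by
  a Borel set from the image of the complement of U. The union of these separators meets
  \<open>range j\<close> exactly in the image of U, which exhibits the required set as a preimage
  under \<open>F\<close>.\<close>

lemma borel_measurable_inv:
  fixes j :: "'a::{complete_space, second_countable_topology} \<Rightarrow> 'b::t2_space"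
  assumes cont: "continuous_on UNIV j" and inj: "inj j"
    and F[measurable]: "F \<in> borel_measurable N" and ran: "\<And>s. s \<in> space N \<Longrightarrow> F s \<in> range j"
  shows "(\<lambda>s. inv j (F s)) \<in> borel_measurable N"
proof (rule borel_measurableI)
  fix U :: "'a set" assume U: "open U"
  define B where "B = - U"
  have Bc: "closed B" using U by (simp add: B_def closed_Compl)
  obtain C where C: "\<And>n::nat. closed (C n)" "U = (\<Union>n. C n)"
  \<comment> \<open>The distance to the empty set is 0 by convention, so the case U = UNIV does not
    fit the description by \<open>infdist\<close>.\<close>
  proof (cases "B = {}")
    case True
    then show ?thesis using that[of "\<lambda>_. UNIV"] by (auto simp: B_def)
  next
    case False
    have "x \<in> U \<longleftrightarrow> (\<exists>n. 1 / real (Suc n) \<le> infdist x B)" for x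
    proof -
      have "x \<in> U \<longleftrightarrow> 0 < infdist x B"
        using in_closed_iff_infdist_zero[OF Bc False, of x] infdist_nonneg[of x B] by (auto simp: B_def)
      also have "\<dots> \<longleftrightarrow> (\<exists>n. 1 / real (Suc n) \<le> infdist x B)"
      proof
        assume "0 < infdist x B"
        then show "\<exists>n. 1 / real (Suc n) \<le> infdist x B" using nat_approx_posE by (metis less_imp_le)
      next
        assume "\<exists>n. 1 / real (Suc n) \<le> infdist x B"
        then obtain n where "1 / real (Suc n) \<le> infdist x B" ..
        moreover have "0 < 1 / real (Suc n)" by simp
        ultimately show "0 < infdist x B" by linarith
      qed
      finally show ?thesis .
    qed
    then show ?thesis
      by (intro that[of "\<lambda>n. {x. 1 / real (Suc n) \<le> infdist x B}"])
        (auto intro!: closed_Collect_le continuous_intros)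
  qed
  have "\<exists>D\<in>sets borel. j ` C n \<subseteq> D \<and> D \<inter> j ` B = {}" for n
  proof -
    have "C n \<inter> B = {}" using C(2) by (auto simp: B_def)
    then show ?thesis using disjoint_closed_images_separable[OF cont inj C(1)[of n] Bc] by metis
  qed
  then obtain D where D: "\<And>n. D n \<in> sets borel" "\<And>n. j ` C n \<subseteq> D n" "\<And>n. D n \<inter> j ` B = {}" by metis
  have "(\<lambda>s. inv j (F s)) -` U \<inter> space N = F -` (\<Union>n. D n) \<inter> space N"
  proof (intro set_eqI iffI; clarsimp)
    fix s assume s: "inv j (F s) \<in> U" "s \<in> space N"
    then have "F s = j (inv j (F s))" using ran by (simp add: f_inv_into_f)
    then show "\<exists>n. F s \<in> D n" using s C(2) D(2) by (metis UN_E image_subset_iff)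
  next
    fix s n assume s: "s \<in> space N" "F s \<in> D n"
    then obtain a where a: "F s = j a" using ran by blast
    then have "a \<notin> B" using s D(3) by blast
    then show "inv j (F s) \<in> U" using a inj by (simp add: B_def)
  qed
  also have "\<dots> \<in> sets N" using D(1) by (intro measurable_sets[OF F]) auto
  finally show "(\<lambda>s. inv j (F s)) -` U \<inter> space N \<in> sets N" .
qed

subsection \<open>Orthonormal bases and the reproducing kernel Hilbert space\<close>

lemma norm_sum_orthonormal:
  fixes h :: "nat \<Rightarrow> 'h::real_inner"
  assumes "orthonormal_basis h"
  shows "(norm (\<Sum>k<n. c k *\<^sub>R h k))\<^sup>2 = (\<Sum>k<n. (c k)\<^sup>2 * (norm (h k))\<^sup>2)"
proof (induction n)
  case (Suc n)
  have "inner (\<Sum>k<n. c k *\<^sub>R h k) (c n *\<^sub>R h n) = 0"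
    using assms by (auto simp: inner_sum_left orthonormal_basis_def intro!: sum.neutral)
  then show ?case using Suc
    by (simp add: norm_add_Pythagorean orthogonal_def power_mult_distrib del: inner_scaleR_right)
qed simp

text \<open>Zero vectors are allowed among the \<open>h k\<close>, which is why \<open>n01\<close>
  replaces normalisation. The maps y - P n y do not increase the norm and vanish eventually at each
  element of the span, so density gives P n x -> x.\<close>

lemma orthonormal_basis_parseval:
  fixes h :: "nat \<Rightarrow> 'h::real_inner"
  assumes ob: "orthonormal_basis h"
  shows "(\<lambda>k. (inner x (h k))\<^sup>2) sums (norm x)\<^sup>2"
proof -
  have orth: "inner (h j) (h k) = (if j = k then (norm (h k))\<^sup>2 else 0)" for j k
    using ob by (auto simp: orthonormal_basis_def power2_norm_eq_inner)
  have n01: "(norm (h k))\<^sup>2 * inner y (h k) = inner y (h k)" for k y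
    using ob by (cases "h k = 0") (auto simp: orthonormal_basis_def)
  define P where "P n y = (\<Sum>k<n. inner y (h k) *\<^sub>R h k)" for n y
  have normP: "(norm (P n y))\<^sup>2 = (\<Sum>k<n. (inner y (h k))\<^sup>2)" for n y
    unfolding P_def norm_sum_orthonormal[OF ob]
    by (intro sum.cong refl) (metis n01 mult.commute power2_eq_square mult.assoc)
  have PP: "inner y (P n y) = (norm (P n y))\<^sup>2" for n y
    unfolding normP by (simp add: P_def inner_sum_right power2_eq_square)
  have diff: "(norm (y - P n y))\<^sup>2 = (norm y)\<^sup>2 - (norm (P n y))\<^sup>2" for n y
    using PP[of y n] by (simp add: power2_norm_eq_inner inner_diff_left inner_diff_right inner_commute)
  have P1: "norm (y - P n y) \<le> norm y" for n y
  proof (rule power2_le_imp_le)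
    show "(norm (y - P n y))\<^sup>2 \<le> (norm y)\<^sup>2" unfolding diff by simp
  qed simp
  have Plin: "P n (y - z) = P n y - P n z" for n y z
    by (simp add: P_def inner_diff_left scaleR_left_diff_distrib sum_subtractf)
  have spanP: "\<exists>N. \<forall>n\<ge>N. P n y = y" if "y \<in> span (range h)" for y
    using that
  proof (induction rule: span_induct_alt)
    case base
    then show ?case by (simp add: P_def)
  next
    case (step c z y)
    then obtain m where m: "z = h m" by auto
    obtain N where N: "\<And>n. n \<ge> N \<Longrightarrow> P n y = y" using step by auto
    have "P n (c *\<^sub>R z + y) = c *\<^sub>R z + y" if n: "n \<ge> max N (Suc m)" for n
    proof -
      have "P n (c *\<^sub>R h m + y) = (\<Sum>k<n. (c * inner (h m) (h k)) *\<^sub>R h k) + P n y"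
        by (simp add: P_def inner_add_left scaleR_left_distrib sum.distrib)
      also have "(\<Sum>k<n. (c * inner (h m) (h k)) *\<^sub>R h k) = (\<Sum>k<n. if k = m then c *\<^sub>R h m else 0)"
      proof (intro sum.cong refl)
        fix k show "(c * inner (h m) (h k)) *\<^sub>R h k = (if k = m then c *\<^sub>R h m else 0)"
          using ob orth[of m k] by (cases "h k = 0") (auto simp: orthonormal_basis_def)
      qed
      also have "\<dots> = c *\<^sub>R h m" using n by simp
      finally show ?thesis using N n m by simp
    qed
    then show ?case by blast
  qed
  have "(\<lambda>n. norm (x - P n x)) \<longlonglongrightarrow> 0"
  proof (rule LIMSEQ_I)
    fix e :: real assume e: "e > 0"
    have "x \<in> closure (span (range h))" using ob by (simp add: orthonormal_basis_def)
    then obtain y where y: "y \<in> span (range h)" "norm (x - y) < e"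
      using e by (metis closure_approachable dist_norm norm_minus_commute)
    obtain N where N: "\<And>n. n \<ge> N \<Longrightarrow> P n y = y" using spanP[OF y(1)] by auto
    have "norm (norm (x - P n x) - 0) < e" if "n \<ge> N" for n
    proof -
      have "x - P n x = (x - y) - P n (x - y)" using N[OF that] by (simp add: Plin)
      then have "norm (x - P n x) \<le> norm (x - y)" by (simp only: P1)
      then show ?thesis using y(2) by simp
    qed
    then show "\<exists>no. \<forall>n\<ge>no. norm (norm (x - P n x) - 0) < e" by blast
  qed
  then have "(\<lambda>n. (norm x)\<^sup>2 - (norm (x - P n x))\<^sup>2) \<longlonglongrightarrow> (norm x)\<^sup>2 - 0\<^sup>2"
    by (intro tendsto_intros)
  then have "(\<lambda>n. \<Sum>k<n. (inner x (h k))\<^sup>2) \<longlonglongrightarrow> (norm x)\<^sup>2"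
    unfolding diff normP by simp
  then show ?thesis by (simp add: sums_def)
qed

text \<open>Projection onto the closure of S: a minimising sequence for the distance from x is
  Cauchy by the parallelogram identity, and the difference between x and its limit is orthogonal to
  S, hence zero.\<close>

lemma subspace_dense_if_orthogonal_trivial:
  fixes S :: "'h::{real_inner, complete_space} set"
  assumes S: "subspace S" and triv: "\<And>z. (\<And>s. s \<in> S \<Longrightarrow> inner s z = 0) \<Longrightarrow> z = 0"
  shows "closure S = UNIV"
proof -
  have "x \<in> closure S" for x
  proof -
    have ne: "S \<noteq> {}" using subspace_0[OF S] by auto
    define d where "d = infdist x S"
    have dle: "d \<le> norm (x - s)" if "s \<in> S" for s
      unfolding d_def using infdist_le[OF that] by (simp add: dist_norm)
    have "\<exists>s\<in>S. norm (x - s) < d + 1 / real (Suc n)" for n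
    proof (rule ccontr)
      assume "\<not> ?thesis"
      then have "d + 1 / real (Suc n) \<le> (INF s\<in>S. dist x s)"
        using ne by (intro cINF_greatest) (auto simp: dist_norm not_less)
      moreover have "1 / real (Suc n) > 0" by simp
      ultimately show False using ne by (simp add: d_def infdist_notempty)
    qed
    then obtain s where s: "\<And>n. s n \<in> S" "\<And>n. norm (x - s n) < d + 1 / real (Suc n)" by metis
    have d0: "d \<ge> 0" by (simp add: d_def infdist_nonneg)
    have par: "(norm (s m - s n))\<^sup>2 \<le> 2 * (norm (x - s m))\<^sup>2 + 2 * (norm (x - s n))\<^sup>2 - 4 * d\<^sup>2" for m n
    proof -
      have "(1/2) *\<^sub>R (s m + s n) \<in> S" using s(1) S by (intro subspace_scale subspace_add)
      then have "d\<^sup>2 \<le> (norm (x - (1/2) *\<^sub>R (s m + s n)))\<^sup>2" using dle d0 by (intro power_mono) auto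
      moreover have "4 * (norm (x - (1/2) *\<^sub>R (s m + s n)))\<^sup>2 + (norm (s m - s n))\<^sup>2
          = 2 * (norm (x - s m))\<^sup>2 + 2 * (norm (x - s n))\<^sup>2"
        unfolding power2_norm_eq_inner
        by (simp add: inner_diff_left inner_diff_right inner_add_left inner_add_right inner_commute algebra_simps)
      ultimately show ?thesis by simp
    qed
    have up: "(\<lambda>n. d + 1 / real (Suc n)) \<longlonglongrightarrow> d + 0"
      by (intro tendsto_add tendsto_const LIMSEQ_Suc[OF lim_1_over_n])
    have lim: "(\<lambda>n. norm (x - s n)) \<longlonglongrightarrow> d"
    proof (rule tendsto_sandwich[rotated 3])
      show "(\<lambda>n. d + 1 / real (Suc n)) \<longlonglongrightarrow> d" using up by simp
      show "(\<lambda>_. d) \<longlonglongrightarrow> d" by simp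
      show "\<forall>\<^sub>F n in sequentially. d \<le> norm (x - s n)" using dle[OF s(1)] by simp
      show "\<forall>\<^sub>F n in sequentially. norm (x - s n) \<le> d + 1 / real (Suc n)"
        using less_imp_le[OF s(2)] by (intro always_eventually allI)
    qed
    have "Cauchy s"
    proof (rule metric_CauchyI)
      fix e :: real assume e: "e > 0"
      have "(\<lambda>n. 2 * (norm (x - s n))\<^sup>2 - 2 * d\<^sup>2) \<longlonglongrightarrow> 2 * d\<^sup>2 - 2 * d\<^sup>2"
        by (intro tendsto_intros lim)
      then have "\<forall>\<^sub>F n in sequentially. 2 * (norm (x - s n))\<^sup>2 - 2 * d\<^sup>2 < e\<^sup>2 / 2"
        using e by (intro order_tendstoD) auto
      then obtain N where N: "\<And>n. n \<ge> N \<Longrightarrow> 2 * (norm (x - s n))\<^sup>2 - 2 * d\<^sup>2 < e\<^sup>2 / 2"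
        by (auto simp: eventually_sequentially)
      have "dist (s m) (s n) < e" if "m \<ge> N" "n \<ge> N" for m n
      proof -
        have "(norm (s m - s n))\<^sup>2 < e\<^sup>2" using par[of m n] N[OF that(1)] N[OF that(2)] by simp
        then show ?thesis using e by (simp add: dist_norm power_less_imp_less_base)
      qed
      then show "\<exists>M. \<forall>m\<ge>M. \<forall>n\<ge>M. dist (s m) (s n) < e" by blast
    qed
    then obtain y where y: "s \<longlonglongrightarrow> y" using Cauchy_convergent_iff convergent_def by blast
    have yS: "y \<in> closure S" using y s(1) by (auto simp: closure_sequential)
    have nd: "norm (x - y) = d"
      using LIMSEQ_unique[OF lim tendsto_norm[OF tendsto_diff[OF tendsto_const y]]] by simp
    have dle': "d \<le> norm (x - y - t *\<^sub>R u)" if "u \<in> S" for t u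
    proof (rule tendsto_lowerbound[where F=sequentially])
      show "(\<lambda>n. norm (x - (s n + t *\<^sub>R u))) \<longlonglongrightarrow> norm (x - y - t *\<^sub>R u)"
        using y by (auto intro!: tendsto_eq_intros simp: diff_diff_eq)
      show "\<forall>\<^sub>F n in sequentially. d \<le> norm (x - (s n + t *\<^sub>R u))"
        using that s(1) S by (intro always_eventually allI dle subspace_add subspace_scale) auto
    qed simp
    have "inner u (x - y) = 0" if u: "u \<in> S" for u
    proof (rule ccontr)
      assume ne: "inner u (x - y) \<noteq> 0"
      define c where "c = inner u (x - y)"
      have "(norm (x - y))\<^sup>2 \<le> (norm (x - y - t *\<^sub>R u))\<^sup>2" for t
        using dle'[OF u] nd d0 by (intro power_mono) auto
      then have *: "0 \<le> t\<^sup>2 * (norm u)\<^sup>2 - 2 * t * c" for t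
        unfolding power2_norm_eq_inner c_def
        by (simp add: inner_diff_left inner_diff_right inner_commute algebra_simps power2_eq_square)
      have u0: "(norm u)\<^sup>2 > 0" using ne by auto
      \<comment> \<open>The choice t = c / |u|^2 minimises the quadratic in t obtained just
        before.\<close>
      have "0 \<le> (c / (norm u)\<^sup>2)\<^sup>2 * (norm u)\<^sup>2 - 2 * (c / (norm u)\<^sup>2) * c" by (rule *)
      also have "\<dots> = - (c\<^sup>2 / (norm u)\<^sup>2)" using u0 by (simp add: field_simps power2_eq_square)
      also have "\<dots> < 0" using u0 ne by (simp add: c_def)
      finally show False by simp
    qed
    then have "x - y = 0" by (rule triv)
    then show ?thesis using yS by simp
  qed
  then show ?thesis by auto
qed

text \<open>Density of the range comes from injectivity of \<open>i\<close>: a vector z orthogonal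
  to all \<open>istar v\<close> has v (i z) = 0 for every v, so i z = 0 by Hahn-Banach. The identity
  for C expresses the variance of the Wiener process through the Hilbert norm, so that all later
  integrands can take values in H_C.\<close>

lemma rkhs_adjoint:
  fixes C :: "'v::real_normed_vector dual \<Rightarrow> 'v" and i :: "'h::{real_inner, complete_space} \<Rightarrow>\<^sub>L 'v"
  assumes "is_rkhs C i"
  obtains istar where "bounded_linear istar" "\<And>v x. inner (istar v) x = blinfun_apply v (blinfun_apply i x)"
    "\<And>v. blinfun_apply v (C v) = (norm (istar v))\<^sup>2" "closure (range istar) = UNIV"
proof -
  obtain istar where istar: "\<And>v x. inner (istar v) x = blinfun_apply v (blinfun_apply i x)"
    "\<And>v. C v = blinfun_apply i (istar v)" and inj: "inj (blinfun_apply i)"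
    using assms by (auto simp: is_rkhs_def)
  have "bounded_linear istar"
  proof (rule bounded_linear_intro[where K="norm i"])
    show "istar (u + v) = istar u + istar v" for u v
      by (rule vector_eq_rdot[THEN iffD1]) (simp add: istar inner_add_left blinfun.add_left)
    show "istar (c *\<^sub>R v) = c *\<^sub>R istar v" for c v
      by (rule vector_eq_rdot[THEN iffD1]) (simp add: istar blinfun.scaleR_left)
    show "norm (istar v) \<le> norm v * norm i" for v
    proof -
      have "(norm (istar v))\<^sup>2 = blinfun_apply v (blinfun_apply i (istar v))" by (simp add: istar(1)[symmetric] power2_norm_eq_inner)
      also have "\<dots> \<le> norm v * norm (blinfun_apply i (istar v))" by (metis abs_le_D1 norm_blinfun real_norm_def)
      also have "\<dots> \<le> norm v * (norm i * norm (istar v))" by (intro mult_left_mono norm_blinfun) auto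
      finally show ?thesis by (cases "norm (istar v) = 0") (auto simp: power2_eq_square)
    qed
  qed
  moreover have "closure (range istar) = UNIV"
  proof (rule subspace_dense_if_orthogonal_trivial)
    show "subspace (range istar)"
      using \<open>bounded_linear istar\<close> by (simp add: bounded_linear.linear linear_subspace_image)
    fix z assume *: "\<And>s. s \<in> range istar \<Longrightarrow> inner s z = 0"
    obtain v :: "'v dual" where v: "blinfun_apply v (blinfun_apply i z) = norm (blinfun_apply i z)" by (metis hahn_banach_norm)
    have "blinfun_apply i z = 0" using *[of "istar v"] v istar(1)[of v z] by simp
    then show "z = 0" using inj by (metis blinfun.zero_right injD)
  qed
  moreover have "blinfun_apply v (C v) = (norm (istar v))\<^sup>2" for v
    by (metis istar power2_norm_eq_inner)
  ultimately show ?thesis using that istar(1) by blast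
qed

section \<open>Uniqueness of multivariate laws from characteristic functions\<close>

text \<open>The weights become probability densities (2 + a) / k, positive since |a| <= 1, and the
  one-dimensional uniqueness theorem applies to the law of X under the tilted measure. The
  contribution of the constant 2 is then subtracted.\<close>

lemma weighted_char_unique:
  fixes a :: "'a \<Rightarrow> real" and b :: "'b \<Rightarrow> real"
  assumes P: "prob_space P" and Q: "prob_space Q"
    and [measurable]: "X \<in> borel_measurable P" "Y \<in> borel_measurable Q" "a \<in> borel_measurable P" "b \<in> borel_measurable Q"
    and a1: "\<And>w. \<bar>a w\<bar> \<le> 1" and b1: "\<And>w. \<bar>b w\<bar> \<le> 1"
    and XY: "\<And>u. (\<integral>w. iexp (u * X w) \<partial>P) = (\<integral>w. iexp (u * Y w) \<partial>Q)"
    and aXY: "\<And>u. (\<integral>w. a w * iexp (u * X w) \<partial>P) = (\<integral>w. b w * iexp (u * Y w) \<partial>Q)"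
    and S[measurable]: "S \<in> sets borel"
  shows "(\<integral>w. a w * indicator S (X w) \<partial>P) = (\<integral>w. b w * indicator S (Y w) \<partial>Q)"
proof -
  interpret P: prob_space P by fact
  interpret Q: prob_space Q by fact
  \<comment> \<open>Stated for arbitrary weights, so that a = b = 0 yields the constant part to be
    subtracted.\<close>
  have key: "(\<integral>w. (2 + a w) * indicator S (X w) \<partial>P) = (\<integral>w. (2 + b w) * indicator S (Y w) \<partial>Q)"
    if a: "a \<in> borel_measurable P" and b: "b \<in> borel_measurable Q"
      and a1: "\<And>w. \<bar>a w\<bar> \<le> 1" and b1: "\<And>w. \<bar>b w\<bar> \<le> 1"
      and aXY: "\<And>u. (\<integral>w. a w * iexp (u * X w) \<partial>P) = (\<integral>w. b w * iexp (u * Y w) \<partial>Q)"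
    for a :: "'a \<Rightarrow> real" and b :: "'b \<Rightarrow> real"
  proof -
    note [measurable] = a b
    define k where "k = (\<integral>w. 2 + a w \<partial>P)"
    have intP: "integrable P (\<lambda>w. of_real (a w) * iexp (u * X w))" for u
      using a1 by (intro P.integrable_const_bound[where B=1]) (auto simp: norm_mult)
    have intQ: "integrable Q (\<lambda>w. of_real (b w) * iexp (u * Y w))" for u
      using b1 by (intro Q.integrable_const_bound[where B=1]) (auto simp: norm_mult)
    have intP1: "integrable P (\<lambda>w. iexp (u * X w))" for u
      by (intro P.integrable_const_bound[where B=1]) auto
    have intQ1: "integrable Q (\<lambda>w. iexp (u * Y w))" for u
      by (intro Q.integrable_const_bound[where B=1]) auto
    have ia: "integrable P a" using a1 by (intro P.integrable_const_bound[where B=1]) auto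
    have ib: "integrable Q b" using b1 by (intro Q.integrable_const_bound[where B=1]) auto
    \<comment> \<open>At u = 0 the hypothesis says that both tilted measures have the same
      normalising constant.\<close>
    have "complex_of_real (\<integral>w. a w \<partial>P) = of_real (\<integral>w. b w \<partial>Q)" using aXY[of 0] by simp
    then have kQ: "k = (\<integral>w. 2 + b w \<partial>Q)"
      unfolding k_def of_real_eq_iff using ia ib by (simp add: P.prob_space Q.prob_space)
    have "(\<integral>w. (1::real) \<partial>P) \<le> k"
      unfolding k_def
    proof (intro integral_mono)
      show "1 \<le> 2 + a w" for w using a1[of w] by (simp add: abs_le_iff)
    qed (use ia in auto)
    then have k1: "k \<ge> 1" by (simp add: P.prob_space)
    define P' where "P' = density P (\<lambda>w. ennreal ((2 + a w) / k))"
    define Q' where "Q' = density Q (\<lambda>w. ennreal ((2 + b w) / k))"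
    have pa: "0 \<le> (2 + a w) / k" for w using a1[of w] k1 by (simp add: abs_le_iff)
    have pb: "0 \<le> (2 + b w) / k" for w using b1[of w] k1 by (simp add: abs_le_iff)
    have "emeasure P' (space P') = 1"
    proof -
      have "emeasure P' (space P') = (\<integral>\<^sup>+w. ennreal ((2 + a w) / k) \<partial>P)"
        unfolding P'_def by (subst emeasure_density) (auto intro!: nn_integral_cong)
      also have "\<dots> = ennreal (\<integral>w. (2 + a w) / k \<partial>P)" using ia pa by (intro nn_integral_eq_integral) auto
      also have "(\<integral>w. (2 + a w) / k \<partial>P) = 1" using k1 by (simp add: k_def)
      finally show ?thesis by simp
    qed
    then interpret P': prob_space P' by (rule prob_spaceI)
    have "emeasure Q' (space Q') = 1"
    proof -
      have "emeasure Q' (space Q') = (\<integral>\<^sup>+w. ennreal ((2 + b w) / k) \<partial>Q)"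
        unfolding Q'_def by (subst emeasure_density) (auto intro!: nn_integral_cong)
      also have "\<dots> = ennreal (\<integral>w. (2 + b w) / k \<partial>Q)" using ib pb by (intro nn_integral_eq_integral) auto
      also have "(\<integral>w. (2 + b w) / k \<partial>Q) = 1" using k1 by (simp add: kQ)
      finally show ?thesis by simp
    qed
    then interpret Q': prob_space Q' by (rule prob_spaceI)
    have [measurable]: "X \<in> borel_measurable P'" "Y \<in> borel_measurable Q'" by (auto simp: P'_def Q'_def)
    have cP: "char (distr P' borel X) u = (2 * (\<integral>w. iexp (u * X w) \<partial>P) + (\<integral>w. a w * iexp (u * X w) \<partial>P)) / k" for u
    proof -
      have "char (distr P' borel X) u = (\<integral>w. iexp (u * X w) \<partial>P')"
        unfolding char_def by (subst integral_distr) auto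
      also have "\<dots> = (\<integral>w. ((2 + a w) / k) *\<^sub>R iexp (u * X w) \<partial>P)"
        unfolding P'_def using pa by (subst integral_density) auto
      also have "\<dots> = (\<integral>w. (2 * iexp (u * X w) + a w * iexp (u * X w)) / k \<partial>P)"
        by (intro Bochner_Integration.integral_cong refl) (simp add: scaleR_conv_of_real algebra_simps add_divide_distrib)
      also have "\<dots> = (2 * (\<integral>w. iexp (u * X w) \<partial>P) + (\<integral>w. a w * iexp (u * X w) \<partial>P)) / k"
        using intP[of u] intP1[of u] by simp
      finally show ?thesis .
    qed
    have cQ: "char (distr Q' borel Y) u = (2 * (\<integral>w. iexp (u * Y w) \<partial>Q) + (\<integral>w. b w * iexp (u * Y w) \<partial>Q)) / k" for u
    proof -
      have "char (distr Q' borel Y) u = (\<integral>w. iexp (u * Y w) \<partial>Q')"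
        unfolding char_def by (subst integral_distr) auto
      also have "\<dots> = (\<integral>w. ((2 + b w) / k) *\<^sub>R iexp (u * Y w) \<partial>Q)"
        unfolding Q'_def using pb by (subst integral_density) auto
      also have "\<dots> = (\<integral>w. (2 * iexp (u * Y w) + b w * iexp (u * Y w)) / k \<partial>Q)"
        by (intro Bochner_Integration.integral_cong refl) (simp add: scaleR_conv_of_real algebra_simps add_divide_distrib)
      also have "\<dots> = (2 * (\<integral>w. iexp (u * Y w) \<partial>Q) + (\<integral>w. b w * iexp (u * Y w) \<partial>Q)) / k"
        using intQ[of u] intQ1[of u] by simp
      finally show ?thesis .
    qed
    have eq: "distr P' borel X = distr Q' borel Y"
    proof (rule Levy_uniqueness)
      show "char (distr P' borel X) = char (distr Q' borel Y)"
        by (rule ext) (simp only: cP cQ XY aXY)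
    qed (auto intro!: P'.real_distribution_distr Q'.real_distribution_distr)
    have "(\<integral>w. indicat_real S (X w) \<partial>P') = (\<integral>w. indicat_real S (Y w) \<partial>Q')"
    proof -
      have "(\<integral>x. indicat_real S x \<partial>distr P' borel X) = (\<integral>x. indicat_real S x \<partial>distr Q' borel Y)"
        by (simp only: eq)
      then show ?thesis by (subst (asm) (1 2) integral_distr) auto
    qed
    then have "(\<integral>w. ((2 + a w) / k) * indicator S (X w) \<partial>P) = (\<integral>w. ((2 + b w) / k) * indicator S (Y w) \<partial>Q)"
      unfolding P'_def Q'_def using pa pb by (simp add: integral_density)
    then have "(\<integral>w. ((2 + a w) * indicator S (X w)) / k \<partial>P) = (\<integral>w. ((2 + b w) * indicator S (Y w)) / k \<partial>Q)"
      by simp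
    then show ?thesis using k1 by simp
  qed
  have "(\<integral>w. (2 + 0) * indicat_real S (X w) \<partial>P) = (\<integral>w. (2 + 0) * indicator S (Y w) \<partial>Q)"
    by (rule key) auto
  then have 0: "(\<integral>w. 2 * indicat_real S (X w) \<partial>P) = (\<integral>w. 2 * indicator S (Y w) \<partial>Q)"
    by (simp only: add_0_right)
  have 1: "(\<integral>w. (2 + a w) * indicator S (X w) \<partial>P) = (\<integral>w. (2 + b w) * indicator S (Y w) \<partial>Q)"
    by (rule key[OF _ _ a1 b1 aXY]) measurable
  have i1: "integrable P (\<lambda>w. 2 * indicat_real S (X w))"
    by (intro P.integrable_const_bound[where B=2]) (auto simp: indicator_def)
  have i2: "integrable Q (\<lambda>w. 2 * indicat_real S (Y w))"
    by (intro Q.integrable_const_bound[where B=2]) (auto simp: indicator_def)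
  have i3: "integrable P (\<lambda>w. a w * indicat_real S (X w))"
    using a1 by (intro P.integrable_const_bound[where B=1]) (auto simp: indicator_def)
  have i4: "integrable Q (\<lambda>w. b w * indicat_real S (Y w))"
    using b1 by (intro Q.integrable_const_bound[where B=1]) (auto simp: indicator_def)
  show ?thesis
    using 1 unfolding distrib_right Bochner_Integration.integral_add[OF i1 i3] Bochner_Integration.integral_add[OF i2 i4] 0
    by simp
qed

text \<open>Real and imaginary part of the weight are treated separately. This requires the
  hypothesis for the conjugate weight, which is the conjugate of the hypothesis at -u.\<close>

lemma complex_weighted_char_unique:
  fixes c :: "'a \<Rightarrow> complex" and d :: "'b \<Rightarrow> complex"
  assumes P: "prob_space P" and Q: "prob_space Q"
    and [measurable]: "X \<in> borel_measurable P" "Y \<in> borel_measurable Q" "c \<in> borel_measurable P" "d \<in> borel_measurable Q"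
    and c1: "\<And>w. norm (c w) \<le> 1" and d1: "\<And>w. norm (d w) \<le> 1"
    and XY: "\<And>u. (\<integral>w. iexp (u * X w) \<partial>P) = (\<integral>w. iexp (u * Y w) \<partial>Q)"
    and cXY: "\<And>u. (\<integral>w. c w * iexp (u * X w) \<partial>P) = (\<integral>w. d w * iexp (u * Y w) \<partial>Q)"
    and S[measurable]: "S \<in> sets borel"
  shows "(\<integral>w. c w * indicator S (X w) \<partial>P) = (\<integral>w. d w * indicator S (Y w) \<partial>Q)"
proof -
  interpret P: prob_space P by fact
  interpret Q: prob_space Q by fact
  have [measurable]: "cnj \<in> borel_measurable borel"
    by (intro borel_measurable_continuous_onI continuous_intros)
  have iP: "integrable P (\<lambda>w. c w * iexp (u * X w))" "integrable P (\<lambda>w. cnj (c w) * iexp (u * X w))" for u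
    using c1 by (auto intro!: P.integrable_const_bound[where B=1] simp: norm_mult)
  have iQ: "integrable Q (\<lambda>w. d w * iexp (u * Y w))" "integrable Q (\<lambda>w. cnj (d w) * iexp (u * Y w))" for u
    using d1 by (auto intro!: Q.integrable_const_bound[where B=1] simp: norm_mult)
  have cnjXY: "(\<integral>w. cnj (c w) * iexp (u * X w) \<partial>P) = (\<integral>w. cnj (d w) * iexp (u * Y w) \<partial>Q)" for u
  proof -
    have "(\<integral>w. cnj (c w * iexp (- u * X w)) \<partial>P) = (\<integral>w. cnj (d w * iexp (- u * Y w)) \<partial>Q)"
      unfolding Bochner_Integration.integral_cnj by (rule arg_cong[OF cXY])
    then show ?thesis by (simp add: exp_cnj)
  qed
  have re: "complex_of_real (Re z) = (z + cnj z) / 2" and im: "complex_of_real (Im z) = (z - cnj z) / (2 * \<i>)" for z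
    by (auto simp: complex_eq_iff)
  have R: "(\<integral>w. Re (c w) * indicator S (X w) \<partial>P) = (\<integral>w. Re (d w) * indicator S (Y w) \<partial>Q)"
  proof (rule weighted_char_unique[OF P Q _ _ _ _ _ _ XY _ S])
    show "\<bar>Re (c w)\<bar> \<le> 1" "\<bar>Re (d w')\<bar> \<le> 1" for w w'
      using abs_Re_le_cmod[of "c w"] abs_Re_le_cmod[of "d w'"] c1[of w] d1[of w'] by linarith+
    fix u
    have "(\<integral>w. Re (c w) * iexp (u * X w) \<partial>P) = (\<integral>w. (c w * iexp (u * X w) + cnj (c w) * iexp (u * X w)) / 2 \<partial>P)"
      by (simp add: re algebra_simps)
    also have "\<dots> = (\<integral>w. (d w * iexp (u * Y w) + cnj (d w) * iexp (u * Y w)) / 2 \<partial>Q)"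
      using iP[of u] iQ[of u] cXY[of u] cnjXY[of u] by simp
    also have "\<dots> = (\<integral>w. Re (d w) * iexp (u * Y w) \<partial>Q)"
      by (simp add: re algebra_simps)
    finally show "(\<integral>w. Re (c w) * iexp (u * X w) \<partial>P) = (\<integral>w. Re (d w) * iexp (u * Y w) \<partial>Q)" .
  qed auto
  have I: "(\<integral>w. Im (c w) * indicator S (X w) \<partial>P) = (\<integral>w. Im (d w) * indicator S (Y w) \<partial>Q)"
  proof (rule weighted_char_unique[OF P Q _ _ _ _ _ _ XY _ S])
    show "\<bar>Im (c w)\<bar> \<le> 1" "\<bar>Im (d w')\<bar> \<le> 1" for w w'
      using abs_Im_le_cmod[of "c w"] abs_Im_le_cmod[of "d w'"] c1[of w] d1[of w'] by linarith+
    fix u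
    have "(\<integral>w. Im (c w) * iexp (u * X w) \<partial>P) = (\<integral>w. (c w * iexp (u * X w) - cnj (c w) * iexp (u * X w)) / (2 * \<i>) \<partial>P)"
      by (simp add: im algebra_simps)
    also have "\<dots> = (\<integral>w. (d w * iexp (u * Y w) - cnj (d w) * iexp (u * Y w)) / (2 * \<i>) \<partial>Q)"
      using iP[of u] iQ[of u] cXY[of u] cnjXY[of u] by simp
    also have "\<dots> = (\<integral>w. Im (d w) * iexp (u * Y w) \<partial>Q)"
      by (simp add: im algebra_simps)
    finally show "(\<integral>w. Im (c w) * iexp (u * X w) \<partial>P) = (\<integral>w. Im (d w) * iexp (u * Y w) \<partial>Q)" .
  qed auto
  have iR: "integrable P (\<lambda>w. c w * indicator S (X w))"
    using c1 by (intro P.integrable_const_bound[where B=1]) (auto simp: norm_mult indicator_def)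
  have iS: "integrable Q (\<lambda>w. d w * indicator S (Y w))"
    using d1 by (intro Q.integrable_const_bound[where B=1]) (auto simp: norm_mult indicator_def)
  have ReI: "Re (z * indicator S x) = Re z * indicator S x" "Im (z * indicator S x) = Im z * indicator S x" for z and x :: real
    by (auto simp: indicator_def)
  show ?thesis
    using R I by (simp add: complex_eq_iff integral_Re[OF iR, symmetric] integral_Im[OF iR, symmetric]
        integral_Re[OF iS, symmetric] integral_Im[OF iS, symmetric] ReI del: times_complex.simps)
qed

text \<open>Coordinates are treated one at a time: the product of the indicators already obtained,
  times the full exponential, is a bounded complex weight for the next coordinate, and letting the
  frequency of that coordinate vary brings in its indicator. After the last coordinate, zero
  frequencies give equality on boxes.\<close>

theorem multivariate_char_unique:
  fixes X :: "'i \<Rightarrow> 'a \<Rightarrow> real" and Y :: "'i \<Rightarrow> 'b \<Rightarrow> real"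
  assumes P: "prob_space P" and Q: "prob_space Q" and fin: "finite B"
    and X[measurable]: "\<And>b. b \<in> B \<Longrightarrow> X b \<in> borel_measurable P"
    and Y[measurable]: "\<And>b. b \<in> B \<Longrightarrow> Y b \<in> borel_measurable Q"
    and eq: "\<And>u. (\<integral>w. iexp (\<Sum>b\<in>B. u b * X b w) \<partial>P) = (\<integral>w. iexp (\<Sum>b\<in>B. u b * Y b w) \<partial>Q)"
  shows "distr P (Pi\<^sub>M B (\<lambda>_. borel)) (\<lambda>w. \<lambda>b\<in>B. X b w) = distr Q (Pi\<^sub>M B (\<lambda>_. borel)) (\<lambda>w. \<lambda>b\<in>B. Y b w)"
proof -
  interpret P: prob_space P by fact
  interpret Q: prob_space Q by fact
  have claim: "(\<integral>w. (\<Prod>b\<in>D. indicator (A b) (X b w)) * iexp (\<Sum>b\<in>B. u b * X b w) \<partial>P) =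
      (\<integral>w. (\<Prod>b\<in>D. indicator (A b) (Y b w)) * iexp (\<Sum>b\<in>B. u b * Y b w) \<partial>Q)"
    if "D \<subseteq> B" and A: "\<And>b. b \<in> D \<Longrightarrow> A b \<in> sets borel" for D u and A :: "'i \<Rightarrow> real set"
  proof -
    have "finite D" using that(1) fin by (rule finite_subset)
    then show ?thesis using that
    proof (induction arbitrary: u)
      case empty
      then show ?case using eq by simp
    next
      case (insert b D)
      have bB: "b \<in> B" and DB: "D \<subseteq> B" using insert.prems by auto
      have [measurable]: "X b \<in> borel_measurable P" "Y b \<in> borel_measurable Q" using bB by auto
      have [measurable]: "A b \<in> sets borel" using insert.prems by auto
      have Am: "A d \<in> sets borel" "d \<in> B" if "d \<in> D" for d using insert.prems that by auto
      have prod1: "norm (\<Prod>b\<in>D. indicator (A b) (z b) :: complex) \<le> 1" for z :: "'i \<Rightarrow> real"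
        unfolding prod_norm[symmetric] by (intro prod_le_1) (auto simp: indicator_def)
      \<comment> \<open>Raising the frequency \<open>u b\<close> by t multiplies the weight by exp(i
        t X b), so the induction hypothesis at the shifted frequency is the weighted identity needed
        for coordinate b.\<close>
      have upd: "(\<Sum>d\<in>B. (u(b := u b + t)) d * z d) = (\<Sum>d\<in>B. u d * z d) + t * z b" for t and z :: "'i \<Rightarrow> real"
        using fin bB by (simp add: sum.remove[of B b] algebra_simps)
      have upd0: "(\<Sum>d\<in>B. (if d = b then t else 0) * z d) = t * z b" for t and z :: "'i \<Rightarrow> real"
        using fin bB by (simp add: sum.remove[of B b])
      have "(\<integral>w. (\<Prod>b\<in>D. indicator (A b) (X b w)) * iexp (\<Sum>b\<in>B. u b * X b w) * indicator (A b) (X b w) \<partial>P) =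
        (\<integral>w. (\<Prod>b\<in>D. indicator (A b) (Y b w)) * iexp (\<Sum>b\<in>B. u b * Y b w) * indicator (A b) (Y b w) \<partial>Q)"
      proof (rule complex_weighted_char_unique[OF P Q])
        show "(\<integral>w. iexp (t * X b w) \<partial>P) = (\<integral>w. iexp (t * Y b w) \<partial>Q)" for t
          using eq[of "\<lambda>d. if d = b then t else 0"] by (simp add: upd0)
        show "(\<integral>w. (\<Prod>b\<in>D. indicator (A b) (X b w)) * iexp (\<Sum>b\<in>B. u b * X b w) * iexp (t * X b w) \<partial>P) =
            (\<integral>w. (\<Prod>b\<in>D. indicator (A b) (Y b w)) * iexp (\<Sum>b\<in>B. u b * Y b w) * iexp (t * Y b w) \<partial>Q)" for t
          using insert.IH[OF DB, of "u(b := u b + t)"] insert.prems(2)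
          unfolding upd by (simp add: distrib_left exp_add mult.assoc)
      qed (use prod1 Am in \<open>auto simp: norm_mult intro!: borel_measurable_times borel_measurable_prod\<close>)
      then show ?case using insert.hyps by (simp add: mult_ac)
    qed
  qed
  show ?thesis
  proof (rule measure_eqI_PiM_finite[OF fin])
    fix A :: "'i \<Rightarrow> real set" assume A: "\<And>b. b \<in> B \<Longrightarrow> A b \<in> sets borel"
    have ind: "(\<Prod>b\<in>B. indicator (A b) (x b)) = indicat_real (Pi\<^sub>E B A) (\<lambda>b\<in>B. x b)" for x :: "'i \<Rightarrow> real"
      using fin by (auto simp: indicator_def PiE_iff prod_zero_iff intro!: prod.neutral)
    have meas: "Pi\<^sub>E B A \<in> sets (Pi\<^sub>M B (\<lambda>_. borel))" using fin A by (intro sets_PiM_I_finite) auto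
    have mX: "(\<lambda>w. \<lambda>b\<in>B. X b w) \<in> P \<rightarrow>\<^sub>M Pi\<^sub>M B (\<lambda>_. borel)" and mY: "(\<lambda>w. \<lambda>b\<in>B. Y b w) \<in> Q \<rightarrow>\<^sub>M Pi\<^sub>M B (\<lambda>_. borel)"
      by (auto intro!: measurable_restrict)
    have "(\<integral>w. of_real (\<Prod>b\<in>B. indicator (A b) (X b w)) \<partial>P) = (\<integral>w. complex_of_real (\<Prod>b\<in>B. indicator (A b) (Y b w)) \<partial>Q)"
    proof -
      have "complex_of_real (\<Prod>b\<in>B. indicator (A b) (z b)) = (\<Prod>b\<in>B. indicator (A b) (z b))" for z :: "'i \<Rightarrow> real"
        unfolding of_real_prod by (intro prod.cong) (auto simp: indicator_def)
      then show ?thesis using claim[of B A "\<lambda>_. 0", OF subset_refl A] by simp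
    qed
    then have "(\<integral>w. indicat_real (Pi\<^sub>E B A) (\<lambda>b\<in>B. X b w) \<partial>P) = (\<integral>w. indicat_real (Pi\<^sub>E B A) (\<lambda>b\<in>B. Y b w) \<partial>Q)"
      unfolding ind by simp
    then have "measure (distr P (Pi\<^sub>M B (\<lambda>_. borel)) (\<lambda>w. \<lambda>b\<in>B. X b w)) (Pi\<^sub>E B A) =
        measure (distr Q (Pi\<^sub>M B (\<lambda>_. borel)) (\<lambda>w. \<lambda>b\<in>B. Y b w)) (Pi\<^sub>E B A)"
      using integral_distr[OF mX, of "indicat_real (Pi\<^sub>E B A)"] integral_distr[OF mY, of "indicat_real (Pi\<^sub>E B A)"] meas
      by simp
    then show "emeasure (distr P (Pi\<^sub>M B (\<lambda>_. borel)) (\<lambda>w. \<lambda>b\<in>B. X b w)) (Pi\<^sub>E B A) =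
        emeasure (distr Q (Pi\<^sub>M B (\<lambda>_. borel)) (\<lambda>w. \<lambda>b\<in>B. Y b w)) (Pi\<^sub>E B A)"
      using P.prob_space_distr[OF mX] Q.prob_space_distr[OF mY]
      by (simp add: finite_measure.emeasure_eq_measure prob_space_def)
  next
    show "sets (distr P (Pi\<^sub>M B (\<lambda>_. borel)) (\<lambda>w. \<lambda>b\<in>B. X b w)) = sets (Pi\<^sub>M B (\<lambda>_. borel))"
      "sets (distr Q (Pi\<^sub>M B (\<lambda>_. borel)) (\<lambda>w. \<lambda>b\<in>B. Y b w)) = sets (Pi\<^sub>M B (\<lambda>_. borel))"
      by simp_all
    have mX: "(\<lambda>w. \<lambda>b\<in>B. X b w) \<in> P \<rightarrow>\<^sub>M Pi\<^sub>M B (\<lambda>_. borel)" by (auto intro!: measurable_restrict)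
    show "range (\<lambda>_::nat. space (Pi\<^sub>M B (\<lambda>_. borel))) \<subseteq> prod_algebra B (\<lambda>_. borel :: real measure)"
      using fin by (auto simp: space_PiM intro!: prod_algebraI_finite)
    show "(\<Union>i::nat. space (Pi\<^sub>M B (\<lambda>_. borel :: real measure))) = space (Pi\<^sub>M B (\<lambda>_. borel))" by simp
    show "emeasure (distr P (Pi\<^sub>M B (\<lambda>_. borel)) (\<lambda>w. \<lambda>b\<in>B. X b w)) (space (Pi\<^sub>M B (\<lambda>_. borel))) \<noteq> \<infinity>"
      using P.prob_space_distr[OF mX] by (simp add: finite_measure.emeasure_finite prob_space_def)
  qed
qed

subsection \<open>Increments of the subordinated process\<close>

text \<open>The selector \<open>\<iota>\<close> reads one coordinate of each vector increment. For
  W, whose coordinates are evaluations at \<open>v 0\<close>, \<open>v 1\<close> and so on, it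
  allows a different functional on every time interval.\<close>

lemma (in prob_space) levy_increments_integral:
  fixes f :: "nat \<Rightarrow> real \<Rightarrow> complex"
  assumes X: "levy_process M n X" and \<iota>: "\<And>k. k < m \<Longrightarrow> \<iota> k < n"
    and t: "0 \<le> t 0" "\<And>k. k < m \<Longrightarrow> t k \<le> t (Suc k)"
    and f[measurable]: "\<And>k. f k \<in> borel_measurable borel" and f1: "\<And>k x. norm (f k x) \<le> 1"
  shows "(\<integral>w. (\<Prod>k<m. f k (X (t (Suc k)) w (\<iota> k) - X (t k) w (\<iota> k))) \<partial>M) =
    (\<Prod>k<m. \<integral>w. f k (X (t (Suc k) - t k) w (\<iota> k)) \<partial>M)"
proof -
  have tpos: "0 \<le> t k" if "k \<le> m" for k
    using that by (induction k) (use t in \<open>auto intro: order_trans\<close>)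
  have meas: "(\<lambda>w. X s w i) \<in> borel_measurable M" if "s \<ge> 0" "i < n" for s i
    using X that by (auto simp: levy_process_def)
  have iv: "indep_vars (\<lambda>_. Pi\<^sub>M {..<n} (\<lambda>_. borel)) (\<lambda>k w. \<lambda>i\<in>{..<n}. X (t (Suc k)) w i - X (t k) w i) {..<m}"
    using X t by (auto simp: levy_process_def)
  have "indep_vars (\<lambda>_. borel) (\<lambda>k w. f k ((\<lambda>i\<in>{..<n}. X (t (Suc k)) w i - X (t k) w i) (\<iota> k))) {..<m}"
    by (rule indep_vars_compose2[OF iv], rule measurable_compose[OF _ f], rule measurable_component_singleton)
      (use \<iota> in auto)
  then have iv': "indep_vars (\<lambda>_. borel) (\<lambda>k w. f k (X (t (Suc k)) w (\<iota> k) - X (t k) w (\<iota> k))) {..<m}"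
    by (rule indep_vars_cong[THEN iffD1, rotated -1]) (use \<iota> in auto)
  have "(\<integral>w. (\<Prod>k<m. f k (X (t (Suc k)) w (\<iota> k) - X (t k) w (\<iota> k))) \<partial>M) =
      (\<Prod>k<m. \<integral>w. f k (X (t (Suc k)) w (\<iota> k) - X (t k) w (\<iota> k)) \<partial>M)"
  proof (rule indep_vars_lebesgue_integral[OF _ iv'])
    fix k assume "k \<in> {..<m}"
    then have "(\<lambda>w. X (t (Suc k)) w (\<iota> k) - X (t k) w (\<iota> k)) \<in> borel_measurable M"
      using tpos[of k] tpos[of "Suc k"] \<iota>[of k] by (intro borel_measurable_diff meas) auto
    then show "integrable M (\<lambda>w. f k (X (t (Suc k)) w (\<iota> k) - X (t k) w (\<iota> k)))"
      using f1 by (intro integrable_const_bound[where B=1]) (auto intro: measurable_compose[OF _ f])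
  qed simp
  also have "\<dots> = (\<Prod>k<m. \<integral>w. f k (X (t (Suc k) - t k) w (\<iota> k)) \<partial>M)"
  proof (rule prod.cong)
    fix k assume "k \<in> {..<m}"
    then have k: "k < m" by simp
    have tk: "0 \<le> t k" "t k \<le> t (Suc k)" using tpos[of k] t(2)[OF k] k by auto
    let ?N = "Pi\<^sub>M {..<n} (\<lambda>_. borel) :: (nat \<Rightarrow> real) measure"
    have m1: "(\<lambda>w. \<lambda>i\<in>{..<n}. X (t (Suc k)) w i - X (t k) w i) \<in> M \<rightarrow>\<^sub>M ?N"
      using tk by (intro measurable_restrict borel_measurable_diff meas) auto
    have m2: "(\<lambda>w. \<lambda>i\<in>{..<n}. X (t (Suc k) - t k) w i) \<in> M \<rightarrow>\<^sub>M ?N"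
      using tk by (intro measurable_restrict meas) auto
    have mf: "(\<lambda>x. f k (x (\<iota> k))) \<in> borel_measurable ?N"
      by (rule measurable_compose[OF _ f], rule measurable_component_singleton) (use \<iota>[OF k] in auto)
    have eq: "distr M ?N (\<lambda>w. \<lambda>i\<in>{..<n}. X (t (Suc k)) w i - X (t k) w i) =
        distr M ?N (\<lambda>w. \<lambda>i\<in>{..<n}. X (t (Suc k) - t k) w i)"
      using X tk unfolding levy_process_def by blast
    show "(\<integral>w. f k (X (t (Suc k)) w (\<iota> k) - X (t k) w (\<iota> k)) \<partial>M) = (\<integral>w. f k (X (t (Suc k) - t k) w (\<iota> k)) \<partial>M)"
      using integral_distr[OF m1 mf] integral_distr[OF m2 mf] \<iota>[OF k] by (simp add: eq)
  qed simp
  finally show ?thesis .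
qed

lemma exp_minus_one_le: "0 \<le> y \<Longrightarrow> 1 - exp (- y) \<le> min 1 (y::real)"
  using exp_ge_add_one_self[of "-y"] by (simp add: min_def)

text \<open>Discretisation from strictly above, adapted to right-continuous paths.\<close>

definition dyadic_above :: "nat \<Rightarrow> real \<Rightarrow> real" where
  "dyadic_above n x = (real (nat \<lfloor>2 ^ n * x\<rfloor>) + 1) / 2 ^ n"

lemma dyadic_above_mono: "x \<le> y \<Longrightarrow> dyadic_above n x \<le> dyadic_above n y"
  unfolding dyadic_above_def by (intro divide_right_mono add_right_mono) (auto intro!: nat_mono floor_mono)

lemma dyadic_above_pos: "0 < dyadic_above n x"
  unfolding dyadic_above_def by (intro divide_pos_pos) auto

text \<open>The added 1 makes the inequality strict even at dyadic points, as convergence along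
  \<open>at_right\<close> demands.\<close>

lemma dyadic_above_gt: "x < dyadic_above n x"
proof -
  have "2 ^ n * x < real (nat \<lfloor>2 ^ n * x\<rfloor>) + 1" by linarith
  then show ?thesis unfolding dyadic_above_def by (simp add: field_simps)
qed

lemma dyadic_above_le: assumes "0 \<le> x" shows "dyadic_above n x \<le> x + 1 / 2 ^ n"
proof -
  have "0 \<le> 2 ^ n * x" using assms by simp
  then have "real (nat \<lfloor>2 ^ n * x\<rfloor>) \<le> 2 ^ n * x" by linarith
  then show ?thesis unfolding dyadic_above_def by (simp add: field_simps)
qed

lemma dyadic_above_at_right:
  assumes "0 \<le> x" shows "filterlim (\<lambda>n. dyadic_above n x) (at_right x) sequentially"
proof -
  have "(\<lambda>n. x + 1 / 2 ^ n) \<longlonglongrightarrow> x + 0"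
    by (intro tendsto_add tendsto_const LIMSEQ_divide_realpow_zero) auto
  then have "(\<lambda>n. dyadic_above n x) \<longlonglongrightarrow> x"
    using dyadic_above_le[OF assms] dyadic_above_gt[of x]
    by (intro tendsto_sandwich[of "\<lambda>_. x" "\<lambda>n. dyadic_above n x" _ "\<lambda>n. x + 1 / 2 ^ n"]) (auto simp: less_imp_le)
  then show ?thesis
    by (auto simp: filterlim_at dyadic_above_gt intro!: always_eventually less_imp_neq[symmetric])
qed

lemma tendsto_at_right_imp_dyadic:
  assumes "(f \<longlongrightarrow> c) (at_right x)" "0 \<le> x"
  shows "(\<lambda>n. f (dyadic_above n x)) \<longlonglongrightarrow> c"
  using filterlim_compose[OF assms(1) dyadic_above_at_right[OF assms(2)]] .

section \<open>The subordinated Wiener process and its Laplace exponent\<close>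

text \<open>\<open>L\<close> is fixed merely as a measurable version: at each time and functional it
  equals W at the random time outside a null set that may depend on both.\<close>

locale subordinated_wiener = prob_space M for M :: "'w measure" +
  fixes C :: "'v::real_normed_vector dual \<Rightarrow> 'v" and istar :: "'v dual \<Rightarrow> 'h::{real_inner, complete_space}"
    and W L :: "real \<Rightarrow> 'v dual \<Rightarrow> 'w \<Rightarrow> real" and l :: "real \<Rightarrow> 'w \<Rightarrow> real" and \<rho> :: "real measure" and T :: real
  assumes T_pos: "0 < T"
    and istar: "bounded_linear istar" and norm_istar: "\<And>v. blinfun_apply v (C v) = (norm (istar v))\<^sup>2"
    and wiener: "cylindrical_wiener M C W" and sub: "subordinator M \<rho> l"
    and indep: "indep_set (generated_sigma M ({0..} \<times> UNIV) (\<lambda>(t, v). W t v)) (generated_sigma M {0..} l)"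
    and L_meas[measurable]: "\<And>t v. 0 \<le> t \<Longrightarrow> L t v \<in> borel_measurable M"
    and L_eq: "\<And>t v. 0 \<le> t \<Longrightarrow> AE w in M. L t v w = W (l t w) v w"
begin

definition laplace_exp :: "real \<Rightarrow> real" where
  "laplace_exp \<beta> = (LINT s:{0<..}|\<rho>. 1 - exp (- \<beta> * s))"

lemma sets_rho[measurable_cong]: "sets \<rho> = sets borel"
  using sub by (simp add: subordinator_def)

lemma rho_nonpos: "emeasure \<rho> {..0} = 0"
  using sub by (simp add: subordinator_def)

lemma AE_rho_pos: "AE s in \<rho>. 0 < s"
  using rho_nonpos by (intro AE_I[where N="{..0}"]) (auto simp: sets_rho)

lemma rho_min_integrable: "set_integrable \<rho> {0<..} (\<lambda>s. min s 1)"
proof -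
  have "(\<integral>\<^sup>+s. ennreal (norm (indicator {0<..} s *\<^sub>R min s 1)) \<partial>\<rho>) = (\<integral>\<^sup>+s\<in>{0<..}. ennreal (min s 1) \<partial>\<rho>)"
    by (intro nn_integral_cong) (auto simp: indicator_def)
  also have "\<dots> < \<infinity>" using sub by (simp add: subordinator_def)
  finally show ?thesis unfolding set_integrable_def integrable_iff_bounded by simp
qed

text \<open>A majorant uniform over \<beta> <= B and integrable against \<open>\<rho>\<close>; it
  serves both integrability and dominated convergence.\<close>

lemma one_minus_exp_bound:
  assumes "0 \<le> \<beta>" "\<beta> \<le> B" "0 \<le> (s::real)" shows "0 \<le> 1 - exp (- \<beta> * s)" "1 - exp (- \<beta> * s) \<le> max 1 B * min s 1"
proof -
  show "0 \<le> 1 - exp (- \<beta> * s)" using assms by simp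
  have "1 - exp (- \<beta> * s) \<le> min 1 (\<beta> * s)" using exp_minus_one_le[of "\<beta> * s"] assms by simp
  also have "\<dots> \<le> max 1 B * min s 1"
  proof (cases "s \<le> 1")
    case True
    have "\<beta> * s \<le> max 1 B * s" using assms by (intro mult_right_mono) auto
    then show ?thesis using True by (simp add: min_def)
  next
    case False
    have "min 1 (\<beta> * s) \<le> 1" by simp
    also have "1 \<le> max 1 B * min s 1" using False by simp
    finally show ?thesis .
  qed
  finally show "1 - exp (- \<beta> * s) \<le> max 1 B * min s 1" .
qed

lemma rho_exp_integrable: assumes "0 \<le> \<beta>" shows "set_integrable \<rho> {0<..} (\<lambda>s. 1 - exp (- \<beta> * s))"
proof (rule set_integrable_bound)
  show "set_integrable \<rho> {0<..} (\<lambda>s. max 1 \<beta> * min s 1)" using rho_min_integrable by (rule set_integrable_mult_right)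
  show "set_borel_measurable \<rho> {0<..} (\<lambda>s. 1 - exp (- \<beta> * s))" unfolding set_borel_measurable_def by measurable
  show "AE s in \<rho>. s \<in> {0<..} \<longrightarrow> norm (1 - exp (- \<beta> * s)) \<le> norm (max 1 \<beta> * min s 1)"
  proof (intro AE_I2 impI)
    fix s :: real assume "s \<in> {0<..}"
    then show "norm (1 - exp (- \<beta> * s)) \<le> norm (max 1 \<beta> * min s 1)"
      using one_minus_exp_bound[OF assms order_refl, of s] by (simp only: real_norm_def greaterThan_iff less_imp_le abs_of_nonneg)
        (metis abs_ge_self order_trans)
  qed
qed

text \<open>The positive half line may be replaced by the whole line because \<open>\<rho>\<close>
  gives no mass to \<open>{..0}\<close>. In this form the exponent can enter Fubini arguments
  without integrability conditions.\<close>

lemma ennreal_laplace_exp: assumes "0 \<le> \<beta>"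
  shows "ennreal (laplace_exp \<beta>) = (\<integral>\<^sup>+s. ennreal (1 - exp (- \<beta> * s)) \<partial>\<rho>)"
proof -
  have "(\<integral>\<^sup>+s. ennreal (1 - exp (- \<beta> * s)) \<partial>\<rho>) = (\<integral>\<^sup>+s. ennreal (indicator {0<..} s *\<^sub>R (1 - exp (- \<beta> * s))) \<partial>\<rho>)"
    by (intro nn_integral_cong_AE eventually_mono[OF AE_rho_pos]) auto
  also have "\<dots> = ennreal (laplace_exp \<beta>)"
    unfolding laplace_exp_def set_lebesgue_integral_def using rho_exp_integrable[OF assms] assms
    by (intro nn_integral_eq_integral) (auto simp: set_integrable_def indicator_def)
  finally show ?thesis ..
qed

lemma laplace_exp_0[simp]: "laplace_exp 0 = 0"
  by (simp add: laplace_exp_def)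

lemma laplace_exp_nonneg: "0 \<le> \<beta> \<Longrightarrow> 0 \<le> laplace_exp \<beta>"
  unfolding laplace_exp_def set_lebesgue_integral_def by (intro integral_nonneg_AE AE_I2) (auto simp: indicator_def)

lemma laplace_exp_mono: "0 \<le> a \<Longrightarrow> a \<le> b \<Longrightarrow> laplace_exp a \<le> laplace_exp b"
  unfolding laplace_exp_def using rho_exp_integrable[of a] rho_exp_integrable[of b]
  by (intro set_integral_mono) (auto intro: mult_right_mono)

text \<open>Subadditivity of a Bernstein function: integrate (1 - exp(-as)) (1 - exp(-bs)) >=
  0.\<close>

lemma laplace_exp_add: assumes "0 \<le> a" "0 \<le> b" shows "laplace_exp (a + b) \<le> laplace_exp a + laplace_exp b"
proof -
  have "laplace_exp (a + b) \<le> (LINT s:{0<..}|\<rho>. (1 - exp (- a * s)) + (1 - exp (- b * s)))"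
    unfolding laplace_exp_def
  proof (rule set_integral_mono)
    show "set_integrable \<rho> {0<..} (\<lambda>s. 1 - exp (- (a + b) * s))" using assms by (intro rho_exp_integrable) auto
    show "set_integrable \<rho> {0<..} (\<lambda>s. (1 - exp (- a * s)) + (1 - exp (- b * s)))"
      using assms by (intro set_integral_add rho_exp_integrable)
    fix s :: real assume "s \<in> {0<..}"
    then have "0 \<le> (1 - exp (- a * s)) * (1 - exp (- b * s))" using assms by (intro mult_nonneg_nonneg) auto
    then show "1 - exp (- (a + b) * s) \<le> (1 - exp (- a * s)) + (1 - exp (- b * s))"
      by (simp add: exp_add[symmetric] algebra_simps)
  qed
  also have "\<dots> = laplace_exp a + laplace_exp b"
    unfolding laplace_exp_def using assms by (intro set_integral_add rho_exp_integrable)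
  finally show ?thesis .
qed

text \<open>Subadditivity gives the integer multiples, and rounding c up to an integer costs the
  extra 1. The bound covers c < 1 as well, where the constant c itself would in general be too
  small.\<close>

lemma laplace_exp_mult: assumes "0 \<le> c" "0 \<le> x" shows "laplace_exp (c * x) \<le> (c + 1) * laplace_exp x"
proof -
  have nat: "laplace_exp (real n * x) \<le> real n * laplace_exp x" for n
  proof (induction n)
    case (Suc n)
    have "laplace_exp (real n * x + x) \<le> laplace_exp (real n * x) + laplace_exp x"
      using assms by (intro laplace_exp_add) auto
    then show ?case using Suc by (simp add: algebra_simps)
  qed simp
  define n where "n = nat \<lceil>c\<rceil>"
  have n: "c \<le> real n" "real n \<le> c + 1" using assms unfolding n_def by linarith+
  have "laplace_exp (c * x) \<le> laplace_exp (real n * x)"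
    using n assms by (intro laplace_exp_mono mult_right_mono) auto
  also have "\<dots> \<le> real n * laplace_exp x" by (rule nat)
  also have "\<dots> \<le> (c + 1) * laplace_exp x" using n laplace_exp_nonneg[OF assms(2)] by (intro mult_right_mono)
  finally show ?thesis .
qed

lemma laplace_exp_tendsto:
  assumes X: "X \<longlonglongrightarrow> x" and nn: "\<And>n. 0 \<le> X n"
  shows "(\<lambda>n. laplace_exp (X n)) \<longlonglongrightarrow> laplace_exp x"
proof -
  obtain B where B: "\<And>n. norm (X n) \<le> B" using convergent_imp_Bseq[OF convergentI[OF X]] by (auto simp: Bseq_def)
  have XB: "X n \<le> B" for n using B[of n] by simp
  show ?thesis
    unfolding laplace_exp_def set_lebesgue_integral_def
  proof (rule integral_dominated_convergence)
    show "integrable \<rho> (\<lambda>s. indicator {0<..} s *\<^sub>R (max 1 B * min s 1))"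
      using set_integrable_mult_right[OF rho_min_integrable, of "max 1 B"] by (simp add: set_integrable_def)
    show "AE s in \<rho>. (\<lambda>n. indicator {0<..} s *\<^sub>R (1 - exp (- X n * s))) \<longlonglongrightarrow> indicator {0<..} s *\<^sub>R (1 - exp (- x * s))"
      by (intro AE_I2 tendsto_intros X)
    show "AE s in \<rho>. norm (indicator {0<..} s *\<^sub>R (1 - exp (- X n * s))) \<le> indicator {0<..} s *\<^sub>R (max 1 B * min s 1)" for n
      using one_minus_exp_bound[OF nn[of n] XB[of n]] nn[of n] by (intro AE_I2) (auto simp: indicator_def)
  qed measurable
qed

lemma laplace_exp_continuous: "continuous_on {0..} laplace_exp"
  unfolding continuous_on_sequentially by (auto simp: o_def intro: laplace_exp_tendsto)

lemma laplace_exp_measurable: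
  assumes [measurable]: "f \<in> borel_measurable N" and nn: "\<And>x. 0 \<le> f x"
  shows "(\<lambda>x. laplace_exp (f x)) \<in> borel_measurable N"
proof -
  have "continuous_on UNIV (\<lambda>x. laplace_exp (max 0 x))"
    by (rule continuous_on_compose2[OF laplace_exp_continuous]) (auto intro!: continuous_intros)
  then have "(\<lambda>x. laplace_exp (max 0 (f x))) \<in> borel_measurable N"
    using borel_measurable_continuous_onI measurable_compose[OF assms(1)] by blast
  then show ?thesis using nn by (simp add: max_def)
qed

lemma l_meas[measurable]: "0 \<le> t \<Longrightarrow> l t \<in> borel_measurable M"
  using sub by (simp add: subordinator_def levy_process_def)

lemma AE_l: "AE w in M. \<forall>s t. 0 \<le> s \<and> s \<le> t \<longrightarrow> 0 \<le> l s w \<and> l s w \<le> l t w"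
proof -
  have "AE w in M. l 0 w = 0" "AE w in M. \<forall>s t. 0 \<le> s \<and> s \<le> t \<longrightarrow> l s w \<le> l t w"
    using sub by (auto simp: subordinator_def levy_process_def)
  then show ?thesis by eventually_elim (metis order_refl)
qed

lemma l_laplace: assumes "0 \<le> t" "0 \<le> \<beta>" shows "(\<integral>w. exp (- \<beta> * l t w) \<partial>M) = exp (- t * laplace_exp \<beta>)"
proof (cases "\<beta> = 0")
  case False
  then show ?thesis using sub assms unfolding subordinator_def laplace_exp_def by auto
qed (simp add: prob_space)

lemma l_increments_laplace:
  assumes t: "0 \<le> t 0" "\<And>k. k < m \<Longrightarrow> t k \<le> t (Suc k)" and \<beta>: "\<And>k. 0 \<le> \<beta> k"
  shows "(\<integral>w. exp (- (\<Sum>k<m. \<beta> k * (l (t (Suc k)) w - l (t k) w))) \<partial>M) = exp (- (\<Sum>k<m. (t (Suc k) - t k) * laplace_exp (\<beta> k)))"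
proof -
  have tpos: "0 \<le> t k" if "k \<le> m" for k
    using that by (induction k) (use t in \<open>auto intro: order_trans\<close>)
  \<comment> \<open>Clipping at 0 bounds f by 1 on the whole line; the increments of l are
    nonnegative almost surely, so the integrals are unaffected.\<close>
  define f where "f k x = complex_of_real (exp (- \<beta> k * max 0 x))" for k x
  have lp: "levy_process M 1 (\<lambda>t w _. l t w)" using sub by (simp add: subordinator_def)
  have [measurable]: "f k \<in> borel_measurable borel" for k unfolding f_def by measurable
  have f1: "norm (f k x) \<le> 1" for k x using \<beta>[of k] by (simp add: f_def)
  have [measurable]: "l (t k) \<in> borel_measurable M" "l (t (Suc k)) \<in> borel_measurable M" if "k \<in> {..<m}" for k
    using tpos[of k] tpos[of "Suc k"] that by (auto intro!: l_meas)
  have "complex_of_real (\<integral>w. exp (- (\<Sum>k<m. \<beta> k * (l (t (Suc k)) w - l (t k) w))) \<partial>M) =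
      (\<integral>w. complex_of_real (exp (- (\<Sum>k<m. \<beta> k * (l (t (Suc k)) w - l (t k) w)))) \<partial>M)" by simp
  also have "\<dots> = (\<integral>w. (\<Prod>k<m. f k (l (t (Suc k)) w - l (t k) w)) \<partial>M)"
  proof (rule integral_cong_AE)
    show "AE w in M. complex_of_real (exp (- (\<Sum>k<m. \<beta> k * (l (t (Suc k)) w - l (t k) w)))) =
        (\<Prod>k<m. f k (l (t (Suc k)) w - l (t k) w))"
      using AE_l
    proof eventually_elim
      case (elim w)
      have "(\<Prod>k<m. f k (l (t (Suc k)) w - l (t k) w)) = (\<Prod>k<m. complex_of_real (exp (- (\<beta> k * (l (t (Suc k)) w - l (t k) w)))))"
      proof (rule prod.cong)
        fix k assume "k \<in> {..<m}"
        then have "l (t k) w \<le> l (t (Suc k)) w" using elim tpos[of k] t(2)[of k] by auto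
        then show "f k (l (t (Suc k)) w - l (t k) w) = complex_of_real (exp (- (\<beta> k * (l (t (Suc k)) w - l (t k) w))))"
          by (simp add: f_def)
      qed simp
      then show ?case by (simp add: sum_negf[symmetric] exp_sum of_real_prod)
    qed
  qed measurable
  also have "\<dots> = (\<Prod>k<m. \<integral>w. f k (l (t (Suc k) - t k) w) \<partial>M)"
    using levy_increments_integral[OF lp, of m "\<lambda>_. 0" t f] t f1 by simp
  also have "\<dots> = (\<Prod>k<m. complex_of_real (exp (- (t (Suc k) - t k) * laplace_exp (\<beta> k))))"
  proof (rule prod.cong)
    fix k assume "k \<in> {..<m}"
    then have tk: "0 \<le> t (Suc k) - t k" using t(2)[of k] by simp
    have [measurable]: "l (t (Suc k) - t k) \<in> borel_measurable M" using l_meas[OF tk] .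
    have "(\<integral>w. f k (l (t (Suc k) - t k) w) \<partial>M) = (\<integral>w. complex_of_real (exp (- \<beta> k * l (t (Suc k) - t k) w)) \<partial>M)"
    proof (rule integral_cong_AE)
      show "AE w in M. f k (l (t (Suc k) - t k) w) = complex_of_real (exp (- \<beta> k * l (t (Suc k) - t k) w))"
        using AE_l
      proof eventually_elim
        case (elim w)
        then have "0 \<le> l (t (Suc k) - t k) w" using tk by blast
        then show ?case by (simp add: f_def)
      qed
    qed measurable
    then show "(\<integral>w. f k (l (t (Suc k) - t k) w) \<partial>M) = complex_of_real (exp (- (t (Suc k) - t k) * laplace_exp (\<beta> k)))"
      using l_laplace[OF tk \<beta>[of k]] by simp
  qed simp
  also have "\<dots> = complex_of_real (exp (- (\<Sum>k<m. (t (Suc k) - t k) * laplace_exp (\<beta> k))))"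
    unfolding sum_negf[symmetric] exp_sum[OF finite_lessThan] of_real_prod
      mult_minus_left by (rule refl)
  finally show ?thesis unfolding of_real_eq_iff .
qed

lemma W_levy: "levy_process M n (\<lambda>t w i. W t (v i) w)"
  using wiener by (simp add: cylindrical_wiener_def cylindrical_levy_process_def)

lemma W_rv: "0 \<le> t \<Longrightarrow> cylindrical_rv M (W t)"
  using wiener by (simp add: cylindrical_wiener_def cylindrical_levy_process_def)

lemma W_meas[measurable]: "0 \<le> t \<Longrightarrow> W t v \<in> borel_measurable M"
  using W_rv by (simp add: cylindrical_rv_def)

lemma W_char: assumes "0 \<le> t" shows "(\<integral>w. iexp (W t v w) \<partial>M) = complex_of_real (exp (- t * ((norm (istar v))\<^sup>2 / 2)))"
proof -
  \<comment> \<open>The jump term integrates against the zero measure and vanishes, whatever the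
    sigma-algebra; only the Gaussian part of the symbol remains.\<close>
  have z: "integral\<^sup>L (measure_of UNIV A (\<lambda>_. 0)) f = 0" for A and f :: "'v \<Rightarrow> complex"
  proof -
    have "emeasure (measure_of UNIV A (\<lambda>_. 0)) X = 0" for X
      by (metis emeasure_measure_of_conv)
    then have "AE x in measure_of UNIV A (\<lambda>_. 0). f x = 0"
      by (intro AE_I[where N="space (measure_of UNIV A (\<lambda>_. 0))"] sets.top) auto
    then show ?thesis by (simp add: integral_eq_zero_AE)
  qed
  have "levy_symbol (\<lambda>_. 0) C (\<lambda>_. 0) v = - complex_of_real ((norm (istar v))\<^sup>2 / 2)"
    by (simp add: levy_symbol_def z norm_istar)
  then show ?thesis
    using wiener assms by (simp add: cylindrical_wiener_def has_cyl_characteristics_def exp_of_real[symmetric])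
qed

lemma W_increments_char:
  assumes t: "0 \<le> t 0" "\<And>k. k < m \<Longrightarrow> t k \<le> t (Suc k)"
  shows "(\<integral>w. iexp (\<Sum>k<m. W (t (Suc k)) (v k) w - W (t k) (v k) w) \<partial>M) =
    complex_of_real (exp (- (\<Sum>k<m. (norm (istar (v k)))\<^sup>2 / 2 * (t (Suc k) - t k))))"
proof -
  have "(\<integral>w. iexp (\<Sum>k<m. W (t (Suc k)) (v k) w - W (t k) (v k) w) \<partial>M) =
      (\<integral>w. (\<Prod>k<m. iexp (W (t (Suc k)) (v k) w - W (t k) (v k) w)) \<partial>M)"
    by (simp add: exp_sum[symmetric] sum_distrib_left)
  also have "\<dots> = (\<Prod>k<m. \<integral>w. iexp (W (t (Suc k) - t k) (v k) w) \<partial>M)"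
    using levy_increments_integral[OF W_levy[of m v], of m "\<lambda>k. k" t "\<lambda>_ x. iexp x"] t by simp
  also have "\<dots> = (\<Prod>k<m. complex_of_real (exp (- (t (Suc k) - t k) * ((norm (istar (v k)))\<^sup>2 / 2))))"
    using t(2) by (intro prod.cong W_char refl) auto
  also have "\<dots> = complex_of_real (exp (- (\<Sum>k<m. (norm (istar (v k)))\<^sup>2 / 2 * (t (Suc k) - t k))))"
    unfolding sum_negf[symmetric] exp_sum[OF finite_lessThan] of_real_prod
    by (intro prod.cong refl arg_cong[where f="\<lambda>x. complex_of_real (exp x)"]) (metis minus_mult_left mult.commute)
  finally show ?thesis .
qed

text \<open>Almost surely a path of W(.)v is right-continuous at all times at once, so it may be
  followed along random times approaching l(t) from the right. These approximations sample W only at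
  countably many deterministic times, which is what makes measurability and conditioning
  possible.\<close>

lemma AE_W_dyadic_tendsto:
  assumes "0 \<le> t" shows "AE w in M. (\<lambda>n. W (dyadic_above n (l t w)) v w) \<longlonglongrightarrow> L t v w"
proof -
  have "AE w in M. \<forall>i<1::nat. \<forall>t\<ge>0. ((\<lambda>s. W s v w) \<longlongrightarrow> W t v w) (at_right t) \<and>
        (0 < t \<longrightarrow> (\<exists>l. ((\<lambda>s. W s v w) \<longlongrightarrow> l) (at_left t)))"
    using W_levy[of 1 "\<lambda>_. v"] unfolding levy_process_def by blast
  then show ?thesis using AE_l L_eq[OF assms, of v]
    by eventually_elim (use assms in \<open>auto intro!: tendsto_at_right_imp_dyadic\<close>)
qed

end

section \<open>Characteristic functions of increments of L\<close>

context subordinated_wiener begin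

text \<open>Conditioning on the independent time change.\<close>

lemma L_increments_char:
  assumes t: "0 \<le> t 0" "\<And>k. k < m \<Longrightarrow> t k \<le> t (Suc k)"
  shows "(\<integral>w. iexp (\<Sum>k<m. L (t (Suc k)) (v k) w - L (t k) (v k) w) \<partial>M) =
    complex_of_real (exp (- (\<Sum>k<m. (t (Suc k) - t k) * laplace_exp ((norm (istar (v k)))\<^sup>2 / 2))))"
proof -
  have tpos: "0 \<le> t k" if "k \<le> m" for k
    using that by (induction k) (use t in \<open>auto intro: order_trans\<close>)
  define q where "q k = (norm (istar (v k)))\<^sup>2 / 2" for k
  have q0: "0 \<le> q k" for k by (simp add: q_def)
  define gW where "gW = {(case p of (t, v) \<Rightarrow> W t v) -` B \<inter> space M |p B. p \<in> {0..} \<times> UNIV \<and> B \<in> sets borel}"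
  define gl where "gl = {l s -` B \<inter> space M |s B. s \<in> {0..} \<and> B \<in> sets borel}"
  \<comment> \<open>The two generated sigma-algebras are turned into measure spaces on the same
    sample space. The identity map into \<open>NW\<close> then plays the role of the path of W, so
    that no path space has to be constructed.\<close>
  define NW where "NW = sigma (space M) gW"
  define Nl where "Nl = sigma (space M) gl"
  have gW: "gW \<subseteq> Pow (space M)" and gl: "gl \<subseteq> Pow (space M)" by (auto simp: gW_def gl_def)
  have sNW: "space NW = space M" "sets NW = generated_sigma M ({0..} \<times> UNIV) (\<lambda>(t, v). W t v)"
    unfolding NW_def generated_sigma_def using gW by (simp_all add: space_measure_of sets_measure_of gW_def)
  have sNl: "space Nl = space M" "sets Nl = generated_sigma M {0..} l"
    unfolding Nl_def generated_sigma_def using gl by (simp_all add: space_measure_of sets_measure_of gl_def)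
  have ind: "indep_set (sets NW) (sets Nl)" using indep by (simp add: sNW sNl)
  have subW: "sets NW \<subseteq> events" and subl: "sets Nl \<subseteq> events"
    using ind unfolding indep_sets2_eq by auto
  have WN[measurable]: "W s u \<in> borel_measurable NW" if "0 \<le> s" for s u
  proof (rule measurableI)
    fix B :: "real set" assume "B \<in> sets borel"
    then have "W s u -` B \<inter> space M \<in> gW" unfolding gW_def using that by (intro CollectI exI[of _ "(s, u)"] exI[of _ B]) auto
    then show "W s u -` B \<inter> space NW \<in> sets NW" unfolding sNW(1) unfolding NW_def using gW by auto
  qed simp
  have lN[measurable]: "l s \<in> borel_measurable Nl" if "0 \<le> s" for s
  proof (rule measurableI)
    fix B :: "real set" assume "B \<in> sets borel"
    then have "l s -` B \<inter> space M \<in> gl" unfolding gl_def using that by (intro CollectI exI[of _ s] exI[of _ B]) auto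
    then show "l s -` B \<inter> space Nl \<in> sets Nl" unfolding sNl(1) unfolding Nl_def using gl by auto
  qed simp
  define Pl where "Pl = (Pi\<^sub>M {..m} (\<lambda>_. borel) :: (nat \<Rightarrow> real) measure)"
  define lv where "lv w = (\<lambda>k\<in>{..m}. l (t k) w)" for w
  have lvN: "lv \<in> Nl \<rightarrow>\<^sub>M Pl" unfolding lv_def Pl_def using tpos by (intro measurable_restrict lN) auto
  have idN[measurable]: "(\<lambda>w. w) \<in> M \<rightarrow>\<^sub>M NW"
    using subW by (intro measurableI) (auto simp: sNW(1) Int_absorb2 dest: sets.sets_into_space)
  have lvM[measurable]: "lv \<in> M \<rightarrow>\<^sub>M Pl"
    unfolding lv_def Pl_def using tpos by (intro measurable_restrict l_meas) auto
  interpret DW: prob_space "distr M NW (\<lambda>w. w)" by (rule prob_space_distr) fact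
  interpret Dl: prob_space "distr M Pl lv" by (rule prob_space_distr) fact
  interpret DP: pair_prob_space "distr M NW (\<lambda>w. w)" "distr M Pl lv" by standard
  have pairM: "(\<lambda>w. (w, lv w)) \<in> M \<rightarrow>\<^sub>M NW \<Otimes>\<^sub>M Pl" by (intro measurable_Pair idN lvM)
  \<comment> \<open>Independence makes the joint law of w, seen in \<open>NW\<close>, and of the
    time vector a product measure, so conditioning on l becomes Fubini's theorem.\<close>
  have joint: "distr M NW (\<lambda>w. w) \<Otimes>\<^sub>M distr M Pl lv = distr M (NW \<Otimes>\<^sub>M Pl) (\<lambda>w. (w, lv w))"
  proof (rule pair_measure_eqI)
    show "sigma_finite_measure (distr M NW (\<lambda>w. w))" "sigma_finite_measure (distr M Pl lv)"
      by (rule DW.sigma_finite_measure_axioms, rule Dl.sigma_finite_measure_axioms)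
    show "sets (distr M NW (\<lambda>w. w) \<Otimes>\<^sub>M distr M Pl lv) = sets (distr M (NW \<Otimes>\<^sub>M Pl) (\<lambda>w. (w, lv w)))"
      unfolding sets_distr by (rule sets_pair_measure_cong[OF sets_distr sets_distr])
    fix A B assume A: "A \<in> sets (distr M NW (\<lambda>w. w))" and B: "B \<in> sets (distr M Pl lv)"
    have A': "A \<in> sets NW" "A \<subseteq> space M" using A sets.sets_into_space[of A NW] by (auto simp: sNW(1))
    have B': "lv -` B \<inter> space M \<in> sets Nl" using B measurable_sets[OF lvN, of B] by (simp add: sNl(1))
    have "emeasure (distr M NW (\<lambda>w. w)) A * emeasure (distr M Pl lv) B = emeasure M A * emeasure M (lv -` B \<inter> space M)"
      using A B A' by (simp add: emeasure_distr Int_absorb2)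
    also have "\<dots> = emeasure M (A \<inter> (lv -` B \<inter> space M))"
      using ind A' B' unfolding indep_sets2_eq by (simp add: emeasure_eq_measure ennreal_mult')
    also have "A \<inter> (lv -` B \<inter> space M) = (\<lambda>w. (w, lv w)) -` (A \<times> B) \<inter> space M" by auto
    also have "emeasure M \<dots> = emeasure (distr M (NW \<Otimes>\<^sub>M Pl) (\<lambda>w. (w, lv w))) (A \<times> B)"
      using A B pairM by (intro emeasure_distr[symmetric]) auto
    finally show "emeasure (distr M NW (\<lambda>w. w)) A * emeasure (distr M Pl lv) B =
        emeasure (distr M (NW \<Otimes>\<^sub>M Pl) (\<lambda>w. (w, lv w))) (A \<times> B)" .
  qed
  define F where "F n w x = iexp (\<Sum>k<m. W (dyadic_above n (x (Suc k))) (v k) w - W (dyadic_above n (x k)) (v k) w)"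
    for n w and x :: "nat \<Rightarrow> real"
  \<comment> \<open>Joint measurability in w and in the time vector holds since the discretised time
    takes countably many values.\<close>
  have Wd: "(\<lambda>p. W (dyadic_above n (snd p k)) u (fst p)) \<in> borel_measurable (NW \<Otimes>\<^sub>M Pl)" if "k \<le> m" for n k u
  proof -
    have [measurable]: "(\<lambda>p. snd p k) \<in> borel_measurable (NW \<Otimes>\<^sub>M Pl)"
      unfolding Pl_def using that by (intro measurable_compose[OF measurable_snd measurable_component_singleton]) auto
    show ?thesis
      unfolding dyadic_above_def
    proof (rule measurable_compose_countable[where g="\<lambda>p. nat \<lfloor>2 ^ n * snd p k\<rfloor>"])
      show "(\<lambda>p. W ((real i + 1) / 2 ^ n) u (fst p)) \<in> borel_measurable (NW \<Otimes>\<^sub>M Pl)" for i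
        by (rule measurable_compose[OF measurable_fst]) (rule WN, simp)
    qed measurable
  qed
  have Fm: "(\<lambda>(w, x). F n w x) \<in> borel_measurable (NW \<Otimes>\<^sub>M Pl)" for n
  proof -
    have "(\<lambda>p. \<Sum>k<m. W (dyadic_above n (snd p (Suc k))) (v k) (fst p) - W (dyadic_above n (snd p k)) (v k) (fst p))
        \<in> borel_measurable (NW \<Otimes>\<^sub>M Pl)"
      by (intro borel_measurable_sum borel_measurable_diff Wd) auto
    then show ?thesis unfolding F_def case_prod_beta by measurable
  qed
  have Fm': "(\<lambda>(w, x). F n w x) \<in> borel_measurable (distr M NW (\<lambda>w. w) \<Otimes>\<^sub>M distr M Pl lv)" for n
    using Fm[of n] by (simp add: measurable_cong_sets[OF sets_pair_measure_cong[OF sets_distr sets_distr] refl])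
  have Fint: "integrable (distr M NW (\<lambda>w. w) \<Otimes>\<^sub>M distr M Pl lv) (\<lambda>(w, x). F n w x)" for n
    by (rule DP.integrable_const_bound[where B=1, OF _ Fm']) (auto simp: F_def)
  \<comment> \<open>For a frozen time vector the inner integral is the Gaussian formula for
    increments of W; it applies since l is almost surely nondecreasing and the discretisation
    preserves order.\<close>
  have step: "(\<integral>w. F n w (lv w) \<partial>M) = (\<integral>w. complex_of_real (exp (- (\<Sum>k<m. q k * (dyadic_above n (l (t (Suc k)) w) - dyadic_above n (l (t k) w))))) \<partial>M)" for n
  proof -
    define G where "G x = (\<integral>w. F n w x \<partial>distr M NW (\<lambda>w. w))" for x
    have Gm: "G \<in> borel_measurable Pl"
      using borel_measurable_integrable[OF DP.integrable_snd[OF Fint[of n]]] unfolding G_def by simp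
    have "(\<integral>w. F n w (lv w) \<partial>M) = (\<integral>p. (case p of (w, x) \<Rightarrow> F n w x) \<partial>distr M (NW \<Otimes>\<^sub>M Pl) (\<lambda>w. (w, lv w)))"
      using Fm[of n] by (subst integral_distr) auto
    also have "\<dots> = (\<integral>x. G x \<partial>distr M Pl lv)"
      unfolding joint[symmetric] G_def using DP.integral_snd[OF Fint[of n]] by simp
    also have "\<dots> = (\<integral>w. G (lv w) \<partial>M)" using Gm by (intro integral_distr) auto
    also have "\<dots> = (\<integral>w. complex_of_real (exp (- (\<Sum>k<m. q k * (dyadic_above n (l (t (Suc k)) w) - dyadic_above n (l (t k) w))))) \<partial>M)"
    proof (rule integral_cong_AE)
      show "(\<lambda>w. G (lv w)) \<in> borel_measurable M" using measurable_compose[OF lvM Gm] .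
      have [measurable]: "l (t k) \<in> borel_measurable M" "l (t (Suc k)) \<in> borel_measurable M" if "k \<in> {..<m}" for k
        using tpos[of k] tpos[of "Suc k"] that by (auto intro!: l_meas)
      show "(\<lambda>w. complex_of_real (exp (- (\<Sum>k<m. q k * (dyadic_above n (l (t (Suc k)) w) - dyadic_above n (l (t k) w)))))) \<in> borel_measurable M"
        unfolding dyadic_above_def by measurable
      show "AE w in M. G (lv w) = complex_of_real (exp (- (\<Sum>k<m. q k * (dyadic_above n (l (t (Suc k)) w) - dyadic_above n (l (t k) w)))))"
        using AE_l
      proof eventually_elim
        case (elim w)
        have mono: "lv w k \<le> lv w (Suc k)" if "k < m" for k
          using elim tpos[of k] t(2)[of k] that by (auto simp: lv_def)
        have "(\<lambda>w'. F n w' (lv w)) \<in> borel_measurable NW"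
          unfolding F_def by (intro measurable_compose[OF _ borel_measurable_exp] borel_measurable_times borel_measurable_const
            measurable_compose[OF _ borel_measurable_of_real] borel_measurable_sum borel_measurable_diff WN less_imp_le[OF dyadic_above_pos])
        then have "G (lv w) = (\<integral>w'. F n w' (lv w) \<partial>M)"
          unfolding G_def by (intro integral_distr) auto
        also have "\<dots> = complex_of_real (exp (- (\<Sum>k<m. q k * (dyadic_above n (lv w (Suc k)) - dyadic_above n (lv w k)))))"
          unfolding F_def q_def using mono
          by (intro W_increments_char[of "\<lambda>k. dyadic_above n (lv w k)"] dyadic_above_mono less_imp_le[OF dyadic_above_pos])
        finally show ?case by (simp add: lv_def)
      qed
    qed
    finally show ?thesis .
  qed
  have [measurable]: "L (t k) u \<in> borel_measurable M" "L (t (Suc k)) u \<in> borel_measurable M"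
    "l (t k) \<in> borel_measurable M" "l (t (Suc k)) \<in> borel_measurable M" if "k \<in> {..<m}" for k u
    using tpos[of k] tpos[of "Suc k"] that by (auto intro!: l_meas L_meas)
  have lim1: "(\<lambda>n. \<integral>w. F n w (lv w) \<partial>M) \<longlonglongrightarrow> (\<integral>w. iexp (\<Sum>k<m. L (t (Suc k)) (v k) w - L (t k) (v k) w) \<partial>M)"
  proof (rule integral_dominated_convergence[where w="\<lambda>_. 1"])
    have "AE w in M. \<forall>k\<in>{..<m}. (\<lambda>n. W (dyadic_above n (l (t k) w)) (v k) w) \<longlonglongrightarrow> L (t k) (v k) w \<and>
        (\<lambda>n. W (dyadic_above n (l (t (Suc k)) w)) (v k) w) \<longlonglongrightarrow> L (t (Suc k)) (v k) w"
      using tpos by (intro AE_finite_allI AE_conjI AE_W_dyadic_tendsto) auto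
    then show "AE w in M. (\<lambda>n. F n w (lv w)) \<longlonglongrightarrow> iexp (\<Sum>k<m. L (t (Suc k)) (v k) w - L (t k) (v k) w)"
      by eventually_elim (auto simp: F_def lv_def intro!: tendsto_intros)
    show "(\<lambda>w. F n w (lv w)) \<in> borel_measurable M" for n
      using measurable_compose[OF measurable_Pair[OF idN lvM] Fm[of n]] by simp
  qed (auto simp: F_def)
  have lim2: "(\<lambda>n. \<integral>w. complex_of_real (exp (- (\<Sum>k<m. q k * (dyadic_above n (l (t (Suc k)) w) - dyadic_above n (l (t k) w))))) \<partial>M)
      \<longlonglongrightarrow> (\<integral>w. complex_of_real (exp (- (\<Sum>k<m. q k * (l (t (Suc k)) w - l (t k) w)))) \<partial>M)"
  proof (rule integral_dominated_convergence[where w="\<lambda>_. 1"])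
    show "AE w in M. (\<lambda>n. complex_of_real (exp (- (\<Sum>k<m. q k * (dyadic_above n (l (t (Suc k)) w) - dyadic_above n (l (t k) w))))))
        \<longlonglongrightarrow> complex_of_real (exp (- (\<Sum>k<m. q k * (l (t (Suc k)) w - l (t k) w))))"
      using AE_l
    proof eventually_elim
      case (elim w)
      have d: "(\<lambda>n. dyadic_above n (l (t k) w)) \<longlonglongrightarrow> l (t k) w" if "k \<le> m" for k
        using dyadic_above_at_right[of "l (t k) w"] elim tpos[OF that] by (auto simp: filterlim_at)
      show ?case by (intro tendsto_intros d) auto
    qed
    show "AE w in M. norm (complex_of_real (exp (- (\<Sum>k<m. q k * (dyadic_above n (l (t (Suc k)) w) - dyadic_above n (l (t k) w)))))) \<le> 1" for n
      using AE_l
    proof eventually_elim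
      case (elim w)
      have "0 \<le> (\<Sum>k<m. q k * (dyadic_above n (l (t (Suc k)) w) - dyadic_above n (l (t k) w)))"
      proof (rule sum_nonneg)
        fix k assume "k \<in> {..<m}"
        then have "l (t k) w \<le> l (t (Suc k)) w" using elim tpos[of k] t(2)[of k] by auto
        then show "0 \<le> q k * (dyadic_above n (l (t (Suc k)) w) - dyadic_above n (l (t k) w))"
          using q0[of k] dyadic_above_mono by simp
      qed
      then show ?case by simp
    qed
    show "(\<lambda>w. complex_of_real (exp (- (\<Sum>k<m. q k * (dyadic_above n (l (t (Suc k)) w) - dyadic_above n (l (t k) w)))))) \<in> borel_measurable M" for n
      unfolding dyadic_above_def by measurable
  qed (auto intro: measurable_compose[OF _ borel_measurable_of_real])
  have "(\<integral>w. iexp (\<Sum>k<m. L (t (Suc k)) (v k) w - L (t k) (v k) w) \<partial>M) =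
      (\<integral>w. complex_of_real (exp (- (\<Sum>k<m. q k * (l (t (Suc k)) w - l (t k) w)))) \<partial>M)"
    using LIMSEQ_unique[OF lim1] lim2 unfolding step by blast
  also have "\<dots> = complex_of_real (\<integral>w. exp (- (\<Sum>k<m. q k * (l (t (Suc k)) w - l (t k) w))) \<partial>M)" by simp
  also have "\<dots> = complex_of_real (exp (- (\<Sum>k<m. (t (Suc k) - t k) * laplace_exp (q k))))"
    using l_increments_laplace[of t m q] t q0 by simp
  finally show ?thesis by (simp add: q_def)
qed

text \<open>Linearity of W(t) has an exceptional null set for each t, which rules out substituting a
  random time. It holds simultaneously at the countably many dyadic times and passes to the limit by
  right continuity.\<close>

lemma AE_L_linear:
  assumes t: "0 \<le> t"
  shows "AE w in M. L t (a *\<^sub>R u + b *\<^sub>R v) w = a * L t u w + b * L t v w"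
proof -
  have "AE w in M. \<forall>n k. W ((real k + 1) / 2 ^ n) (a *\<^sub>R u + b *\<^sub>R v) w =
      a * W ((real k + 1) / 2 ^ n) u w + b * W ((real k + 1) / 2 ^ n) v w"
    unfolding AE_all_countable
  proof (intro allI)
    fix n k :: nat
    show "AE w in M. W ((real k + 1) / 2 ^ n) (a *\<^sub>R u + b *\<^sub>R v) w =
      a * W ((real k + 1) / 2 ^ n) u w + b * W ((real k + 1) / 2 ^ n) v w"
      using W_rv[of "(real k + 1) / 2 ^ n"] by (simp add: cylindrical_rv_def)
  qed
  then show ?thesis
    using AE_W_dyadic_tendsto[OF t, of u] AE_W_dyadic_tendsto[OF t, of v] AE_W_dyadic_tendsto[OF t, of "a *\<^sub>R u + b *\<^sub>R v"]
  proof eventually_elim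
    case (elim w)
    have "(\<lambda>n. a * W (dyadic_above n (l t w)) u w + b * W (dyadic_above n (l t w)) v w) \<longlonglongrightarrow> a * L t u w + b * L t v w"
      using elim by (intro tendsto_intros)
    moreover have "a * W (dyadic_above n (l t w)) u w + b * W (dyadic_above n (l t w)) v w = W (dyadic_above n (l t w)) (a *\<^sub>R u + b *\<^sub>R v) w" for n
      using elim(1) by (simp add: dyadic_above_def)
    ultimately show ?case using elim(4) LIMSEQ_unique by simp
  qed
qed

end

subsection \<open>Convergence in probability\<close>

text \<open>\<open>L0norm M (X - Y)\<close> metrises convergence in probability.\<close>

definition L0norm :: "'w measure \<Rightarrow> ('w \<Rightarrow> 'a::real_normed_vector) \<Rightarrow> real" where
  "L0norm M X = (\<integral>w. min 1 (norm (X w)) \<partial>M)"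

context prob_space begin

lemma min1_integrable:
  fixes X :: "'a \<Rightarrow> real"
  assumes [measurable]: "X \<in> borel_measurable M" and "\<And>w. 0 \<le> X w"
  shows "integrable M (\<lambda>w. min 1 (X w))"
  using assms(2) by (intro integrable_const_bound[where B=1]) auto

lemma L0norm_nonneg: "0 \<le> L0norm M X"
  unfolding L0norm_def by (intro integral_nonneg_AE) auto

lemma L0norm_cong_AE:
  assumes "X \<in> borel_measurable M" "Y \<in> borel_measurable M" "AE w in M. X w = Y w"
  shows "L0norm M X = L0norm M Y"
  unfolding L0norm_def
proof (rule integral_cong_AE)
  show "(\<lambda>w. min 1 (norm (X w))) \<in> borel_measurable M" "(\<lambda>w. min 1 (norm (Y w))) \<in> borel_measurable M"
    using assms(1,2) by measurable
  show "AE w in M. min 1 (norm (X w)) = min 1 (norm (Y w))" using assms(3) by eventually_elim simp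
qed

lemma L0norm_triangle:
  fixes X Y :: "'a \<Rightarrow> 'b::{real_normed_vector, second_countable_topology}"
  assumes [measurable]: "X \<in> borel_measurable M" "Y \<in> borel_measurable M"
  shows "L0norm M (\<lambda>w. X w + Y w) \<le> L0norm M X + L0norm M Y"
proof -
  have "L0norm M (\<lambda>w. X w + Y w) \<le> (\<integral>w. min 1 (norm (X w)) + min 1 (norm (Y w)) \<partial>M)"
    unfolding L0norm_def
  proof (rule integral_mono)
    fix w
    have "norm (X w + Y w) \<le> norm (X w) + norm (Y w)" by (rule norm_triangle_ineq)
    then show "min 1 (norm (X w + Y w)) \<le> min 1 (norm (X w)) + min 1 (norm (Y w))"
      unfolding min_def by (simp split: if_splits) (use norm_ge_zero[of "X w"] norm_ge_zero[of "Y w"] in linarith)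
  qed (auto intro!: Bochner_Integration.integrable_add min1_integrable)
  also have "\<dots> = L0norm M X + L0norm M Y"
    unfolding L0norm_def by (intro Bochner_Integration.integral_add min1_integrable) auto
  finally show ?thesis .
qed

lemma L0norm_diff_commute: "L0norm M (\<lambda>w. X w - Y w) = L0norm M (\<lambda>w. Y w - X w)"
  by (simp add: L0norm_def norm_minus_commute)

lemma L0norm_triangle_diff:
  fixes X Y Z :: "'a \<Rightarrow> 'b::{real_normed_vector, second_countable_topology}"
  assumes [measurable]: "X \<in> borel_measurable M" "Y \<in> borel_measurable M" "Z \<in> borel_measurable M"
  shows "L0norm M (\<lambda>w. X w - Z w) \<le> L0norm M (\<lambda>w. X w - Y w) + L0norm M (\<lambda>w. Y w - Z w)"
  using L0norm_triangle[of "\<lambda>w. X w - Y w" "\<lambda>w. Y w - Z w"] by simp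

lemma L0norm_linear_le:
  fixes X :: "'a \<Rightarrow> 'b::{real_normed_vector, second_countable_topology}"
  assumes [measurable]: "X \<in> borel_measurable M" "Y \<in> borel_measurable M"
    and K: "1 \<le> K" and bound: "\<And>w. norm (Y w) \<le> K * norm (X w)"
  shows "L0norm M Y \<le> K * L0norm M X"
proof -
  have "L0norm M Y \<le> (\<integral>w. K * min 1 (norm (X w)) \<partial>M)"
    unfolding L0norm_def
  proof (rule integral_mono)
    fix w
    show "min 1 (norm (Y w)) \<le> K * min 1 (norm (X w))"
      using bound[of w] K by (simp add: min_def)
  qed (auto intro!: integrable_mult_right min1_integrable)
  then show ?thesis by (simp add: L0norm_def)
qed

lemma AE_eq_0_if_L0norm:
  fixes X :: "'a \<Rightarrow> 'b::{real_normed_vector, second_countable_topology}"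
  assumes [measurable]: "X \<in> borel_measurable M" and "L0norm M X \<le> 0"
  shows "AE w in M. X w = 0"
proof -
  have "(\<integral>w. min 1 (norm (X w)) \<partial>M) = 0" using assms(2) L0norm_nonneg[of X] unfolding L0norm_def by linarith
  then have "AE w in M. min 1 (norm (X w)) = 0"
    by (subst (asm) integral_nonneg_eq_0_iff_AE) (auto intro!: min1_integrable)
  then show ?thesis by eventually_elim (auto simp: min_def split: if_splits)
qed

lemma L0norm_AE_tendsto:
  fixes X :: "nat \<Rightarrow> 'a \<Rightarrow> 'b::{real_normed_vector, second_countable_topology}"
  assumes [measurable]: "\<And>n. X n \<in> borel_measurable M" "Y \<in> borel_measurable M"
    and "AE w in M. (\<lambda>n. X n w) \<longlonglongrightarrow> Y w"
  shows "(\<lambda>n. L0norm M (\<lambda>w. X n w - Y w)) \<longlonglongrightarrow> 0"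
proof -
  have "(\<lambda>n. \<integral>w. min 1 (norm (X n w - Y w)) \<partial>M) \<longlonglongrightarrow> (\<integral>w. 0 \<partial>M)"
  proof (rule integral_dominated_convergence[where w="\<lambda>_. 1"])
    show "AE w in M. (\<lambda>n. min 1 (norm (X n w - Y w))) \<longlonglongrightarrow> 0"
      using assms(3)
    proof eventually_elim
      case (elim w)
      then have "(\<lambda>n. norm (X n w - Y w)) \<longlonglongrightarrow> 0" by (simp add: LIM_zero tendsto_norm_zero)
      then have "(\<lambda>n. min 1 (norm (X n w - Y w))) \<longlonglongrightarrow> min 1 0" by (intro tendsto_intros)
      then show ?case by simp
    qed
  qed auto
  then show ?thesis by (simp add: L0norm_def)
qed

lemma conv_in_prob_iff_L0norm:
  assumes [measurable]: "\<And>n. X n \<in> borel_measurable M" "Y \<in> borel_measurable M"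
  shows "conv_in_prob M X Y \<longleftrightarrow> (\<lambda>n. L0norm M (\<lambda>w. X n w - Y w)) \<longlonglongrightarrow> 0"
proof
  assume c: "conv_in_prob M X Y"
  show "(\<lambda>n. L0norm M (\<lambda>w. X n w - Y w)) \<longlonglongrightarrow> 0"
  proof (rule LIMSEQ_I)
    fix e :: real assume e: "0 < e"
    have "(\<lambda>n. measure M {w \<in> space M. e / 2 < \<bar>X n w - Y w\<bar>}) \<longlonglongrightarrow> 0" using c half_gt_zero[OF e] unfolding conv_in_prob_def by blast
    then have "\<forall>\<^sub>F n in sequentially. measure M {w \<in> space M. e / 2 < \<bar>X n w - Y w\<bar>} < e / 2"
      using e by (intro order_tendstoD) auto
    then obtain N where N: "\<And>n. n \<ge> N \<Longrightarrow> measure M {w \<in> space M. e / 2 < \<bar>X n w - Y w\<bar>} < e / 2"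
      by (auto simp: eventually_sequentially)
    have "norm (L0norm M (\<lambda>w. X n w - Y w) - 0) < e" if "n \<ge> N" for n
    proof -
      let ?S = "{w \<in> space M. e / 2 < \<bar>X n w - Y w\<bar>}"
      have "L0norm M (\<lambda>w. X n w - Y w) \<le> (\<integral>w. e / 2 + indicator ?S w \<partial>M)"
        unfolding L0norm_def
      proof (rule integral_mono)
        fix w assume "w \<in> space M"
        then show "min 1 (norm (X n w - Y w)) \<le> e / 2 + indicator ?S w" using e by (auto simp: indicator_def min_def)
      qed (auto intro!: min1_integrable Bochner_Integration.integrable_add integrable_real_indicator simp: emeasure_eq_measure)
      also have "\<dots> = e / 2 + measure M ?S"
        by (subst Bochner_Integration.integral_add) (auto intro!: integrable_real_indicator simp: prob_space emeasure_eq_measure)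
      also have "\<dots> < e" using N[OF that] by simp
      finally show ?thesis using L0norm_nonneg[of "\<lambda>w. X n w - Y w"] by simp
    qed
    then show "\<exists>no. \<forall>n\<ge>no. norm (L0norm M (\<lambda>w. X n w - Y w) - 0) < e" by blast
  qed
next
  assume c: "(\<lambda>n. L0norm M (\<lambda>w. X n w - Y w)) \<longlonglongrightarrow> 0"
  show "conv_in_prob M X Y"
    unfolding conv_in_prob_def
  proof (intro allI impI)
    fix e :: real assume e: "0 < e"
    have le: "measure M {w \<in> space M. e < \<bar>X n w - Y w\<bar>} \<le> L0norm M (\<lambda>w. X n w - Y w) / min 1 e" for n
    proof -
      let ?S = "{w \<in> space M. e < \<bar>X n w - Y w\<bar>}"
      have [simp]: "integrable M (indicat_real ?S)"
        by (intro integrable_real_indicator) (auto simp: emeasure_eq_measure)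
      have "min 1 e * measure M ?S = (\<integral>w. min 1 e * indicator ?S w \<partial>M)" by simp
      also have "\<dots> \<le> L0norm M (\<lambda>w. X n w - Y w)"
        unfolding L0norm_def
      proof (rule integral_mono)
        fix w assume "w \<in> space M"
        then show "min 1 e * indicator ?S w \<le> min 1 (norm (X n w - Y w))" using e by (auto simp: indicator_def)
      qed (auto intro!: min1_integrable integrable_mult_right)
      finally show ?thesis using e by (simp add: field_simps)
    qed
    have lim: "(\<lambda>n. L0norm M (\<lambda>w. X n w - Y w) / min 1 e) \<longlonglongrightarrow> 0"
      using tendsto_divide[OF c tendsto_const, of "min 1 e"] e by simp
    have "norm (measure M {w \<in> space M. e < \<bar>X n w - Y w\<bar>}) \<le> L0norm M (\<lambda>w. X n w - Y w) / min 1 e" for n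
      using le[of n] by simp
    then show "(\<lambda>n. measure M {w \<in> space M. e < \<bar>X n w - Y w\<bar>}) \<longlonglongrightarrow> 0"
      by (rule Lim_null_comparison[OF always_eventually[OF allI] lim])
  qed
qed

text \<open>The rate makes the truncated increments summable almost surely. They are then eventually
  below 1, where truncation is inactive, so the series of increments converges absolutely and Y n
  converges almost surely.\<close>

lemma L0norm_complete:
  fixes Y :: "nat \<Rightarrow> 'a \<Rightarrow> 'b::{banach, second_countable_topology}"
  assumes [measurable]: "\<And>n. Y n \<in> borel_measurable M"
    and rate: "\<And>n. L0norm M (\<lambda>w. Y (Suc n) w - Y n w) \<le> (1/2) ^ n"
  obtains Z where "Z \<in> borel_measurable M" "(\<lambda>n. L0norm M (\<lambda>w. Y n w - Z w)) \<longlonglongrightarrow> 0"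
proof -
  define D where "D n w = min 1 (norm (Y (Suc n) w - Y n w))" for n w
  have Dm[measurable]: "D n \<in> borel_measurable M" for n unfolding D_def by measurable
  have D0: "0 \<le> D n w" for n w by (simp add: D_def)
  have "(\<integral>\<^sup>+w. (\<Sum>n. ennreal (D n w)) \<partial>M) = (\<Sum>n. \<integral>\<^sup>+w. ennreal (D n w) \<partial>M)"
    by (rule nn_integral_suminf) measurable
  also have "\<dots> \<le> (\<Sum>n. ennreal ((1/2) ^ n))"
  proof (rule suminf_le)
    fix n
    have "(\<integral>\<^sup>+w. ennreal (D n w) \<partial>M) = ennreal (\<integral>w. D n w \<partial>M)"
      using D0 unfolding D_def by (intro nn_integral_eq_integral min1_integrable) auto
    also have "\<dots> \<le> ennreal ((1/2) ^ n)" using rate[of n] by (intro ennreal_leI) (simp add: L0norm_def D_def)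
    finally show "(\<integral>\<^sup>+w. ennreal (D n w) \<partial>M) \<le> ennreal ((1/2) ^ n)" .
  qed auto
  also have "\<dots> = ennreal (\<Sum>n. (1/2) ^ n)" by (rule suminf_ennreal2) (auto intro: summable_geometric)
  finally have "(\<integral>\<^sup>+w. (\<Sum>n. ennreal (D n w)) \<partial>M) < \<infinity>" by (simp add: le_less_trans ennreal_less_top)
  then have "AE w in M. (\<Sum>n. ennreal (D n w)) \<noteq> \<infinity>"
    by (intro nn_integral_noteq_infinite) auto
  then have conv: "AE w in M. convergent (\<lambda>n. Y n w)"
  proof eventually_elim
    case (elim w)
    then have sD: "summable (\<lambda>n. D n w)" using D0 by (intro summable_suminf_not_top) (auto simp: infinity_ennreal_def)
    then have "(\<lambda>n. D n w) \<longlonglongrightarrow> 0" by (rule summable_LIMSEQ_zero)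
    then have "\<forall>\<^sub>F n in sequentially. D n w < 1" by (rule order_tendstoD) simp
    then have "\<forall>\<^sub>F n in sequentially. norm (Y (Suc n) w - Y n w) = D n w"
      by eventually_elim (auto simp: D_def min_def split: if_splits)
    then have "summable (\<lambda>n. norm (Y (Suc n) w - Y n w))" using sD by (subst summable_cong)
    then have "summable (\<lambda>n. Y (Suc n) w - Y n w)" by (rule summable_norm_cancel)
    then have "convergent (\<lambda>n. \<Sum>k<n. Y (Suc k) w - Y k w)" by (simp add: summable_iff_convergent)
    then have "convergent (\<lambda>n. (Y n w - Y 0 w) + Y 0 w)"
      unfolding sum_lessThan_telescope[of "\<lambda>k. Y k w"] by (intro convergent_add convergent_const)
    then show ?case by simp
  qed
  define Z where "Z w = lim (\<lambda>n. Y n w)" for w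
  have [measurable]: "Z \<in> borel_measurable M" unfolding Z_def by measurable
  show thesis
  proof (rule that)
    show "(\<lambda>n. L0norm M (\<lambda>w. Y n w - Z w)) \<longlonglongrightarrow> 0"
    proof (rule L0norm_AE_tendsto)
      show "AE w in M. (\<lambda>n. Y n w) \<longlonglongrightarrow> Z w"
        using conv by eventually_elim (simp add: Z_def convergent_LIMSEQ_iff)
    qed auto
  qed fact
qed

lemma square_expectation_le:
  fixes X :: "'a \<Rightarrow> real"
  assumes "integrable M X" "integrable M (\<lambda>w. (X w)\<^sup>2)"
  shows "(\<integral>w. X w \<partial>M)\<^sup>2 \<le> (\<integral>w. (X w)\<^sup>2 \<partial>M)"
  using variance_positive[of X] variance_eq[OF assms] by simp

text \<open>Averaging the characteristic function over a standard normal u gives E exp(-Z^2/2) by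
  Fubini, and since E u^2 = 1 the hypothesis averages to the lower bound 1 - 2x. With the factor 3
  from \<open>pw\<close> this yields 6x.\<close>

lemma L0norm_square_le_of_char:
  assumes [measurable]: "Z \<in> borel_measurable M" and x: "0 \<le> x"
    and cf: "\<And>u. 1 - (u\<^sup>2 + 1) * x \<le> Re (\<integral>w. iexp (u * Z w) \<partial>M)"
  shows "(L0norm M Z)\<^sup>2 \<le> 6 * x"
proof -
  let ?N = std_normal_distribution
  interpret N: real_distribution ?N by (rule real_dist_normal_dist)
  interpret P: pair_prob_space ?N M by standard
  have meas: "(\<lambda>(u, w). iexp (u * Z w)) \<in> borel_measurable (?N \<Otimes>\<^sub>M M)" by measurable
  have int: "integrable (?N \<Otimes>\<^sub>M M) (\<lambda>(u, w). iexp (u * Z w))"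
    by (rule P.integrable_const_bound[where B=1, OF _ meas]) auto
  have "(\<integral>u. (\<integral>w. iexp (u * Z w) \<partial>M) \<partial>?N) = (\<integral>w. (\<integral>u. iexp (u * Z w) \<partial>?N) \<partial>M)"
    using P.Fubini_integral[OF int] by simp
  also have "\<dots> = (\<integral>w. complex_of_real (exp (- (Z w)\<^sup>2 / 2)) \<partial>M)"
  proof (intro Bochner_Integration.integral_cong refl)
    fix w
    have "(\<integral>u. iexp (u * Z w) \<partial>?N) = char ?N (Z w)" by (simp add: char_def mult.commute)
    then show "(\<integral>u. iexp (u * Z w) \<partial>?N) = complex_of_real (exp (- (Z w)\<^sup>2 / 2))"
      by (simp only: char_std_normal_distribution)
  qed
  also have "\<dots> = complex_of_real (\<integral>w. exp (- (Z w)\<^sup>2 / 2) \<partial>M)" by simp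
  finally have eq: "Re (\<integral>u. (\<integral>w. iexp (u * Z w) \<partial>M) \<partial>?N) = (\<integral>w. exp (- (Z w)\<^sup>2 / 2) \<partial>M)" by simp
  have iint: "integrable ?N (\<lambda>u. \<integral>w. iexp (u * Z w) \<partial>M)" by (rule P.integrable_fst[OF int])
  have i2: "integrable ?N (\<lambda>u. u\<^sup>2)" by (rule integrable_std_normal_distribution_moment)
  have m2: "(\<integral>u. u\<^sup>2 \<partial>?N) = 1" using std_normal_distribution_even_moments(1)[of 1] by simp
  have "1 - 2 * x = (\<integral>u. 1 - (u\<^sup>2 + 1) * x \<partial>?N)"
    using i2 m2 N.prob_space by (simp add: N.prob_space[unfolded N.space_eq_univ] algebra_simps)
  also have "\<dots> \<le> (\<integral>u. Re (\<integral>w. iexp (u * Z w) \<partial>M) \<partial>?N)"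
    using cf iint i2 by (intro integral_mono) auto
  also have "\<dots> = (\<integral>w. exp (- (Z w)\<^sup>2 / 2) \<partial>M)" using eq integral_Re[OF iint] by simp
  finally have main: "1 - 2 * x \<le> (\<integral>w. exp (- (Z w)\<^sup>2 / 2) \<partial>M)" .
  \<comment> \<open>With y = z^2/2, exp(-y) <= 1/(1 + y) leaves y/(1 + y) = z^2/(2 + z^2), which is
    at least z^2/3 for |z| <= 1 and at least 1/3 otherwise.\<close>
  have pw: "(min 1 \<bar>z\<bar>)\<^sup>2 \<le> 3 * (1 - exp (- z\<^sup>2 / 2))" for z :: real
  proof -
    define y where "y = z\<^sup>2 / 2"
    have y: "0 \<le> y" by (simp add: y_def)
    have "exp (- y) \<le> 1 / (1 + y)"
      using exp_ge_add_one_self[of y] y by (simp add: exp_minus field_simps)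
    then have "1 - exp (- y) \<ge> y / (1 + y)" using y by (simp add: field_simps)
    moreover have "(min 1 \<bar>z\<bar>)\<^sup>2 \<le> 3 * (y / (1 + y))"
    proof (cases "\<bar>z\<bar> \<le> 1")
      case True
      then have "z\<^sup>2 \<le> 1" by (simp add: abs_square_le_1)
      then have "z\<^sup>2 * z\<^sup>2 \<le> 1 * z\<^sup>2" by (intro mult_right_mono) auto
      then have "z\<^sup>2 * (1 + y) \<le> 3 * y" by (simp add: y_def field_simps)
      then have "z\<^sup>2 \<le> 3 * y / (1 + y)" using y by (subst pos_le_divide_eq) auto
      moreover have "min 1 \<bar>z\<bar> = \<bar>z\<bar>" using True by simp
      ultimately show ?thesis by simp
    next
      case False
      then have "1 \<le> z\<^sup>2" using one_le_power[of "\<bar>z\<bar>" 2] by simp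
      moreover have "min 1 \<bar>z\<bar> = 1" using False by simp
      ultimately show ?thesis by (simp add: y_def field_simps)
    qed
    ultimately show ?thesis by (simp add: y_def)
  qed
  have i1: "integrable M (\<lambda>w. exp (- (Z w)\<^sup>2 / 2))" by (intro integrable_const_bound[where B=1]) auto
  have ib: "integrable M (\<lambda>w. min 1 \<bar>Z w\<bar>)" "integrable M (\<lambda>w. (min 1 \<bar>Z w\<bar>)\<^sup>2)"
    by (intro integrable_const_bound[where B=1]; auto simp: power_le_one)+
  have "(L0norm M Z)\<^sup>2 \<le> (\<integral>w. (min 1 \<bar>Z w\<bar>)\<^sup>2 \<partial>M)"
    unfolding L0norm_def using square_expectation_le[OF ib] by simp
  also have "\<dots> \<le> (\<integral>w. 3 * (1 - exp (- (Z w)\<^sup>2 / 2)) \<partial>M)"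
    using ib i1 by (intro integral_mono pw) auto
  also have "\<dots> = 3 * (1 - (\<integral>w. exp (- (Z w)\<^sup>2 / 2) \<partial>M))" using i1 by (simp add: prob_space)
  finally show ?thesis using main by simp
qed

end

subsection \<open>Energy and the scalar integral\<close>

text \<open>Convexity of exp on the segment from 0 to -cy, at the point with weight 1/c.\<close>

lemma one_minus_exp_scale:
  assumes "1 \<le> c" shows "1 - exp (- (c * y)) \<le> c * (1 - exp (- y :: real))"
proof -
  have "exp ((1 - 1 / c) *\<^sub>R 0 + (1 / c) *\<^sub>R (- (c * y))) \<le> (1 - 1 / c) * exp 0 + (1 / c) * exp (- (c * y))"
    using assms by (intro convex_onD[OF exp_convex]) auto
  then have "c * exp (- y) \<le> c * ((1 - 1 / c) + (1 / c) * exp (- (c * y)))"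
    using assms by (intro mult_left_mono) auto
  then show ?thesis using assms by (simp add: algebra_simps)
qed

text \<open>The exact constant c matters in the perturbation of energies, where c = 1 + \<eta> has
  to tend to 1.\<close>

lemma (in subordinated_wiener) laplace_exp_scale:
  assumes "1 \<le> c" "0 \<le> x" shows "laplace_exp (c * x) \<le> c * laplace_exp x"
proof -
  have "laplace_exp (c * x) \<le> (LINT s:{0<..}|\<rho>. c * (1 - exp (- x * s)))"
    unfolding laplace_exp_def
  proof (rule set_integral_mono)
    show "set_integrable \<rho> {0<..} (\<lambda>s. 1 - exp (- (c * x) * s))" using assms by (intro rho_exp_integrable) auto
    show "set_integrable \<rho> {0<..} (\<lambda>s. c * (1 - exp (- x * s)))"
      using rho_exp_integrable[OF assms(2)] by (rule set_integrable_mult_right)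
    show "1 - exp (- (c * x) * s) \<le> c * (1 - exp (- x * s))" for s
      using one_minus_exp_scale[OF assms(1), of "x * s"] by (simp add: mult.assoc)
  qed
  also have "\<dots> = c * laplace_exp x" unfolding laplace_exp_def by (rule set_integral_mult_right)
  finally show ?thesis .
qed

lemma strict_grid_exists:
  assumes G: "finite G" "G \<subseteq> {0..T}" and T: "0 < (T::real)"
  obtains m :: nat and t where "G \<subseteq> t ` {..m}" "\<And>i j. i < j \<Longrightarrow> j \<le> m \<Longrightarrow> t i < t j" "t 0 = 0" "t m = T"
proof -
  define xs where "xs = sorted_list_of_set (insert 0 (insert T G))"
  have set: "set xs = insert 0 (insert T G)" unfolding xs_def by (rule set_sorted_list_of_set) (use G in simp)
  have sorted: "sorted_wrt (<) xs" unfolding xs_def by (rule strict_sorted_list_of_set)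
  define m where "m = length xs - 1"
  have len: "length xs = Suc m" using set by (cases xs) (auto simp: m_def)
  have mono: "xs ! i < xs ! j" if "i < j" "j \<le> m" for i j
    using sorted_wrt_nth_less[OF sorted that(1)] that len by simp
  have range: "xs ! i \<in> {0..T}" if "i \<le> m" for i
    using nth_mem[of i xs] that len set G(2) T by auto
  have im: "(!) xs ` {..m} = set xs"
    using len by (auto simp: set_conv_nth image_def less_Suc_eq_le)
  show ?thesis
  proof (rule that[of "(!) xs" m])
    show "G \<subseteq> (!) xs ` {..m}" unfolding im set by auto
    show "xs ! i < xs ! j" if "i < j" "j \<le> m" for i j using mono that .
    have "0 \<in> (!) xs ` {..m}" unfolding im set by simp
    then obtain i where i: "i \<le> m" "xs ! i = 0" by (metis atMost_iff imageE)
    show "xs ! 0 = 0"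
    proof (cases "i = 0")
      case False
      then have "xs ! 0 < 0" using mono[of 0 i] i by simp
      then show ?thesis using range[of 0] by simp
    qed (use i in simp)
    have "T \<in> (!) xs ` {..m}" unfolding im set by simp
    then obtain i where i: "i \<le> m" "xs ! i = T" by (metis atMost_iff imageE)
    show "xs ! m = T"
    proof (cases "i = m")
      case False
      then have "T < xs ! m" using mono[of i m] i by simp
      then show ?thesis using range[of m] by simp
    qed (use i in simp)
  qed
qed

locale subordinated_wiener_basis = subordinated_wiener M C istar W L l \<rho> T
  for M :: "'w measure" and C :: "'v::real_normed_vector dual \<Rightarrow> 'v" and istar :: "'v dual \<Rightarrow> 'h::{real_inner, complete_space}"
    and W L l \<rho> T +
  fixes h :: "nat \<Rightarrow> 'h"
  assumes basis: "orthonormal_basis h" and dense: "closure (range istar) = UNIV"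
begin

definition time_measure :: "real measure" where "time_measure = restrict_space lborel {0..T}"

lemma space_time[simp]: "space time_measure = {0..T}"
  by (simp add: time_measure_def space_restrict_space)

lemma time_measurable: "f \<in> borel_measurable borel \<Longrightarrow> f \<in> borel_measurable time_measure"
  unfolding time_measure_def by (rule measurable_restrict_space1) simp

lemma nn_integral_time: "(\<integral>\<^sup>+s. f s \<partial>time_measure) = (\<integral>\<^sup>+s. f s * indicator {0..T} s \<partial>lborel)"
  unfolding time_measure_def by (rule nn_integral_restrict_space) simp

lemma AE_time: "(AE s in time_measure. P s) \<longleftrightarrow> (AE s in lborel. s \<in> {0..T} \<longrightarrow> P s)"
  unfolding time_measure_def by (rule AE_restrict_space_iff) simp

lemma emeasure_time: "emeasure time_measure {0..T} = ennreal T"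
  using T_pos by (simp add: time_measure_def emeasure_restrict_space)

text \<open>The type \<open>'h\<close> carries no countability assumption, so measurability is
  required weakly; the countable basis still makes norms measurable through Parseval's identity. For
  the semigroup the inner products are orbits tested by functionals.\<close>

definition wmeas :: "(real \<Rightarrow> 'h) \<Rightarrow> bool" where
  "wmeas g \<longleftrightarrow> (\<forall>x. (\<lambda>s. inner (g s) x) \<in> borel_measurable time_measure)"

lemma wmeasI: "(\<And>x. (\<lambda>s. inner (g s) x) \<in> borel_measurable time_measure) \<Longrightarrow> wmeas g"
  by (simp add: wmeas_def)

lemma wmeas_inner: "wmeas g \<Longrightarrow> (\<lambda>s. inner (g s) x) \<in> borel_measurable time_measure"
  by (simp add: wmeas_def)

lemma wmeas_add: "wmeas f \<Longrightarrow> wmeas g \<Longrightarrow> wmeas (\<lambda>s. f s + g s)"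
  unfolding wmeas_def inner_add_left by (auto intro!: borel_measurable_add)

lemma wmeas_diff: "wmeas f \<Longrightarrow> wmeas g \<Longrightarrow> wmeas (\<lambda>s. f s - g s)"
  unfolding wmeas_def inner_diff_left by (auto intro!: borel_measurable_diff)

lemma wmeas_scale: "wmeas f \<Longrightarrow> wmeas (\<lambda>s. c *\<^sub>R f s)"
  unfolding wmeas_def inner_scaleR_left by (auto intro!: borel_measurable_times)

lemma wmeas_zero: "wmeas (\<lambda>s. 0)"
  by (simp add: wmeas_def)

lemma wmeas_indicator: "A \<in> sets borel \<Longrightarrow> wmeas (\<lambda>s. indicator A s *\<^sub>R x)"
  unfolding wmeas_def inner_scaleR_left by (auto intro!: time_measurable)

lemma wmeas_norm:
  assumes "wmeas g" shows "(\<lambda>s. norm (g s)) \<in> borel_measurable time_measure"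
proof -
  have "(\<lambda>s. (norm (g s))\<^sup>2) \<in> borel_measurable time_measure"
  proof (rule borel_measurable_LIMSEQ_real)
    show "(\<lambda>n. \<Sum>k<n. (inner (g s) (h k))\<^sup>2) \<longlonglongrightarrow> (norm (g s))\<^sup>2" for s
      using orthonormal_basis_parseval[OF basis, of "g s"] by (simp add: sums_def)
    show "(\<lambda>s. \<Sum>k<n. (inner (g s) (h k))\<^sup>2) \<in> borel_measurable time_measure" for n
      by (intro borel_measurable_sum borel_measurable_power wmeas_inner assms)
  qed
  then have "(\<lambda>s. sqrt ((norm (g s))\<^sup>2)) \<in> borel_measurable time_measure" by (rule measurable_compose[OF _ borel_measurable_sqrt])
  then show ?thesis by simp
qed

definition energy :: "(real \<Rightarrow> 'h) \<Rightarrow> ennreal" where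
  "energy g = (\<integral>\<^sup>+s. ennreal (laplace_exp ((norm (g s))\<^sup>2 / 2)) \<partial>time_measure)"

lemma energy_integrand_measurable:
  assumes "wmeas g" shows "(\<lambda>s. laplace_exp ((norm (g s))\<^sup>2 / 2)) \<in> borel_measurable time_measure"
  using wmeas_norm[OF assms] by (intro laplace_exp_measurable) auto

lemma laplace_exp_half_nonneg: "0 \<le> laplace_exp ((norm x)\<^sup>2 / 2)"
  by (intro laplace_exp_nonneg) simp

lemma energy_le:
  assumes f: "wmeas f" and g: "wmeas g" and a: "0 \<le> a" and b: "0 \<le> b"
    and le: "\<And>s. s \<in> {0..T} \<Longrightarrow> laplace_exp ((norm (k s))\<^sup>2 / 2) \<le> a * laplace_exp ((norm (f s))\<^sup>2 / 2) + b * laplace_exp ((norm (g s))\<^sup>2 / 2)"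
  shows "energy k \<le> ennreal a * energy f + ennreal b * energy g"
proof -
  have "energy k \<le> (\<integral>\<^sup>+s. ennreal a * ennreal (laplace_exp ((norm (f s))\<^sup>2 / 2)) + ennreal b * ennreal (laplace_exp ((norm (g s))\<^sup>2 / 2)) \<partial>time_measure)"
    unfolding energy_def
  proof (rule nn_integral_mono)
    fix s assume "s \<in> space time_measure"
    then have "ennreal (laplace_exp ((norm (k s))\<^sup>2 / 2)) \<le>
        ennreal (a * laplace_exp ((norm (f s))\<^sup>2 / 2) + b * laplace_exp ((norm (g s))\<^sup>2 / 2))"
      by (intro ennreal_leI le) simp
    then show "ennreal (laplace_exp ((norm (k s))\<^sup>2 / 2)) \<le>
        ennreal a * ennreal (laplace_exp ((norm (f s))\<^sup>2 / 2)) + ennreal b * ennreal (laplace_exp ((norm (g s))\<^sup>2 / 2))"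
      using a b laplace_exp_half_nonneg[of "f s"] laplace_exp_half_nonneg[of "g s"]
      by (simp add: ennreal_plus ennreal_mult)
  qed
  also have "\<dots> = ennreal a * energy f + ennreal b * energy g"
    unfolding energy_def using energy_integrand_measurable[OF f] energy_integrand_measurable[OF g]
    by (subst nn_integral_add) (auto simp: nn_integral_cmult)
  finally show ?thesis .
qed

lemma norm_add_square_le: "(norm (a + b))\<^sup>2 \<le> 2 * (norm a)\<^sup>2 + 2 * (norm (b::'a::real_normed_vector))\<^sup>2"
proof -
  have "(norm (a + b))\<^sup>2 \<le> (norm a + norm b)\<^sup>2" by (intro power_mono norm_triangle_ineq) simp
  also have "\<dots> \<le> 2 * (norm a)\<^sup>2 + 2 * (norm b)\<^sup>2"
    using sum_squares_bound[of "norm a" "norm b"] by (simp add: power2_sum)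
  finally show ?thesis .
qed

text \<open>Pointwise from |a + b|^2 <= 2|a|^2 + 2|b|^2, subadditivity of the Laplace exponent and
  its growth by at most 2 under doubling. The energy of a difference thus satisfies a triangle
  inequality up to the factor 2.\<close>

lemma energy_add_le:
  assumes "wmeas f" "wmeas g" shows "energy (\<lambda>s. f s + g s) \<le> 2 * energy f + 2 * energy g"
proof -
  have "laplace_exp ((norm (a + b))\<^sup>2 / 2) \<le> 2 * laplace_exp ((norm a)\<^sup>2 / 2) + 2 * laplace_exp ((norm b)\<^sup>2 / 2)" for a b :: 'h
  proof -
    have "laplace_exp ((norm (a + b))\<^sup>2 / 2) \<le> laplace_exp (2 * ((norm a)\<^sup>2 / 2) + 2 * ((norm b)\<^sup>2 / 2))"
      using norm_add_square_le[of a b] by (intro laplace_exp_mono) auto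
    also have "\<dots> \<le> laplace_exp (2 * ((norm a)\<^sup>2 / 2)) + laplace_exp (2 * ((norm b)\<^sup>2 / 2))"
      by (intro laplace_exp_add) auto
    also have "\<dots> \<le> 2 * laplace_exp ((norm a)\<^sup>2 / 2) + 2 * laplace_exp ((norm b)\<^sup>2 / 2)"
      by (intro add_mono laplace_exp_scale) auto
    finally show ?thesis .
  qed
  then show ?thesis using energy_le[OF assms, of 2 2 "\<lambda>s. f s + g s"] by simp
qed

lemma energy_triangle:
  assumes "wmeas f" "wmeas g" "wmeas k"
  shows "energy (\<lambda>s. f s - k s) \<le> 2 * energy (\<lambda>s. f s - g s) + 2 * energy (\<lambda>s. g s - k s)"
  using energy_add_le[OF wmeas_diff[OF assms(1,2)] wmeas_diff[OF assms(2,3)]] by simp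

lemma energy_scale_le:
  assumes "wmeas f" shows "energy (\<lambda>s. c *\<^sub>R f s) \<le> ennreal (c\<^sup>2 + 1) * energy f"
proof -
  have "laplace_exp ((norm (c *\<^sub>R a))\<^sup>2 / 2) \<le> (c\<^sup>2 + 1) * laplace_exp ((norm a)\<^sup>2 / 2)" for a :: 'h
    using laplace_exp_mult[of "c\<^sup>2" "(norm a)\<^sup>2 / 2"] by (simp add: power_mult_distrib)
  then show ?thesis using energy_le[OF assms wmeas_zero, of "c\<^sup>2 + 1" 0 "\<lambda>s. c *\<^sub>R f s"] by simp
qed

lemma energy_minus_commute: "energy (\<lambda>s. f s - g s) = energy (\<lambda>s. g s - f s)"
  by (simp add: energy_def norm_minus_commute)

text \<open>Young's inequality with parameter \<eta>. In contrast to the factor 2 of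
  \<open>energy_add_le\<close>, the leading factor can be brought close to 1, which makes the energy
  continuous along approximations.\<close>

lemma energy_perturb:
  assumes "wmeas f" "wmeas g" and \<eta>: "0 < \<eta>"
  shows "energy f \<le> ennreal (1 + \<eta>) * energy g + ennreal (1 + 1 / \<eta>) * energy (\<lambda>s. f s - g s)"
proof (rule energy_le)
  fix s
  have "(norm a)\<^sup>2 \<le> (1 + \<eta>) * (norm b)\<^sup>2 + (1 + 1 / \<eta>) * (norm (a - b))\<^sup>2" for a b :: 'h
  proof -
    have "norm a \<le> norm b + norm (a - b)" by (metis add.commute norm_triangle_sub)
    then have "(norm a)\<^sup>2 \<le> (norm b + norm (a - b))\<^sup>2" by (intro power_mono) auto
    also have "\<dots> = (norm b)\<^sup>2 + (norm (a - b))\<^sup>2 + 2 * (sqrt \<eta> * norm b) * (norm (a - b) / sqrt \<eta>)"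
      using \<eta> by (simp add: power2_sum)
    also have "2 * (sqrt \<eta> * norm b) * (norm (a - b) / sqrt \<eta>) \<le> (sqrt \<eta> * norm b)\<^sup>2 + (norm (a - b) / sqrt \<eta>)\<^sup>2"
      by (rule sum_squares_bound)
    also have "(sqrt \<eta> * norm b)\<^sup>2 + (norm (a - b) / sqrt \<eta>)\<^sup>2 = \<eta> * (norm b)\<^sup>2 + (1 / \<eta>) * (norm (a - b))\<^sup>2"
      using \<eta> by (simp add: power_mult_distrib power_divide)
    finally show ?thesis by (simp add: algebra_simps)
  qed
  from this[of "f s" "g s"]
  have "laplace_exp ((norm (f s))\<^sup>2 / 2) \<le> laplace_exp ((1 + \<eta>) * ((norm (g s))\<^sup>2 / 2) + (1 + 1 / \<eta>) * ((norm (f s - g s))\<^sup>2 / 2))"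
    by (intro laplace_exp_mono) auto
  also have "\<dots> \<le> laplace_exp ((1 + \<eta>) * ((norm (g s))\<^sup>2 / 2)) + laplace_exp ((1 + 1 / \<eta>) * ((norm (f s - g s))\<^sup>2 / 2))"
    using \<eta> by (intro laplace_exp_add mult_nonneg_nonneg) auto
  also have "\<dots> \<le> (1 + \<eta>) * laplace_exp ((norm (g s))\<^sup>2 / 2) + (1 + 1 / \<eta>) * laplace_exp ((norm (f s - g s))\<^sup>2 / 2)"
    using \<eta> by (intro add_mono laplace_exp_scale) auto
  finally show "laplace_exp ((norm (f s))\<^sup>2 / 2) \<le> (1 + \<eta>) * laplace_exp ((norm (g s))\<^sup>2 / 2) + (1 + 1 / \<eta>) * laplace_exp ((norm (f s - g s))\<^sup>2 / 2)" .
qed (use assms wmeas_diff in auto)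

lemma energy_bounded:
  assumes "\<And>s. s \<in> {0..T} \<Longrightarrow> norm (g s) \<le> K"
  shows "energy g \<le> ennreal (laplace_exp (K\<^sup>2 / 2)) * ennreal T"
proof -
  have "energy g \<le> (\<integral>\<^sup>+s. ennreal (laplace_exp (K\<^sup>2 / 2)) \<partial>time_measure)"
    unfolding energy_def using assms
    by (intro nn_integral_mono ennreal_leI laplace_exp_mono divide_right_mono power_mono) auto
  also have "\<dots> = ennreal (laplace_exp (K\<^sup>2 / 2)) * ennreal T" using emeasure_time by simp
  finally show ?thesis .
qed

lemma energy_cong_AE: "AE s in time_measure. f s = g s \<Longrightarrow> energy f = energy g"
  unfolding energy_def by (rule nn_integral_cong_AE) (erule eventually_mono, simp)

lemma energy_dominated:
  assumes w: "\<And>n. wmeas (d n)" and K: "\<And>n s. s \<in> {0..T} \<Longrightarrow> norm (d n s) \<le> K"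
    and lim: "AE s in time_measure. (\<lambda>n. norm (d n s)) \<longlonglongrightarrow> 0"
  shows "(\<lambda>n. energy (d n)) \<longlonglongrightarrow> 0"
proof -
  have "(\<lambda>n. \<integral>\<^sup>+s. ennreal (laplace_exp ((norm (d n s))\<^sup>2 / 2)) \<partial>time_measure) \<longlonglongrightarrow> (\<integral>\<^sup>+s. 0 \<partial>time_measure)"
  proof (rule nn_integral_dominated_convergence[where w="\<lambda>_. ennreal (laplace_exp (K\<^sup>2 / 2))"])
    show "AE s in time_measure. ennreal (laplace_exp ((norm (d n s))\<^sup>2 / 2)) \<le> ennreal (laplace_exp (K\<^sup>2 / 2))" for n
      using K by (intro AE_I2 ennreal_leI laplace_exp_mono divide_right_mono power_mono) auto
    show "(\<integral>\<^sup>+s. ennreal (laplace_exp (K\<^sup>2 / 2)) \<partial>time_measure) < \<infinity>"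
      by (simp add: emeasure_time ennreal_mult_less_top)
    show "AE s in time_measure. (\<lambda>n. ennreal (laplace_exp ((norm (d n s))\<^sup>2 / 2))) \<longlonglongrightarrow> 0"
      using lim
    proof eventually_elim
      case (elim s)
      have "(\<lambda>n. (norm (d n s))\<^sup>2 / 2) \<longlonglongrightarrow> 0\<^sup>2 / 2" by (intro tendsto_intros elim) simp
      then have "(\<lambda>n. laplace_exp ((norm (d n s))\<^sup>2 / 2)) \<longlonglongrightarrow> laplace_exp 0"
        by (intro laplace_exp_tendsto) auto
      then have "(\<lambda>n. ennreal (laplace_exp ((norm (d n s))\<^sup>2 / 2))) \<longlonglongrightarrow> ennreal 0"
        by (intro tendsto_ennrealI) simp
      then show ?case by simp
    qed
  qed (auto intro!: measurable_compose[OF energy_integrand_measurable[OF w] measurable_ennreal])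
  then show ?thesis by (simp add: energy_def)
qed

section \<open>Elementary integrands and their characteristic functions\<close>

text \<open>A relation between a step function and one of its integrals, built term by term.
  Intervals may overlap, so closure under sums is immediate, and the integral is attached to the way
  the function is built; that the function determines it almost surely follows later from
  \<open>stoch_int_unique\<close>.\<close>

inductive elem :: "(real \<Rightarrow> 'v dual) \<Rightarrow> ('w \<Rightarrow> real) \<Rightarrow> bool" where
  zero: "elem (\<lambda>_. 0) (\<lambda>_. 0)"
| step: "elem e Z \<Longrightarrow> 0 \<le> a \<Longrightarrow> a \<le> b \<Longrightarrow> b \<le> T \<Longrightarrow>
    elem (\<lambda>s. e s + indicator {a<..b} s *\<^sub>R v) (\<lambda>w. Z w + (L b v w - L a v w))"

lemma elem_measurable: "elem e Z \<Longrightarrow> Z \<in> borel_measurable M"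
proof (induction rule: elem.induct)
  case (step e Z a b v)
  then have "L b v \<in> borel_measurable M" "L a v \<in> borel_measurable M" by (auto intro!: L_meas)
  then show ?case using step by (intro borel_measurable_add borel_measurable_diff)
qed simp

lemma istar_linear: "istar (u + v) = istar u + istar v" "istar (c *\<^sub>R u) = c *\<^sub>R istar u" "istar 0 = 0" "istar (u - v) = istar u - istar v"
  using bounded_linear.linear[OF istar] by (simp_all add: linear_add linear_scale linear_0 linear_diff)

lemma elem_wmeas: "elem e Z \<Longrightarrow> wmeas (\<lambda>s. istar (e s))"
proof (induction rule: elem.induct)
  case zero
  then show ?case by (simp add: istar_linear wmeas_zero)
next
  case (step e Z a b v)
  then show ?case unfolding istar_linear by (intro wmeas_add wmeas_indicator) auto
qed

lemma elem_add:
  assumes "elem e Z" "elem e' Z'" shows "elem (\<lambda>s. e s + e' s) (\<lambda>w. Z w + Z' w)"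
  using assms(2)
proof (induction rule: elem.induct)
  case zero
  then show ?case using assms(1) by simp
next
  case (step e' Z' a b v)
  then show ?case using elem.step[OF step.IH step.hyps(2-4), of v] by (simp add: add.assoc)
qed

lemma elem_scale: "elem e Z \<Longrightarrow> \<exists>Z'. elem (\<lambda>s. c *\<^sub>R e s) Z' \<and> (AE w in M. Z' w = c * Z w)"
proof (induction rule: elem.induct)
  case zero
  then show ?case by (auto intro!: exI[of _ "\<lambda>_. 0"] elem.zero)
next
  case (step e Z a b v)
  then obtain Z' where Z': "elem (\<lambda>s. c *\<^sub>R e s) Z'" "AE w in M. Z' w = c * Z w" by blast
  have "elem (\<lambda>s. c *\<^sub>R (e s + indicator {a<..b} s *\<^sub>R v)) (\<lambda>w. Z' w + (L b (c *\<^sub>R v) w - L a (c *\<^sub>R v) w))"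
    using elem.step[OF Z'(1) step.hyps(2-4), of "c *\<^sub>R v"] by (simp add: scaleR_add_right mult.commute)
  moreover have "AE w in M. Z' w + (L b (c *\<^sub>R v) w - L a (c *\<^sub>R v) w) = c * (Z w + (L b v w - L a v w))"
  proof -
    have "AE w in M. L a (c *\<^sub>R v) w = c * L a v w" "AE w in M. L b (c *\<^sub>R v) w = c * L b v w"
      using AE_L_linear[of a c v 0 0] AE_L_linear[of b c v 0 0] step.hyps by simp_all
    then show ?thesis using Z'(2) by eventually_elim (simp add: algebra_simps)
  qed
  ultimately show ?case by blast
qed

lemma AE_L_zero: "0 \<le> t \<Longrightarrow> AE w in M. L t 0 w = 0"
  using AE_L_linear[of t 0 0 0 0] by simp

definition strict_grid :: "nat \<Rightarrow> (nat \<Rightarrow> real) \<Rightarrow> bool" where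
  "strict_grid m t \<longleftrightarrow> (\<forall>i j. i < j \<longrightarrow> j \<le> m \<longrightarrow> t i < t j) \<and> t 0 = 0 \<and> t m = T"

definition grid_rep :: "(real \<Rightarrow> 'v dual) \<Rightarrow> ('w \<Rightarrow> real) \<Rightarrow> nat \<Rightarrow> (nat \<Rightarrow> real) \<Rightarrow> (nat \<Rightarrow> 'v dual) \<Rightarrow> bool" where
  "grid_rep e Z m t u \<longleftrightarrow> (\<forall>k<m. \<forall>s. t k < s \<and> s \<le> t (Suc k) \<longrightarrow> e s = u k) \<and> e 0 = 0 \<and>
      (AE w in M. Z w = (\<Sum>k<m. L (t (Suc k)) (u k) w - L (t k) (u k) w))"

text \<open>The claim is for every grid through the points of G, which suits the induction: a grid
  through the enlarged set also passes through the old one, and the new interval is then a union of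
  cells.\<close>

lemma elem_grid:
  assumes "elem e Z"
  shows "\<exists>G. finite G \<and> G \<subseteq> {0..T} \<and> (\<forall>m t. G \<subseteq> t ` {..m} \<longrightarrow> strict_grid m t \<longrightarrow> (\<exists>u. grid_rep e Z m t u))"
  using assms
proof (induction rule: elem.induct)
  case zero
  show ?case
  proof (intro exI[of _ "{}"] conjI allI impI)
    fix m t assume "strict_grid m t"
    then have mono: "\<forall>i j. i < j \<longrightarrow> j \<le> m \<longrightarrow> t i < t j" and t0: "t 0 = 0" by (simp_all add: strict_grid_def)
    have tpos: "0 \<le> t k" if "k \<le> m" for k
      using mono[rule_format, of 0 k] that t0 by (cases "k = 0") auto
    have "AE w in M. \<forall>k\<in>{..<m}. L (t (Suc k)) 0 w = 0 \<and> L (t k) 0 w = 0"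
      by (intro AE_finite_allI AE_conjI AE_L_zero tpos) auto
    then have "AE w in M. 0 = (\<Sum>k<m. L (t (Suc k)) 0 w - L (t k) 0 w)"
      by eventually_elim simp
    then show "\<exists>u. grid_rep (\<lambda>_. 0) (\<lambda>_. 0) m t u"
      unfolding grid_rep_def by (intro exI[of _ "\<lambda>_. 0"]) simp
  qed auto
next
  case (step e Z a b v)
  then obtain G where G: "finite G" "G \<subseteq> {0..T}"
    and IH: "\<And>m t. G \<subseteq> t ` {..m} \<Longrightarrow> strict_grid m t \<Longrightarrow> \<exists>u. grid_rep e Z m t u" by metis
  show ?case
  proof (intro exI[of _ "insert a (insert b G)"] conjI allI impI)
    show "finite (insert a (insert b G))" using G by simp
    show "insert a (insert b G) \<subseteq> {0..T}" using G step.hyps by auto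
    fix m t
    assume sub: "insert a (insert b G) \<subseteq> t ` {..m}" and grid: "strict_grid m t"
    then have mono: "\<forall>i j. i < j \<longrightarrow> j \<le> m \<longrightarrow> t i < t j" and t0: "t 0 = 0" and tm: "t m = T"
      by (simp_all add: strict_grid_def)
    have tpos: "0 \<le> t k" if "k \<le> m" for k
      using mono[rule_format, of 0 k] that t0 by (cases "k = 0") auto
    have monole: "t i \<le> t j" if "i \<le> j" "j \<le> m" for i j
      using mono[rule_format, of i j] that by (cases "i = j") auto
    obtain u where u: "\<And>k s. k < m \<Longrightarrow> t k < s \<Longrightarrow> s \<le> t (Suc k) \<Longrightarrow> e s = u k" and e0: "e 0 = 0"
      and Z: "AE w in M. Z w = (\<Sum>k<m. L (t (Suc k)) (u k) w - L (t k) (u k) w)"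
      using IH[of t m] sub grid unfolding grid_rep_def by auto
    obtain \<alpha> where \<alpha>: "\<alpha> \<le> m" "a = t \<alpha>" using sub by auto
    obtain \<beta> where \<beta>: "\<beta> \<le> m" "b = t \<beta>" using sub by auto
    have \<alpha>\<beta>: "\<alpha> \<le> \<beta>"
    proof (rule ccontr)
      assume "\<not> \<alpha> \<le> \<beta>"
      then have "t \<beta> < t \<alpha>" using mono \<alpha> by auto
      then show False using step.hyps \<alpha> \<beta> by simp
    qed
    \<comment> \<open>Indicator of the cells that make up the new interval; the corresponding
      increments of L telescope.\<close>
    define c :: "nat \<Rightarrow> real" where "c k = (if \<alpha> \<le> k \<and> k < \<beta> then 1 else 0)" for k
    have "\<forall>k<m. \<forall>s. t k < s \<and> s \<le> t (Suc k) \<longrightarrow> e s + indicator {a<..b} s *\<^sub>R v = u k + c k *\<^sub>R v"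
    proof (intro allI impI)
      fix k s assume k: "k < m" and s: "t k < s \<and> s \<le> t (Suc k)"
      have "s \<in> {a<..b} \<longleftrightarrow> \<alpha> \<le> k \<and> k < \<beta>"
      proof
        assume ab: "s \<in> {a<..b}"
        show "\<alpha> \<le> k \<and> k < \<beta>"
        proof (intro conjI; rule ccontr)
          assume "\<not> \<alpha> \<le> k"
          then have "t (Suc k) \<le> t \<alpha>" using monole[of "Suc k" \<alpha>] \<alpha> by simp
          then show False using s ab \<alpha> by simp
        next
          assume "\<not> k < \<beta>"
          then have "t \<beta> \<le> t k" using monole[of \<beta> k] k by simp
          then show False using s ab \<beta> by simp
        qed
      next
        assume "\<alpha> \<le> k \<and> k < \<beta>"
        then show "s \<in> {a<..b}" using monole[of \<alpha> k] monole[of "Suc k" \<beta>] s k \<alpha> \<beta> by auto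
      qed
      then show "e s + indicator {a<..b} s *\<^sub>R v = u k + c k *\<^sub>R v" using u[OF k] s by (simp add: c_def indicator_def)
    qed
    moreover have "e 0 + indicator {a<..b} 0 *\<^sub>R v = 0" using e0 step.hyps by simp
    moreover have "AE w in M. Z w + (L b v w - L a v w) =
        (\<Sum>k<m. L (t (Suc k)) (u k + c k *\<^sub>R v) w - L (t k) (u k + c k *\<^sub>R v) w)"
    proof -
      have "AE w in M. \<forall>k\<in>{..<m}. L (t (Suc k)) (u k + c k *\<^sub>R v) w = L (t (Suc k)) (u k) w + c k * L (t (Suc k)) v w \<and>
          L (t k) (u k + c k *\<^sub>R v) w = L (t k) (u k) w + c k * L (t k) v w"
      proof (intro AE_finite_allI AE_conjI)
        fix k assume "k \<in> {..<m}"
        then have "0 \<le> t k" "0 \<le> t (Suc k)" using tpos by auto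
        then show "AE w in M. L (t (Suc k)) (u k + c k *\<^sub>R v) w = L (t (Suc k)) (u k) w + c k * L (t (Suc k)) v w"
          "AE w in M. L (t k) (u k + c k *\<^sub>R v) w = L (t k) (u k) w + c k * L (t k) v w"
          using AE_L_linear[of "t (Suc k)" 1 "u k" "c k" v] AE_L_linear[of "t k" 1 "u k" "c k" v] by simp_all
      qed simp
      then show ?thesis using Z
      proof eventually_elim
        case (elim w)
        have "(\<Sum>k<m. L (t (Suc k)) (u k + c k *\<^sub>R v) w - L (t k) (u k + c k *\<^sub>R v) w) =
            (\<Sum>k<m. (L (t (Suc k)) (u k) w - L (t k) (u k) w) + c k * (L (t (Suc k)) v w - L (t k) v w))"
          using elim(1) by (intro sum.cong refl) (simp add: algebra_simps)
        also have "\<dots> = Z w + (\<Sum>k<m. c k * (L (t (Suc k)) v w - L (t k) v w))"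
          unfolding sum.distrib using elim(2) by simp
        also have "(\<Sum>k<m. c k * (L (t (Suc k)) v w - L (t k) v w)) = (\<Sum>k=\<alpha>..<\<beta>. L (t (Suc k)) v w - L (t k) v w)"
          unfolding c_def using \<beta> by (intro sum.mono_neutral_cong_right) auto
        also have "\<dots> = L b v w - L a v w"
          using sum_Suc_diff'[OF \<alpha>\<beta>, of "\<lambda>k. L (t k) v w"] \<alpha> \<beta> by simp
        finally show ?case ..
      qed
    qed
    ultimately show "\<exists>u. grid_rep (\<lambda>s. e s + indicator {a<..b} s *\<^sub>R v) (\<lambda>w. Z w + (L b v w - L a v w)) m t u"
      unfolding grid_rep_def by (intro exI[of _ "\<lambda>k. u k + c k *\<^sub>R v"] conjI)
  qed
qed

text \<open>On a common grid the increments belong to disjoint intervals, so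
  \<open>L_increments_char\<close> applies, and the energy integrand is constant on the cells. The
  two sums coincide.\<close>

lemma elem_char:
  assumes "elem e Z"
  obtains x where "0 \<le> x" "energy (\<lambda>s. istar (e s)) = ennreal x" "(\<integral>w. iexp (Z w) \<partial>M) = complex_of_real (exp (- x))"
proof -
  from elem_grid[OF assms] obtain G where G: "finite G" "G \<subseteq> {0..T}" and
    grid: "\<And>m t. G \<subseteq> t ` {..m} \<Longrightarrow> strict_grid m t \<Longrightarrow> \<exists>u. grid_rep e Z m t u" by metis
  obtain m :: nat and t where t: "G \<subseteq> t ` {..m}" "\<And>i j. i < j \<Longrightarrow> j \<le> m \<Longrightarrow> t i < t j" "t 0 = 0" "t m = T"
    using strict_grid_exists[OF G T_pos] by metis
  obtain u where u: "\<And>k s. k < m \<Longrightarrow> t k < s \<Longrightarrow> s \<le> t (Suc k) \<Longrightarrow> e s = u k" and e0: "e 0 = 0"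
    and Z: "AE w in M. Z w = (\<Sum>k<m. L (t (Suc k)) (u k) w - L (t k) (u k) w)"
    using grid[OF t(1)] t(2-4) unfolding grid_rep_def strict_grid_def by auto
  have tpos: "0 \<le> t k" if "k \<le> m" for k
    using t(2)[of 0 k] that t(3) by (cases "k = 0") auto
  have monole: "t i \<le> t j" if "i \<le> j" "j \<le> m" for i j
    using t(2)[of i j] that by (cases "i = j") auto
  define c where "c k = laplace_exp ((norm (istar (u k)))\<^sup>2 / 2)" for k
  have c0: "0 \<le> c k" for k unfolding c_def by (rule laplace_exp_half_nonneg)
  have "energy (\<lambda>s. istar (e s)) = (\<integral>\<^sup>+s. (\<Sum>k<m. ennreal (c k) * indicator {t k<..t (Suc k)} s) \<partial>lborel)"
    unfolding energy_def nn_integral_time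
  proof (rule nn_integral_cong)
    fix s :: real
    show "ennreal (laplace_exp ((norm (istar (e s)))\<^sup>2 / 2)) * indicator {0..T} s = (\<Sum>k<m. ennreal (c k) * indicator {t k<..t (Suc k)} s)"
    proof (cases "0 < s \<and> s \<le> T")
      case False
      have "s \<notin> {t k<..t (Suc k)}" if "k < m" for k
        using False tpos[of k] monole[of "Suc k" m] t(4) that by auto
      then have "(\<Sum>k<m. ennreal (c k) * indicator {t k<..t (Suc k)} s) = 0" by (intro sum.neutral) auto
      moreover have "ennreal (laplace_exp ((norm (istar (e s)))\<^sup>2 / 2)) * indicator {0..T} s = 0"
        using False e0 by (cases "s = 0") (auto simp: istar_linear indicator_def)
      ultimately show ?thesis by simp
    next
      case True
      \<comment> \<open>The cell containing s ends at the first grid point at or after s.\<close>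
      define K where "K = (LEAST k. s \<le> t k)"
      have K1: "s \<le> t K" unfolding K_def by (rule LeastI[of _ m]) (use True t(4) in simp)
      have Km: "K \<le> m" unfolding K_def by (rule Least_le) (use True t(4) in simp)
      have K0: "K \<noteq> 0" using K1 True t(3) by (cases "K = 0") auto
      then obtain p where p: "K = Suc p" by (cases K) auto
      have tp: "t p < s" using not_less_Least[of p "\<lambda>k. s \<le> t k"] p unfolding K_def by auto
      have "(\<Sum>k<m. ennreal (c k) * indicator {t k<..t (Suc k)} s) = (\<Sum>k<m. if k = p then ennreal (c p) else 0)"
      proof (intro sum.cong refl)
        fix k assume "k \<in> {..<m}"
        then have k: "k < m" by simp
        consider "k = p" | "k < p" | "p < k" by linarith
        then show "ennreal (c k) * indicator {t k<..t (Suc k)} s = (if k = p then ennreal (c p) else 0)"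
        proof cases
          case 1
          then show ?thesis using tp K1 p by simp
        next
          case 2
          then have "t (Suc k) \<le> t p" using monole[of "Suc k" p] Km p by simp
          then show ?thesis using 2 tp by simp
        next
          case 3
          then have "t K \<le> t k" using monole[of K k] k p by simp
          then show ?thesis using 3 K1 by simp
        qed
      qed
      also have "\<dots> = ennreal (c p)" using Km p by simp
      also have "\<dots> = ennreal (laplace_exp ((norm (istar (e s)))\<^sup>2 / 2)) * indicator {0..T} s"
        using u[of p s] tp K1 p Km True by (simp add: c_def)
      finally show ?thesis ..
    qed
  qed
  also have "\<dots> = (\<Sum>k<m. ennreal (c k) * ennreal (t (Suc k) - t k))"
    using t(2) by (subst nn_integral_sum) (auto simp: nn_integral_cmult_indicator less_imp_le)
  also have "\<dots> = ennreal (\<Sum>k<m. (t (Suc k) - t k) * c k)"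
    using c0 monole by (subst sum_ennreal[symmetric]) (auto simp: ennreal_mult mult.commute)
  finally have en: "energy (\<lambda>s. istar (e s)) = ennreal (\<Sum>k<m. (t (Suc k) - t k) * c k)" .
  have "(\<integral>w. iexp (Z w) \<partial>M) = (\<integral>w. iexp (\<Sum>k<m. L (t (Suc k)) (u k) w - L (t k) (u k) w) \<partial>M)"
  proof (rule integral_cong_AE)
    have [measurable]: "Z \<in> borel_measurable M" using elem_measurable[OF assms] .
    have [measurable]: "L (t k) v \<in> borel_measurable M" "L (t (Suc k)) v \<in> borel_measurable M" if "k \<in> {..<m}" for k v
      using tpos[of k] tpos[of "Suc k"] that by (auto intro!: L_meas)
    show "(\<lambda>w. iexp (Z w)) \<in> borel_measurable M" by measurable
    show "(\<lambda>w. iexp (\<Sum>k<m. L (t (Suc k)) (u k) w - L (t k) (u k) w)) \<in> borel_measurable M" by measurable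
    show "AE w in M. iexp (Z w) = iexp (\<Sum>k<m. L (t (Suc k)) (u k) w - L (t k) (u k) w)"
      using Z by eventually_elim simp
  qed
  also have "\<dots> = complex_of_real (exp (- (\<Sum>k<m. (t (Suc k) - t k) * c k)))"
    unfolding c_def using t(3) monole by (intro L_increments_char) auto
  finally have "(\<integral>w. iexp (Z w) \<partial>M) = complex_of_real (exp (- (\<Sum>k<m. (t (Suc k) - t k) * c k)))" .
  moreover have "0 \<le> (\<Sum>k<m. (t (Suc k) - t k) * c k)" using c0 monole by (intro sum_nonneg mult_nonneg_nonneg) auto
  ultimately show thesis using that en by blast
qed

text \<open>Multiplying the integrand by u multiplies the energy by at most u^2 + 1, so exp(-y) >= 1
  - y gives the lower bound on the characteristic function that
  \<open>L0norm_square_le_of_char\<close> asks for.\<close>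

lemma elem_L0norm:
  assumes e: "elem e Z" and en: "energy (\<lambda>s. istar (e s)) \<le> ennreal x" and x: "0 \<le> x"
  shows "(L0norm M Z)\<^sup>2 \<le> 6 * x"
proof (rule L0norm_square_le_of_char)
  show "Z \<in> borel_measurable M" using elem_measurable[OF e] .
  fix u :: real
  obtain Z' where Z': "elem (\<lambda>s. u *\<^sub>R e s) Z'" "AE w in M. Z' w = u * Z w" using elem_scale[OF e] by blast
  obtain y where y: "0 \<le> y" "energy (\<lambda>s. istar (u *\<^sub>R e s)) = ennreal y" "(\<integral>w. iexp (Z' w) \<partial>M) = complex_of_real (exp (- y))"
    using elem_char[OF Z'(1)] .
  have "ennreal y \<le> ennreal (u\<^sup>2 + 1) * energy (\<lambda>s. istar (e s))"
    using energy_scale_le[OF elem_wmeas[OF e], of u] y(2) by (simp add: istar_linear)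
  also have "\<dots> \<le> ennreal (u\<^sup>2 + 1) * ennreal x" using en by (rule mult_left_mono) simp
  also have "\<dots> = ennreal ((u\<^sup>2 + 1) * x)" using x by (intro ennreal_mult[symmetric]) auto
  finally have yx: "y \<le> (u\<^sup>2 + 1) * x" using x by (subst (asm) ennreal_le_iff) auto
  have "(\<integral>w. iexp (u * Z w) \<partial>M) = (\<integral>w. iexp (Z' w) \<partial>M)"
  proof (rule integral_cong_AE)
    have [measurable]: "Z \<in> borel_measurable M" "Z' \<in> borel_measurable M" using elem_measurable e Z' by auto
    show "(\<lambda>w. iexp (u * Z w)) \<in> borel_measurable M" "(\<lambda>w. iexp (Z' w)) \<in> borel_measurable M" by measurable
    show "AE w in M. iexp (u * Z w) = iexp (Z' w)" using Z'(2) by eventually_elim simp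
  qed
  then have "Re (\<integral>w. iexp (u * Z w) \<partial>M) = exp (- y)" using y(3) by simp
  then show "1 - (u\<^sup>2 + 1) * x \<le> Re (\<integral>w. iexp (u * Z w) \<partial>M)"
    using exp_ge_add_one_self[of "- y"] yx by simp
qed fact

end

lemma norm_iexp_diff_le: "norm (iexp x - iexp y) \<le> 2 * min 1 \<bar>x - y\<bar>"
proof -
  have "norm (iexp x - iexp y) = norm (iexp y * (iexp (x - y) - 1))"
    by (simp add: algebra_simps exp_add[symmetric])
  also have "\<dots> = norm (iexp (x - y) - 1)" by (simp add: norm_mult)
  also have "\<dots> \<le> \<bar>x - y\<bar>" using iexp_approx1[of "x - y" 0] by simp
  finally have 1: "norm (iexp x - iexp y) \<le> \<bar>x - y\<bar>" .
  have "norm (iexp x - iexp y) \<le> norm (iexp x) + norm (iexp y)" by (rule norm_triangle_ineq4)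
  also have "\<dots> = 2" by simp
  finally have 2: "norm (iexp x - iexp y) \<le> 2" .
  show ?thesis
  proof (cases "1 \<le> \<bar>x - y\<bar>")
    case True
    then show ?thesis using 2 by simp
  next
    case False
    then have "2 * min 1 \<bar>x - y\<bar> = \<bar>x - y\<bar> + \<bar>x - y\<bar>" by simp
    then show ?thesis using 1 by linarith
  qed
qed

lemma ennreal_small_combination:
  assumes "x < ennreal (\<epsilon> / 8)" "y < ennreal (\<epsilon> / 8)" "0 < \<epsilon>"
  shows "2 * x + 2 * y < ennreal \<epsilon>"
proof -
  have "2 * x + 2 * y \<le> 2 * ennreal (\<epsilon> / 8) + 2 * ennreal (\<epsilon> / 8)"
    using assms by (intro add_mono mult_left_mono) auto
  also have "\<dots> = ennreal (2 * (\<epsilon> / 8) + 2 * (\<epsilon> / 8))"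
    using assms by (simp only: ennreal_plus ennreal_mult ennreal_numeral)
  also have "\<dots> < ennreal \<epsilon>" using assms by (intro ennreal_lessI) auto
  finally show ?thesis .
qed

section \<open>Closure of the elementary integral in energy and probability\<close>

context subordinated_wiener_basis begin

text \<open>The closure of the graph of the elementary integral, with energy on the side of
  integrands and \<open>L0norm\<close> on the side of integrals. It is a relation because an
  integral is determined only up to null sets.\<close>

definition stoch_int :: "(real \<Rightarrow> 'h) \<Rightarrow> ('w \<Rightarrow> real) \<Rightarrow> bool" where
  "stoch_int g Z \<longleftrightarrow> wmeas g \<and> Z \<in> borel_measurable M \<and>
    (\<forall>\<epsilon>>0. \<exists>e Y. elem e Y \<and> energy (\<lambda>s. g s - istar (e s)) < ennreal \<epsilon> \<and> L0norm M (\<lambda>w. Z w - Y w) < \<epsilon>)"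

lemma stoch_int_wmeas: "stoch_int g Z \<Longrightarrow> wmeas g"
  by (simp add: stoch_int_def)

lemma stoch_int_measurable: "stoch_int g Z \<Longrightarrow> Z \<in> borel_measurable M"
  by (simp add: stoch_int_def)

lemma stoch_int_approx:
  assumes "stoch_int g Z" "0 < \<epsilon>"
  obtains e Y where "elem e Y" "energy (\<lambda>s. g s - istar (e s)) < ennreal \<epsilon>" "L0norm M (\<lambda>w. Z w - Y w) < \<epsilon>"
  using assms unfolding stoch_int_def by blast

lemma energy_zero: "energy (\<lambda>s. 0) = 0"
  by (simp add: energy_def)

lemma stoch_int_elem: assumes "elem e Z" shows "stoch_int (\<lambda>s. istar (e s)) Z"
  unfolding stoch_int_def
proof (intro conjI allI impI elem_wmeas[OF assms] elem_measurable[OF assms])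
  fix \<epsilon> :: real assume "0 < \<epsilon>"
  then show "\<exists>e' Y. elem e' Y \<and> energy (\<lambda>s. istar (e s) - istar (e' s)) < ennreal \<epsilon> \<and> L0norm M (\<lambda>w. Z w - Y w) < \<epsilon>"
    using assms by (intro exI[of _ e] exI[of _ Z]) (simp add: energy_zero L0norm_def)
qed

text \<open>Closing the graph a second time adds nothing. The share \<epsilon>/8 absorbs the factor
  2 of the triangle inequality for energies and keeps the inequality strict.\<close>

lemma stoch_int_closure:
  assumes g: "wmeas g" and Z[measurable]: "Z \<in> borel_measurable M"
    and app: "\<And>\<epsilon>. 0 < \<epsilon> \<Longrightarrow> \<exists>g' Z'. stoch_int g' Z' \<and> energy (\<lambda>s. g s - g' s) < ennreal \<epsilon> \<and> L0norm M (\<lambda>w. Z w - Z' w) < \<epsilon>"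
  shows "stoch_int g Z"
  unfolding stoch_int_def
proof (intro conjI allI impI g Z)
  fix \<epsilon> :: real assume \<epsilon>: "0 < \<epsilon>"
  then have \<epsilon>8: "0 < \<epsilon> / 8" by simp
  obtain g' Z' where 1: "stoch_int g' Z'" "energy (\<lambda>s. g s - g' s) < ennreal (\<epsilon> / 8)" "L0norm M (\<lambda>w. Z w - Z' w) < \<epsilon> / 8"
    using app[OF \<epsilon>8] by blast
  obtain e Y where 2: "elem e Y" "energy (\<lambda>s. g' s - istar (e s)) < ennreal (\<epsilon> / 8)" "L0norm M (\<lambda>w. Z' w - Y w) < \<epsilon> / 8"
    using stoch_int_approx[OF 1(1) \<epsilon>8] .
  have [measurable]: "Z' \<in> borel_measurable M" "Y \<in> borel_measurable M"
    using stoch_int_measurable[OF 1(1)] elem_measurable[OF 2(1)] by auto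
  have "energy (\<lambda>s. g s - istar (e s)) \<le> 2 * energy (\<lambda>s. g s - g' s) + 2 * energy (\<lambda>s. g' s - istar (e s))"
    by (rule energy_triangle[OF g stoch_int_wmeas[OF 1(1)] elem_wmeas[OF 2(1)]])
  also have "\<dots> < ennreal \<epsilon>" by (rule ennreal_small_combination[OF 1(2) 2(2) \<epsilon>])
  finally have "energy (\<lambda>s. g s - istar (e s)) < ennreal \<epsilon>" .
  moreover have "L0norm M (\<lambda>w. Z w - Y w) < \<epsilon>"
    using L0norm_triangle_diff[of Z Z' Y] 1(3) 2(3) \<epsilon> by simp
  ultimately show "\<exists>e Y. elem e Y \<and> energy (\<lambda>s. g s - istar (e s)) < ennreal \<epsilon> \<and> L0norm M (\<lambda>w. Z w - Y w) < \<epsilon>"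
    using 2(1) by blast
qed

text \<open>An elementary approximant within x of g has energy at most 2x + 2x, so its truncated
  norm is at most the root of 6 times 4x; the approximation error adds x.\<close>

lemma stoch_int_L0norm:
  assumes Z: "stoch_int g Z" and en: "energy g \<le> ennreal x" and x: "0 < x"
  shows "L0norm M Z \<le> x + sqrt (24 * x)"
proof -
  obtain e Y where e: "elem e Y" "energy (\<lambda>s. g s - istar (e s)) < ennreal x" "L0norm M (\<lambda>w. Z w - Y w) < x"
    using stoch_int_approx[OF Z x] .
  have [measurable]: "Z \<in> borel_measurable M" "Y \<in> borel_measurable M"
    using stoch_int_measurable[OF Z] elem_measurable[OF e(1)] by auto
  have "energy (\<lambda>s. istar (e s)) \<le> 2 * energy (\<lambda>s. istar (e s) - g s) + 2 * energy g"
    using energy_add_le[OF wmeas_diff[OF elem_wmeas[OF e(1)] stoch_int_wmeas[OF Z]] stoch_int_wmeas[OF Z]] by simp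
  also have "\<dots> \<le> 2 * ennreal x + 2 * ennreal x"
    using e(2) en by (intro add_mono mult_left_mono) (auto simp: energy_minus_commute)
  also have "\<dots> = ennreal (4 * x)"
    using x by (simp flip: ennreal_numeral ennreal_mult ennreal_plus)
  finally have "(L0norm M Y)\<^sup>2 \<le> 6 * (4 * x)" using x by (intro elem_L0norm[OF e(1)]) auto
  then have "L0norm M Y \<le> sqrt (24 * x)" by (intro real_le_rsqrt) simp
  moreover have "L0norm M Z \<le> L0norm M (\<lambda>w. Z w - Y w) + L0norm M Y"
    using L0norm_triangle[of "\<lambda>w. Z w - Y w" Y] by simp
  ultimately show ?thesis using e(3) by simp
qed

lemma stoch_int_zero: "stoch_int (\<lambda>_. 0) (\<lambda>_. 0)"
  using stoch_int_elem[OF elem.zero] by (simp add: istar_linear)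

lemma stoch_int_add:
  assumes f: "stoch_int f X" and g: "stoch_int g Y"
  shows "stoch_int (\<lambda>s. f s + g s) (\<lambda>w. X w + Y w)"
  unfolding stoch_int_def
proof (intro conjI allI impI)
  have [measurable]: "X \<in> borel_measurable M" "Y \<in> borel_measurable M"
    using stoch_int_measurable f g by auto
  show "wmeas (\<lambda>s. f s + g s)" using f g by (intro wmeas_add stoch_int_wmeas)
  show "(\<lambda>w. X w + Y w) \<in> borel_measurable M" by measurable
  fix \<epsilon> :: real assume \<epsilon>: "0 < \<epsilon>"
  then have \<epsilon>8: "0 < \<epsilon> / 8" by simp
  obtain e E where 1: "elem e E" "energy (\<lambda>s. f s - istar (e s)) < ennreal (\<epsilon> / 8)" "L0norm M (\<lambda>w. X w - E w) < \<epsilon> / 8"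
    using stoch_int_approx[OF f \<epsilon>8] .
  obtain e' E' where 2: "elem e' E'" "energy (\<lambda>s. g s - istar (e' s)) < ennreal (\<epsilon> / 8)" "L0norm M (\<lambda>w. Y w - E' w) < \<epsilon> / 8"
    using stoch_int_approx[OF g \<epsilon>8] .
  have [measurable]: "E \<in> borel_measurable M" "E' \<in> borel_measurable M" using elem_measurable 1 2 by auto
  have "energy (\<lambda>s. (f s + g s) - istar (e s + e' s)) \<le> 2 * energy (\<lambda>s. f s - istar (e s)) + 2 * energy (\<lambda>s. g s - istar (e' s))"
    using energy_add_le[OF wmeas_diff[OF stoch_int_wmeas[OF f] elem_wmeas[OF 1(1)]] wmeas_diff[OF stoch_int_wmeas[OF g] elem_wmeas[OF 2(1)]]]
    by (simp add: istar_linear algebra_simps)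
  also have "\<dots> < ennreal \<epsilon>" by (rule ennreal_small_combination[OF 1(2) 2(2) \<epsilon>])
  finally have "energy (\<lambda>s. (f s + g s) - istar (e s + e' s)) < ennreal \<epsilon>" .
  moreover have "L0norm M (\<lambda>w. (X w + Y w) - (E w + E' w)) < \<epsilon>"
  proof -
    have "L0norm M (\<lambda>w. (X w - E w) + (Y w - E' w)) \<le> L0norm M (\<lambda>w. X w - E w) + L0norm M (\<lambda>w. Y w - E' w)"
      by (rule L0norm_triangle) measurable
    then show ?thesis using 1(3) 2(3) \<epsilon> by (simp add: add_diff_add)
  qed
  ultimately show "\<exists>e Z. elem e Z \<and> energy (\<lambda>s. f s + g s - istar (e s)) < ennreal \<epsilon> \<and> L0norm M (\<lambda>w. X w + Y w - Z w) < \<epsilon>"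
    using elem_add[OF 1(1) 2(1)] by blast
qed

lemma stoch_int_AE:
  assumes Z: "stoch_int g Z" and Z'[measurable]: "Z' \<in> borel_measurable M" and eq: "AE w in M. Z w = Z' w"
  shows "stoch_int g Z'"
proof (rule stoch_int_closure[OF stoch_int_wmeas[OF Z] Z'])
  have [measurable]: "Z \<in> borel_measurable M" by (rule stoch_int_measurable[OF Z])
  have "L0norm M (\<lambda>w. Z' w - Z w) = L0norm M (\<lambda>w. 0 :: real)"
    by (rule L0norm_cong_AE) (use eq in \<open>auto elim: eventually_mono\<close>)
  then show "\<exists>g' Y. stoch_int g' Y \<and> energy (\<lambda>s. g s - g' s) < ennreal \<epsilon> \<and> L0norm M (\<lambda>w. Z' w - Y w) < \<epsilon>" if "0 < \<epsilon>" for \<epsilon>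
    using that Z by (intro exI[of _ g] exI[of _ Z]) (simp add: energy_zero L0norm_def)
qed

lemma stoch_int_AE_fun:
  assumes Z: "stoch_int g Z" and g': "wmeas g'" and eq: "AE s in time_measure. g s = g' s"
  shows "stoch_int g' Z"
proof (rule stoch_int_closure[OF g' stoch_int_measurable[OF Z]])
  have "energy (\<lambda>s. g' s - g s) = energy (\<lambda>s. 0)"
    by (rule energy_cong_AE) (use eq in \<open>auto elim: eventually_mono\<close>)
  then show "\<exists>k Y. stoch_int k Y \<and> energy (\<lambda>s. g' s - k s) < ennreal \<epsilon> \<and> L0norm M (\<lambda>w. Z w - Y w) < \<epsilon>" if "0 < \<epsilon>" for \<epsilon>
    using that Z by (intro exI[of _ g] exI[of _ Z]) (simp add: energy_zero L0norm_def)
qed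

lemma stoch_int_scale:
  assumes Z: "stoch_int g Z" shows "stoch_int (\<lambda>s. c *\<^sub>R g s) (\<lambda>w. c * Z w)"
proof (rule stoch_int_closure)
  have [measurable]: "Z \<in> borel_measurable M" by (rule stoch_int_measurable[OF Z])
  show "wmeas (\<lambda>s. c *\<^sub>R g s)" by (rule wmeas_scale[OF stoch_int_wmeas[OF Z]])
  show "(\<lambda>w. c * Z w) \<in> borel_measurable M" by measurable
  fix \<epsilon> :: real assume \<epsilon>: "0 < \<epsilon>"
  define K where "K = c\<^sup>2 + 1 + \<bar>c\<bar>"
  have K: "1 \<le> K" "c\<^sup>2 + 1 \<le> K" "\<bar>c\<bar> \<le> K" by (auto simp: K_def)
  have \<epsilon>K: "0 < \<epsilon> / K" using \<epsilon> K by simp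
  obtain e E where 1: "elem e E" "energy (\<lambda>s. g s - istar (e s)) < ennreal (\<epsilon> / K)" "L0norm M (\<lambda>w. Z w - E w) < \<epsilon> / K"
    using stoch_int_approx[OF Z \<epsilon>K] .
  have [measurable]: "E \<in> borel_measurable M" by (rule elem_measurable[OF 1(1)])
  obtain E' where E': "elem (\<lambda>s. c *\<^sub>R e s) E'" "AE w in M. E' w = c * E w" using elem_scale[OF 1(1)] by blast
  have "energy (\<lambda>s. c *\<^sub>R g s - istar (c *\<^sub>R e s)) \<le> ennreal (c\<^sup>2 + 1) * energy (\<lambda>s. g s - istar (e s))"
    using energy_scale_le[OF wmeas_diff[OF stoch_int_wmeas[OF Z] elem_wmeas[OF 1(1)]], of c] by (simp add: istar_linear scaleR_diff_right)
  also have "\<dots> \<le> ennreal K * energy (\<lambda>s. g s - istar (e s))" using K by (intro mult_right_mono ennreal_leI) auto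
  also have "\<dots> < ennreal K * ennreal (\<epsilon> / K)"
    using 1(2) K by (intro ennreal_mult_strict_left_mono) (auto simp: ennreal_zero_less_divide)
  also have "\<dots> = ennreal \<epsilon>" using K \<epsilon> by (simp flip: ennreal_mult)
  finally have en: "energy (\<lambda>s. c *\<^sub>R g s - istar (c *\<^sub>R e s)) < ennreal \<epsilon>" .
  have "stoch_int (\<lambda>s. istar (c *\<^sub>R e s)) (\<lambda>w. c * E w)"
    by (rule stoch_int_AE[OF stoch_int_elem[OF E'(1)] _ E'(2)]) measurable
  moreover have "L0norm M (\<lambda>w. c * Z w - c * E w) \<le> K * L0norm M (\<lambda>w. Z w - E w)"
    using K by (intro L0norm_linear_le) (auto simp: abs_mult right_diff_distrib[symmetric] intro!: mult_right_mono)
  moreover have "K * L0norm M (\<lambda>w. Z w - E w) < \<epsilon>" using 1(3) K by (simp add: field_simps)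
  ultimately show "\<exists>g' Z'. stoch_int g' Z' \<and> energy (\<lambda>s. c *\<^sub>R g s - g' s) < ennreal \<epsilon> \<and> L0norm M (\<lambda>w. c * Z w - Z' w) < \<epsilon>"
    using en by (intro exI[of _ "\<lambda>s. istar (c *\<^sub>R e s)"] exI[of _ "\<lambda>w. c * E w"]) auto
qed

lemma stoch_int_diff:
  assumes "stoch_int f X" "stoch_int g Y" shows "stoch_int (\<lambda>s. f s - g s) (\<lambda>w. X w - Y w)"
  using stoch_int_add[OF assms(1) stoch_int_scale[OF assms(2), of "-1"]] by simp

lemma stoch_int_sum:
  assumes "finite I" "\<And>i. i \<in> I \<Longrightarrow> stoch_int (f i) (X i)"
  shows "stoch_int (\<lambda>s. \<Sum>i\<in>I. f i s) (\<lambda>w. \<Sum>i\<in>I. X i w)"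
  using assms by (induction rule: finite_induct) (auto intro: stoch_int_zero stoch_int_add)

lemma stoch_int_L0norm_small:
  assumes "0 < \<epsilon>"
  obtains \<delta> where "0 < \<delta>" "\<And>g Z. stoch_int g Z \<Longrightarrow> energy g < ennreal \<delta> \<Longrightarrow> L0norm M Z < \<epsilon>"
proof -
  have "((\<lambda>x. x + sqrt (24 * x)) \<longlongrightarrow> 0 + sqrt (24 * 0)) (at_right 0)"
    by (intro tendsto_intros)
  then have "\<forall>\<^sub>F x in at_right 0. x + sqrt (24 * x) < \<epsilon>"
    using assms by (intro order_tendstoD) auto
  then have "\<forall>\<^sub>F x in at_right 0. x + sqrt (24 * x) < \<epsilon> \<and> 0 < x"
    by (intro eventually_conj eventually_at_right_less)
  then obtain \<delta> where "\<delta> + sqrt (24 * \<delta>) < \<epsilon>" "0 < \<delta>"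
    using eventually_happens trivial_limit_at_right_real by blast
  then show thesis
    by (intro that[of \<delta>] le_less_trans[OF stoch_int_L0norm]) (auto intro: less_imp_le)
qed

lemma stoch_int_tendsto:
  assumes "\<And>n. stoch_int (g n) (Z n)" "stoch_int g' Z'" and lim: "(\<lambda>n. energy (\<lambda>s. g n s - g' s)) \<longlonglongrightarrow> 0"
  shows "(\<lambda>n. L0norm M (\<lambda>w. Z n w - Z' w)) \<longlonglongrightarrow> 0"
proof (rule LIMSEQ_I)
  fix \<epsilon> :: real assume "0 < \<epsilon>"
  then obtain \<delta> where \<delta>: "0 < \<delta>" "\<And>g Z. stoch_int g Z \<Longrightarrow> energy g < ennreal \<delta> \<Longrightarrow> L0norm M Z < \<epsilon>"
    using stoch_int_L0norm_small by metis
  have "\<forall>\<^sub>F n in sequentially. energy (\<lambda>s. g n s - g' s) < ennreal \<delta>"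
    using lim \<delta>(1) by (intro order_tendstoD) auto
  then obtain N where N: "\<And>n. n \<ge> N \<Longrightarrow> energy (\<lambda>s. g n s - g' s) < ennreal \<delta>" by (auto simp: eventually_sequentially)
  have "norm (L0norm M (\<lambda>w. Z n w - Z' w) - 0) < \<epsilon>" if "n \<ge> N" for n
    using \<delta>(2)[OF stoch_int_diff[OF assms(1,2)] N[OF that]] L0norm_nonneg[of "\<lambda>w. Z n w - Z' w"] by simp
  then show "\<exists>no. \<forall>n\<ge>no. norm (L0norm M (\<lambda>w. Z n w - Z' w) - 0) < \<epsilon>" by blast
qed

text \<open>The difference of two integrals of g is an integral of 0, whose energy lies below every
  positive \<delta>.\<close>

lemma stoch_int_unique:
  assumes "stoch_int g Z" "stoch_int g Z'" shows "AE w in M. Z w = Z' w"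
proof -
  have s: "stoch_int (\<lambda>s. 0) (\<lambda>w. Z w - Z' w)" using stoch_int_diff[OF assms] by simp
  have "L0norm M (\<lambda>w. Z w - Z' w) \<le> 0"
  proof (rule field_le_epsilon)
    fix \<epsilon> :: real assume "0 < \<epsilon>"
    then obtain \<delta> where \<delta>: "0 < \<delta>" "\<And>g Z. stoch_int g Z \<Longrightarrow> energy g < ennreal \<delta> \<Longrightarrow> L0norm M Z < \<epsilon>"
      using stoch_int_L0norm_small by metis
    have "L0norm M (\<lambda>w. Z w - Z' w) < \<epsilon>" using \<delta>(2)[OF s] \<delta>(1) by (simp add: energy_zero)
    then show "L0norm M (\<lambda>w. Z w - Z' w) \<le> 0 + \<epsilon>" by simp
  qed
  then have "AE w in M. Z w - Z' w = 0"
    using stoch_int_measurable[OF s] by (intro AE_eq_0_if_L0norm)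
  then show ?thesis by eventually_elim simp
qed

lemma stoch_int_exists:
  assumes g: "wmeas g"
    and app: "\<And>\<epsilon>. 0 < \<epsilon> \<Longrightarrow> \<exists>g' Z'. stoch_int g' Z' \<and> energy (\<lambda>s. g s - g' s) < ennreal \<epsilon>"
  obtains Z where "stoch_int g Z"
proof -
  \<comment> \<open>Consecutive approximants differ by energy at most x = 4^-n/100, and x + sqrt(24
    x) <= 2^-n, the rate demanded by \<open>L0norm_complete\<close>.\<close>
  define \<epsilon> where "\<epsilon> n = (1/4 :: real) ^ n / 400" for n :: nat
  have \<epsilon>0: "0 < \<epsilon> n" for n by (simp add: \<epsilon>_def)
  have "\<forall>n. \<exists>p. stoch_int (fst p) (snd p) \<and> energy (\<lambda>s. g s - fst p s) < ennreal (\<epsilon> n)"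
    using app[OF \<epsilon>0] by (metis fst_conv snd_conv)
  then obtain p where p: "\<And>n. stoch_int (fst (p n)) (snd (p n))" "\<And>n. energy (\<lambda>s. g s - fst (p n) s) < ennreal (\<epsilon> n)"
    by metis
  define f where "f n = fst (p n)" for n
  define Z where "Z n = snd (p n)" for n
  have fZ: "stoch_int (f n) (Z n)" and en: "energy (\<lambda>s. g s - f n s) < ennreal (\<epsilon> n)" for n
    using p by (auto simp: f_def Z_def)
  have rate: "L0norm M (\<lambda>w. Z (Suc n) w - Z n w) \<le> (1/2) ^ n" for n
  proof -
    let ?x = "(1/4 :: real) ^ n / 100"
    have "energy (\<lambda>s. f (Suc n) s - f n s) \<le> 2 * energy (\<lambda>s. f (Suc n) s - g s) + 2 * energy (\<lambda>s. g s - f n s)"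
      by (intro energy_triangle stoch_int_wmeas[OF fZ] g)
    also have "\<dots> \<le> 2 * ennreal (\<epsilon> n) + 2 * ennreal (\<epsilon> n)"
    proof (intro add_mono mult_left_mono)
      have "energy (\<lambda>s. f (Suc n) s - g s) \<le> ennreal (\<epsilon> (Suc n))"
        using en[of "Suc n"] by (simp add: energy_minus_commute)
      also have "\<dots> \<le> ennreal (\<epsilon> n)" by (intro ennreal_leI) (simp add: \<epsilon>_def)
      finally show "energy (\<lambda>s. f (Suc n) s - g s) \<le> ennreal (\<epsilon> n)" .
      show "energy (\<lambda>s. g s - f n s) \<le> ennreal (\<epsilon> n)" using en[of n] by simp
    qed auto
    also have "\<dots> = ennreal (4 * \<epsilon> n)"
      using \<epsilon>0[of n] by (simp flip: ennreal_numeral ennreal_mult ennreal_plus)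
    finally have "L0norm M (\<lambda>w. Z (Suc n) w - Z n w) \<le> ?x + sqrt (24 * ?x)"
      by (intro stoch_int_L0norm[OF stoch_int_diff[OF fZ fZ]]) (auto simp: \<epsilon>_def)
    also have "sqrt (24 * ?x) \<le> (1/2) ^ n / 2"
    proof (rule real_le_lsqrt)
      have "((1/2) ^ n / 2)\<^sup>2 = (1/4 :: real) ^ n / 4"
        by (simp add: power_divide power_mult[symmetric] mult.commute[of n 2]) (simp add: power_mult)
      show "24 * ?x \<le> ((1/2) ^ n / 2)\<^sup>2" unfolding \<open>((1/2) ^ n / 2)\<^sup>2 = (1/4 :: real) ^ n / 4\<close> by simp
    qed auto
    also have "?x \<le> (1/2) ^ n / 2"
    proof -
      have "(1/4 :: real) ^ n \<le> (1/2) ^ n" "0 \<le> (1/2 :: real) ^ n" by (auto intro: power_mono)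
      then show ?thesis by linarith
    qed
    finally show ?thesis by simp
  qed
  obtain Y where Y: "Y \<in> borel_measurable M" "(\<lambda>n. L0norm M (\<lambda>w. Z n w - Y w)) \<longlonglongrightarrow> 0"
    using L0norm_complete[of Z, OF stoch_int_measurable[OF fZ] rate] .
  have "stoch_int g Y"
  proof (rule stoch_int_closure[OF g Y(1)])
    fix \<delta> :: real assume \<delta>: "0 < \<delta>"
    have "(\<lambda>n. (1/4 :: real) ^ n / 400) \<longlonglongrightarrow> 0 / 400" by (intro tendsto_intros LIMSEQ_realpow_zero) auto
    then have "\<forall>\<^sub>F n in sequentially. \<epsilon> n < \<delta>" using \<delta> unfolding \<epsilon>_def by (intro order_tendstoD) auto
    moreover have "\<forall>\<^sub>F n in sequentially. L0norm M (\<lambda>w. Z n w - Y w) < \<delta>" using Y(2) \<delta> by (rule order_tendstoD)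
    ultimately have "\<forall>\<^sub>F n in sequentially. \<epsilon> n < \<delta> \<and> L0norm M (\<lambda>w. Z n w - Y w) < \<delta>" by (rule eventually_conj)
    then obtain n where n: "\<epsilon> n < \<delta>" "L0norm M (\<lambda>w. Z n w - Y w) < \<delta>" using eventually_happens by fastforce
    have "energy (\<lambda>s. g s - f n s) < ennreal \<delta>" using en[of n] n(1) \<epsilon>0[of n] by (auto intro: less_trans ennreal_lessI)
    moreover have "L0norm M (\<lambda>w. Y w - Z n w) < \<delta>" using n(2) by (simp add: L0norm_diff_commute)
    ultimately show "\<exists>g' Z'. stoch_int g' Z' \<and> energy (\<lambda>s. g s - g' s) < ennreal \<delta> \<and> L0norm M (\<lambda>w. Y w - Z' w) < \<delta>"
      using fZ by blast
  qed
  then show thesis by (rule that)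
qed

text \<open>For elementary approximants the formula is \<open>elem_char\<close>. Their
  characteristic functions converge by convergence in probability; their energies converge because
  \<open>energy_perturb\<close> is applied in both directions with small \<eta>.\<close>

lemma stoch_int_char:
  assumes Z: "stoch_int g Z" and x: "energy g = ennreal x" "0 \<le> x"
  shows "(\<integral>w. iexp (Z w) \<partial>M) = complex_of_real (exp (- x))"
proof -
  have ex: "\<forall>n. \<exists>p. elem (fst p) (snd p) \<and> energy (\<lambda>s. g s - istar (fst p s)) < ennreal (1 / real (Suc n)) \<and> L0norm M (\<lambda>w. Z w - snd p w) < 1 / real (Suc n)"
  proof
    fix n
    have "0 < 1 / real (Suc n)" by simp
    then obtain e Y where "elem e Y" "energy (\<lambda>s. g s - istar (e s)) < ennreal (1 / real (Suc n))"
        "L0norm M (\<lambda>w. Z w - Y w) < 1 / real (Suc n)"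
      using stoch_int_approx[OF Z] by metis
    then show "\<exists>p. elem (fst p) (snd p) \<and> energy (\<lambda>s. g s - istar (fst p s)) < ennreal (1 / real (Suc n)) \<and> L0norm M (\<lambda>w. Z w - snd p w) < 1 / real (Suc n)"
      by (intro exI[of _ "(e, Y)"]) simp
  qed
  from choice[OF ex] obtain p where "\<forall>n. elem (fst (p n)) (snd (p n)) \<and> energy (\<lambda>s. g s - istar (fst (p n) s)) < ennreal (1 / real (Suc n)) \<and>
      L0norm M (\<lambda>w. Z w - snd (p n) w) < 1 / real (Suc n)" ..
  then have p: "\<And>n. elem (fst (p n)) (snd (p n))" "\<And>n. energy (\<lambda>s. g s - istar (fst (p n) s)) < ennreal (1 / real (Suc n))"
      "\<And>n. L0norm M (\<lambda>w. Z w - snd (p n) w) < 1 / real (Suc n)" by simp_all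
  define Y where "Y n = snd (p n)" for n
  have [measurable]: "Z \<in> borel_measurable M" "Y n \<in> borel_measurable M" for n
    using stoch_int_measurable[OF Z] elem_measurable[OF p(1)] by (auto simp: Y_def)
  have ex: "\<forall>n. \<exists>a. 0 \<le> a \<and> energy (\<lambda>s. istar (fst (p n) s)) = ennreal a \<and> (\<integral>w. iexp (Y n w) \<partial>M) = complex_of_real (exp (- a))"
    using elem_char[OF p(1)] unfolding Y_def by metis
  from choice[OF ex] obtain a where "\<forall>n. 0 \<le> a n \<and> energy (\<lambda>s. istar (fst (p n) s)) = ennreal (a n) \<and> (\<integral>w. iexp (Y n w) \<partial>M) = complex_of_real (exp (- a n))" ..
  then have a: "\<And>n. 0 \<le> a n" "\<And>n. energy (\<lambda>s. istar (fst (p n) s)) = ennreal (a n)" "\<And>n. (\<integral>w. iexp (Y n w) \<partial>M) = complex_of_real (exp (- a n))"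
    by simp_all
  have ineq: "u \<le> (1 + \<eta>) * v + (1 + 1 / \<eta>) * (1 / real (Suc n))"
    if "wmeas f" "wmeas k" "energy f = ennreal u" "energy k = ennreal v" "0 \<le> v" "0 < \<eta>" "energy (\<lambda>s. f s - k s) < ennreal (1 / real (Suc n))"
    for f k u v \<eta> n
  proof -
    have "ennreal u \<le> ennreal (1 + \<eta>) * ennreal v + ennreal (1 + 1 / \<eta>) * energy (\<lambda>s. f s - k s)"
      using energy_perturb[OF that(1,2,6)] that by simp
    also have "\<dots> \<le> ennreal (1 + \<eta>) * ennreal v + ennreal (1 + 1 / \<eta>) * ennreal (1 / real (Suc n))"
      using that by (intro add_left_mono mult_left_mono) auto
    also have "\<dots> = ennreal ((1 + \<eta>) * v + (1 + 1 / \<eta>) * (1 / real (Suc n)))"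
    proof -
      have n: "0 \<le> 1 + \<eta>" "0 \<le> 1 + 1 / \<eta>" "0 \<le> 1 / real (Suc n)" using that by auto
      have n': "0 \<le> (1 + \<eta>) * v" "0 \<le> (1 + 1 / \<eta>) * (1 / real (Suc n))"
        using n that(5) by (auto intro!: mult_nonneg_nonneg simp del: of_nat_Suc)
      show ?thesis by (simp only: ennreal_plus[OF n'] ennreal_mult[OF n(1) that(5)] ennreal_mult[OF n(2,3)])
    qed
    finally show ?thesis using that by (subst (asm) ennreal_le_iff) (auto intro!: add_nonneg_nonneg mult_nonneg_nonneg)
  qed
  have lima: "a \<longlonglongrightarrow> x"
  proof (rule LIMSEQ_I)
    fix r :: real assume r: "0 < r"
    \<comment> \<open>Chosen so that 2 \<eta> x <= r/4; the index N then makes the remaining error d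
      satisfy 2 d < r/4.\<close>
    define \<eta> where "\<eta> = min 1 (r / (8 * (x + 1)))"
    have \<eta>: "0 < \<eta>" "\<eta> \<le> 1" "\<eta> \<le> r / (8 * (x + 1))" using r x(2) by (auto simp: \<eta>_def)
    have "\<eta> * (8 * (x + 1)) \<le> r" using \<eta>(3) x(2) by (simp add: pos_le_divide_eq)
    then have \<eta>x: "2 * (\<eta> * x) \<le> r / 4" using \<eta>(1) by (simp add: algebra_simps)
    obtain N where N: "2 * (1 + 1 / \<eta>) / (r / 4) < real N" using reals_Archimedean2 by blast
    have "norm (a n - x) < r" if n: "n \<ge> N" for n
    proof -
      define d where "d = (1 + 1 / \<eta>) * (1 / real (Suc n))"
      have d0: "0 \<le> d" using \<eta> by (auto simp: d_def intro!: mult_nonneg_nonneg add_nonneg_nonneg)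
      have "2 * (1 + 1 / \<eta>) / (r / 4) < real (Suc n)" using N n by linarith
      then have "2 * (1 + 1 / \<eta>) < real (Suc n) * (r / 4)" using r by (subst (asm) pos_divide_less_eq) auto
      then have "2 * (1 + 1 / \<eta>) / real (Suc n) < r / 4" by (subst pos_divide_less_eq) (auto simp: mult.commute)
      then have d: "2 * d < r / 4" by (simp add: d_def)
      have wm: "wmeas g" "wmeas (\<lambda>s. istar (fst (p n) s))" using stoch_int_wmeas[OF Z] elem_wmeas[OF p(1)] by auto
      have 1: "a n \<le> (1 + \<eta>) * x + d"
        unfolding d_def using p(2)[of n] by (intro ineq[OF wm(2,1) a(2) x \<eta>(1)]) (simp add: energy_minus_commute)
      have 2: "x \<le> (1 + \<eta>) * a n + d"
        unfolding d_def by (intro ineq[OF wm x(1) a(2) a(1) \<eta>(1)] p(2))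
      have "\<eta> * a n \<le> \<eta> * ((1 + \<eta>) * x + d)" using 1 \<eta> by (intro mult_left_mono) auto
      also have "\<dots> = \<eta> * x + \<eta> * (\<eta> * x) + \<eta> * d" by (simp add: algebra_simps)
      also have "\<dots> \<le> \<eta> * x + 1 * (\<eta> * x) + 1 * d"
        using \<eta> x(2) d0 by (intro add_mono mult_right_mono order_refl mult_nonneg_nonneg) auto
      finally have "\<eta> * a n \<le> 2 * (\<eta> * x) + d" by simp
      then show ?thesis using 1 2 d \<eta>x d0 r by (simp add: abs_le_iff abs_less_iff algebra_simps)
    qed
    then show "\<exists>no. \<forall>n\<ge>no. norm (a n - x) < r" by blast
  qed
  have "(\<lambda>n. \<integral>w. iexp (Y n w) \<partial>M) \<longlonglongrightarrow> (\<integral>w. iexp (Z w) \<partial>M)"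
  proof (rule LIM_zero_cancel, rule Lim_null_comparison)
    show "\<forall>\<^sub>F n in sequentially. norm ((\<integral>w. iexp (Y n w) \<partial>M) - (\<integral>w. iexp (Z w) \<partial>M)) \<le> 2 * (1 / real (Suc n))"
    proof (intro always_eventually allI)
      fix n
      have i: "integrable M (\<lambda>w. iexp (Y n w))" "integrable M (\<lambda>w. iexp (Z w))"
        by (intro integrable_const_bound[where B=1]; simp)+
      have "norm ((\<integral>w. iexp (Y n w) \<partial>M) - (\<integral>w. iexp (Z w) \<partial>M)) = norm (\<integral>w. iexp (Y n w) - iexp (Z w) \<partial>M)"
        using i by simp
      also have "\<dots> \<le> (\<integral>w. norm (iexp (Y n w) - iexp (Z w)) \<partial>M)" by (rule integral_norm_bound)
      also have "\<dots> \<le> (\<integral>w. 2 * min 1 (norm (Z w - Y n w)) \<partial>M)"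
      proof (rule integral_mono)
        show "norm (iexp (Y n w) - iexp (Z w)) \<le> 2 * min 1 (norm (Z w - Y n w))" for w
          using norm_iexp_diff_le[of "Y n w" "Z w"] by (simp add: abs_minus_commute)
      qed (use i in \<open>auto intro!: min1_integrable integrable_mult_right integrable_norm\<close>)
      also have "\<dots> = 2 * L0norm M (\<lambda>w. Z w - Y n w)" by (simp add: L0norm_def)
      also have "\<dots> \<le> 2 * (1 / real (Suc n))" using p(3)[of n] by (simp add: Y_def)
      finally show "norm ((\<integral>w. iexp (Y n w) \<partial>M) - (\<integral>w. iexp (Z w) \<partial>M)) \<le> 2 * (1 / real (Suc n))" .
    qed
    show "(\<lambda>n. 2 * (1 / real (Suc n))) \<longlonglongrightarrow> 0"
      using tendsto_mult[OF tendsto_const LIMSEQ_Suc[OF lim_1_over_n], of 2] by simp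
  qed
  moreover have "(\<lambda>n. \<integral>w. iexp (Y n w) \<partial>M) \<longlonglongrightarrow> complex_of_real (exp (- x))"
    unfolding a(3) by (intro tendsto_intros lima)
  ultimately show ?thesis by (rule LIMSEQ_unique)
qed

lemma stoch_int_pointwise_limit:
  fixes f :: "nat \<Rightarrow> real \<Rightarrow> 'h"
  assumes g: "wmeas g" and f: "\<And>n. stoch_int (f n) (Y n)" and K: "\<And>n s. norm (g s - f n s) \<le> K"
    and lim: "\<And>s. (\<lambda>n. norm (g s - f n s)) \<longlonglongrightarrow> 0"
  shows "\<exists>Z. stoch_int g Z"
proof -
  have lim: "(\<lambda>n. energy (\<lambda>s. g s - f n s)) \<longlonglongrightarrow> 0"
  proof (rule energy_dominated[where K=K])
    show "wmeas (\<lambda>s. g s - f n s)" for n by (intro wmeas_diff g stoch_int_wmeas[OF f])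
  qed (use K lim in auto)
  show ?thesis
  proof (rule stoch_int_exists[OF g])
    fix \<epsilon> :: real assume "0 < \<epsilon>"
    then have "\<forall>\<^sub>F n in sequentially. energy (\<lambda>s. g s - f n s) < ennreal \<epsilon>" by (intro order_tendstoD(2)[OF lim]) simp
    then obtain n where "energy (\<lambda>s. g s - f n s) < ennreal \<epsilon>" using eventually_happens by fastforce
    then show "\<exists>g' Z'. stoch_int g' Z' \<and> energy (\<lambda>s. g s - g' s) < ennreal \<epsilon>" using f by blast
  qed blast
qed

text \<open>Three extensions: from intervals with values \<open>istar v\<close> to arbitrary x,
  since the range of \<open>istar\<close> is dense, and from there to Borel sets by disjoint-union
  induction over the half-open intervals, which are stable under intersection.\<close>

lemma stoch_int_indicator:
  assumes "A \<in> sets borel" obtains Z where "stoch_int (\<lambda>s. indicator A s *\<^sub>R x) Z"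
proof -
  \<comment> \<open>The interval is cut to [0,T]; the point 0, lost because elementary intervals are
    open on the left, is a null set.\<close>
  have Ioc_v: "\<exists>Z. stoch_int (\<lambda>s. indicator {a<..b} s *\<^sub>R istar v) Z" for a b :: real and v
  proof (cases "max 0 a \<le> min T b")
    case True
    have "elem (\<lambda>s. 0 + indicator {max 0 a<..min T b} s *\<^sub>R v) (\<lambda>w. 0 + (L (min T b) v w - L (max 0 a) v w))"
      using True by (intro elem.step elem.zero) auto
    from stoch_int_elem[OF this] have "stoch_int (\<lambda>s. indicator {max 0 a<..min T b} s *\<^sub>R istar v) (\<lambda>w. L (min T b) v w - L (max 0 a) v w)"
      by (simp add: istar_linear)
    then have "stoch_int (\<lambda>s. indicator {a<..b} s *\<^sub>R istar v) (\<lambda>w. L (min T b) v w - L (max 0 a) v w)"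
    proof (rule stoch_int_AE_fun)
      show "AE s in time_measure. indicator {max 0 a<..min T b} s *\<^sub>R istar v = indicator {a<..b} s *\<^sub>R istar v"
        unfolding AE_time using AE_lborel_singleton[of 0]
      proof eventually_elim
        case (elim s)
        have "s \<in> {0..T} \<Longrightarrow> s \<in> {max 0 a<..min T b} \<longleftrightarrow> s \<in> {a<..b}" using elim by simp
        then show ?case by (simp add: indicator_def)
      qed
    qed (rule wmeas_indicator, simp)
    then show ?thesis by blast
  next
    case False
    have "stoch_int (\<lambda>s. indicator {a<..b} s *\<^sub>R istar v) (\<lambda>_. 0)"
      using stoch_int_zero
    proof (rule stoch_int_AE_fun)
      show "AE s in time_measure. 0 = indicator {a<..b} s *\<^sub>R istar v"
        unfolding AE_time using AE_lborel_singleton[of 0]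
      proof eventually_elim
        case (elim s)
        have "s \<notin> {a<..b}" if "s \<in> {0..T}"
        proof
          assume "s \<in> {a<..b}"
          then have "max 0 a \<le> s" "s \<le> min T b" using that by auto
          then show False using False by linarith
        qed
        then show ?case by (simp add: indicator_def)
      qed
    qed (rule wmeas_indicator, simp)
    then show ?thesis by blast
  qed
  have Ioc: "\<exists>Z. stoch_int (\<lambda>s. indicator {a<..b} s *\<^sub>R x) Z" for a b :: real and x
  proof -
    have "x \<in> closure (range istar)" using dense by simp
    then obtain y where y: "\<And>n. y n \<in> range istar" "y \<longlonglongrightarrow> x" unfolding closure_sequential by blast
    have "\<forall>n. \<exists>v. y n = istar v" using y(1) by blast
    then obtain v where v: "\<And>n. y n = istar (v n)" by metis
    have lim: "(\<lambda>n. x - istar (v n)) \<longlonglongrightarrow> 0" using tendsto_diff[OF tendsto_const[of x] y(2)] by (simp add: v)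
    obtain K where K: "\<And>n. norm (x - istar (v n)) \<le> K"
      using convergent_imp_Bseq[OF convergentI[OF lim]] by (auto simp: Bseq_def)
    have "\<forall>n. \<exists>Z. stoch_int (\<lambda>s. indicator {a<..b} s *\<^sub>R istar (v n)) Z" using Ioc_v by blast
    from choice[OF this] obtain Y where Y: "stoch_int (\<lambda>s. indicator {a<..b} s *\<^sub>R istar (v n)) (Y n)" for n by blast
    show ?thesis
    proof (rule stoch_int_pointwise_limit[where f="\<lambda>n s. indicator {a<..b} s *\<^sub>R istar (v n)" and Y=Y and K=K])
      show "wmeas (\<lambda>s. indicator {a<..b} s *\<^sub>R x)" by (rule wmeas_indicator) simp
      show "stoch_int (\<lambda>s. indicator {a<..b} s *\<^sub>R istar (v n)) (Y n)" for n by (rule Y)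
      show "norm (indicator {a<..b} s *\<^sub>R x - indicator {a<..b} s *\<^sub>R istar (v n)) \<le> K" for n s
        using K[of n] order_trans[OF norm_ge_zero K[of n]] by (cases "s \<in> {a<..b}") simp_all
      show "(\<lambda>n. norm (indicator {a<..b} s *\<^sub>R x - indicator {a<..b} s *\<^sub>R istar (v n))) \<longlonglongrightarrow> 0" for s
        using tendsto_norm_zero[OF lim] by (cases "s \<in> {a<..b}") simp_all
    qed
  qed
  \<comment> \<open>Constants serve the complement step of the induction.\<close>
  have univ: "\<exists>Z. stoch_int (\<lambda>s. x) Z" for x
  proof -
    obtain Z where "stoch_int (\<lambda>s. indicator {0<..T} s *\<^sub>R x) Z" using Ioc by blast
    then have "stoch_int (\<lambda>s. x) Z"
    proof (rule stoch_int_AE_fun)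
      show "AE s in time_measure. indicator {0<..T} s *\<^sub>R x = x"
        unfolding AE_time using AE_lborel_singleton[of 0] by eventually_elim (simp add: indicator_def)
      show "wmeas (\<lambda>s. x)" by (simp add: wmeas_def)
    qed
    then show ?thesis by blast
  qed
  have "A \<in> sigma_sets UNIV (range (\<lambda>(a, b). {a<..b :: real}))"
    using assms unfolding borel_sigma_sets_Ioc by simp
  then have "\<forall>x. \<exists>Z. stoch_int (\<lambda>s. indicator A s *\<^sub>R x) Z"
  proof (rule sigma_sets_induct_disjoint[rotated 2])
    show "Int_stable (range (\<lambda>(a, b). {a<..b :: real}))"
    proof (rule Int_stableI)
      fix A B :: "real set" assume "A \<in> range (\<lambda>(a, b). {a<..b})" "B \<in> range (\<lambda>(a, b). {a<..b})"
      then obtain a b c d where "A = {a<..b}" "B = {c<..d}" by auto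
      then have "A \<inter> B = (\<lambda>(a, b). {a<..b}) (max a c, min b d)" by auto
      then show "A \<inter> B \<in> range (\<lambda>(a, b). {a<..b})" by blast
    qed
    show "range (\<lambda>(a, b). {a<..b :: real}) \<subseteq> Pow UNIV" by simp
  next
    fix B :: "real set" assume "B \<in> range (\<lambda>(a, b). {a<..b})"
    then show "\<forall>x. \<exists>Z. stoch_int (\<lambda>s. indicator B s *\<^sub>R x) Z" using Ioc by auto
  next
    show "\<forall>x. \<exists>Z. stoch_int (\<lambda>s. indicator {} s *\<^sub>R x) Z" using stoch_int_zero by auto
  next
    fix B :: "real set" assume IH: "\<forall>x. \<exists>Z. stoch_int (\<lambda>s. indicator B s *\<^sub>R x) Z"
    show "\<forall>x. \<exists>Z. stoch_int (\<lambda>s. indicator (UNIV - B) s *\<^sub>R x) Z"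
    proof
      fix x
      obtain Z Z' where "stoch_int (\<lambda>s. indicator B s *\<^sub>R x) Z" "stoch_int (\<lambda>s. x) Z'" using IH univ by blast
      from stoch_int_diff[OF this(2,1)] have "stoch_int (\<lambda>s. x - indicator B s *\<^sub>R x) (\<lambda>w. Z' w - Z w)" .
      moreover have "(\<lambda>s. x - indicator B s *\<^sub>R x) = (\<lambda>s. indicator (UNIV - B) s *\<^sub>R x)"
        by (auto simp: indicator_def fun_eq_iff)
      ultimately show "\<exists>Z. stoch_int (\<lambda>s. indicator (UNIV - B) s *\<^sub>R x) Z" by auto
    qed
  next
    fix B :: "nat \<Rightarrow> real set"
    assume disj: "disjoint_family B" and B: "range B \<subseteq> sigma_sets UNIV (range (\<lambda>(a, b). {a<..b :: real}))"
      and IH: "\<And>i. \<forall>x. \<exists>Z. stoch_int (\<lambda>s. indicator (B i) s *\<^sub>R x) Z"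
    show "\<forall>x. \<exists>Z. stoch_int (\<lambda>s. indicator (\<Union>i. B i) s *\<^sub>R x) Z"
    proof
      fix x
      have "\<forall>i. \<exists>Z. stoch_int (\<lambda>s. indicator (B i) s *\<^sub>R x) Z" using IH by blast
      from choice[OF this] obtain Y where Y: "stoch_int (\<lambda>s. indicator (B i) s *\<^sub>R x) (Y i)" for i by blast
      have Bb: "B i \<in> sets borel" for i using B unfolding borel_sigma_sets_Ioc by auto
      define f where "f n s = (\<Sum>i<n. indicator (B i) s *\<^sub>R x)" for n :: nat and s
      have f_eq: "f n s = indicator (\<Union>i<n. B i) s *\<^sub>R x" for n s
        unfolding f_def using disj
        by (subst indicator_UN_disjoint) (auto simp: scaleR_sum_left disjoint_family_on_def)
      show "\<exists>Z. stoch_int (\<lambda>s. indicator (\<Union>i. B i) s *\<^sub>R x) Z"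
      proof (rule stoch_int_pointwise_limit[where f=f and K="norm x"])
        show "wmeas (\<lambda>s. indicator (\<Union>i. B i) s *\<^sub>R x)" using Bb by (intro wmeas_indicator) auto
        show "stoch_int (f n) (\<lambda>w. \<Sum>i<n. Y i w)" for n
          unfolding f_def using Y by (intro stoch_int_sum) auto
        show "norm (indicator (\<Union>i. B i) s *\<^sub>R x - f n s) \<le> norm x" for n s
          unfolding f_eq by (auto simp: indicator_def)
        show "(\<lambda>n. norm (indicator (\<Union>i. B i) s *\<^sub>R x - f n s)) \<longlonglongrightarrow> 0" for s
        proof (cases "s \<in> (\<Union>i. B i)")
          case True
          then obtain k where k: "s \<in> B k" by blast
          have "\<forall>\<^sub>F n in sequentially. norm (indicator (\<Union>i. B i) s *\<^sub>R x - f n s) = 0"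
            unfolding eventually_sequentially f_eq using True k by (intro exI[of _ "Suc k"]) (auto simp: indicator_def)
          then show ?thesis by (rule tendsto_eventually)
        next
          case False
          then show ?thesis unfolding f_eq by (auto simp: indicator_def)
        qed
      qed
    qed
  qed
  then show thesis using that by blast
qed

end

subsection \<open>Regulated functions and the cylindrical integral\<close>

lemma partition_cases:
  fixes t :: "nat \<Rightarrow> real"
  assumes "t 0 \<le> s" "s \<le> t m"
  obtains k where "k \<le> m" "s = t k" | k where "k < m" "t k < s" "s < t (Suc k)"
proof -
  define K where "K = (LEAST k. s \<le> t k)"
  have K1: "s \<le> t K" unfolding K_def by (rule LeastI[of _ m]) (rule assms(2))
  have Km: "K \<le> m" unfolding K_def by (rule Least_le) (rule assms(2))
  show thesis
  proof (cases "s = t K")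
    case True
    then show thesis using that(1) Km by blast
  next
    case False
    then have lt: "s < t K" using K1 by simp
    then have "K \<noteq> 0" using assms(1) by (cases "K = 0") auto
    then obtain p where p: "K = Suc p" by (cases K) auto
    have "t p < s" using not_less_Least[of p "\<lambda>k. s \<le> t k"] p unfolding K_def by auto
    then show thesis using that(2)[of p] lt p Km by simp
  qed
qed

text \<open>Bisection: the two one-sided limits at x make a partition with the single interior point
  x good enough on every short interval around x, and partitions of adjacent intervals concatenate.
  Values at partition points are left uncontrolled.\<close>

lemma regulated_simple_approx:
  fixes g :: "real \<Rightarrow> 'b::metric_space"
  assumes g: "regulated T g" and T: "0 \<le> T" and \<epsilon>: "0 < \<epsilon>"
  obtains m t v where "t 0 = 0" "t m = T"
    "\<And>k. k < m \<Longrightarrow> t k \<le> t (Suc k)" "\<And>k s. k < m \<Longrightarrow> s \<in> {t k<..<t (Suc k)} \<Longrightarrow> dist (v k) (g s) < \<epsilon>"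
proof -
  define R where "R a b m t v \<longleftrightarrow> t 0 = a \<and> t m = b \<and> (\<forall>k<m. t k \<le> t (Suc k) \<and> (\<forall>s\<in>{t k<..<t (Suc k)}. dist (v k) (g s) < \<epsilon>))"
    for a b :: real and m :: nat and t and v :: "nat \<Rightarrow> 'b"
  have "0 \<le> (0::real) \<longrightarrow> T \<le> T \<longrightarrow> (\<exists>m t v. R 0 T m t v)"
  proof (rule Bolzano[OF T, of "\<lambda>a b. 0 \<le> a \<longrightarrow> b \<le> T \<longrightarrow> (\<exists>m t v. R a b m t v)"])
    fix a b c :: real
    assume 1: "0 \<le> a \<longrightarrow> b \<le> T \<longrightarrow> (\<exists>m t v. R a b m t v)" and 2: "0 \<le> b \<longrightarrow> c \<le> T \<longrightarrow> (\<exists>m t v. R b c m t v)"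
      and abc: "a \<le> b" "b \<le> c"
    show "0 \<le> a \<longrightarrow> c \<le> T \<longrightarrow> (\<exists>m t v. R a c m t v)"
    proof (intro impI)
      assume "0 \<le> a" "c \<le> T"
      then obtain m t v m' t' v' where r: "R a b m t v" "R b c m' t' v'" using 1 2 abc by force
      have "R a c (m + m') (\<lambda>k. if k \<le> m then t k else t' (k - m)) (\<lambda>k. if k < m then v k else v' (k - m))"
        unfolding R_def
      proof (intro conjI allI impI)
        fix k assume k: "k < m + m'"
        let ?t = "\<lambda>k. if k \<le> m then t k else t' (k - m)" and ?v = "\<lambda>k. if k < m then v k else v' (k - m)"
        have "?t k \<le> ?t (Suc k) \<and> (\<forall>s\<in>{?t k<..<?t (Suc k)}. dist (?v k) (g s) < \<epsilon>)"
        proof (cases "k < m")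
          case True
          then show ?thesis using r(1) by (simp add: R_def)
        next
          case False
          have "?t k = t' (k - m)" "?t (Suc k) = t' (Suc (k - m))"
            using False r by (auto simp: R_def Suc_diff_le)
          then show ?thesis using r(2) k False by (simp add: R_def)
        qed
        then show "?t k \<le> ?t (Suc k)" "\<forall>s\<in>{?t k<..<?t (Suc k)}. dist (?v k) (g s) < \<epsilon>" by auto
      qed (use r in \<open>auto simp: R_def\<close>)
      then show "\<exists>m t v. R a c m t v" by blast
    qed
  next
    fix x assume x: "0 \<le> x" "x \<le> T"
    \<comment> \<open>At x = T no right limit is given, but then no s < T lies to the right and the
      condition is vacuous.\<close>
    have "\<exists>d>0. \<exists>l. \<forall>s. x < s \<and> s < x + d \<and> s < T \<longrightarrow> dist l (g s) < \<epsilon>"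
    proof (cases "x < T")
      case True
      then obtain l where "(g \<longlongrightarrow> l) (at_right x)" using g x by (auto simp: regulated_def)
      then have "\<forall>\<^sub>F s in at_right x. dist (g s) l < \<epsilon>" using \<epsilon> by (rule tendstoD)
      then obtain b where "b > x" "\<And>s. x < s \<Longrightarrow> s < b \<Longrightarrow> dist (g s) l < \<epsilon>"
        unfolding eventually_at_right_field by blast
      then show ?thesis by (intro exI[of _ "b - x"]) (auto simp: dist_commute intro!: exI[of _ l])
    next
      case False
      then show ?thesis by (intro exI[of _ 1]) auto
    qed
    then obtain dR lR where R: "dR > 0" "\<And>s. x < s \<Longrightarrow> s < x + dR \<Longrightarrow> s < T \<Longrightarrow> dist lR (g s) < \<epsilon>" by blast
    have "\<exists>d>0. \<exists>l. \<forall>s. x - d < s \<and> s < x \<and> 0 < s \<longrightarrow> dist l (g s) < \<epsilon>"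
    proof (cases "0 < x")
      case True
      then obtain l where "(g \<longlongrightarrow> l) (at_left x)" using g x by (auto simp: regulated_def)
      then have "\<forall>\<^sub>F s in at_left x. dist (g s) l < \<epsilon>" using \<epsilon> by (rule tendstoD)
      then obtain b where "b < x" "\<And>s. b < s \<Longrightarrow> s < x \<Longrightarrow> dist (g s) l < \<epsilon>"
        unfolding eventually_at_left_field by blast
      then show ?thesis by (intro exI[of _ "x - b"]) (auto simp: dist_commute intro!: exI[of _ l])
    next
      case False
      then show ?thesis by (intro exI[of _ 1]) auto
    qed
    then obtain dL lL where L: "dL > 0" "\<And>s. x - dL < s \<Longrightarrow> s < x \<Longrightarrow> 0 < s \<Longrightarrow> dist lL (g s) < \<epsilon>" by blast
    have "0 \<le> a \<longrightarrow> b \<le> T \<longrightarrow> (\<exists>m t v. R a b m t v)" if ab: "a \<le> x" "x \<le> b" "b - a < min dL dR" for a b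
    proof (intro impI)
      assume ab': "0 \<le> a" "b \<le> T"
      have "R a b 2 (\<lambda>k. if k = 0 then a else if k = 1 then x else b) (\<lambda>k. if k = 0 then lL else lR)"
        unfolding R_def
      proof (intro conjI allI impI)
        fix k :: nat assume "k < 2"
        then consider "k = 0" | "k = 1" by linarith
        then have "(if k = 0 then a else if k = 1 then x else b) \<le> (if Suc k = 0 then a else if Suc k = 1 then x else b) \<and>
          (\<forall>s\<in>{if k = 0 then a else if k = 1 then x else b<..<if Suc k = 0 then a else if Suc k = 1 then x else b}.
            dist (if k = 0 then lL else lR) (g s) < \<epsilon>)"
        proof cases
          case 1
          then show ?thesis using ab ab' by (auto intro!: L(2))
        next
          case 2
          then show ?thesis using ab ab' by (auto intro!: R(2))
        qed
        then show "(if k = 0 then a else if k = 1 then x else b) \<le> (if Suc k = 0 then a else if Suc k = 1 then x else b)"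
          "\<forall>s\<in>{if k = 0 then a else if k = 1 then x else b<..<if Suc k = 0 then a else if Suc k = 1 then x else b}.
            dist (if k = 0 then lL else lR) (g s) < \<epsilon>" by auto
      qed auto
      then show "\<exists>m t v. R a b m t v" by blast
    qed
    then show "\<exists>d>0. \<forall>a b. a \<le> x \<and> x \<le> b \<and> b - a < d \<longrightarrow> 0 \<le> a \<longrightarrow> b \<le> T \<longrightarrow> (\<exists>m t v. R a b m t v)"
      using L(1) R(1) by (intro exI[of _ "min dL dR"]) auto
  qed
  then obtain m t v where "R 0 T m t v" by auto
  then show thesis by (intro that[of t m v]) (auto simp: R_def)
qed

lemma partition_mono:
  fixes t :: "nat \<Rightarrow> real"
  assumes "\<And>k. k < m \<Longrightarrow> t k \<le> t (Suc k)" "i \<le> j" "j \<le> m"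
  shows "t i \<le> t j"
  using assms(2,3)
proof (induction rule: dec_induct)
  case (step n)
  then show ?case using assms(1)[of n] by simp
qed simp

text \<open>The approximant keeps the values of g itself at the partition points, where a simple
  function is unrestricted; the error is then uniform.\<close>

lemma regulated_uniform_simple:
  fixes g :: "real \<Rightarrow> 'b::metric_space"
  assumes g: "regulated T g" and T: "0 \<le> T" and \<epsilon>: "0 < \<epsilon>"
  obtains \<phi> m t v where "represents_simple T \<phi> m t v" "\<And>s. dist (\<phi> s) (g s) < \<epsilon>"
proof -
  obtain m t v where t: "t 0 = 0" "t m = T" "\<And>k. k < m \<Longrightarrow> t k \<le> t (Suc k)"
    and v: "\<And>k s. k < m \<Longrightarrow> s \<in> {t k<..<t (Suc k)} \<Longrightarrow> dist (v k) (g s) < \<epsilon>"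
    using regulated_simple_approx[OF g T \<epsilon>] by metis
  have mono: "t i \<le> t j" if "i \<le> j" "j \<le> m" for i j
    using partition_mono[of m t, OF t(3)] that by blast
  define Q where "Q s k \<longleftrightarrow> k < m \<and> s \<in> {t k<..<t (Suc k)}" for s k
  have uniq: "k = k'" if "Q s k" "Q s k'" for s k k'
  proof (rule ccontr)
    assume "k \<noteq> k'"
    then consider "k < k'" | "k' < k" by linarith
    then show False
    proof cases
      case 1
      then have "t (Suc k) \<le> t k'" using mono[of "Suc k" k'] that by (simp add: Q_def)
      then show False using that by (simp add: Q_def)
    next
      case 2
      then have "t (Suc k') \<le> t k" using mono[of "Suc k'" k] that by (simp add: Q_def)
      then show False using that by (simp add: Q_def)
    qed
  qed
  define \<phi> where "\<phi> s = (if \<exists>k. Q s k then v (THE k. Q s k) else g s)" for s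
  have \<phi>: "\<phi> s = v k" if "Q s k" for s k
    using that uniq unfolding \<phi>_def by (metis the_equality)
  show thesis
  proof (rule that[of \<phi> m t v])
    show "represents_simple T \<phi> m t v"
      unfolding represents_simple_def using t \<phi> by (auto simp: Q_def)
    show "dist (\<phi> s) (g s) < \<epsilon>" for s
    proof (cases "\<exists>k. Q s k")
      case True
      then obtain k where "Q s k" ..
      then show ?thesis using \<phi> v by (simp add: Q_def)
    next
      case False
      then show ?thesis using \<epsilon> by (simp add: \<phi>_def)
    qed
  qed
qed

lemma regulated_bounded:
  fixes g :: "real \<Rightarrow> 'b::real_normed_vector"
  assumes g: "regulated T g" and T: "0 \<le> T"
  obtains K where "\<And>s. s \<in> {0..T} \<Longrightarrow> norm (g s) \<le> K"
proof -
  obtain m t v where t: "t 0 = 0" "t m = T"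
    and v: "\<And>k s. k < m \<Longrightarrow> s \<in> {t k<..<t (Suc k)} \<Longrightarrow> dist (v k) (g s) < 1"
    using regulated_simple_approx[OF g T zero_less_one] by metis
  define K1 where "K1 = (\<Sum>k<m. norm (v k) + 1)"
  define K2 where "K2 = (\<Sum>k\<le>m. norm (g (t k)))"
  have K: "0 \<le> K1" "0 \<le> K2" by (auto simp: K1_def K2_def intro!: sum_nonneg)
  have "norm (g s) \<le> K1 + K2" if s: "s \<in> {0..T}" for s
  proof (rule partition_cases[of t s m])
    show "t 0 \<le> s" "s \<le> t m" using s t by auto
  next
    fix k assume k: "k \<le> m" "s = t k"
    have "norm (g (t k)) \<le> K2" unfolding K2_def using k by (intro member_le_sum) auto
    then show ?thesis using K k by simp
  next
    fix k assume k: "k < m" "t k < s" "s < t (Suc k)"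
    have "norm (g s) \<le> norm (v k) + norm (g s - v k)" by (rule norm_triangle_sub)
    also have "\<dots> \<le> norm (v k) + 1" using v[of k s] k by (simp add: dist_norm norm_minus_commute)
    also have "\<dots> \<le> K1" unfolding K1_def using k by (intro member_le_sum) auto
    finally show ?thesis using K by simp
  qed
  then show thesis by (rule that)
qed

text \<open>The indicator of A is an almost everywhere limit of continuous functions. Clipped to
  [0,1] and multiplied by u they are regulated, since one-sided limits multiply, and bounded by the
  bound of u.\<close>

lemma bounded_ae_approx_indicator:
  fixes u :: "real \<Rightarrow> 'b::real_normed_vector"
  assumes u: "regulated T u" and T: "0 \<le> T" and A: "A \<in> sets borel"
  obtains g where "bounded_ae_approx T g (\<lambda>s. indicator A s *\<^sub>R u s)"
proof -
  have "indicat_real A \<in> borel_measurable lebesgue" using A by (intro measurable_completion) simp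
  then obtain N \<theta> where N: "negligible N" and cont: "\<And>n. continuous_on UNIV (\<theta> n :: real \<Rightarrow> real)"
    and lim: "\<And>x. x \<notin> N \<Longrightarrow> (\<lambda>n. \<theta> n x) \<longlonglongrightarrow> indicat_real A x"
    using lebesgue_measurable_imp_measurable_on_real[of "indicat_real A" UNIV, unfolded measurable_on_def] by auto
  define c where "c n s = max 0 (min 1 (\<theta> n s))" for n s
  have c01: "0 \<le> c n s" "c n s \<le> 1" for n s by (auto simp: c_def)
  have cc: "(c n \<longlongrightarrow> c n s) (at s within X)" for n s X
  proof -
    have "continuous_on UNIV (c n)" unfolding c_def by (intro continuous_intros cont)
    then have "(c n \<longlongrightarrow> c n s) (at s)" by (simp add: continuous_on_eq_continuous_at isContD)
    then show ?thesis by (rule tendsto_mono[OF at_le, rotated]) simp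
  qed
  obtain K where K: "\<And>s. s \<in> {0..T} \<Longrightarrow> norm (u s) \<le> K" using regulated_bounded[OF u T] by metis
  show thesis
  proof (rule that[of "\<lambda>n s. c n s *\<^sub>R u s"], unfold bounded_ae_approx_def, intro conjI allI)
    show "regulated T (\<lambda>s. c n s *\<^sub>R u s)" for n
    proof -
      have "\<exists>l. ((\<lambda>s. c n s *\<^sub>R u s) \<longlongrightarrow> l) (at t within X)" if ex: "\<exists>l. (u \<longlongrightarrow> l) (at t within X)" for t X
      proof -
        obtain l where "(u \<longlongrightarrow> l) (at t within X)" using ex ..
        from tendsto_scaleR[OF cc this] show ?thesis by blast
      qed
      then show ?thesis using u unfolding regulated_def by simp
    qed
    show "\<exists>K. \<forall>n. \<forall>s\<in>{0..T}. norm (c n s *\<^sub>R u s) \<le> K"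
    proof (intro exI[of _ K] allI ballI)
      fix n s assume "s \<in> {0..T}"
      have "norm (c n s *\<^sub>R u s) \<le> 1 * norm (u s)" using c01[where n=n and s=s] by (simp add: mult_left_le_one_le)
      then show "norm (c n s *\<^sub>R u s) \<le> K" using K[OF \<open>s \<in> {0..T}\<close>] by simp
    qed
    have "AE s in lebesgue. s \<notin> N" using N by (intro AE_not_in) (simp add: negligible_iff_null_sets)
    then have "AE s in lborel. s \<notin> N" by (simp add: AE_completion_iff)
    then show "AE s in lborel. s \<in> {0..T} \<longrightarrow> (\<lambda>n. c n s *\<^sub>R u s) \<longlonglongrightarrow> indicator A s *\<^sub>R u s"
    proof eventually_elim
      case (elim s)
      have "(\<lambda>n. c n s) \<longlonglongrightarrow> max 0 (min 1 (indicat_real A s))" unfolding c_def by (intro tendsto_intros lim elim)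
      moreover have "max 0 (min 1 (indicat_real A s)) = indicat_real A s" by (simp add: indicator_def)
      ultimately show ?case by (auto intro!: tendsto_intros)
    qed
  qed
qed

section \<open>The scalar integral as a version of J and of its extension\<close>

context subordinated_wiener_basis begin

text \<open>The elementary function agrees with \<open>\<phi>\<close> on [0,T] except perhaps at the
  partition points, where \<open>\<phi>\<close> is free, and at 0. Such a finite set is invisible to
  the energy.\<close>

lemma represents_simple_elem:
  assumes r: "represents_simple T \<phi> m t v"
  obtains e F where "elem e (simple_integral L m t v)" "finite F" "\<And>s. s \<in> {0..T} \<Longrightarrow> s \<notin> F \<Longrightarrow> e s = \<phi> s"
proof -
  have t: "t 0 = 0" "t m = T" "\<And>k. k < m \<Longrightarrow> t k \<le> t (Suc k)" and \<phi>: "\<And>k s. k < m \<Longrightarrow> s \<in> {t k<..<t (Suc k)} \<Longrightarrow> \<phi> s = v k"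
    using r by (auto simp: represents_simple_def)
  have mono: "t i \<le> t j" if "i \<le> j" "j \<le> m" for i j
    using partition_mono[of m t, OF t(3)] that by blast
  have "\<exists>e. elem e (\<lambda>w. \<Sum>k<n. L (t (Suc k)) (v k) w - L (t k) (v k) w) \<and>
      (\<forall>s. 0 < s \<and> s \<le> t n \<and> s \<notin> t ` {..m} \<longrightarrow> e s = \<phi> s) \<and> (\<forall>s>t n. e s = 0)" if "n \<le> m" for n
    using that
  proof (induction n)
    case 0
    then show ?case using t(1) by (intro exI[of _ "\<lambda>_. 0"]) (auto intro: elem.zero)
  next
    case (Suc n)
    then obtain e where e: "elem e (\<lambda>w. \<Sum>k<n. L (t (Suc k)) (v k) w - L (t k) (v k) w)"
      "\<And>s. 0 < s \<Longrightarrow> s \<le> t n \<Longrightarrow> s \<notin> t ` {..m} \<Longrightarrow> e s = \<phi> s" "\<And>s. s > t n \<Longrightarrow> e s = 0" by auto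
    have tn: "0 \<le> t n" "t n \<le> t (Suc n)" "t (Suc n) \<le> T"
      using mono[of 0 n] mono[of "Suc n" m] Suc.prems t by auto
    let ?e = "\<lambda>s. e s + indicator {t n<..t (Suc n)} s *\<^sub>R v n"
    have "elem ?e (\<lambda>w. \<Sum>k<Suc n. L (t (Suc k)) (v k) w - L (t k) (v k) w)"
      using elem.step[OF e(1) tn, of "v n"] by simp
    moreover have "?e s = \<phi> s" if s: "0 < s" "s \<le> t (Suc n)" "s \<notin> t ` {..m}" for s
    proof (cases "s \<le> t n")
      case True
      then show ?thesis using e(2)[OF s(1) True s(3)] by simp
    next
      case False
      have "s \<noteq> t (Suc n)" using s(3) Suc.prems by auto
      then have "\<phi> s = v n" using \<phi>[of n s] False s(2) Suc.prems by simp
      then show ?thesis using e(3)[of s] False s(2) by simp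
    qed
    moreover have "?e s = 0" if "s > t (Suc n)" for s
      using e(3)[of s] that tn by simp
    ultimately show ?case by blast
  qed
  from this[OF order_refl] obtain e where e: "elem e (\<lambda>w. \<Sum>k<m. L (t (Suc k)) (v k) w - L (t k) (v k) w)"
    "\<And>s. 0 < s \<Longrightarrow> s \<le> t m \<Longrightarrow> s \<notin> t ` {..m} \<Longrightarrow> e s = \<phi> s" by blast
  show thesis
  proof (rule that[of e "insert 0 (t ` {..m})"])
    show "elem e (simple_integral L m t v)" using e(1) by (simp add: simple_integral_def[abs_def])
    show "e s = \<phi> s" if "s \<in> {0..T}" "s \<notin> insert 0 (t ` {..m})" for s
      using that t(2) by (intro e(2)) auto
  qed simp
qed

lemma stoch_int_simple:
  assumes r: "represents_simple T \<phi> m t v"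
  shows "stoch_int (\<lambda>s. istar (\<phi> s)) (simple_integral L m t v)"
proof -
  obtain e F where e: "elem e (simple_integral L m t v)" "finite F" "\<And>s. s \<in> {0..T} \<Longrightarrow> s \<notin> F \<Longrightarrow> e s = \<phi> s"
    using represents_simple_elem[OF r] by metis
  show ?thesis
  proof (rule stoch_int_AE_fun[OF stoch_int_elem[OF e(1)]])
    have "AE s in lborel. s \<notin> F" using e(2) by (intro AE_not_in finite_imp_null_set_lborel)
    then show "AE s in time_measure. istar (e s) = istar (\<phi> s)"
      unfolding AE_time by eventually_elim (use e(3) in auto)
    show "wmeas (\<lambda>s. istar (\<phi> s))"
    proof (rule wmeasI)
      fix x
      show "(\<lambda>s. inner (istar (\<phi> s)) x) \<in> borel_measurable time_measure"
      proof (rule measurable_discrete_difference[OF wmeas_inner[OF elem_wmeas[OF e(1)]], where X="F \<inter> {0..T}"])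
        show "countable (F \<inter> {0..T})" using e(2) by (simp add: countable_finite)
        show "{s} \<in> sets time_measure" if "s \<in> F \<inter> {0..T}" for s
          using that by (auto simp: time_measure_def sets_restrict_space intro!: image_eqI[of _ _ "{s}"])
      qed (use e(3) in auto)
    qed
  qed
qed

lemma energy_small_uniform:
  assumes "0 < r"
  obtains \<delta> where "0 < \<delta>" "\<And>d :: real \<Rightarrow> 'h. (\<And>s. s \<in> {0..T} \<Longrightarrow> norm (d s) \<le> \<delta>) \<Longrightarrow> energy d < ennreal r"
proof -
  have "(\<lambda>n. (1 / real (Suc n))\<^sup>2 / 2) \<longlonglongrightarrow> 0\<^sup>2 / 2" by (intro tendsto_intros LIMSEQ_Suc[OF lim_1_over_n]) simp
  then have "(\<lambda>n. laplace_exp ((1 / real (Suc n))\<^sup>2 / 2)) \<longlonglongrightarrow> laplace_exp 0"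
    by (intro laplace_exp_tendsto) auto
  then have "(\<lambda>n. laplace_exp ((1 / real (Suc n))\<^sup>2 / 2) * T) \<longlonglongrightarrow> laplace_exp 0 * T" by (intro tendsto_intros)
  then have "\<forall>\<^sub>F n in sequentially. laplace_exp ((1 / real (Suc n))\<^sup>2 / 2) * T < r"
    using assms by (intro order_tendstoD) auto
  then obtain n where n: "laplace_exp ((1 / real (Suc n))\<^sup>2 / 2) * T < r" using eventually_happens by fastforce
  show thesis
  proof (rule that[of "1 / real (Suc n)"])
    fix d :: "real \<Rightarrow> 'h" assume "\<And>s. s \<in> {0..T} \<Longrightarrow> norm (d s) \<le> 1 / real (Suc n)"
    then have "energy d \<le> ennreal (laplace_exp ((1 / real (Suc n))\<^sup>2 / 2)) * ennreal T" by (rule energy_bounded)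
    also have "\<dots> = ennreal (laplace_exp ((1 / real (Suc n))\<^sup>2 / 2) * T)"
      using T_pos by (intro ennreal_mult[symmetric] laplace_exp_nonneg) auto
    also have "\<dots> < ennreal r" using n assms by (intro ennreal_lessI) auto
    finally show "energy d < ennreal r" .
  qed simp
qed

lemma istar_bound: obtains B where "0 < B" "\<And>v. norm (istar v) \<le> B * norm v"
  using bounded_linear.pos_bounded[OF istar] by (metis mult.commute)

lemma uniform_limit_simple:
  assumes r: "\<And>n. represents_simple T (\<phi> n) (m n) (t n) (v n)" and ul: "uniform_limit {0..T} \<phi> g sequentially"
  shows "wmeas (\<lambda>s. istar (g s))" "(\<lambda>n. energy (\<lambda>s. istar (\<phi> n s) - istar (g s))) \<longlonglongrightarrow> 0"
proof -
  show w: "wmeas (\<lambda>s. istar (g s))"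
  proof (rule wmeasI, rule borel_measurable_LIMSEQ_real)
    fix x
    show "(\<lambda>s. inner (istar (\<phi> n s)) x) \<in> borel_measurable time_measure" for n
      by (rule wmeas_inner[OF stoch_int_wmeas[OF stoch_int_simple[OF r]]])
    fix s assume "s \<in> space time_measure"
    then have "(\<lambda>n. \<phi> n s) \<longlonglongrightarrow> g s" using tendsto_uniform_limitI[OF ul] by simp
    then show "(\<lambda>n. inner (istar (\<phi> n s)) x) \<longlonglongrightarrow> inner (istar (g s)) x"
      by (intro tendsto_inner tendsto_const bounded_linear.tendsto[OF istar])
  qed
  obtain B where B: "0 < B" "\<And>v. norm (istar v) \<le> B * norm v" using istar_bound by blast
  show "(\<lambda>n. energy (\<lambda>s. istar (\<phi> n s) - istar (g s))) \<longlonglongrightarrow> 0"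
  proof (rule order_tendstoI)
    fix a :: ennreal assume "0 < a"
    then obtain r where r: "0 < r" "ennreal r \<le> a"
    proof (cases a)
      case (real y)
      then show ?thesis using \<open>0 < a\<close> that[of y] by simp
    next
      case top
      then show ?thesis using that[of 1] by simp
    qed
    obtain \<delta> where \<delta>: "0 < \<delta>" "\<And>d :: real \<Rightarrow> 'h. (\<And>s. s \<in> {0..T} \<Longrightarrow> norm (d s) \<le> \<delta>) \<Longrightarrow> energy d < ennreal r"
      using energy_small_uniform[OF r(1)] by blast
    have "\<forall>\<^sub>F n in sequentially. \<forall>s\<in>{0..T}. dist (\<phi> n s) (g s) < \<delta> / B"
      using ul \<delta>(1) B(1) by (intro uniform_limitD) auto
    then show "\<forall>\<^sub>F n in sequentially. energy (\<lambda>s. istar (\<phi> n s) - istar (g s)) < a"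
    proof eventually_elim
      case (elim n)
      have "energy (\<lambda>s. istar (\<phi> n s) - istar (g s)) < ennreal r"
      proof (rule \<delta>(2))
        fix s assume "s \<in> {0..T}"
        then have "norm (\<phi> n s - g s) < \<delta> / B" using elim by (simp add: dist_norm)
        then have "B * norm (\<phi> n s - g s) \<le> \<delta>" using B(1) by (simp add: field_simps)
        then show "norm (istar (\<phi> n s) - istar (g s)) \<le> \<delta>"
          using B(2)[of "\<phi> n s - g s"] by (simp add: istar_linear)
      qed
      then show ?case using r(2) by simp
    qed
  qed simp
qed

text \<open>Membership in \<open>is_J\<close> includes one uniformly convergent sequence of simple
  functions; uniform convergence forces the energies of the errors to 0, so X is a limit in the
  sense of the closed graph.\<close>

lemma is_J_imp_stoch_int:
  assumes "is_J M L T g X" shows "stoch_int (\<lambda>s. istar (g s)) X"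
proof -
  have X[measurable]: "X \<in> borel_measurable M" using assms by (simp add: is_J_def)
  obtain \<phi> m t v where r: "\<And>n. represents_simple T (\<phi> n) (m n) (t n) (v n)" and ul: "uniform_limit {0..T} \<phi> g sequentially"
    using assms unfolding is_J_def by blast
  have c: "conv_in_prob M (\<lambda>n. simple_integral L (m n) (t n) (v n)) X"
    using assms r ul unfolding is_J_def by blast
  have s: "stoch_int (\<lambda>s. istar (\<phi> n s)) (simple_integral L (m n) (t n) (v n))" for n by (rule stoch_int_simple[OF r])
  have [measurable]: "simple_integral L (m n) (t n) (v n) \<in> borel_measurable M" for n by (rule stoch_int_measurable[OF s])
  have l0: "(\<lambda>n. L0norm M (\<lambda>w. simple_integral L (m n) (t n) (v n) w - X w)) \<longlonglongrightarrow> 0"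
    using c by (subst (asm) conv_in_prob_iff_L0norm) auto
  note ul' = uniform_limit_simple[OF r ul]
  show ?thesis
  proof (rule stoch_int_closure[OF ul'(1) X])
    fix \<epsilon> :: real assume \<epsilon>: "0 < \<epsilon>"
    have "\<forall>\<^sub>F n in sequentially. energy (\<lambda>s. istar (\<phi> n s) - istar (g s)) < ennreal \<epsilon>"
      using ul'(2) \<epsilon> by (intro order_tendstoD) auto
    moreover have "\<forall>\<^sub>F n in sequentially. L0norm M (\<lambda>w. simple_integral L (m n) (t n) (v n) w - X w) < \<epsilon>"
      using l0 \<epsilon> by (rule order_tendstoD)
    ultimately have "\<forall>\<^sub>F n in sequentially. energy (\<lambda>s. istar (\<phi> n s) - istar (g s)) < ennreal \<epsilon> \<and>
        L0norm M (\<lambda>w. simple_integral L (m n) (t n) (v n) w - X w) < \<epsilon>" by (rule eventually_conj)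
    then obtain n where "energy (\<lambda>s. istar (\<phi> n s) - istar (g s)) < ennreal \<epsilon>"
        "L0norm M (\<lambda>w. simple_integral L (m n) (t n) (v n) w - X w) < \<epsilon>" using eventually_happens by fastforce
    then show "\<exists>g' Z'. stoch_int g' Z' \<and> energy (\<lambda>s. istar (g s) - g' s) < ennreal \<epsilon> \<and> L0norm M (\<lambda>w. X w - Z' w) < \<epsilon>"
      using s[of n] by (intro exI[of _ "\<lambda>s. istar (\<phi> n s)"] exI[of _ "simple_integral L (m n) (t n) (v n)"])
        (simp add: energy_minus_commute L0norm_diff_commute)
  qed
qed

lemma regulated_simple_sequence:
  assumes "regulated T g"
  obtains \<phi> m t and v :: "nat \<Rightarrow> nat \<Rightarrow> 'v dual" where "\<And>n. represents_simple T (\<phi> n) (m n) (t n) (v n)" "uniform_limit {0..T} \<phi> g sequentially"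
proof -
  have "\<forall>n. \<exists>q. represents_simple T (fst q) (fst (snd q)) (fst (snd (snd q))) (snd (snd (snd q))) \<and> (\<forall>s. dist (fst q s) (g s) < 1 / real (Suc n))"
  proof
    fix n
    have "0 \<le> T" "0 < 1 / real (Suc n)" using T_pos by auto
    then obtain \<phi> m t v where "represents_simple T \<phi> m t v" "\<And>s. dist (\<phi> s) (g s) < 1 / real (Suc n)"
      using regulated_uniform_simple[OF assms] by metis
    then show "\<exists>q. represents_simple T (fst q) (fst (snd q)) (fst (snd (snd q))) (snd (snd (snd q))) \<and> (\<forall>s. dist (fst q s) (g s) < 1 / real (Suc n))"
      by (intro exI[of _ "(\<phi>, m, t, v)"]) simp
  qed
  from choice[OF this] obtain q where q: "\<forall>n. represents_simple T (fst (q n)) (fst (snd (q n))) (fst (snd (snd (q n)))) (snd (snd (snd (q n)))) \<and>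
    (\<forall>s. dist (fst (q n) s) (g s) < 1 / real (Suc n))" ..
  show thesis
  proof (rule that)
    show "represents_simple T (fst (q n)) (fst (snd (q n))) (fst (snd (snd (q n)))) (snd (snd (snd (q n))))" for n using q by simp
    show "uniform_limit {0..T} (\<lambda>n. fst (q n)) g sequentially"
    proof (rule uniform_limitI)
      fix e :: real assume "0 < e"
      then have "\<forall>\<^sub>F n in sequentially. 1 / real (Suc n) < e"
        using LIMSEQ_Suc[OF lim_1_over_n] by (rule order_tendstoD(2)[rotated])
      then show "\<forall>\<^sub>F n in sequentially. \<forall>s\<in>{0..T}. dist (fst (q n) s) (g s) < e"
        by eventually_elim (use q less_trans in blast)
    qed
  qed
qed

text \<open>Every admissible sequence of simple functions has integrals with the same limit, because
  the error energies tend to 0 and energy controls convergence in probability.\<close>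

lemma stoch_int_imp_is_J:
  assumes g: "regulated T g" and X: "stoch_int (\<lambda>s. istar (g s)) X"
  shows "is_J M L T g X"
  unfolding is_J_def
proof (intro conjI allI impI)
  show [measurable]: "X \<in> borel_measurable M" by (rule stoch_int_measurable[OF X])
  show "\<exists>\<phi> m t v. (\<forall>n. represents_simple T (\<phi> n) (m n) (t n) (v n)) \<and> uniform_limit {0..T} \<phi> g sequentially"
    using regulated_simple_sequence[OF g] by metis
  fix \<phi> m t and v :: "nat \<Rightarrow> nat \<Rightarrow> 'v dual"
  assume "(\<forall>n. represents_simple T (\<phi> n) (m n) (t n) (v n)) \<and> uniform_limit {0..T} \<phi> g sequentially"
  then have r: "\<And>n. represents_simple T (\<phi> n) (m n) (t n) (v n)" and ul: "uniform_limit {0..T} \<phi> g sequentially" by auto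
  have s: "stoch_int (\<lambda>s. istar (\<phi> n s)) (simple_integral L (m n) (t n) (v n))" for n by (rule stoch_int_simple[OF r])
  show "conv_in_prob M (\<lambda>n. simple_integral L (m n) (t n) (v n)) X"
    using stoch_int_tendsto[OF s X uniform_limit_simple(2)[OF r ul]] stoch_int_measurable[OF s]
    by (subst conv_in_prob_iff_L0norm) auto
qed

lemma regulated_is_J:
  assumes g: "regulated T g" obtains X where "is_J M L T g X"
proof -
  obtain \<phi> m t and v :: "nat \<Rightarrow> nat \<Rightarrow> 'v dual" where r: "\<And>n. represents_simple T (\<phi> n) (m n) (t n) (v n)" and ul: "uniform_limit {0..T} \<phi> g sequentially"
    using regulated_simple_sequence[OF g] by metis
  note ul' = uniform_limit_simple[OF r ul]
  obtain X where "stoch_int (\<lambda>s. istar (g s)) X"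
  proof (rule stoch_int_exists[OF ul'(1)])
    fix \<epsilon> :: real assume "0 < \<epsilon>"
    then have "\<forall>\<^sub>F n in sequentially. energy (\<lambda>s. istar (\<phi> n s) - istar (g s)) < ennreal \<epsilon>"
      by (intro order_tendstoD(2)[OF ul'(2)]) simp
    then obtain n where "energy (\<lambda>s. istar (\<phi> n s) - istar (g s)) < ennreal \<epsilon>" using eventually_happens by fastforce
    then show "\<exists>g' Z'. stoch_int g' Z' \<and> energy (\<lambda>s. istar (g s) - g' s) < ennreal \<epsilon>"
      using stoch_int_simple[OF r[of n]] by (metis energy_minus_commute)
  qed blast
  then show thesis using that stoch_int_imp_is_J[OF g] by blast
qed

text \<open>Uniform boundedness and convergence almost everywhere make the energies of the errors
  tend to 0 by dominated convergence, so every admissible sequence of integrals has the limit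
  X.\<close>

lemma is_J_extI:
  assumes app: "bounded_ae_approx T g0 f" and K: "\<And>s. s \<in> {0..T} \<Longrightarrow> norm (f s) \<le> K"
    and X: "stoch_int (\<lambda>s. istar (f s)) X"
  shows "is_J_ext M L T f X"
  unfolding is_J_ext_def
proof (intro conjI allI impI)
  show [measurable]: "X \<in> borel_measurable M" by (rule stoch_int_measurable[OF X])
  have "\<exists>Y. is_J M L T (g0 n) Y" for n
  proof -
    have "regulated T (g0 n)" using app by (simp add: bounded_ae_approx_def)
    then show ?thesis using regulated_is_J by blast
  qed
  from choice[OF allI[OF this]] obtain Y0 where "\<forall>n. is_J M L T (g0 n) (Y0 n)" ..
  with app show "\<exists>g Y. bounded_ae_approx T g f \<and> (\<forall>n. is_J M L T (g n) (Y n))"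
    by (intro exI[of _ g0] exI[of _ Y0] conjI)
  fix g Y assume "bounded_ae_approx T g f \<and> (\<forall>n. is_J M L T (g n) (Y n))"
  then have app: "bounded_ae_approx T g f" and J: "\<And>n. is_J M L T (g n) (Y n)" by auto
  have s: "stoch_int (\<lambda>s. istar (g n s)) (Y n)" for n by (rule is_J_imp_stoch_int[OF J])
  obtain K' where K': "\<And>n s. s \<in> {0..T} \<Longrightarrow> norm (g n s) \<le> K'" using app unfolding bounded_ae_approx_def by blast
  obtain B where B: "0 < B" "\<And>v. norm (istar v) \<le> B * norm v" using istar_bound by blast
  have "(\<lambda>n. energy (\<lambda>s. istar (g n s) - istar (f s))) \<longlonglongrightarrow> 0"
  proof (rule energy_dominated[where K="B * K' + B * K"])
    show "wmeas (\<lambda>s. istar (g n s) - istar (f s))" for n by (intro wmeas_diff stoch_int_wmeas[OF s] stoch_int_wmeas[OF X])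
    fix n s assume s: "s \<in> {0..T}"
    have "norm (istar (g n s) - istar (f s)) \<le> norm (istar (g n s)) + norm (istar (f s))" by (rule norm_triangle_ineq4)
    also have "\<dots> \<le> B * norm (g n s) + B * norm (f s)" by (intro add_mono B(2))
    also have "\<dots> \<le> B * K' + B * K" using K[OF s] K'[OF s] B(1) by (intro add_mono mult_left_mono) auto
    finally show "norm (istar (g n s) - istar (f s)) \<le> B * K' + B * K" .
  next
    have "AE s in lborel. s \<in> {0..T} \<longrightarrow> (\<lambda>n. g n s) \<longlonglongrightarrow> f s" using app unfolding bounded_ae_approx_def by blast
    then show "AE s in time_measure. (\<lambda>n. norm (istar (g n s) - istar (f s))) \<longlonglongrightarrow> 0"
      unfolding AE_time
    proof eventually_elim
      case (elim s)
      show ?case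
      proof
        assume "s \<in> {0..T}"
        then have "(\<lambda>n. istar (g n s)) \<longlonglongrightarrow> istar (f s)" using elim by (intro bounded_linear.tendsto[OF istar]) auto
        then show "(\<lambda>n. norm (istar (g n s) - istar (f s))) \<longlonglongrightarrow> 0" by (intro tendsto_norm_zero LIM_zero)
      qed
    qed
  qed
  from stoch_int_tendsto[OF s X this] show "conv_in_prob M Y X"
    using stoch_int_measurable[OF s] by (subst conv_in_prob_iff_L0norm) auto
qed

lemma is_cyl_integralI:
  assumes S: "weakly_regulated T S" and A: "A \<in> sets borel"
    and X: "stoch_int (\<lambda>s. istar (indicator A s *\<^sub>R adjoint_apply (S s) v)) X"
  shows "is_cyl_integral M L T S A v X"
proof -
  have r: "regulated T (\<lambda>s. adjoint_apply (S s) v)" using S by (simp add: weakly_regulated_def)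
  have T: "0 \<le> T" using T_pos by simp
  obtain g where g: "bounded_ae_approx T g (\<lambda>s. indicator A s *\<^sub>R adjoint_apply (S s) v)"
    using bounded_ae_approx_indicator[OF r T A] by blast
  obtain K where K: "\<And>s. s \<in> {0..T} \<Longrightarrow> norm (adjoint_apply (S s) v) \<le> K" using regulated_bounded[OF r T] by blast
  have K': "norm (indicator A s *\<^sub>R adjoint_apply (S s) v) \<le> K" if "s \<in> {0..T}" for s
    using K[OF that] order_trans[OF norm_ge_zero K[OF that]] by (cases "s \<in> A") auto
  show ?thesis unfolding is_cyl_integral_def by (rule is_J_extI[OF g K' X])
qed

text \<open>By definition one approximating sequence exists, and both variables are limits in
  probability of its integrals.\<close>

lemma is_cyl_integral_unique:
  assumes "is_cyl_integral M L T S A v X" "is_cyl_integral M L T S A v Y"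
  shows "AE w in M. X w = Y w"
proof -
  have [measurable]: "X \<in> borel_measurable M" "Y \<in> borel_measurable M"
    using assms by (auto simp: is_cyl_integral_def is_J_ext_def)
  obtain g Z where g: "bounded_ae_approx T g (\<lambda>s. indicator A s *\<^sub>R adjoint_apply (S s) v)" "\<And>n. is_J M L T (g n) (Z n)"
    using assms(1)[unfolded is_cyl_integral_def is_J_ext_def, THEN conjunct2, THEN conjunct1] by auto
  have [measurable]: "Z n \<in> borel_measurable M" for n using g(2) by (simp add: is_J_def)
  have c: "conv_in_prob M Z X" "conv_in_prob M Z Y"
    using assms(1)[unfolded is_cyl_integral_def is_J_ext_def, THEN conjunct2, THEN conjunct2, rule_format, of g Z]
      assms(2)[unfolded is_cyl_integral_def is_J_ext_def, THEN conjunct2, THEN conjunct2, rule_format, of g Z] g by simp_all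
  have l: "(\<lambda>n. L0norm M (\<lambda>w. Z n w - X w)) \<longlonglongrightarrow> 0" "(\<lambda>n. L0norm M (\<lambda>w. Z n w - Y w)) \<longlonglongrightarrow> 0"
    using c by (auto simp: conv_in_prob_iff_L0norm)
  have "L0norm M (\<lambda>w. X w - Y w) \<le> 0"
  proof (rule tendsto_lowerbound)
    show "(\<lambda>n. L0norm M (\<lambda>w. Z n w - X w) + L0norm M (\<lambda>w. Z n w - Y w)) \<longlonglongrightarrow> 0"
      using tendsto_add[OF l] by simp
    show "\<forall>\<^sub>F n in sequentially. L0norm M (\<lambda>w. X w - Y w) \<le> L0norm M (\<lambda>w. Z n w - X w) + L0norm M (\<lambda>w. Z n w - Y w)"
    proof (intro always_eventually allI)
      fix n
      show "L0norm M (\<lambda>w. X w - Y w) \<le> L0norm M (\<lambda>w. Z n w - X w) + L0norm M (\<lambda>w. Z n w - Y w)"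
        using L0norm_triangle_diff[of X "Z n" Y] by (simp add: L0norm_diff_commute[of X "Z n"])
    qed
  qed simp
  then have "AE w in M. X w - Y w = 0" by (intro AE_eq_0_if_L0norm) auto
  then show ?thesis by eventually_elim simp
qed

end

subsection \<open>Gaussian sequences\<close>

lemma prob_space_gauss: "prob_space gauss_space"
  unfolding gauss_space_def
  by (intro prob_space_PiM real_distribution.axioms(1)[OF real_dist_normal_dist])

lemma space_gauss[simp]: "space gauss_space = UNIV"
  by (simp add: gauss_space_def space_PiM)

lemma gauss_component_measurable: "(\<lambda>\<gamma>. \<gamma> k) \<in> borel_measurable gauss_space"
proof -
  have "(\<lambda>\<gamma>. \<gamma> k) \<in> gauss_space \<rightarrow>\<^sub>M std_normal_distribution"
    unfolding gauss_space_def by (rule measurable_component_singleton) simp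
  then show ?thesis by simp
qed

context
  notes gauss_component_measurable[measurable]
begin

lemma gauss_reindex:
  assumes "inj f" shows "distr gauss_space gauss_space (\<lambda>\<gamma> n. \<gamma> (f n)) = gauss_space"
  using distr_PiM_reindex[of UNIV "\<lambda>_. std_normal_distribution" f UNIV] assms
    real_distribution.axioms(1)[OF real_dist_normal_dist] by (simp add: gauss_space_def restrict_def)

text \<open>An injective choice of coordinates of the product is again a product of standard
  normals; the injection is later a pairing of indices.\<close>

lemma gauss_char:
  assumes F: "finite F" and f: "inj_on f F"
  shows "(\<integral>\<gamma>. iexp (\<Sum>b\<in>F. \<theta> b * \<gamma> (f b)) \<partial>gauss_space) = complex_of_real (exp (- (\<Sum>b\<in>F. (\<theta> b)\<^sup>2) / 2))"
proof -
  let ?N = std_normal_distribution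
  interpret N: real_distribution ?N by (rule real_dist_normal_dist)
  interpret PS: product_sigma_finite "\<lambda>_. ?N" by standard
  have d: "distr gauss_space (Pi\<^sub>M F (\<lambda>_. ?N)) (\<lambda>\<gamma>. \<lambda>n\<in>F. \<gamma> (f n)) = Pi\<^sub>M F (\<lambda>_. ?N)"
    unfolding gauss_space_def
    by (rule distr_PiM_reindex) (use f N.prob_space_axioms in auto)
  have mf: "(\<lambda>\<gamma>. \<lambda>n\<in>F. \<gamma> (f n)) \<in> gauss_space \<rightarrow>\<^sub>M Pi\<^sub>M F (\<lambda>_. ?N)"
    by (intro measurable_restrict) simp
  have comp: "(\<lambda>x. x b) \<in> borel_measurable (Pi\<^sub>M F (\<lambda>_. ?N))" if "b \<in> F" for b
    using measurable_component_singleton[OF that, of "\<lambda>_. ?N"] by simp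
  have mg: "(\<lambda>x. iexp (\<Sum>b\<in>F. \<theta> b * x b)) \<in> borel_measurable (Pi\<^sub>M F (\<lambda>_. ?N))"
    by (intro measurable_compose[OF _ borel_measurable_exp] borel_measurable_times borel_measurable_const
        measurable_compose[OF _ borel_measurable_of_real] borel_measurable_sum comp)
  have "(\<integral>\<gamma>. iexp (\<Sum>b\<in>F. \<theta> b * \<gamma> (f b)) \<partial>gauss_space) = (\<integral>x. iexp (\<Sum>b\<in>F. \<theta> b * x b) \<partial>distr gauss_space (Pi\<^sub>M F (\<lambda>_. ?N)) (\<lambda>\<gamma>. \<lambda>n\<in>F. \<gamma> (f n)))"
    by (subst integral_distr[OF mf mg]) (auto intro!: Bochner_Integration.integral_cong sum.cong arg_cong[where f="\<lambda>x. iexp x"])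
  also have "\<dots> = (\<integral>x. (\<Prod>b\<in>F. iexp (\<theta> b * x b)) \<partial>Pi\<^sub>M F (\<lambda>_. ?N))"
    unfolding d by (simp add: exp_sum[OF F] sum_distrib_left)
  also have "\<dots> = (\<Prod>b\<in>F. \<integral>y. iexp (\<theta> b * y) \<partial>?N)"
    by (rule PS.product_integral_prod[OF F]) (intro N.integrable_const_bound[where B=1]; simp)
  also have "\<dots> = (\<Prod>b\<in>F. complex_of_real (exp (- (\<theta> b)\<^sup>2 / 2)))"
  proof (rule prod.cong)
    fix b
    have "(\<integral>y. iexp (\<theta> b * y) \<partial>?N) = char ?N (\<theta> b)" by (simp add: char_def)
    then show "(\<integral>y. iexp (\<theta> b * y) \<partial>?N) = complex_of_real (exp (- (\<theta> b)\<^sup>2 / 2))"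
      by (simp only: char_std_normal_distribution)
  qed simp
  also have "\<dots> = complex_of_real (exp (- (\<Sum>b\<in>F. (\<theta> b)\<^sup>2) / 2))"
    by (simp add: exp_sum[OF F, symmetric] sum_negf sum_divide_distrib flip: of_real_prod)
  finally show ?thesis .
qed

text \<open>The weighted sum has the law of \<sigma> times one coordinate, and \<sigma>^p factors
  out. The absolute moment itself stays unevaluated.\<close>

lemma gauss_sum_moment:
  "(\<integral>\<^sup>+\<gamma>. ennreal (\<bar>\<Sum>k<n. \<gamma> k * a k\<bar> powr p) \<partial>gauss_space) =
    ennreal (sqrt (\<Sum>k<n. (a k)\<^sup>2) powr p) * (\<integral>\<^sup>+\<gamma>. ennreal (\<bar>\<gamma> 0\<bar> powr p) \<partial>gauss_space)"
proof -
  interpret G: prob_space gauss_space by (rule prob_space_gauss)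
  define \<sigma> where "\<sigma> = sqrt (\<Sum>k<n. (a k)\<^sup>2)"
  have \<sigma>: "\<sigma>\<^sup>2 = (\<Sum>k<n. (a k)\<^sup>2)" "0 \<le> \<sigma>" by (auto simp: \<sigma>_def sum_nonneg)
  have "distr gauss_space borel (\<lambda>\<gamma>. \<Sum>k<n. \<gamma> k * a k) = distr gauss_space borel (\<lambda>\<gamma>. \<sigma> * \<gamma> 0)"
  proof (rule Levy_uniqueness)
    show "char (distr gauss_space borel (\<lambda>\<gamma>. \<Sum>k<n. \<gamma> k * a k)) = char (distr gauss_space borel (\<lambda>\<gamma>. \<sigma> * \<gamma> 0))"
    proof (rule ext)
      fix t
      have "char (distr gauss_space borel (\<lambda>\<gamma>. \<Sum>k<n. \<gamma> k * a k)) t = (\<integral>\<gamma>. iexp (\<Sum>k<n. (t * a k) * \<gamma> k) \<partial>gauss_space)"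
        unfolding char_def by (subst integral_distr) (auto simp: sum_distrib_left mult_ac)
      also have "\<dots> = complex_of_real (exp (- (\<Sum>k<n. (t * a k)\<^sup>2) / 2))"
        by (rule gauss_char[of "{..<n}" "\<lambda>k. k"]) auto
      also have "(\<Sum>k<n. (t * a k)\<^sup>2) = (t * \<sigma>)\<^sup>2"
        by (simp add: power_mult_distrib \<sigma>(1) sum_distrib_left)
      also have "complex_of_real (exp (- (t * \<sigma>)\<^sup>2 / 2)) = (\<integral>\<gamma>. iexp (\<Sum>k\<in>{0::nat}. (t * \<sigma>) * \<gamma> k) \<partial>gauss_space)"
        using gauss_char[of "{0::nat}" "\<lambda>k. k" "\<lambda>_. t * \<sigma>"] by simp
      also have "\<dots> = char (distr gauss_space borel (\<lambda>\<gamma>. \<sigma> * \<gamma> 0)) t"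
        unfolding char_def by (subst integral_distr) (auto simp: mult_ac)
      finally show "char (distr gauss_space borel (\<lambda>\<gamma>. \<Sum>k<n. \<gamma> k * a k)) t = char (distr gauss_space borel (\<lambda>\<gamma>. \<sigma> * \<gamma> 0)) t" .
    qed
  qed (auto intro!: G.real_distribution_distr)
  then have "(\<integral>\<^sup>+x. ennreal (\<bar>x\<bar> powr p) \<partial>distr gauss_space borel (\<lambda>\<gamma>. \<Sum>k<n. \<gamma> k * a k)) =
      (\<integral>\<^sup>+x. ennreal (\<bar>x\<bar> powr p) \<partial>distr gauss_space borel (\<lambda>\<gamma>. \<sigma> * \<gamma> 0))" by simp
  then have "(\<integral>\<^sup>+\<gamma>. ennreal (\<bar>\<Sum>k<n. \<gamma> k * a k\<bar> powr p) \<partial>gauss_space) = (\<integral>\<^sup>+\<gamma>. ennreal (\<bar>\<sigma> * \<gamma> 0\<bar> powr p) \<partial>gauss_space)"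
    by (subst (asm) (1 2) nn_integral_distr) auto
  also have "\<dots> = (\<integral>\<^sup>+\<gamma>. ennreal (\<sigma> powr p) * ennreal (\<bar>\<gamma> 0\<bar> powr p) \<partial>gauss_space)"
    using \<sigma>(2) by (intro nn_integral_cong) (simp add: abs_mult powr_mult ennreal_mult)
  also have "\<dots> = ennreal (\<sigma> powr p) * (\<integral>\<^sup>+\<gamma>. ennreal (\<bar>\<gamma> 0\<bar> powr p) \<partial>gauss_space)"
    by (rule nn_integral_cmult) measurable
  finally show ?thesis by (simp add: \<sigma>_def)
qed

text \<open>A positive finite lower bound is all that is used of the moment. If the moment were 0,
  the coordinate would vanish almost surely and its characteristic function at 1 would be 1 instead
  of exp(-1/2).\<close>

lemma gauss_moment_pos:
  obtains c where "0 < c" "ennreal c \<le> (\<integral>\<^sup>+\<gamma>. ennreal (\<bar>\<gamma> 0\<bar> powr p) \<partial>gauss_space)"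
proof -
  interpret G: prob_space gauss_space by (rule prob_space_gauss)
  let ?\<kappa> = "\<integral>\<^sup>+\<gamma>. ennreal (\<bar>\<gamma> 0\<bar> powr p) \<partial>gauss_space"
  have "?\<kappa> \<noteq> 0"
  proof
    assume "?\<kappa> = 0"
    then have "AE \<gamma> in gauss_space. ennreal (\<bar>\<gamma> 0\<bar> powr p) = 0"
      by (subst (asm) nn_integral_0_iff_AE) auto
    then have "AE \<gamma> in gauss_space. \<gamma> 0 = 0" by eventually_elim (auto simp: ennreal_eq_0_iff powr_eq_0_iff)
    then have "(\<integral>\<gamma>. iexp (\<gamma> 0) \<partial>gauss_space) = (\<integral>\<gamma>. 1 \<partial>gauss_space)"
      by (intro integral_cong_AE) (auto elim: eventually_mono)
    then have "complex_of_real (exp (- 1 / 2)) = 1"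
      using gauss_char[of "{0::nat}" "\<lambda>k. k" "\<lambda>_. 1"] by (simp add: G.prob_space[unfolded space_gauss])
    then show False by (simp only: of_real_eq_1_iff) simp
  qed
  then have pos: "0 < ?\<kappa>" by (simp add: zero_less_iff_neq_zero)
  show thesis
  proof (cases "?\<kappa>")
    case (real r)
    then show thesis using that[of r] pos by simp
  next
    case top
    then show thesis using that[of 1] by simp
  qed
qed

end

subsection \<open>Truncated fractional moments of the subordinator\<close>

text \<open>The truncated power \<open>x \<mapsto> x\<^sup>\<alpha> \<and> 1\<close> is comparable to a mixture of the functions
  \<open>x \<mapsto> 1 - exp (- \<beta> x)\<close>, whose expectations are explicit Laplace transforms.\<close>

lemma powr_tail_integral:
  assumes "0 < \<alpha>" "0 < b"
  shows "(\<integral>\<^sup>+\<beta>. ennreal (\<beta> powr (- 1 - \<alpha>)) * indicator {b..} \<beta> \<partial>lborel) = ennreal (b powr (- \<alpha>) / \<alpha>)"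
proof -
  have "(\<integral>\<^sup>+\<beta>. ennreal (\<beta> powr (- 1 - \<alpha>)) * indicator {b..} \<beta> \<partial>lborel) = ennreal (0 - (- (b powr (- \<alpha>) / \<alpha>)))"
  proof (rule nn_integral_FTC_atLeast)
    show "((\<lambda>\<beta>. - (\<beta> powr (- \<alpha>) / \<alpha>)) has_real_derivative \<beta> powr (- 1 - \<alpha>)) (at \<beta>)" if "b \<le> \<beta>" for \<beta>
      using that assms by (auto intro!: derivative_eq_intros simp: field_simps minus_diff_commute[of \<alpha> 1])
    have "((\<lambda>\<beta>. - (\<beta> powr (- \<alpha>) / \<alpha>)) \<longlongrightarrow> - (0 / \<alpha>)) at_top"
      using assms by (intro tendsto_intros tendsto_neg_powr filterlim_ident) auto
    then show "((\<lambda>\<beta>. - (\<beta> powr (- \<alpha>) / \<alpha>)) \<longlongrightarrow> 0) at_top" by simp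
  qed auto
  then show ?thesis by simp
qed

text \<open>For \<alpha> < 1 the weight \<beta>^(-1-\<alpha>) is the one of the classical
  subordination formula for x^\<alpha>, and restricting it to \<beta> >= 1 produces the truncation
  at 1. At \<alpha> = 1, that is p = 2, this weight would give an extra logarithm for small x, so
  Lebesgue measure on [1,2] replaces it.\<close>

lemma bernstein_weight:
  assumes \<alpha>: "0 < \<alpha>" "\<alpha> \<le> 1"
  obtains u and c K :: real where "u \<in> borel_measurable borel" "0 < c" "0 < K"
    "\<And>x. 0 \<le> x \<Longrightarrow> ennreal (c * min 1 (x powr \<alpha>)) \<le> (\<integral>\<^sup>+\<beta>. u \<beta> * ennreal (1 - exp (- \<beta> * x)) * indicator {1..} \<beta> \<partial>lborel)"
    "\<And>x. 0 \<le> x \<Longrightarrow> (\<integral>\<^sup>+\<beta>. u \<beta> * ennreal (1 - exp (- \<beta> * x)) * indicator {1..} \<beta> \<partial>lborel) \<le> ennreal (K * min 1 (x powr \<alpha>))"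
proof (cases "\<alpha> = 1")
  case True
  show thesis
  proof (rule that[of "indicator {1..2}" "1/2" 2])
    fix x :: real assume x: "0 \<le> x"
    have low: "min 1 x / 2 \<le> 1 - exp (- \<beta> * x)" if "1 \<le> \<beta>" for \<beta>
    proof -
      have "exp (- \<beta> * x) \<le> exp (- x)" using that x mult_right_mono[of 1 \<beta> x] by simp
      moreover have "exp (- x) \<le> 1 / (1 + x)"
        using exp_ge_add_one_self[of x] x by (simp add: exp_minus field_simps)
      moreover have "min 1 x / 2 \<le> 1 - 1 / (1 + x)"
      proof (cases "x \<le> 1")
        case True
        have "x * (1 + x) \<le> x * 2" using True x by (intro mult_left_mono) auto
        then have "x / 2 \<le> x / (1 + x)" using x by (simp add: field_simps)
        moreover have "1 - 1 / (1 + x) = x / (1 + x)" using x by (simp add: field_simps)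
        ultimately show ?thesis using True by simp
      next
        case False
        then show ?thesis by (simp add: field_simps)
      qed
      ultimately show ?thesis by linarith
    qed
    have "ennreal (1/2 * min 1 (x powr \<alpha>)) = (\<integral>\<^sup>+\<beta>. ennreal (min 1 x / 2) * indicator {1..2::real} \<beta> \<partial>lborel)"
      using x True by (simp add: nn_integral_cmult_indicator)
    also have "\<dots> \<le> (\<integral>\<^sup>+\<beta>. indicator {1..2::real} \<beta> * ennreal (1 - exp (- \<beta> * x)) * indicator {1..} \<beta> \<partial>lborel)"
      using low by (intro nn_integral_mono) (auto simp: indicator_def intro!: ennreal_leI)
    finally show "ennreal (1/2 * min 1 (x powr \<alpha>)) \<le> (\<integral>\<^sup>+\<beta>. indicator {1..2::real} \<beta> * ennreal (1 - exp (- \<beta> * x)) * indicator {1..} \<beta> \<partial>lborel)" .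
    have up: "1 - exp (- \<beta> * x) \<le> 2 * min 1 x" if "1 \<le> \<beta>" "\<beta> \<le> 2" for \<beta>
    proof -
      have "1 - exp (- \<beta> * x) \<le> min 1 (\<beta> * x)" using exp_minus_one_le[of "\<beta> * x"] that x by simp
      also have "\<dots> \<le> 2 * min 1 x" using mult_right_mono[of \<beta> 2 x] that x by (auto simp: min_def)
      finally show ?thesis .
    qed
    have "(\<integral>\<^sup>+\<beta>. indicator {1..2::real} \<beta> * ennreal (1 - exp (- \<beta> * x)) * indicator {1..} \<beta> \<partial>lborel) \<le> (\<integral>\<^sup>+\<beta>. ennreal (2 * min 1 x) * indicator {1..2::real} \<beta> \<partial>lborel)"
      using up by (intro nn_integral_mono) (auto simp: indicator_def intro!: ennreal_leI)
    also have "\<dots> = ennreal (2 * min 1 (x powr \<alpha>))"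
      using x True by (simp add: nn_integral_cmult_indicator)
    finally show "(\<integral>\<^sup>+\<beta>. indicator {1..2::real} \<beta> * ennreal (1 - exp (- \<beta> * x)) * indicator {1..} \<beta> \<partial>lborel) \<le> ennreal (2 * min 1 (x powr \<alpha>))" .
  qed auto
next
  case False
  then have \<alpha>1: "\<alpha> < 1" using \<alpha> by simp
  define u where "u \<beta> = ennreal (\<beta> powr (- 1 - \<alpha>))" for \<beta>
  have [measurable]: "u \<in> borel_measurable borel" unfolding u_def by measurable
  show thesis
  proof (rule that[of u "1 / (2 * \<alpha>)" "1 / (1 - \<alpha>) + 1 / \<alpha>"])
    fix x :: real assume x: "0 \<le> x"
    show "ennreal (1 / (2 * \<alpha>) * min 1 (x powr \<alpha>)) \<le> (\<integral>\<^sup>+\<beta>. u \<beta> * ennreal (1 - exp (- \<beta> * x)) * indicator {1..} \<beta> \<partial>lborel)"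
    proof (cases "x = 0")
      case False
      then have x: "0 < x" using x by simp
      \<comment> \<open>For \<beta> >= b the factor 1 - exp(-\<beta> x) is at least 1/2, and the
        mass of the weight beyond b is b^(-\<alpha>)/\<alpha>; hence the constant 1/(2
        \<alpha>).\<close>
      define b where "b = max 1 (1 / x)"
      have b: "1 \<le> b" "1 / x \<le> b" by (auto simp: b_def)
      have bp: "b powr (- \<alpha>) = min 1 (x powr \<alpha>)"
      proof (cases "x \<le> 1")
        case True
        then have "b = 1 / x" using x by (simp add: b_def field_simps)
        moreover have "x powr \<alpha> \<le> 1" using True x \<alpha> by (simp add: powr_le1)
        ultimately show ?thesis using x by (simp add: powr_divide powr_minus)
      next
        case False
        then have "b = 1" using x by (simp add: b_def field_simps)
        moreover have "1 \<le> x powr \<alpha>" using False \<alpha> by (simp add: ge_one_powr_ge_zero)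
        ultimately show ?thesis by simp
      qed
      have half: "1/2 \<le> 1 - exp (- \<beta> * x)" if "b \<le> \<beta>" for \<beta>
      proof -
        have "1 / x \<le> \<beta>" using b that by linarith
        then have "1 \<le> \<beta> * x" using x by (simp add: field_simps)
        then have "exp (- \<beta> * x) \<le> exp (- 1)" by simp
        also have "exp (- 1) \<le> (1/2 :: real)" using exp_ge_add_one_self[of 1] by (simp add: exp_minus field_simps)
        finally show ?thesis by simp
      qed
      have half_eq: "1 / (2 * \<alpha>) * min 1 (x powr \<alpha>) = 1/2 * (b powr (- \<alpha>) / \<alpha>)" by (simp add: bp)
      have "ennreal (1 / (2 * \<alpha>) * min 1 (x powr \<alpha>)) = ennreal (1/2) * ennreal (b powr (- \<alpha>) / \<alpha>)"
        unfolding half_eq using \<alpha> by (intro ennreal_mult) auto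
      also have "\<dots> = ennreal (1/2) * (\<integral>\<^sup>+\<beta>. u \<beta> * indicator {b..} \<beta> \<partial>lborel)"
        unfolding u_def using b \<alpha> by (subst powr_tail_integral) auto
      also have "\<dots> = (\<integral>\<^sup>+\<beta>. ennreal (1/2) * (u \<beta> * indicator {b..} \<beta>) \<partial>lborel)"
        by (rule nn_integral_cmult[symmetric]) measurable
      also have "\<dots> \<le> (\<integral>\<^sup>+\<beta>. u \<beta> * ennreal (1 - exp (- \<beta> * x)) * indicator {1..} \<beta> \<partial>lborel)"
      proof (rule nn_integral_mono)
        fix \<beta> :: real
        show "ennreal (1/2) * (u \<beta> * indicator {b..} \<beta>) \<le> u \<beta> * ennreal (1 - exp (- \<beta> * x)) * indicator {1..} \<beta>"
        proof (cases "b \<le> \<beta>")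
          case True
          have "ennreal (1/2) * u \<beta> \<le> ennreal (1 - exp (- \<beta> * x)) * u \<beta>"
            using half[OF True] by (intro mult_right_mono ennreal_leI) auto
          then show ?thesis using True b by (simp add: mult.commute)
        qed simp
      qed
      finally show ?thesis .
    qed (use \<alpha> in simp)
    show "(\<integral>\<^sup>+\<beta>. u \<beta> * ennreal (1 - exp (- \<beta> * x)) * indicator {1..} \<beta> \<partial>lborel) \<le> ennreal ((1 / (1 - \<alpha>) + 1 / \<alpha>) * min 1 (x powr \<alpha>))"
    proof (cases "1 \<le> x")
      case True
      have xp: "1 \<le> x powr \<alpha>" using True \<alpha> by (simp add: ge_one_powr_ge_zero)
      have "(\<integral>\<^sup>+\<beta>. u \<beta> * ennreal (1 - exp (- \<beta> * x)) * indicator {1..} \<beta> \<partial>lborel) \<le> (\<integral>\<^sup>+\<beta>. u \<beta> * indicator {1..} \<beta> \<partial>lborel)"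
      proof (rule nn_integral_mono)
        fix \<beta> :: real
        have "u \<beta> * ennreal (1 - exp (- \<beta> * x)) \<le> u \<beta> * ennreal 1" by (intro mult_left_mono ennreal_leI) auto
        then show "u \<beta> * ennreal (1 - exp (- \<beta> * x)) * indicator {1..} \<beta> \<le> u \<beta> * indicator {1..} \<beta>"
          by (intro mult_right_mono) auto
      qed
      also have "\<dots> = ennreal (1 / \<alpha>)" unfolding u_def using \<alpha> by (subst powr_tail_integral) auto
      also have "\<dots> \<le> ennreal ((1 / (1 - \<alpha>) + 1 / \<alpha>) * min 1 (x powr \<alpha>))"
        using \<alpha>1 xp by (intro ennreal_leI) (simp add: min_def)
      finally show ?thesis .
    next
      case False
      show ?thesis
      proof (cases "x = 0")
        case False
        then have x: "0 < x" "x < 1" using x \<open>\<not> 1 \<le> x\<close> by auto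
        have xp: "min 1 (x powr \<alpha>) = x powr \<alpha>" using x \<alpha> by (simp add: powr_le1)
        \<comment> \<open>The range is split at 1/x: below it 1 - exp(-y) <= y gives x^\<alpha>/(1 -
          \<alpha>), above it the bound 1 gives x^\<alpha>/\<alpha>.\<close>
        have "(\<integral>\<^sup>+\<beta>. u \<beta> * ennreal (1 - exp (- \<beta> * x)) * indicator {1..} \<beta> \<partial>lborel) \<le>
            (\<integral>\<^sup>+\<beta>. ennreal x * (ennreal (\<beta> powr (- \<alpha>)) * indicator {1..1/x} \<beta>) + u \<beta> * indicator {1/x..} \<beta> \<partial>lborel)"
        proof (rule nn_integral_mono)
          fix \<beta> :: real
          show "u \<beta> * ennreal (1 - exp (- \<beta> * x)) * indicator {1..} \<beta> \<le>
            ennreal x * (ennreal (\<beta> powr (- \<alpha>)) * indicator {1..1/x} \<beta>) + u \<beta> * indicator {1/x..} \<beta>"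
          proof (cases "1 / x \<le> \<beta>")
            case True
            have "u \<beta> * ennreal (1 - exp (- \<beta> * x)) \<le> u \<beta> * ennreal 1" by (intro mult_left_mono ennreal_leI) auto
            then have "u \<beta> * ennreal (1 - exp (- \<beta> * x)) * indicator {1..} \<beta> \<le> u \<beta> * ennreal 1 * 1"
              by (intro mult_mono) (auto simp: indicator_def)
            also have "\<dots> = u \<beta> * indicator {1/x..} \<beta>" using True by simp
            also have "\<dots> \<le> ennreal x * (ennreal (\<beta> powr (- \<alpha>)) * indicator {1..1/x} \<beta>) + u \<beta> * indicator {1/x..} \<beta>" by simp
            finally show ?thesis .
          next
            case False
            show ?thesis
            proof (cases "1 \<le> \<beta>")
              case True
              have "\<beta> powr (- 1 - \<alpha>) * (1 - exp (- \<beta> * x)) \<le> \<beta> powr (- 1 - \<alpha>) * (\<beta> * x)"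
                using exp_minus_one_le[of "\<beta> * x"] True x by (intro mult_left_mono) auto
              also have "\<dots> = x * \<beta> powr (- \<alpha>)"
                using True powr_add[of \<beta> 1 "- 1 - \<alpha>"] by simp
              finally have "ennreal (\<beta> powr (- 1 - \<alpha>) * (1 - exp (- \<beta> * x))) \<le> ennreal (x * \<beta> powr (- \<alpha>))" by (rule ennreal_leI)
              then have "u \<beta> * ennreal (1 - exp (- \<beta> * x)) \<le> ennreal x * ennreal (\<beta> powr (- \<alpha>))"
                using True x by (simp add: u_def ennreal_mult)
              then show ?thesis using True False by simp
            qed simp
          qed
        qed
        also have "\<dots> = ennreal x * (\<integral>\<^sup>+\<beta>. ennreal (\<beta> powr (- \<alpha>)) * indicator {1..1/x} \<beta> \<partial>lborel) + (\<integral>\<^sup>+\<beta>. u \<beta> * indicator {1/x..} \<beta> \<partial>lborel)"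
          by (subst nn_integral_add) (auto simp: nn_integral_cmult)
        also have "(\<integral>\<^sup>+\<beta>. ennreal (\<beta> powr (- \<alpha>)) * indicator {1..1/x} \<beta> \<partial>lborel) = ennreal ((1/x) powr (1 - \<alpha>) / (1 - \<alpha>) - 1 powr (1 - \<alpha>) / (1 - \<alpha>))"
        proof (rule nn_integral_FTC_Icc)
          show "((\<lambda>\<beta>. \<beta> powr (1 - \<alpha>) / (1 - \<alpha>)) has_real_derivative \<beta> powr (- \<alpha>)) (at \<beta>)" if "\<beta> \<in> {1..1/x}" for \<beta>
            using that \<alpha>1 by (auto intro!: derivative_eq_intros)
        qed (use x in auto)
        also have "(\<integral>\<^sup>+\<beta>. u \<beta> * indicator {1/x..} \<beta> \<partial>lborel) = ennreal ((1/x) powr (- \<alpha>) / \<alpha>)"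
          unfolding u_def using x \<alpha> by (intro powr_tail_integral) auto
        also have "(1/x) powr (- \<alpha>) = x powr \<alpha>" using x by (simp add: powr_divide powr_minus)
        finally have bound: "(\<integral>\<^sup>+\<beta>. u \<beta> * ennreal (1 - exp (- \<beta> * x)) * indicator {1..} \<beta> \<partial>lborel) \<le>
            ennreal x * ennreal ((1/x) powr (1 - \<alpha>) / (1 - \<alpha>) - 1 powr (1 - \<alpha>) / (1 - \<alpha>)) + ennreal (x powr \<alpha> / \<alpha>)" .
        have "ennreal x * ennreal ((1/x) powr (1 - \<alpha>) / (1 - \<alpha>) - 1 powr (1 - \<alpha>) / (1 - \<alpha>)) \<le> ennreal (x powr \<alpha> / (1 - \<alpha>))"
        proof -
          have "x * ((1/x) powr (1 - \<alpha>) / (1 - \<alpha>) - 1 powr (1 - \<alpha>) / (1 - \<alpha>)) \<le> x * ((1/x) powr (1 - \<alpha>) / (1 - \<alpha>))"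
            using x \<alpha>1 by (intro mult_left_mono) auto
          also have "x * ((1/x) powr (1 - \<alpha>) / (1 - \<alpha>)) = x powr \<alpha> / (1 - \<alpha>)"
          proof -
            have "x * (1/x) powr (1 - \<alpha>) = x powr \<alpha>" using x by (simp add: powr_divide powr_diff)
            then show ?thesis by (simp only: times_divide_eq_right)
          qed
          finally have "ennreal (x * ((1/x) powr (1 - \<alpha>) / (1 - \<alpha>) - 1 powr (1 - \<alpha>) / (1 - \<alpha>))) \<le> ennreal (x powr \<alpha> / (1 - \<alpha>))" by (rule ennreal_leI)
          then show ?thesis using x by (simp add: ennreal_mult')
        qed
        with bound have "(\<integral>\<^sup>+\<beta>. u \<beta> * ennreal (1 - exp (- \<beta> * x)) * indicator {1..} \<beta> \<partial>lborel) \<le> ennreal (x powr \<alpha> / (1 - \<alpha>)) + ennreal (x powr \<alpha> / \<alpha>)"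
          using add_right_mono order_trans by blast
        also have "ennreal (x powr \<alpha> / (1 - \<alpha>)) + ennreal (x powr \<alpha> / \<alpha>) = ennreal ((1 / (1 - \<alpha>) + 1 / \<alpha>) * min 1 (x powr \<alpha>))"
          unfolding xp using \<alpha> \<alpha>1 by (subst ennreal_plus[symmetric]) (auto simp: algebra_simps)
        finally show ?thesis .
      qed simp
    qed
  qed (use \<alpha> \<alpha>1 in \<open>auto intro!: add_pos_pos divide_pos_pos\<close>)
qed

lemma min_one_ennreal: "0 \<le> x \<Longrightarrow> min 1 (ennreal x) = ennreal (min 1 x)"
  by (cases "x \<le> 1") (auto simp: min_def ennreal_ge_1 not_le)

lemma mult_min_one_ennreal: "0 \<le> a \<Longrightarrow> 0 \<le> x \<Longrightarrow> ennreal a * min 1 (ennreal x) = ennreal (a * min 1 x)"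
  by (simp add: min_one_ennreal ennreal_mult)

context subordinated_wiener begin

text \<open>Prepares Fubini for \<open>\<rho>\<close>. Integrability of \<open>min s 1\<close>
  bounds the mass of each half line beyond 1/(n+1), and \<open>{..0}\<close> has mass 0.\<close>

lemma sigma_finite_rho: "sigma_finite_measure \<rho>"
proof
  have sp: "space \<rho> = UNIV" using sets_eq_imp_space_eq[OF sets_rho] by simp
  have fin: "emeasure \<rho> {1 / real (Suc n)<..} \<noteq> \<infinity>" for n
  proof -
    have "ennreal (1 / real (Suc n)) * emeasure \<rho> {1 / real (Suc n)<..} = (\<integral>\<^sup>+s. ennreal (1 / real (Suc n)) * indicator {1 / real (Suc n)<..} s \<partial>\<rho>)"
      by (rule nn_integral_cmult_indicator[symmetric]) (simp add: sets_rho)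
    also have "\<dots> \<le> (\<integral>\<^sup>+s\<in>{0<..}. ennreal (min s 1) \<partial>\<rho>)"
    proof (rule nn_integral_mono)
      fix s :: real
      show "ennreal (1 / real (Suc n)) * indicator {1 / real (Suc n)<..} s \<le> ennreal (min s 1) * indicator {0<..} s"
      proof (cases "1 / real (Suc n) < s")
        case True
        moreover have "0 < 1 / real (Suc n)" "1 / real (Suc n) \<le> 1" by auto
        ultimately have "0 < s" "1 / real (Suc n) \<le> min s 1" by linarith+
        then show ?thesis using True by (simp add: ennreal_leI)
      qed simp
    qed
    also have "\<dots> < \<infinity>" using sub by (simp add: subordinator_def)
    finally have "ennreal (1 / real (Suc n)) * emeasure \<rho> {1 / real (Suc n)<..} < \<infinity>" .
    then show ?thesis by (auto simp: ennreal_mult_less_top)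
  qed
  have "s \<in> {..0} \<or> (\<exists>n. 1 / real (Suc n) < s)" for s :: real
  proof (cases "s \<le> 0")
    case False
    then obtain n where "1 / real (Suc n) < s" using nat_approx_posE[of s] by auto
    then show ?thesis by blast
  qed simp
  then have cover: "\<Union>(insert {..0} (range (\<lambda>n. {1 / real (Suc n)<..}))) = space \<rho>"
    unfolding sp by (auto simp del: of_nat_Suc)
  show "\<exists>A. countable A \<and> A \<subseteq> sets \<rho> \<and> \<Union>A = space \<rho> \<and> (\<forall>a\<in>A. emeasure \<rho> a \<noteq> \<infinity>)"
  proof (intro exI[of _ "insert {..0} (range (\<lambda>n. {1 / real (Suc n)<..}))"] conjI cover ballI)
    fix a assume "a \<in> insert {..0} (range (\<lambda>n. {1 / real (Suc n)<..}))"
    then consider "a = {..0}" | n where "a = {1 / real (Suc n)<..}" by blast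
    then show "emeasure \<rho> a \<noteq> \<infinity>"
    proof cases
      case 1
      then show ?thesis using rho_nonpos by simp
    next
      case 2
      then show ?thesis using fin[of n] by (simp only: not_False_eq_True)
    qed
  next
    show "countable (insert {..0} (range (\<lambda>n. {1 / real (Suc n)<..})))" by simp
    show "insert {..0} (range (\<lambda>n. {1 / real (Suc n)<..})) \<subseteq> sets \<rho>" by (simp add: sets_rho image_subset_iff)
  qed
qed

text \<open>Both sides are compared with the mixture of \<open>bernstein_weight\<close>: from below
  at the increment of l, from above at r. In between, 1 - exp(-y) <= y for y = b - a times the
  Laplace exponent, and the integral representation of that exponent exchanges the law of the
  increment for \<open>\<rho>\<close>.\<close>

lemma l_increment_moment:
  assumes \<alpha>: "0 < \<alpha>" "\<alpha> \<le> 1"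
  obtains K where "0 < K" "\<And>a b c. 0 \<le> a \<Longrightarrow> a \<le> b \<Longrightarrow> 0 \<le> c \<Longrightarrow>
    (\<integral>\<^sup>+w. min 1 (ennreal (c * (max 0 (l b w - l a w)) powr \<alpha>)) \<partial>M) \<le>
      ennreal (K * (b - a)) * (\<integral>\<^sup>+r. min 1 (ennreal (c * \<bar>r\<bar> powr \<alpha>)) \<partial>\<rho>)"
proof -
  obtain u and c0 K :: real where u[measurable]: "u \<in> borel_measurable borel" and c0: "0 < c0" and K: "0 < K"
    and low: "\<And>x. 0 \<le> x \<Longrightarrow> ennreal (c0 * min 1 (x powr \<alpha>)) \<le> (\<integral>\<^sup>+\<beta>. u \<beta> * ennreal (1 - exp (- \<beta> * x)) * indicator {1..} \<beta> \<partial>lborel)"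
    and up: "\<And>x. 0 \<le> x \<Longrightarrow> (\<integral>\<^sup>+\<beta>. u \<beta> * ennreal (1 - exp (- \<beta> * x)) * indicator {1..} \<beta> \<partial>lborel) \<le> ennreal (K * min 1 (x powr \<alpha>))"
    by (rule bernstein_weight[OF \<alpha>]) (rule that; assumption)
  interpret R: sigma_finite_measure \<rho> by (rule sigma_finite_rho)
  interpret PM: pair_sigma_finite lborel M by standard
  interpret PR: pair_sigma_finite lborel \<rho> by standard
  show thesis
  proof (rule that[of "K / c0"])
    fix a b c :: real assume ab: "0 \<le> a" "a \<le> b" and c: "0 \<le> c"
    have [measurable]: "l a \<in> borel_measurable M" "l b \<in> borel_measurable M" using ab by (auto intro!: l_meas)
    define \<tau> where "\<tau> w = max 0 (l b w - l a w)" for w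
    have [measurable]: "\<tau> \<in> borel_measurable M" unfolding \<tau>_def by measurable
    have \<tau>0: "0 \<le> \<tau> w" for w by (simp add: \<tau>_def)
    \<comment> \<open>Absorbs the factor c into the argument of the power.\<close>
    define \<kappa> where "\<kappa> = c powr (1 / \<alpha>)"
    have \<kappa>0: "0 \<le> \<kappa>" by (simp add: \<kappa>_def)
    have \<kappa>: "(\<kappa> * x) powr \<alpha> = c * x powr \<alpha>" if "0 \<le> x" for x
      using that c \<alpha> by (simp add: \<kappa>_def powr_mult powr_powr)
    have lap: "(\<integral>\<^sup>+w. ennreal (1 - exp (- \<beta> * (\<kappa> * \<tau> w))) \<partial>M) \<le> ennreal (b - a) * ennreal (laplace_exp (\<beta> * \<kappa>))" if "0 \<le> \<beta>" for \<beta>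
    proof -
      have \<beta>\<kappa>: "0 \<le> \<beta> * \<kappa>" using that \<kappa>0 by simp
      have int: "integrable M (\<lambda>w. exp (- \<beta> * (\<kappa> * \<tau> w)))"
        using \<beta>\<kappa> \<tau>0 that \<kappa>0 by (intro integrable_const_bound[where B=1]) auto
      have "(\<integral>w. exp (- \<beta> * (\<kappa> * \<tau> w)) \<partial>M) = (\<integral>w. exp (- (\<Sum>k<1. (\<beta> * \<kappa>) * (l (if Suc k = 0 then a else b) w - l (if k = 0 then a else b) w))) \<partial>M)"
      proof (rule integral_cong_AE)
        show "AE w in M. exp (- \<beta> * (\<kappa> * \<tau> w)) = exp (- (\<Sum>k<1. (\<beta> * \<kappa>) * (l (if Suc k = 0 then a else b) w - l (if k = 0 then a else b) w)))"
          using AE_l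
        proof eventually_elim
          case (elim w)
          then have "\<tau> w = l b w - l a w" using ab by (simp add: \<tau>_def)
          then show ?case by (simp add: mult.assoc)
        qed
      qed auto
      also have "\<dots> = exp (- (\<Sum>k<1. ((if Suc k = 0 then a else b) - (if k = 0 then a else b)) * laplace_exp (\<beta> * \<kappa>)))"
        using ab \<beta>\<kappa> by (intro l_increments_laplace[where \<beta>="\<lambda>_. \<beta> * \<kappa>" and t="\<lambda>k. if k = 0 then a else b" and m=1]) auto
      finally have E: "(\<integral>w. exp (- \<beta> * (\<kappa> * \<tau> w)) \<partial>M) = exp (- ((b - a) * laplace_exp (\<beta> * \<kappa>)))" by simp
      have "(\<integral>\<^sup>+w. ennreal (1 - exp (- \<beta> * (\<kappa> * \<tau> w))) \<partial>M) = ennreal (\<integral>w. 1 - exp (- \<beta> * (\<kappa> * \<tau> w)) \<partial>M)"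
        using int that \<kappa>0 \<tau>0 by (intro nn_integral_eq_integral) auto
      also have "(\<integral>w. 1 - exp (- \<beta> * (\<kappa> * \<tau> w)) \<partial>M) = 1 - exp (- ((b - a) * laplace_exp (\<beta> * \<kappa>)))"
        using int E by (simp add: prob_space)
      also have "ennreal \<dots> \<le> ennreal ((b - a) * laplace_exp (\<beta> * \<kappa>))"
        using exp_ge_add_one_self[of "- ((b - a) * laplace_exp (\<beta> * \<kappa>))"] by (intro ennreal_leI) simp
      also have "\<dots> = ennreal (b - a) * ennreal (laplace_exp (\<beta> * \<kappa>))"
        using ab laplace_exp_nonneg[OF \<beta>\<kappa>] by (intro ennreal_mult) auto
      finally show ?thesis .
    qed
    have "ennreal c0 * (\<integral>\<^sup>+w. min 1 (ennreal (c * \<tau> w powr \<alpha>)) \<partial>M) = (\<integral>\<^sup>+w. ennreal c0 * min 1 (ennreal (c * \<tau> w powr \<alpha>)) \<partial>M)"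
      by (rule nn_integral_cmult[symmetric]) measurable
    also have "\<dots> \<le> (\<integral>\<^sup>+w. (\<integral>\<^sup>+\<beta>. u \<beta> * ennreal (1 - exp (- \<beta> * (\<kappa> * \<tau> w))) * indicator {1..} \<beta> \<partial>lborel) \<partial>M)"
    proof (rule nn_integral_mono)
      fix w
      have "ennreal c0 * min 1 (ennreal (c * \<tau> w powr \<alpha>)) = ennreal (c0 * min 1 ((\<kappa> * \<tau> w) powr \<alpha>))"
        using c0 c \<tau>0[of w] by (simp add: \<kappa> mult_min_one_ennreal)
      then show "ennreal c0 * min 1 (ennreal (c * \<tau> w powr \<alpha>)) \<le> (\<integral>\<^sup>+\<beta>. u \<beta> * ennreal (1 - exp (- \<beta> * (\<kappa> * \<tau> w))) * indicator {1..} \<beta> \<partial>lborel)"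
        using low[of "\<kappa> * \<tau> w"] \<kappa>0 \<tau>0[of w] by simp
    qed
    also have "\<dots> = (\<integral>\<^sup>+\<beta>. (\<integral>\<^sup>+w. u \<beta> * ennreal (1 - exp (- \<beta> * (\<kappa> * \<tau> w))) * indicator {1..} \<beta> \<partial>M) \<partial>lborel)"
      by (rule PM.Fubini') measurable
    also have "\<dots> \<le> (\<integral>\<^sup>+\<beta>. ennreal (b - a) * (\<integral>\<^sup>+r. u \<beta> * ennreal (1 - exp (- \<beta> * (\<kappa> * \<bar>r\<bar>))) * indicator {1..} \<beta> \<partial>\<rho>) \<partial>lborel)"
    proof (rule nn_integral_mono)
      fix \<beta> :: real
      show "(\<integral>\<^sup>+w. u \<beta> * ennreal (1 - exp (- \<beta> * (\<kappa> * \<tau> w))) * indicator {1..} \<beta> \<partial>M) \<le>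
          ennreal (b - a) * (\<integral>\<^sup>+r. u \<beta> * ennreal (1 - exp (- \<beta> * (\<kappa> * \<bar>r\<bar>))) * indicator {1..} \<beta> \<partial>\<rho>)"
      proof (cases "1 \<le> \<beta>")
        case True
        then have \<beta>: "0 \<le> \<beta>" "0 \<le> \<beta> * \<kappa>" using \<kappa>0 by auto
        have "ennreal (laplace_exp (\<beta> * \<kappa>)) = (\<integral>\<^sup>+r. ennreal (1 - exp (- \<beta> * (\<kappa> * \<bar>r\<bar>))) \<partial>\<rho>)"
          unfolding ennreal_laplace_exp[OF \<beta>(2)]
          by (intro nn_integral_cong_AE eventually_mono[OF AE_rho_pos]) (simp add: mult.assoc)
        then have "u \<beta> * (\<integral>\<^sup>+w. ennreal (1 - exp (- \<beta> * (\<kappa> * \<tau> w))) \<partial>M) \<le> u \<beta> * (ennreal (b - a) * (\<integral>\<^sup>+r. ennreal (1 - exp (- \<beta> * (\<kappa> * \<bar>r\<bar>))) \<partial>\<rho>))"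
          using lap[OF \<beta>(1)] by (intro mult_left_mono) auto
        then show ?thesis using True
          by (simp add: nn_integral_cmult mult.left_commute)
      qed simp
    qed
    also have "\<dots> = ennreal (b - a) * (\<integral>\<^sup>+\<beta>. (\<integral>\<^sup>+r. u \<beta> * ennreal (1 - exp (- \<beta> * (\<kappa> * \<bar>r\<bar>))) * indicator {1..} \<beta> \<partial>\<rho>) \<partial>lborel)"
      by (rule nn_integral_cmult) measurable
    also have "(\<integral>\<^sup>+\<beta>. (\<integral>\<^sup>+r. u \<beta> * ennreal (1 - exp (- \<beta> * (\<kappa> * \<bar>r\<bar>))) * indicator {1..} \<beta> \<partial>\<rho>) \<partial>lborel) =
        (\<integral>\<^sup>+r. (\<integral>\<^sup>+\<beta>. u \<beta> * ennreal (1 - exp (- \<beta> * (\<kappa> * \<bar>r\<bar>))) * indicator {1..} \<beta> \<partial>lborel) \<partial>\<rho>)"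
      by (rule PR.Fubini'[symmetric]) measurable
    also have "\<dots> \<le> (\<integral>\<^sup>+r. ennreal K * min 1 (ennreal (c * \<bar>r\<bar> powr \<alpha>)) \<partial>\<rho>)"
    proof (rule nn_integral_mono)
      fix r
      have "ennreal K * min 1 (ennreal (c * \<bar>r\<bar> powr \<alpha>)) = ennreal (K * min 1 ((\<kappa> * \<bar>r\<bar>) powr \<alpha>))"
        using K c by (simp add: \<kappa> mult_min_one_ennreal)
      then show "(\<integral>\<^sup>+\<beta>. u \<beta> * ennreal (1 - exp (- \<beta> * (\<kappa> * \<bar>r\<bar>))) * indicator {1..} \<beta> \<partial>lborel) \<le> ennreal K * min 1 (ennreal (c * \<bar>r\<bar> powr \<alpha>))"
        using up[of "\<kappa> * \<bar>r\<bar>"] \<kappa>0 by simp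
    qed
    also have "\<dots> = ennreal K * (\<integral>\<^sup>+r. min 1 (ennreal (c * \<bar>r\<bar> powr \<alpha>)) \<partial>\<rho>)"
      by (rule nn_integral_cmult) measurable
    finally have main: "ennreal c0 * (\<integral>\<^sup>+w. min 1 (ennreal (c * \<tau> w powr \<alpha>)) \<partial>M) \<le>
        ennreal (b - a) * (ennreal K * (\<integral>\<^sup>+r. min 1 (ennreal (c * \<bar>r\<bar> powr \<alpha>)) \<partial>\<rho>))"
      by (simp add: mult_left_mono)
    have "(\<integral>\<^sup>+w. min 1 (ennreal (c * \<tau> w powr \<alpha>)) \<partial>M) = ennreal (1 / c0) * (ennreal c0 * (\<integral>\<^sup>+w. min 1 (ennreal (c * \<tau> w powr \<alpha>)) \<partial>M))"
      using c0 by (simp add: mult.assoc[symmetric] flip: ennreal_mult)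
    also have "\<dots> \<le> ennreal (1 / c0) * (ennreal (b - a) * (ennreal K * (\<integral>\<^sup>+r. min 1 (ennreal (c * \<bar>r\<bar> powr \<alpha>)) \<partial>\<rho>)))"
      by (intro mult_left_mono main) simp
    also have "\<dots> = ennreal (K / c0 * (b - a)) * (\<integral>\<^sup>+r. min 1 (ennreal (c * \<bar>r\<bar> powr \<alpha>)) \<partial>\<rho>)"
      using c0 K ab by (simp add: mult.assoc[symmetric] mult.commute flip: ennreal_mult)
    finally show "(\<integral>\<^sup>+w. min 1 (ennreal (c * (max 0 (l b w - l a w)) powr \<alpha>)) \<partial>M) \<le>
        ennreal (K / c0 * (b - a)) * (\<integral>\<^sup>+r. min 1 (ennreal (c * \<bar>r\<bar> powr \<alpha>)) \<partial>\<rho>)" by (simp add: \<tau>_def)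
  qed (use K c0 in simp)
qed

end

subsection \<open>Laws of step integrals\<close>

text \<open>The p-th power of an L^p norm rather than the norm itself, as an extended nonnegative
  number free of integrability conditions.\<close>

definition gauss_norm :: "real \<Rightarrow> nat \<Rightarrow> (nat \<Rightarrow> 'e::real_normed_vector) \<Rightarrow> ennreal" where
  "gauss_norm p n y = (\<integral>\<^sup>+\<gamma>. ennreal (norm (\<Sum>k<n. \<gamma> k *\<^sub>R y k) powr p) \<partial>gauss_space)"

lemma min_one_sum_le:
  fixes f :: "'i \<Rightarrow> ennreal"
  assumes "finite I" shows "min 1 (\<Sum>i\<in>I. f i) \<le> (\<Sum>i\<in>I. min 1 (f i))"
  using assms
proof (induction rule: finite_induct)
  case (insert i I)
  have "min 1 (f i + (\<Sum>i\<in>I. f i)) \<le> min 1 (f i) + min 1 (\<Sum>i\<in>I. f i)" (is "min 1 (?a + ?b) \<le> _")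
  proof (cases "1 \<le> ?a \<or> 1 \<le> ?b")
    case True
    then have "1 \<le> min 1 ?a + min 1 ?b" by (auto simp: min_absorb1 add_increasing add_increasing2)
    then show ?thesis by (rule min.coboundedI1)
  next
    case False
    then have "min 1 ?a = ?a" "min 1 ?b = ?b" by (auto simp: min_def)
    then show ?thesis by simp
  qed
  also have "\<dots> \<le> min 1 (f i) + (\<Sum>i\<in>I. min 1 (f i))" by (intro add_left_mono insert.IH)
  finally show ?case using insert.hyps by simp
qed simp

lemma min_one_mult_le: "1 \<le> (c::ennreal) \<Longrightarrow> min 1 (c * x) \<le> c * min 1 x"
proof (cases "x \<le> 1")
  case False
  assume "1 \<le> c"
  then have "min 1 (c * x) \<le> c" by (rule order_trans[OF min.cobounded1])
  then show ?thesis using False by (simp add: min_absorb1)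
qed (simp add: min_def)

text \<open>Concavity of truncation, in the form of Jensen's inequality for finitely many
  probability weights.\<close>

lemma min_one_weighted_sum:
  fixes f :: "'i \<Rightarrow> ennreal" and a :: "'i \<Rightarrow> ennreal"
  assumes "(\<Sum>i\<in>I. a i) = 1"
  shows "(\<Sum>i\<in>I. a i * min 1 (f i)) \<le> min 1 (\<Sum>i\<in>I. a i * f i)"
proof (rule min.boundedI)
  have "(\<Sum>i\<in>I. a i * min 1 (f i)) \<le> (\<Sum>i\<in>I. a i * 1)" by (intro sum_mono mult_left_mono) auto
  then show "(\<Sum>i\<in>I. a i * min 1 (f i)) \<le> 1" using assms by simp
  show "(\<Sum>i\<in>I. a i * min 1 (f i)) \<le> (\<Sum>i\<in>I. a i * f i)" by (intro sum_mono mult_left_mono) auto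
qed

text \<open>The expectation over signs is written as a finite sum, which can be exchanged with
  nonnegative integrals. Enlarging the constant to at least 1 lets it be pulled out of a
  truncation.\<close>

lemma type_expectation_le:
  assumes "rademacher_type TYPE('e::real_normed_vector) p"
  obtains K where "1 \<le> K" "\<And>n (x :: nat \<Rightarrow> 'e).
    (\<Sum>\<epsilon>\<in>set_pmf (Pi_pmf {..<n} 0 (\<lambda>_. pmf_of_set {-1, 1})). ennreal (pmf (Pi_pmf {..<n} 0 (\<lambda>_. pmf_of_set {-1, 1})) \<epsilon>) *
      ennreal (norm (\<Sum>k<n. \<epsilon> k *\<^sub>R x k) powr p)) \<le> ennreal (K * (\<Sum>k<n. norm (x k) powr p))"
proof -
  obtain K where K: "\<And>n (x :: nat \<Rightarrow> 'e). measure_pmf.expectation (Pi_pmf {..<n} 0 (\<lambda>_. pmf_of_set {-1, 1}))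
          (\<lambda>\<epsilon>. norm (\<Sum>k<n. \<epsilon> k *\<^sub>R x k) powr p) \<le> K * (\<Sum>k<n. norm (x k) powr p)"
    using assms unfolding rademacher_type_def by blast
  show thesis
  proof (rule that[of "max 1 K"])
    fix n :: nat and x :: "nat \<Rightarrow> 'e"
    let ?D = "Pi_pmf {..<n} 0 (\<lambda>_. pmf_of_set {-1, 1 :: real})"
    have fin: "finite (set_pmf ?D)" by (simp add: set_Pi_pmf finite_PiE_dflt)
    have "(\<Sum>\<epsilon>\<in>set_pmf ?D. ennreal (pmf ?D \<epsilon>) * ennreal (norm (\<Sum>k<n. \<epsilon> k *\<^sub>R x k) powr p)) =
        ennreal (\<Sum>\<epsilon>\<in>set_pmf ?D. pmf ?D \<epsilon> * norm (\<Sum>k<n. \<epsilon> k *\<^sub>R x k) powr p)"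
      by (subst sum_ennreal[symmetric]) (auto simp: ennreal_mult)
    also have "(\<Sum>\<epsilon>\<in>set_pmf ?D. pmf ?D \<epsilon> * norm (\<Sum>k<n. \<epsilon> k *\<^sub>R x k) powr p) =
        measure_pmf.expectation ?D (\<lambda>\<epsilon>. norm (\<Sum>k<n. \<epsilon> k *\<^sub>R x k) powr p)"
      using fin by (subst integral_measure_pmf[of "set_pmf ?D"]) auto
    also have "ennreal \<dots> \<le> ennreal (K * (\<Sum>k<n. norm (x k) powr p))" by (intro ennreal_leI K)
    also have "\<dots> \<le> ennreal (max 1 K * (\<Sum>k<n. norm (x k) powr p))"
      by (intro ennreal_leI mult_right_mono sum_nonneg) auto
    finally show "(\<Sum>\<epsilon>\<in>set_pmf ?D. ennreal (pmf ?D \<epsilon>) * ennreal (norm (\<Sum>k<n. \<epsilon> k *\<^sub>R x k) powr p)) \<le>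
        ennreal (max 1 K * (\<Sum>k<n. norm (x k) powr p))" .
  qed simp
qed

lemma sqrt_powr: "0 \<le> x \<Longrightarrow> sqrt x powr p = x powr (p / 2)"
  by (cases "x = 0") (auto simp: powr_half_sqrt[symmetric] powr_powr)

lemma gauss_norm_reindex:
  fixes y :: "nat \<Rightarrow> 'e::{banach, second_countable_topology}"
  assumes "inj f"
  shows "(\<integral>\<^sup>+\<gamma>. ennreal (norm (\<Sum>k<n. \<gamma> (f k) *\<^sub>R y k) powr p) \<partial>gauss_space) = gauss_norm p n y"
proof -
  have m: "(\<lambda>\<gamma> k. \<gamma> (f k)) \<in> gauss_space \<rightarrow>\<^sub>M gauss_space"
  proof -
    have "(\<lambda>\<gamma> k. \<gamma> (f k)) \<in> gauss_space \<rightarrow>\<^sub>M Pi\<^sub>M UNIV (\<lambda>_. std_normal_distribution)"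
      by (rule measurable_PiM_single') (auto intro: gauss_component_measurable)
    then show ?thesis by (simp add: gauss_space_def)
  qed
  have m2: "(\<lambda>\<gamma>. ennreal (norm (\<Sum>k<n. \<gamma> k *\<^sub>R y k) powr p)) \<in> borel_measurable gauss_space"
  proof -
    have "(\<lambda>\<gamma>. \<Sum>k<n. \<gamma> k *\<^sub>R y k) \<in> borel_measurable gauss_space"
      by (intro borel_measurable_sum borel_measurable_scaleR borel_measurable_const gauss_component_measurable)
    then show ?thesis by measurable
  qed
  have "gauss_norm p n y = (\<integral>\<^sup>+\<gamma>. ennreal (norm (\<Sum>k<n. \<gamma> k *\<^sub>R y k) powr p) \<partial>distr gauss_space gauss_space (\<lambda>\<gamma> k. \<gamma> (f k)))"
    unfolding gauss_norm_def gauss_reindex[OF assms] ..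
  also have "\<dots> = (\<integral>\<^sup>+\<gamma>. ennreal (norm (\<Sum>k<n. \<gamma> (f k) *\<^sub>R y k) powr p) \<partial>gauss_space)"
    by (subst nn_integral_distr[OF m]) (use m2 in simp_all)
  finally show ?thesis ..
qed

context subordinated_wiener_basis begin

text \<open>As the sets are disjoint, the linear combination of integrands equals the sum over k of
  u(a,k) h k on A a, with squared norm the sum of u(a,k)^2 |h k|^2. The factor |h k|^2 is 1 or 0 and
  records basis vectors that are zero.\<close>

lemma joint_char_indicators:
  fixes Z :: "nat \<Rightarrow> nat \<Rightarrow> 'w \<Rightarrow> real"
  assumes A: "\<And>a. a < n \<Longrightarrow> A a \<in> sets borel" and disj: "disjoint_family_on A {..<n}"
    and Z: "\<And>a k. a < n \<Longrightarrow> k < K \<Longrightarrow> stoch_int (\<lambda>s. indicator (A a) s *\<^sub>R h k) (Z a k)"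
  shows "(\<integral>w. iexp (\<Sum>b\<in>{..<n} \<times> {..<K}. u b * Z (fst b) (snd b) w) \<partial>M) =
    complex_of_real (exp (- (\<Sum>a<n. measure lborel (A a \<inter> {0..T}) * laplace_exp ((\<Sum>k<K. (u (a, k))\<^sup>2 * (norm (h k))\<^sup>2) / 2))))"
proof (rule stoch_int_char)
  define U where "U a = (\<Sum>k<K. (u (a, k))\<^sup>2 * (norm (h k))\<^sup>2)" for a
  define G where "G a = (\<Sum>k<K. u (a, k) *\<^sub>R h k)" for a
  have nG: "(norm (G a))\<^sup>2 = U a" for a unfolding G_def U_def by (rule norm_sum_orthonormal[OF basis])
  have U0: "0 \<le> U a" for a unfolding U_def by (intro sum_nonneg) auto
  let ?g = "\<lambda>s. \<Sum>b\<in>{..<n} \<times> {..<K}. u b *\<^sub>R (indicator (A (fst b)) s *\<^sub>R h (snd b))"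
  show "stoch_int ?g (\<lambda>w. \<Sum>b\<in>{..<n} \<times> {..<K}. u b * Z (fst b) (snd b) w)"
    by (intro stoch_int_sum stoch_int_scale Z) auto
  have g: "?g s = (\<Sum>a<n. indicator (A a) s *\<^sub>R G a)" for s
    unfolding G_def scaleR_sum_right by (simp add: sum.cartesian_product case_prod_beta mult.commute)
  have fin: "emeasure lborel (A a \<inter> {0..T}) \<noteq> \<infinity>" for a
  proof -
    have "emeasure lborel (A a \<inter> {0..T}) \<le> emeasure lborel {0..T}" by (intro emeasure_mono) auto
    then show ?thesis using T_pos by (auto simp: top_unique)
  qed
  have pt: "ennreal (laplace_exp ((norm (?g s))\<^sup>2 / 2)) = (\<Sum>a<n. ennreal (laplace_exp (U a / 2)) * indicator (A a) s)" for s
  proof (cases "\<exists>a<n. s \<in> A a")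
    case True
    then obtain a where a: "a < n" "s \<in> A a" by blast
    have other: "s \<notin> A a'" if "a' < n" "a' \<noteq> a" for a'
      using disj a that unfolding disjoint_family_on_def by blast
    have "(\<Sum>a'<n. indicator (A a') s *\<^sub>R G a') = (\<Sum>a'<n. if a' = a then G a else 0)"
      using a other by (intro sum.cong) (auto simp: indicator_def)
    then have "?g s = G a" unfolding g using a by simp
    moreover have "(\<Sum>a'<n. ennreal (laplace_exp (U a' / 2)) * indicator (A a') s) = (\<Sum>a'<n. if a' = a then ennreal (laplace_exp (U a / 2)) else 0)"
      using a other by (intro sum.cong) (auto simp: indicator_def)
    ultimately show ?thesis using a by (simp add: nG)
  next
    case False
    then have "?g s = 0" unfolding g by (intro sum.neutral) auto
    moreover have "(\<Sum>a<n. ennreal (laplace_exp (U a / 2)) * indicator (A a) s) = 0"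
      using False by (intro sum.neutral) auto
    ultimately show ?thesis by simp
  qed
  have "energy ?g = (\<integral>\<^sup>+s. (\<Sum>a<n. ennreal (laplace_exp (U a / 2)) * indicator (A a \<inter> {0..T}) s) \<partial>lborel)"
    unfolding energy_def nn_integral_time pt
    by (intro nn_integral_cong) (auto simp: indicator_def)
  also have "\<dots> = (\<Sum>a<n. ennreal (laplace_exp (U a / 2)) * emeasure lborel (A a \<inter> {0..T}))"
    using A by (subst nn_integral_sum) (auto simp: nn_integral_cmult_indicator)
  also have "\<dots> = (\<Sum>a<n. ennreal (measure lborel (A a \<inter> {0..T}) * laplace_exp (U a / 2)))"
    using fin U0 by (intro sum.cong refl) (simp add: emeasure_eq_ennreal_measure ennreal_mult laplace_exp_nonneg mult.commute)
  also have "\<dots> = ennreal (\<Sum>a<n. measure lborel (A a \<inter> {0..T}) * laplace_exp (U a / 2))"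
    using U0 by (intro sum_ennreal) (auto intro!: mult_nonneg_nonneg laplace_exp_nonneg)
  finally show "energy ?g = ennreal (\<Sum>a<n. measure lborel (A a \<inter> {0..T}) * laplace_exp ((\<Sum>k<K. (u (a, k))\<^sup>2 * (norm (h k))\<^sup>2) / 2))"
    by (simp add: U_def)
  show "0 \<le> (\<Sum>a<n. measure lborel (A a \<inter> {0..T}) * laplace_exp ((\<Sum>k<K. (u (a, k))\<^sup>2 * (norm (h k))\<^sup>2) / 2))"
    by (intro sum_nonneg mult_nonneg_nonneg laplace_exp_nonneg) (auto intro!: sum_nonneg)
qed

text \<open>Increments of l over consecutive intervals of lengths m 0, m 1, ... laid end to end from
  0. The sets A a of a step function may be arbitrary Borel sets, but the law of the integral
  depends on them only through their measures. Clipping at 0 gives a nonnegative value at every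
  sample point.\<close>

definition time_change :: "(nat \<Rightarrow> real) \<Rightarrow> nat \<Rightarrow> 'w \<Rightarrow> real" where
  "time_change m a w = max 0 (l (\<Sum>b<Suc a. m b) w - l (\<Sum>b<a. m b) w)"

lemma time_change_measurable: "(\<And>b. 0 \<le> m b) \<Longrightarrow> time_change m a \<in> borel_measurable M"
  unfolding time_change_def by (intro borel_measurable_max borel_measurable_const borel_measurable_diff l_meas sum_nonneg)

lemma time_change_nonneg: "0 \<le> time_change m a w"
  by (simp add: time_change_def)

text \<open>Given l, the exponent is Gaussian with a variance in which the signs appear only through
  their squares, so the characteristic function is the same for all sign patterns. The coding of
  pairs selects distinct, hence independent, coordinates.\<close>

lemma joint_char_gauss:
  assumes m: "\<And>b. 0 \<le> m b" and \<epsilon>: "\<And>a. a < n \<Longrightarrow> (\<epsilon> a)\<^sup>2 = 1"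
  shows "(\<integral>z. iexp (\<Sum>b\<in>{..<n} \<times> {..<K}. u b * (\<epsilon> (fst b) * sqrt (time_change m (fst b) (fst z)) * norm (h (snd b)) * snd z (prod_encode b)))
      \<partial>(M \<Otimes>\<^sub>M gauss_space)) =
    complex_of_real (exp (- (\<Sum>a<n. m a * laplace_exp ((\<Sum>k<K. (u (a, k))\<^sup>2 * (norm (h k))\<^sup>2) / 2))))"
proof -
  interpret G: prob_space gauss_space by (rule prob_space_gauss)
  interpret P: pair_prob_space M gauss_space by standard
  define U where "U a = (\<Sum>k<K. (u (a, k))\<^sup>2 * (norm (h k))\<^sup>2)" for a
  have U0: "0 \<le> U a" for a unfolding U_def by (intro sum_nonneg) auto
  note tm[measurable] = time_change_measurable[OF m]
  define f where "f w \<gamma> = iexp (\<Sum>b\<in>{..<n} \<times> {..<K}. u b * (\<epsilon> (fst b) * sqrt (time_change m (fst b) w) * norm (h (snd b)) * \<gamma> (prod_encode b)))"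
    for w and \<gamma> :: "nat \<Rightarrow> real"
  have sm: "(\<lambda>z. snd z k) \<in> borel_measurable (M \<Otimes>\<^sub>M gauss_space)" for k
    by (rule measurable_compose[OF measurable_snd gauss_component_measurable])
  have tm': "(\<lambda>z. sqrt (time_change m a (fst z))) \<in> borel_measurable (M \<Otimes>\<^sub>M gauss_space)" for a
    by (rule measurable_compose[OF measurable_fst]) measurable
  have fm: "(\<lambda>(w, \<gamma>). f w \<gamma>) \<in> borel_measurable (M \<Otimes>\<^sub>M gauss_space)"
    unfolding f_def case_prod_beta
    by (intro measurable_compose[OF _ borel_measurable_exp] borel_measurable_times borel_measurable_const
        measurable_compose[OF _ borel_measurable_of_real] borel_measurable_sum sm tm')
  have fint: "integrable (M \<Otimes>\<^sub>M gauss_space) (\<lambda>(w, \<gamma>). f w \<gamma>)"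
    by (rule P.integrable_const_bound[where B=1, OF _ fm]) (auto simp: f_def)
  have inner: "(\<integral>\<gamma>. f w \<gamma> \<partial>gauss_space) = complex_of_real (exp (- (\<Sum>a<n. U a / 2 * time_change m a w)))" for w
  proof -
    define \<theta> where "\<theta> b = u b * (\<epsilon> (fst b) * sqrt (time_change m (fst b) w) * norm (h (snd b)))" for b
    have "(\<integral>\<gamma>. f w \<gamma> \<partial>gauss_space) = (\<integral>\<gamma>. iexp (\<Sum>b\<in>{..<n} \<times> {..<K}. \<theta> b * \<gamma> (prod_encode b)) \<partial>gauss_space)"
      unfolding f_def \<theta>_def by (simp only: mult.assoc)
    also have "\<dots> = complex_of_real (exp (- (\<Sum>b\<in>{..<n} \<times> {..<K}. (\<theta> b)\<^sup>2) / 2))"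
      by (rule gauss_char) (auto intro: inj_on_subset[OF inj_prod_encode])
    also have "(\<Sum>b\<in>{..<n} \<times> {..<K}. (\<theta> b)\<^sup>2) = (\<Sum>a<n. \<Sum>k<K. (\<theta> (a, k))\<^sup>2)"
      by (simp add: sum.cartesian_product case_prod_beta)
    also have "\<dots> = (\<Sum>a<n. U a * time_change m a w)"
    proof (rule sum.cong)
      fix a assume "a \<in> {..<n}"
      then have e: "(\<epsilon> a)\<^sup>2 = 1" using \<epsilon> by simp
      show "(\<Sum>k<K. (\<theta> (a, k))\<^sup>2) = U a * time_change m a w"
        unfolding U_def \<theta>_def sum_distrib_right
        by (intro sum.cong refl) (simp add: power_mult_distrib e time_change_nonneg)
    qed simp
    also have "- (\<Sum>a<n. U a * time_change m a w) / 2 = - (\<Sum>a<n. U a / 2 * time_change m a w)"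
      by (simp add: sum_divide_distrib)
    finally show ?thesis .
  qed
  define t where "t a = (\<Sum>b<a. m b)" for a
  have t: "0 \<le> t a" "t a \<le> t (Suc a)" for a unfolding t_def using m by (auto intro!: sum_nonneg)
  have "(\<integral>z. iexp (\<Sum>b\<in>{..<n} \<times> {..<K}. u b * (\<epsilon> (fst b) * sqrt (time_change m (fst b) (fst z)) * norm (h (snd b)) * snd z (prod_encode b)))
      \<partial>(M \<Otimes>\<^sub>M gauss_space)) = (\<integral>z. (case z of (w, \<gamma>) \<Rightarrow> f w \<gamma>) \<partial>(M \<Otimes>\<^sub>M gauss_space))"
    by (simp add: f_def case_prod_beta)
  also have "\<dots> = (\<integral>w. (\<integral>\<gamma>. f w \<gamma> \<partial>gauss_space) \<partial>M)" by (rule P.integral_fst[OF fint, symmetric])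
  also have "\<dots> = complex_of_real (\<integral>w. exp (- (\<Sum>a<n. U a / 2 * time_change m a w)) \<partial>M)"
    unfolding inner by simp
  also have "(\<integral>w. exp (- (\<Sum>a<n. U a / 2 * time_change m a w)) \<partial>M) = (\<integral>w. exp (- (\<Sum>a<n. U a / 2 * (l (t (Suc a)) w - l (t a) w))) \<partial>M)"
  proof (rule integral_cong_AE)
    have [measurable]: "l (t a) \<in> borel_measurable M" for a using t by (intro l_meas)
    show "(\<lambda>w. exp (- (\<Sum>a<n. U a / 2 * (l (t (Suc a)) w - l (t a) w)))) \<in> borel_measurable M" by measurable
    show "AE w in M. exp (- (\<Sum>a<n. U a / 2 * time_change m a w)) = exp (- (\<Sum>a<n. U a / 2 * (l (t (Suc a)) w - l (t a) w)))"
      using AE_l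
    proof eventually_elim
      case (elim w)
      have "time_change m a w = l (t (Suc a)) w - l (t a) w" for a
        using elim t(1)[of a] t(2)[of a] by (simp add: time_change_def t_def)
      then show ?case by simp
    qed
  qed measurable
  also have "\<dots> = exp (- (\<Sum>a<n. (t (Suc a) - t a) * laplace_exp (U a / 2)))"
    using t U0 by (intro l_increments_laplace) auto
  also have "(\<Sum>a<n. (t (Suc a) - t a) * laplace_exp (U a / 2)) = (\<Sum>a<n. m a * laplace_exp (U a / 2))"
    by (simp add: t_def)
  finally show ?thesis by (simp add: U_def)
qed

text \<open>Equal joint characteristic functions give equal joint laws of the finitely many scalar
  integrals, hence of every measurable function of them. The right-hand side is a conditionally
  Gaussian model on a product space.\<close>

lemma law_matching:
  fixes Z :: "nat \<Rightarrow> nat \<Rightarrow> 'w \<Rightarrow> real" and q :: "nat \<Rightarrow> nat \<Rightarrow> 'e::{banach, second_countable_topology}"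
  assumes A: "\<And>a. a < n \<Longrightarrow> A a \<in> sets borel" and disj: "disjoint_family_on A {..<n}"
    and Z: "\<And>a k. a < n \<Longrightarrow> k < K \<Longrightarrow> stoch_int (\<lambda>s. indicator (A a) s *\<^sub>R h k) (Z a k)"
    and mask: "\<And>a k. h k = 0 \<Longrightarrow> q a k = 0"
    and \<epsilon>: "\<And>a. a < n \<Longrightarrow> (\<epsilon> a)\<^sup>2 = 1"
    and F[measurable]: "F \<in> borel_measurable borel"
  defines "m \<equiv> \<lambda>a. measure lborel (A a \<inter> {0..T})"
  shows "(\<integral>\<^sup>+w. F (\<Sum>a<n. \<Sum>k<K. Z a k w *\<^sub>R q a k) \<partial>M) =
    (\<integral>\<^sup>+z. F (\<Sum>a<n. \<epsilon> a *\<^sub>R (sqrt (time_change m a (fst z)) *\<^sub>R (\<Sum>k<K. snd z (prod_encode (a, k)) *\<^sub>R q a k))) \<partial>(M \<Otimes>\<^sub>M gauss_space))"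
proof -
  interpret G: prob_space gauss_space by (rule prob_space_gauss)
  interpret P: pair_prob_space M gauss_space by standard
  let ?B = "{..<n} \<times> {..<K}"
  let ?N = "Pi\<^sub>M ?B (\<lambda>_. borel) :: (nat \<times> nat \<Rightarrow> real) measure"
  let ?Q = "M \<Otimes>\<^sub>M gauss_space"
  have m0: "0 \<le> m b" for b by (simp add: m_def)
  define X where "X b w = Z (fst b) (snd b) w" for b w
  define Y where "Y b z = \<epsilon> (fst b) * sqrt (time_change m (fst b) (fst z)) * norm (h (snd b)) * snd z (prod_encode b)" for b and z :: "'w \<times> (nat \<Rightarrow> real)"
  have Xm: "X b \<in> borel_measurable M" if "b \<in> ?B" for b
    unfolding X_def[abs_def] using that by (intro stoch_int_measurable[OF Z]) auto
  have Ym: "Y b \<in> borel_measurable ?Q" for b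
    unfolding Y_def[abs_def]
    by (intro borel_measurable_times borel_measurable_const measurable_compose[OF measurable_snd gauss_component_measurable]
        measurable_compose[OF _ borel_measurable_sqrt] measurable_compose[OF measurable_fst time_change_measurable[OF m0]])
  have law: "distr M ?N (\<lambda>w. \<lambda>b\<in>?B. X b w) = distr ?Q ?N (\<lambda>z. \<lambda>b\<in>?B. Y b z)"
  proof (rule multivariate_char_unique)
    show "prob_space M" "prob_space ?Q" by (rule prob_space_axioms, rule P.prob_space_axioms)
    fix u :: "nat \<times> nat \<Rightarrow> real"
    have "(\<integral>w. iexp (\<Sum>b\<in>?B. u b * X b w) \<partial>M) =
        complex_of_real (exp (- (\<Sum>a<n. m a * laplace_exp ((\<Sum>k<K. (u (a, k))\<^sup>2 * (norm (h k))\<^sup>2) / 2))))"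
      unfolding X_def m_def by (rule joint_char_indicators[OF A disj Z])
    also have "\<dots> = (\<integral>z. iexp (\<Sum>b\<in>?B. u b * Y b z) \<partial>?Q)"
      unfolding Y_def by (rule joint_char_gauss[OF m0 \<epsilon>, symmetric])
    finally show "(\<integral>w. iexp (\<Sum>b\<in>?B. u b * X b w) \<partial>M) = (\<integral>z. iexp (\<Sum>b\<in>?B. u b * Y b z) \<partial>?Q)" .
  qed (use Xm Ym in auto)
  define H where "H x = F (\<Sum>b\<in>?B. x b *\<^sub>R q (fst b) (snd b))" for x
  have Hm: "H \<in> borel_measurable ?N"
    unfolding H_def
    by (intro measurable_compose[OF _ F] borel_measurable_sum borel_measurable_scaleR borel_measurable_const measurable_component_singleton)
  have mX: "(\<lambda>w. \<lambda>b\<in>?B. X b w) \<in> M \<rightarrow>\<^sub>M ?N" using Xm by (intro measurable_restrict)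
  have mY: "(\<lambda>z. \<lambda>b\<in>?B. Y b z) \<in> ?Q \<rightarrow>\<^sub>M ?N" using Ym by (intro measurable_restrict)
  have "(\<integral>\<^sup>+w. F (\<Sum>a<n. \<Sum>k<K. Z a k w *\<^sub>R q a k) \<partial>M) = (\<integral>\<^sup>+w. H (\<lambda>b\<in>?B. X b w) \<partial>M)"
    by (simp add: H_def X_def sum.cartesian_product case_prod_beta)
  also have "\<dots> = (\<integral>\<^sup>+x. H x \<partial>distr M ?N (\<lambda>w. \<lambda>b\<in>?B. X b w))" by (subst nn_integral_distr[OF mX]) (use Hm in simp_all)
  also have "\<dots> = (\<integral>\<^sup>+z. H (\<lambda>b\<in>?B. Y b z) \<partial>?Q)" unfolding law by (subst nn_integral_distr[OF mY]) (use Hm in simp_all)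
  also have "\<dots> = (\<integral>\<^sup>+z. F (\<Sum>a<n. \<epsilon> a *\<^sub>R (sqrt (time_change m a (fst z)) *\<^sub>R (\<Sum>k<K. snd z (prod_encode (a, k)) *\<^sub>R q a k))) \<partial>?Q)"
  proof (rule nn_integral_cong)
    fix z :: "'w \<times> (nat \<Rightarrow> real)"
    have nq: "norm (h k) *\<^sub>R q a k = q a k" for a k
      using basis mask[of k a] by (cases "h k = 0") (auto simp: orthonormal_basis_def)
    have "(\<Sum>b\<in>?B. Y b z *\<^sub>R q (fst b) (snd b)) = (\<Sum>a<n. \<Sum>k<K. Y (a, k) z *\<^sub>R q a k)"
      by (simp add: sum.cartesian_product case_prod_beta)
    also have "\<dots> = (\<Sum>a<n. \<epsilon> a *\<^sub>R (sqrt (time_change m a (fst z)) *\<^sub>R (\<Sum>k<K. snd z (prod_encode (a, k)) *\<^sub>R q a k)))"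
    proof (intro sum.cong refl)
      fix a
      have "Y (a, k) z *\<^sub>R q a k = \<epsilon> a *\<^sub>R (sqrt (time_change m a (fst z)) *\<^sub>R (snd z (prod_encode (a, k)) *\<^sub>R q a k))" for k
      proof -
        have "Y (a, k) z *\<^sub>R q a k = (\<epsilon> a * sqrt (time_change m a (fst z)) * snd z (prod_encode (a, k))) *\<^sub>R (norm (h k) *\<^sub>R q a k)"
          by (simp add: Y_def mult_ac)
        then show ?thesis unfolding nq by (simp add: mult_ac)
      qed
      then show "(\<Sum>k<K. Y (a, k) z *\<^sub>R q a k) = \<epsilon> a *\<^sub>R (sqrt (time_change m a (fst z)) *\<^sub>R (\<Sum>k<K. snd z (prod_encode (a, k)) *\<^sub>R q a k))"
        by (simp only: scaleR_sum_right)
    qed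
    finally show "H (\<lambda>b\<in>?B. Y b z) = F (\<Sum>a<n. \<epsilon> a *\<^sub>R (sqrt (time_change m a (fst z)) *\<^sub>R (\<Sum>k<K. snd z (prod_encode (a, k)) *\<^sub>R q a k)))"
      by (simp add: H_def)
  qed
  finally show ?thesis .
qed

text \<open>Each sign pattern gives the same truncated moment, so this moment equals its average
  over all patterns. For a fixed point of the model the average is over signs in front of fixed
  vectors, which is where the type inequality applies; the truncation is moved outside the average
  by concavity.\<close>

lemma simple_integral_estimate:
  assumes type: "rademacher_type TYPE('e::{banach, second_countable_topology}) p" and p: "1 \<le> p" "p \<le> 2"
  obtains B :: real where "0 < B" "\<And>n K A Z (q :: nat \<Rightarrow> nat \<Rightarrow> 'e).
    (\<And>a. a < n \<Longrightarrow> A a \<in> sets borel) \<Longrightarrow> disjoint_family_on A {..<n} \<Longrightarrow>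
    (\<And>a k. a < n \<Longrightarrow> k < K \<Longrightarrow> stoch_int (\<lambda>s. indicator (A a) s *\<^sub>R h k) (Z a k)) \<Longrightarrow>
    (\<And>a k. h k = 0 \<Longrightarrow> q a k = 0) \<Longrightarrow>
    (\<integral>\<^sup>+w. min 1 (ennreal (norm (\<Sum>a<n. \<Sum>k<K. Z a k w *\<^sub>R q a k) powr p)) \<partial>M) \<le>
    ennreal B * (\<Sum>a<n. ennreal (measure lborel (A a \<inter> {0..T})) *
      (\<integral>\<^sup>+r. min 1 (ennreal (\<bar>r\<bar> powr (p / 2)) * gauss_norm p K (q a)) \<partial>\<rho>))"
proof -
  have p2: "0 < p / 2" "p / 2 \<le> 1" using p by auto
  obtain C0 where C0: "0 < C0" "\<And>a b c. 0 \<le> a \<Longrightarrow> a \<le> b \<Longrightarrow> 0 \<le> c \<Longrightarrow>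
    (\<integral>\<^sup>+w. min 1 (ennreal (c * (max 0 (l b w - l a w)) powr (p / 2))) \<partial>M) \<le>
      ennreal (C0 * (b - a)) * (\<integral>\<^sup>+r. min 1 (ennreal (c * \<bar>r\<bar> powr (p / 2))) \<partial>\<rho>)"
    by (rule l_increment_moment[OF p2]) (rule that; assumption)
  obtain Kt where Kt: "1 \<le> Kt" "\<And>n (x :: nat \<Rightarrow> 'e).
    (\<Sum>\<epsilon>\<in>set_pmf (Pi_pmf {..<n} 0 (\<lambda>_. pmf_of_set {-1, 1})). ennreal (pmf (Pi_pmf {..<n} 0 (\<lambda>_. pmf_of_set {-1, 1})) \<epsilon>) *
      ennreal (norm (\<Sum>k<n. \<epsilon> k *\<^sub>R x k) powr p)) \<le> ennreal (Kt * (\<Sum>k<n. norm (x k) powr p))"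
    by (rule type_expectation_le[OF type]) (rule that; assumption)
  interpret G: prob_space gauss_space by (rule prob_space_gauss)
  interpret R: sigma_finite_measure \<rho> by (rule sigma_finite_rho)
  interpret P: pair_prob_space M gauss_space by standard
  interpret PR: pair_sigma_finite gauss_space \<rho> by standard
  let ?Q = "M \<Otimes>\<^sub>M gauss_space"
  show thesis
  proof (rule that[of "C0 * Kt"])
    show "0 < C0 * Kt" using C0 Kt by simp
    fix n K :: nat and A Z and q :: "nat \<Rightarrow> nat \<Rightarrow> 'e"
    assume A: "\<And>a. a < n \<Longrightarrow> A a \<in> sets borel" and disj: "disjoint_family_on A {..<n}"
      and Z: "\<And>a k. a < n \<Longrightarrow> k < K \<Longrightarrow> stoch_int (\<lambda>s. indicator (A a) s *\<^sub>R h k) (Z a k)"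
      and mask: "\<And>a k. h k = 0 \<Longrightarrow> q a k = 0"
    define m where "m a = measure lborel (A a \<inter> {0..T})" for a
    have m0: "0 \<le> m a" for a by (simp add: m_def)
    define F where "F x = min 1 (ennreal (norm x powr p))" for x :: 'e
    have Fm: "F \<in> borel_measurable borel" unfolding F_def by measurable
    define I where "I = (\<integral>\<^sup>+w. F (\<Sum>a<n. \<Sum>k<K. Z a k w *\<^sub>R q a k) \<partial>M)"
    define g where "g a \<gamma> = (\<Sum>k<K. \<gamma> (prod_encode (a, k)) *\<^sub>R q a k)" for a and \<gamma> :: "nat \<Rightarrow> real"
    have gm: "g a \<in> borel_measurable gauss_space" for a
      unfolding g_def by (intro borel_measurable_sum borel_measurable_scaleR borel_measurable_const gauss_component_measurable)
    define x where "x z a = sqrt (time_change m a (fst z)) *\<^sub>R g a (snd z)" for a and z :: "'w \<times> (nat \<Rightarrow> real)"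
    have xm: "(\<lambda>z. x z a) \<in> borel_measurable ?Q" for a
      unfolding x_def
      by (intro borel_measurable_scaleR measurable_compose[OF _ borel_measurable_sqrt] measurable_compose[OF measurable_fst time_change_measurable[OF m0]]
          measurable_compose[OF measurable_snd gm])
    let ?D = "Pi_pmf {..<n} 0 (\<lambda>_. pmf_of_set {-1, 1 :: real})"
    have finD: "finite (set_pmf ?D)" by (simp add: set_Pi_pmf finite_PiE_dflt)
    have sumD: "(\<Sum>\<epsilon>\<in>set_pmf ?D. ennreal (pmf ?D \<epsilon>)) = 1"
      using finD by (subst sum_ennreal) (auto simp: sum_pmf_eq_1)
    have I_eq: "I = (\<integral>\<^sup>+z. F (\<Sum>a<n. \<epsilon> a *\<^sub>R x z a) \<partial>?Q)" if "\<epsilon> \<in> set_pmf ?D" for \<epsilon>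
    proof -
      have "(\<epsilon> a)\<^sup>2 = 1" if "a < n" for a
        using \<open>\<epsilon> \<in> set_pmf ?D\<close> that by (auto simp: set_Pi_pmf PiE_dflt_def)
      from law_matching[OF A disj Z mask this Fm] show ?thesis
        unfolding I_def x_def g_def m_def by simp
    qed
    have FM: "(\<lambda>z. F (\<Sum>a<n. \<epsilon> a *\<^sub>R x z a)) \<in> borel_measurable ?Q" for \<epsilon>
      by (intro measurable_compose[OF _ Fm] borel_measurable_sum borel_measurable_scaleR borel_measurable_const xm)
    \<comment> \<open>The same number I is written once for each sign pattern and averaged with the
      Rademacher weights.\<close>
    have "I = (\<Sum>\<epsilon>\<in>set_pmf ?D. ennreal (pmf ?D \<epsilon>)) * I" by (simp add: sumD)
    also have "\<dots> = (\<Sum>\<epsilon>\<in>set_pmf ?D. ennreal (pmf ?D \<epsilon>) * (\<integral>\<^sup>+z. F (\<Sum>a<n. \<epsilon> a *\<^sub>R x z a) \<partial>?Q))"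
      unfolding sum_distrib_right by (intro sum.cong refl) (simp add: I_eq[symmetric])
    also have "\<dots> = (\<Sum>\<epsilon>\<in>set_pmf ?D. (\<integral>\<^sup>+z. ennreal (pmf ?D \<epsilon>) * F (\<Sum>a<n. \<epsilon> a *\<^sub>R x z a) \<partial>?Q))"
      by (intro sum.cong refl nn_integral_cmult[symmetric] measurable_compose[OF _ Fm] borel_measurable_sum borel_measurable_scaleR borel_measurable_const xm)
    also have "\<dots> = (\<integral>\<^sup>+z. (\<Sum>\<epsilon>\<in>set_pmf ?D. ennreal (pmf ?D \<epsilon>) * F (\<Sum>a<n. \<epsilon> a *\<^sub>R x z a)) \<partial>?Q)"
      using FM by (intro nn_integral_sum[symmetric]) measurable
    also have "\<dots> \<le> (\<integral>\<^sup>+z. (\<Sum>a<n. min 1 (ennreal (Kt * norm (g a (snd z)) powr p * time_change m a (fst z) powr (p / 2)))) \<partial>?Q)"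
    proof (rule nn_integral_mono)
      fix z
      have "(\<Sum>\<epsilon>\<in>set_pmf ?D. ennreal (pmf ?D \<epsilon>) * F (\<Sum>a<n. \<epsilon> a *\<^sub>R x z a)) \<le>
          min 1 (\<Sum>\<epsilon>\<in>set_pmf ?D. ennreal (pmf ?D \<epsilon>) * ennreal (norm (\<Sum>a<n. \<epsilon> a *\<^sub>R x z a) powr p))"
        unfolding F_def by (rule min_one_weighted_sum[OF sumD])
      also have "\<dots> \<le> min 1 (ennreal (Kt * (\<Sum>a<n. norm (x z a) powr p)))"
        by (intro min.mono order_refl Kt(2))
      also have "ennreal (Kt * (\<Sum>a<n. norm (x z a) powr p)) = (\<Sum>a<n. ennreal (Kt * norm (x z a) powr p))"
        using Kt(1) by (subst sum_ennreal) (auto simp: sum_distrib_left)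
      also have "min 1 \<dots> \<le> (\<Sum>a<n. min 1 (ennreal (Kt * norm (x z a) powr p)))" by (rule min_one_sum_le) simp
      also have "\<dots> = (\<Sum>a<n. min 1 (ennreal (Kt * norm (g a (snd z)) powr p * time_change m a (fst z) powr (p / 2))))"
        by (intro sum.cong refl) (simp add: x_def powr_mult sqrt_powr time_change_nonneg mult_ac)
      finally show "(\<Sum>\<epsilon>\<in>set_pmf ?D. ennreal (pmf ?D \<epsilon>) * F (\<Sum>a<n. \<epsilon> a *\<^sub>R x z a)) \<le>
          (\<Sum>a<n. min 1 (ennreal (Kt * norm (g a (snd z)) powr p * time_change m a (fst z) powr (p / 2))))" .
    qed
    also have "\<dots> = (\<Sum>a<n. (\<integral>\<^sup>+z. min 1 (ennreal (Kt * norm (g a (snd z)) powr p * time_change m a (fst z) powr (p / 2))) \<partial>?Q))"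
    proof (rule nn_integral_sum)
      fix a
      have [measurable]: "(\<lambda>z. g a (snd z)) \<in> borel_measurable ?Q" "(\<lambda>z. time_change m a (fst z)) \<in> borel_measurable ?Q"
        by (rule measurable_compose[OF measurable_snd gm], rule measurable_compose[OF measurable_fst time_change_measurable[OF m0]])
      show "(\<lambda>z. min 1 (ennreal (Kt * norm (g a (snd z)) powr p * time_change m a (fst z) powr (p / 2)))) \<in> borel_measurable ?Q"
        by measurable
    qed
    also have "\<dots> \<le> (\<Sum>a<n. ennreal (C0 * m a) * (ennreal Kt * (\<integral>\<^sup>+r. min 1 (ennreal (\<bar>r\<bar> powr (p / 2)) * gauss_norm p K (q a)) \<partial>\<rho>)))"
    proof (rule sum_mono)
      fix a
      have [measurable]: "(\<lambda>z. g a (snd z)) \<in> borel_measurable ?Q" "(\<lambda>z. time_change m a (fst z)) \<in> borel_measurable ?Q"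
        by (rule measurable_compose[OF measurable_snd gm], rule measurable_compose[OF measurable_fst time_change_measurable[OF m0]])
      have [measurable]: "g a \<in> borel_measurable gauss_space" by (rule gm)
      have [measurable]: "(\<lambda>z. g a (fst z)) \<in> borel_measurable (gauss_space \<Otimes>\<^sub>M \<rho>)"
        by (rule measurable_compose[OF measurable_fst gm])
      \<comment> \<open>The increment of l is integrated first, with the Gaussian vector frozen
        inside the constant c of \<open>l_increment_moment\<close>; the Gaussian average follows
        after the passage to \<open>\<rho>\<close>, where it moves inside the truncation.\<close>
      have "(\<integral>\<^sup>+z. min 1 (ennreal (Kt * norm (g a (snd z)) powr p * time_change m a (fst z) powr (p / 2))) \<partial>?Q) =
          (\<integral>\<^sup>+\<gamma>. (\<integral>\<^sup>+w. min 1 (ennreal (Kt * norm (g a \<gamma>) powr p * time_change m a w powr (p / 2))) \<partial>M) \<partial>gauss_space)"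
        by (subst P.nn_integral_snd[symmetric]) (auto simp: case_prod_beta)
      also have "\<dots> \<le> (\<integral>\<^sup>+\<gamma>. ennreal (C0 * m a) * (\<integral>\<^sup>+r. min 1 (ennreal (Kt * norm (g a \<gamma>) powr p * \<bar>r\<bar> powr (p / 2))) \<partial>\<rho>) \<partial>gauss_space)"
      proof (rule nn_integral_mono)
        fix \<gamma>
        show "(\<integral>\<^sup>+w. min 1 (ennreal (Kt * norm (g a \<gamma>) powr p * time_change m a w powr (p / 2))) \<partial>M) \<le>
            ennreal (C0 * m a) * (\<integral>\<^sup>+r. min 1 (ennreal (Kt * norm (g a \<gamma>) powr p * \<bar>r\<bar> powr (p / 2))) \<partial>\<rho>)"
          using C0(2)[of "\<Sum>b<a. m b" "\<Sum>b<Suc a. m b" "Kt * norm (g a \<gamma>) powr p"] m0 Kt(1)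
          by (simp add: time_change_def sum_nonneg)
      qed
      also have "\<dots> = ennreal (C0 * m a) * (\<integral>\<^sup>+\<gamma>. (\<integral>\<^sup>+r. min 1 (ennreal (Kt * norm (g a \<gamma>) powr p * \<bar>r\<bar> powr (p / 2))) \<partial>\<rho>) \<partial>gauss_space)"
        by (rule nn_integral_cmult) measurable
      also have "(\<integral>\<^sup>+\<gamma>. (\<integral>\<^sup>+r. min 1 (ennreal (Kt * norm (g a \<gamma>) powr p * \<bar>r\<bar> powr (p / 2))) \<partial>\<rho>) \<partial>gauss_space) =
          (\<integral>\<^sup>+r. (\<integral>\<^sup>+\<gamma>. min 1 (ennreal (Kt * norm (g a \<gamma>) powr p * \<bar>r\<bar> powr (p / 2))) \<partial>gauss_space) \<partial>\<rho>)"
        by (rule PR.Fubini'[symmetric]) measurable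
      also have "\<dots> \<le> (\<integral>\<^sup>+r. ennreal Kt * min 1 (ennreal (\<bar>r\<bar> powr (p / 2)) * gauss_norm p K (q a)) \<partial>\<rho>)"
      proof (rule nn_integral_mono)
        fix r
        \<comment> \<open>Each block of coordinates indexed by a has the same law, which removes the
          coding from the Gaussian norm.\<close>
        have inj: "inj (\<lambda>k. prod_encode (a, k))" by (auto simp: inj_on_def)
        have "(\<integral>\<^sup>+\<gamma>. min 1 (ennreal (Kt * norm (g a \<gamma>) powr p * \<bar>r\<bar> powr (p / 2))) \<partial>gauss_space) \<le>
            min 1 (ennreal Kt * (ennreal (\<bar>r\<bar> powr (p / 2)) * gauss_norm p K (q a)))"
        proof (rule min.boundedI)
          have "(\<integral>\<^sup>+\<gamma>. min 1 (ennreal (Kt * norm (g a \<gamma>) powr p * \<bar>r\<bar> powr (p / 2))) \<partial>gauss_space) \<le> (\<integral>\<^sup>+\<gamma>. 1 \<partial>gauss_space)"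
            by (intro nn_integral_mono) simp
          then show "(\<integral>\<^sup>+\<gamma>. min 1 (ennreal (Kt * norm (g a \<gamma>) powr p * \<bar>r\<bar> powr (p / 2))) \<partial>gauss_space) \<le> 1"
            using G.emeasure_space_1 by simp
          have "(\<integral>\<^sup>+\<gamma>. min 1 (ennreal (Kt * norm (g a \<gamma>) powr p * \<bar>r\<bar> powr (p / 2))) \<partial>gauss_space) \<le>
              (\<integral>\<^sup>+\<gamma>. (ennreal Kt * ennreal (\<bar>r\<bar> powr (p / 2))) * ennreal (norm (g a \<gamma>) powr p) \<partial>gauss_space)"
            using Kt(1) by (intro nn_integral_mono min.coboundedI2) (simp add: mult_ac flip: ennreal_mult)
          also have "\<dots> = (ennreal Kt * ennreal (\<bar>r\<bar> powr (p / 2))) * (\<integral>\<^sup>+\<gamma>. ennreal (norm (g a \<gamma>) powr p) \<partial>gauss_space)"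
            by (rule nn_integral_cmult) measurable
          also have "(\<integral>\<^sup>+\<gamma>. ennreal (norm (g a \<gamma>) powr p) \<partial>gauss_space) = gauss_norm p K (q a)"
            unfolding g_def by (rule gauss_norm_reindex[OF inj])
          finally show "(\<integral>\<^sup>+\<gamma>. min 1 (ennreal (Kt * norm (g a \<gamma>) powr p * \<bar>r\<bar> powr (p / 2))) \<partial>gauss_space) \<le>
              ennreal Kt * (ennreal (\<bar>r\<bar> powr (p / 2)) * gauss_norm p K (q a))" by (simp add: mult.assoc)
        qed
        also have "\<dots> \<le> ennreal Kt * min 1 (ennreal (\<bar>r\<bar> powr (p / 2)) * gauss_norm p K (q a))"
          using Kt(1) by (intro min_one_mult_le) (simp add: ennreal_ge_1)
        finally show "(\<integral>\<^sup>+\<gamma>. min 1 (ennreal (Kt * norm (g a \<gamma>) powr p * \<bar>r\<bar> powr (p / 2))) \<partial>gauss_space) \<le>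
            ennreal Kt * min 1 (ennreal (\<bar>r\<bar> powr (p / 2)) * gauss_norm p K (q a))" .
      qed
      also have "\<dots> = ennreal Kt * (\<integral>\<^sup>+r. min 1 (ennreal (\<bar>r\<bar> powr (p / 2)) * gauss_norm p K (q a)) \<partial>\<rho>)"
        by (rule nn_integral_cmult) measurable
      finally show "(\<integral>\<^sup>+z. min 1 (ennreal (Kt * norm (g a (snd z)) powr p * time_change m a (fst z) powr (p / 2))) \<partial>?Q) \<le>
          ennreal (C0 * m a) * (ennreal Kt * (\<integral>\<^sup>+r. min 1 (ennreal (\<bar>r\<bar> powr (p / 2)) * gauss_norm p K (q a)) \<partial>\<rho>))"
        by (simp add: mult_left_mono)
    qed
    also have "\<dots> = ennreal (C0 * Kt) * (\<Sum>a<n. ennreal (m a) * (\<integral>\<^sup>+r. min 1 (ennreal (\<bar>r\<bar> powr (p / 2)) * gauss_norm p K (q a)) \<partial>\<rho>))"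
      unfolding sum_distrib_left using C0(1) Kt(1) m0 by (intro sum.cong refl) (simp add: ennreal_mult mult_ac)
    finally show "(\<integral>\<^sup>+w. min 1 (ennreal (norm (\<Sum>a<n. \<Sum>k<K. Z a k w *\<^sub>R q a k) powr p)) \<partial>M) \<le>
      ennreal (C0 * Kt) * (\<Sum>a<n. ennreal (measure lborel (A a \<inter> {0..T})) *
        (\<integral>\<^sup>+r. min 1 (ennreal (\<bar>r\<bar> powr (p / 2)) * gauss_norm p K (q a)) \<partial>\<rho>))"
      by (simp add: I_def F_def m_def)
  qed
qed

end

subsection \<open>Limits of step integrals\<close>

text \<open>The constant 4 = 2^2 serves all exponents up to 2 at once.\<close>

lemma powr_add_le:
  fixes a b :: real
  assumes "0 \<le> a" "0 \<le> b" "0 \<le> p" "p \<le> 2"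
  shows "(a + b) powr p \<le> 4 * (a powr p + b powr p)"
proof -
  have "(a + b) powr p \<le> (2 * max a b) powr p" using assms by (intro powr_mono2) auto
  also have "\<dots> = 2 powr p * max a b powr p" using assms by (simp add: powr_mult)
  also have "\<dots> \<le> 4 * (a powr p + b powr p)"
  proof (rule mult_mono)
    have "(2::real) powr p \<le> 2 powr 2" using assms by (intro powr_mono) auto
    then show "(2::real) powr p \<le> 4" by simp
    show "max a b powr p \<le> a powr p + b powr p" by (cases "a \<le> b") (auto simp: max_def)
  qed auto
  finally show ?thesis .
qed

lemma min_one_four_add_le: "min 1 (c * (4 * (x + y))) \<le> 4 * (min 1 (c * x) + min 1 (c * y :: ennreal))"
proof -
  have "min 1 (c * (4 * (x + y))) = min 1 (4 * (c * x + c * y))" by (simp add: distrib_left mult.left_commute)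
  also have "\<dots> \<le> 4 * min 1 (c * x + c * y)" by (rule min_one_mult_le) simp
  also have "min 1 (c * x + c * y) \<le> min 1 (c * x) + min 1 (c * y)"
    using min_one_sum_le[of "UNIV :: bool set" "\<lambda>b. if b then c * x else c * y"] by (simp add: UNIV_bool add.commute)
  finally show ?thesis by (simp add: mult_left_mono)
qed

text \<open>For p <= 2 the truncated p-th moment dominates the truncated second moment, which in
  turn dominates the square of \<open>L0norm\<close>; so the moment estimates yield Cauchy sequences
  in probability.\<close>

lemma min_one_square_le_powr:
  assumes "0 \<le> x" "1 \<le> p" "p \<le> 2" shows "ennreal ((min 1 x)\<^sup>2) \<le> min 1 (ennreal (x powr p))"
proof (cases "x \<le> 1")
  case True
  have "x\<^sup>2 \<le> x powr p"
  proof (cases "x = 0")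
    case False
    then have "x powr 2 \<le> x powr p" using assms True by (intro powr_mono') auto
    then show ?thesis using assms False by simp
  qed simp
  moreover have "x\<^sup>2 \<le> 1" using True assms by (simp add: power_le_one)
  ultimately show ?thesis using True by (simp add: min_absorb2 ennreal_leI)
next
  case False
  then have "1 \<le> x powr p" using assms by (intro ge_one_powr_ge_zero) auto
  then show ?thesis using False by (simp add: min_absorb1 ennreal_ge_1)
qed

text \<open>With y = d^2 r the left side is at most min 1 y, and lowering the exponent from 1 to p/2
  increases the truncated power. This turns p-th power errors into energy errors.\<close>

lemma one_minus_exp_le_powr:
  assumes r: "0 < r" and d: "0 \<le> d" and p: "1 \<le> p" "p \<le> 2"
  shows "ennreal (1 - exp (- (d\<^sup>2 / 2) * r)) \<le> min 1 (ennreal (\<bar>r\<bar> powr (p / 2)) * ennreal (d powr p))"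
proof (rule min.boundedI)
  show "ennreal (1 - exp (- (d\<^sup>2 / 2) * r)) \<le> 1" by simp
  have dp: "(d\<^sup>2) powr (p / 2) = d powr p"
    using d by (cases "d = 0") (auto simp: powr_powr simp flip: powr_numeral)
  have e: "ennreal (\<bar>r\<bar> powr (p / 2)) * ennreal (d powr p) = ennreal ((d\<^sup>2 * r) powr (p / 2))"
    using r d by (simp add: powr_mult dp mult.commute flip: ennreal_mult)
  have "1 - exp (- (d\<^sup>2 / 2) * r) \<le> (d\<^sup>2 * r) powr (p / 2)"
  proof (cases "d\<^sup>2 * r \<le> 1")
    case True
    have "1 - exp (- (d\<^sup>2 / 2) * r) \<le> d\<^sup>2 / 2 * r" using exp_ge_add_one_self[of "- (d\<^sup>2 / 2) * r"] by simp
    also have "\<dots> \<le> d\<^sup>2 * r" using r by simp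
    also have "\<dots> \<le> (d\<^sup>2 * r) powr (p / 2)"
    proof (cases "d = 0")
      case False
      then have "(d\<^sup>2 * r) powr 1 \<le> (d\<^sup>2 * r) powr (p / 2)" using True r p by (intro powr_mono') auto
      then show ?thesis using r by simp
    qed simp
    finally show ?thesis .
  next
    case False
    then have "1 \<le> (d\<^sup>2 * r) powr (p / 2)" using p by (intro ge_one_powr_ge_zero) auto
    moreover have "1 - exp (- (d\<^sup>2 / 2) * r) \<le> 1" by simp
    ultimately show ?thesis by linarith
  qed
  then show "ennreal (1 - exp (- (d\<^sup>2 / 2) * r)) \<le> ennreal (\<bar>r\<bar> powr (p / 2)) * ennreal (d powr p)"
    unfolding e by (rule ennreal_leI)
qed

context subordinated_wiener_basis begin

lemma stoch_int_cong:
  assumes Z: "stoch_int g Z" and eq: "\<And>s. s \<in> {0..T} \<Longrightarrow> g s = g' s"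
  shows "stoch_int g' Z"
proof (rule stoch_int_AE_fun[OF Z])
  show "wmeas g'"
  proof (rule wmeasI)
    fix x
    show "(\<lambda>s. inner (g' s) x) \<in> borel_measurable time_measure"
      using wmeas_inner[OF stoch_int_wmeas[OF Z], of x] by (rule measurable_cong[THEN iffD1, rotated]) (simp add: eq)
  qed
  show "AE s in time_measure. g s = g' s" by (rule AE_I2) (simp add: eq)
qed

lemma sigma_finite_time: "sigma_finite_measure time_measure"
proof -
  have "finite_measure time_measure" by (rule finite_measureI) (simp add: emeasure_time)
  then show ?thesis by (rule finite_measure.axioms)
qed

text \<open>A step function is encoded by a measurable index map \<open>\<kappa>\<close> into a list
  of coefficient sequences; its level sets are the sets A a. Rewriting the sum over level sets as a
  time integral puts the bound in a form that can be estimated for each s separately.\<close>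

lemma elementary_integral:
  assumes type: "rademacher_type TYPE('e::{banach, second_countable_topology}) p" and p: "1 \<le> p" "p \<le> 2"
  obtains B :: real where "0 < B" "\<And>\<kappa> N K (q :: nat \<Rightarrow> nat \<Rightarrow> 'e).
    \<kappa> \<in> time_measure \<rightarrow>\<^sub>M count_space UNIV \<Longrightarrow> \<forall>s. \<kappa> s < N \<Longrightarrow> \<forall>a k. h k = 0 \<longrightarrow> q a k = 0 \<Longrightarrow>
    \<exists>Y. Y \<in> borel_measurable M \<and> (\<forall>v :: 'e \<Rightarrow>\<^sub>L real. stoch_int (\<lambda>s. \<Sum>k<K. v (q (\<kappa> s) k) *\<^sub>R h k) (\<lambda>w. v (Y w))) \<and>
      (\<integral>\<^sup>+w. min 1 (ennreal (norm (Y w) powr p)) \<partial>M) \<le>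
      ennreal B * (\<integral>\<^sup>+s. \<integral>\<^sup>+r. min 1 (ennreal (\<bar>r\<bar> powr (p / 2)) * gauss_norm p K (q (\<kappa> s))) \<partial>\<rho> \<partial>time_measure)"
proof -
  show thesis
  proof (rule simple_integral_estimate[OF type p])
  fix B :: real assume B: "0 < B" and est: "\<And>n K A Z (q :: nat \<Rightarrow> nat \<Rightarrow> 'e).
    (\<And>a. a < n \<Longrightarrow> A a \<in> sets borel) \<Longrightarrow> disjoint_family_on A {..<n} \<Longrightarrow>
    (\<And>a k. a < n \<Longrightarrow> k < K \<Longrightarrow> stoch_int (\<lambda>s. indicator (A a) s *\<^sub>R h k) (Z a k)) \<Longrightarrow>
    (\<And>a k. h k = 0 \<Longrightarrow> q a k = 0) \<Longrightarrow>
    (\<integral>\<^sup>+w. min 1 (ennreal (norm (\<Sum>a<n. \<Sum>k<K. Z a k w *\<^sub>R q a k) powr p)) \<partial>M) \<le>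
    ennreal B * (\<Sum>a<n. ennreal (measure lborel (A a \<inter> {0..T})) *
      (\<integral>\<^sup>+r. min 1 (ennreal (\<bar>r\<bar> powr (p / 2)) * gauss_norm p K (q a)) \<partial>\<rho>))"
  show thesis
  proof (rule that[OF B])
    fix \<kappa> :: "real \<Rightarrow> nat" and N K :: nat and q :: "nat \<Rightarrow> nat \<Rightarrow> 'e"
    assume \<kappa>: "\<kappa> \<in> time_measure \<rightarrow>\<^sub>M count_space UNIV" and "\<forall>s. \<kappa> s < N" "\<forall>a k. h k = 0 \<longrightarrow> q a k = 0"
    then have N: "\<And>s. \<kappa> s < N" and mask: "\<And>a k. h k = 0 \<Longrightarrow> q a k = 0" by auto
    define A where "A a = {s\<in>{0..T}. \<kappa> s = a}" for a
    have At: "A a \<in> sets time_measure" for a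
    proof -
      have "\<kappa> -` {a} \<inter> space time_measure \<in> sets time_measure" by (rule measurable_sets[OF \<kappa>]) simp
      also have "\<kappa> -` {a} \<inter> space time_measure = A a" by (auto simp: A_def)
      finally show ?thesis .
    qed
    have A: "A a \<in> sets borel" for a
      using At[of a] unfolding time_measure_def by (auto simp: sets_restrict_space)
    have disj: "disjoint_family_on A {..<N}" by (auto simp: disjoint_family_on_def A_def)
    have "\<exists>Z. stoch_int (\<lambda>s. indicator (A a) s *\<^sub>R h k) Z" for a k using stoch_int_indicator[OF A] by blast
    then obtain Z where Z: "\<And>a k. stoch_int (\<lambda>s. indicator (A a) s *\<^sub>R h k) (Z a k)" by metis
    define Y where "Y w = (\<Sum>a<N. \<Sum>k<K. Z a k w *\<^sub>R q a k)" for w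
    have [measurable]: "Z a k \<in> borel_measurable M" for a k by (rule stoch_int_measurable[OF Z])
    have Ym: "Y \<in> borel_measurable M" unfolding Y_def by measurable
    have Yv: "stoch_int (\<lambda>s. \<Sum>k<K. v (q (\<kappa> s) k) *\<^sub>R h k) (\<lambda>w. v (Y w))" for v :: "'e \<Rightarrow>\<^sub>L real"
    proof -
      have "stoch_int (\<lambda>s. \<Sum>a<N. \<Sum>k<K. v (q a k) *\<^sub>R (indicator (A a) s *\<^sub>R h k)) (\<lambda>w. \<Sum>a<N. \<Sum>k<K. v (q a k) * Z a k w)"
        by (intro stoch_int_sum stoch_int_scale Z) auto
      also have "(\<lambda>w. \<Sum>a<N. \<Sum>k<K. v (q a k) * Z a k w) = (\<lambda>w. v (Y w))"
        by (simp add: Y_def blinfun.sum_right blinfun.scaleR_right mult.commute)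
      finally show ?thesis
      proof (rule stoch_int_cong)
        fix s assume s: "s \<in> {0..T}"
        have "(\<Sum>a<N. \<Sum>k<K. v (q a k) *\<^sub>R (indicator (A a) s *\<^sub>R h k)) = (\<Sum>a<N. if a = \<kappa> s then \<Sum>k<K. v (q a k) *\<^sub>R h k else 0)"
          using s by (intro sum.cong refl) (auto simp: A_def)
        also have "\<dots> = (\<Sum>k<K. v (q (\<kappa> s) k) *\<^sub>R h k)" using N by simp
        finally show "(\<Sum>a<N. \<Sum>k<K. v (q a k) *\<^sub>R (indicator (A a) s *\<^sub>R h k)) = (\<Sum>k<K. v (q (\<kappa> s) k) *\<^sub>R h k)" .
      qed
    qed
    define G where "G a = (\<integral>\<^sup>+r. min 1 (ennreal (\<bar>r\<bar> powr (p / 2)) * gauss_norm p K (q a)) \<partial>\<rho>)" for a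
    have em: "emeasure time_measure (A a) = ennreal (measure lborel (A a \<inter> {0..T}))" for a
    proof -
      have AT: "A a \<inter> {0..T} = A a" "A a \<subseteq> {0..T}" by (auto simp: A_def)
      have "emeasure lborel (A a) \<le> emeasure lborel {0..T}" using AT by (intro emeasure_mono) auto
      then have "emeasure lborel (A a) \<noteq> \<infinity>" using T_pos by (auto simp: top_unique)
      then have "emeasure lborel (A a) = ennreal (measure lborel (A a \<inter> {0..T}))"
        unfolding AT(1) by (simp add: emeasure_eq_ennreal_measure)
      moreover have "emeasure time_measure (A a) = emeasure lborel (A a)"
        unfolding time_measure_def using AT(2) A by (intro emeasure_restrict_space) auto
      ultimately show ?thesis by simp
    qed
    have "(\<integral>\<^sup>+s. G (\<kappa> s) \<partial>time_measure) = (\<integral>\<^sup>+s. (\<Sum>a<N. G a * indicator (A a) s) \<partial>time_measure)"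
    proof (rule nn_integral_cong)
      fix s assume s: "s \<in> space time_measure"
      have "(\<Sum>a<N. G a * indicator (A a) s) = (\<Sum>a<N. if a = \<kappa> s then G a else 0)"
        using s by (intro sum.cong refl) (auto simp: A_def)
      then show "G (\<kappa> s) = (\<Sum>a<N. G a * indicator (A a) s)" using N by simp
    qed
    also have "\<dots> = (\<Sum>a<N. (\<integral>\<^sup>+s. G a * indicator (A a) s \<partial>time_measure))"
      using At by (intro nn_integral_sum) simp
    also have "\<dots> = (\<Sum>a<N. ennreal (measure lborel (A a \<inter> {0..T})) * G a)"
      using At by (intro sum.cong refl) (simp add: nn_integral_cmult_indicator em mult.commute)
    finally have G: "(\<integral>\<^sup>+s. G (\<kappa> s) \<partial>time_measure) = (\<Sum>a<N. ennreal (measure lborel (A a \<inter> {0..T})) * G a)" .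
    have "(\<integral>\<^sup>+w. min 1 (ennreal (norm (Y w) powr p)) \<partial>M) \<le> ennreal B * (\<integral>\<^sup>+s. G (\<kappa> s) \<partial>time_measure)"
      unfolding G unfolding G_def Y_def by (rule est[OF A disj Z mask])
    then show "\<exists>Y. Y \<in> borel_measurable M \<and> (\<forall>v :: 'e \<Rightarrow>\<^sub>L real. stoch_int (\<lambda>s. \<Sum>k<K. v (q (\<kappa> s) k) *\<^sub>R h k) (\<lambda>w. v (Y w))) \<and>
      (\<integral>\<^sup>+w. min 1 (ennreal (norm (Y w) powr p)) \<partial>M) \<le>
      ennreal B * (\<integral>\<^sup>+s. \<integral>\<^sup>+r. min 1 (ennreal (\<bar>r\<bar> powr (p / 2)) * gauss_norm p K (q (\<kappa> s))) \<partial>\<rho> \<partial>time_measure)"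
      using Ym Yv unfolding G_def by blast
  qed
  qed
qed

text \<open>Abstract form of the construction: \<open>D m s\<close> is the error of the m-th
  candidate at time s, and the semigroup does not occur. Candidate 0 provides the dominating
  function, \<open>approx\<close> makes the errors of the best choices tend to 0, and
  \<open>tri\<close> controls differences of two choices. A single Y serves for every
  functional.\<close>

lemma approximate_integral:
  fixes q :: "nat \<Rightarrow> nat \<Rightarrow> 'e::{banach, second_countable_topology}"
  assumes type: "rademacher_type TYPE('e) p" and p: "1 \<le> p" "p \<le> 2"
    and D[measurable]: "\<And>m. D m \<in> borel_measurable time_measure"
    and mask: "\<And>m k. h k = 0 \<Longrightarrow> q m k = 0"
    and supp: "\<And>m k. supp m \<le> k \<Longrightarrow> q m k = 0"
    and approx: "\<And>s \<epsilon>. s \<in> {0..T} \<Longrightarrow> 0 < \<epsilon> \<Longrightarrow> \<exists>m. D m s < \<epsilon>"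
    and tri: "\<And>a b s K. s \<in> {0..T} \<Longrightarrow> supp a \<le> K \<Longrightarrow> supp b \<le> K \<Longrightarrow>
      gauss_norm p K (\<lambda>k. q a k - q b k) \<le> 4 * (D a s + D b s)"
    and fin: "(\<integral>\<^sup>+r. \<integral>\<^sup>+s. min 1 (ennreal (\<bar>r\<bar> powr (p / 2)) * D 0 s) \<partial>time_measure \<partial>\<rho>) < \<infinity>"
  obtains Y where "Y \<in> borel_measurable M"
    "\<And>v G c. wmeas G \<Longrightarrow> (\<And>s m. s \<in> {0..T} \<Longrightarrow>
        ennreal (norm (G s - (\<Sum>k<supp m. blinfun_apply v (q m k) *\<^sub>R h k)) powr p) \<le> ennreal c * D m s) \<Longrightarrow>
      stoch_int G (\<lambda>w. blinfun_apply v (Y w))"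
proof -
  interpret R: sigma_finite_measure \<rho> by (rule sigma_finite_rho)
  interpret Tm: sigma_finite_measure time_measure by (rule sigma_finite_time)
  interpret PT: pair_sigma_finite \<rho> time_measure by standard
  \<comment> \<open>At stage n the index of a smallest error among the candidates 0 to n, found by
    successive comparison; the recursion also carries the proof of measurability.\<close>
  define \<kappa> where "\<kappa> = rec_nat (\<lambda>s. 0) (\<lambda>n f s. if D (Suc n) s < D (f s) s then Suc n else f s)"
  have \<kappa>_simps: "\<kappa> 0 = (\<lambda>s. 0)" "\<And>n. \<kappa> (Suc n) = (\<lambda>s. if D (Suc n) s < D (\<kappa> n s) s then Suc n else \<kappa> n s)"
    unfolding \<kappa>_def by simp_all
  have \<kappa>m: "\<kappa> n \<in> time_measure \<rightarrow>\<^sub>M count_space UNIV" for n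
  proof (induction n)
    case (Suc n)
    note Suc.IH[measurable]
    have [measurable]: "(\<lambda>s. D (\<kappa> n s) s) \<in> borel_measurable time_measure"
      by (rule measurable_compose_countable[OF D Suc.IH])
    show ?case unfolding \<kappa>_simps by measurable
  qed (simp add: \<kappa>_simps)
  have \<kappa>_le: "\<kappa> n s \<le> n" for n s by (induction n) (auto simp: \<kappa>_simps intro: le_SucI)
  define E where "E n s = D (\<kappa> n s) s" for n s
  have Em[measurable]: "E n \<in> borel_measurable time_measure" for n
    unfolding E_def by (rule measurable_compose_countable[OF D \<kappa>m])
  have E_le: "m \<le> n \<Longrightarrow> E n s \<le> D m s" for m n s
  proof (induction n)
    case (Suc n)
    have "E (Suc n) s \<le> D (Suc n) s" "E (Suc n) s \<le> E n s" by (auto simp: E_def \<kappa>_simps)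
    then show ?case using Suc by (cases "m = Suc n") (auto intro: order_trans)
  qed (simp add: E_def \<kappa>_simps)
  have E_lim: "(\<lambda>n. E n s) \<longlonglongrightarrow> 0" if s: "s \<in> {0..T}" for s
  proof (rule order_tendstoI)
    fix a :: ennreal assume "0 < a"
    then obtain m where "D m s < a" using approx[OF s] by blast
    then show "\<forall>\<^sub>F n in sequentially. E n s < a"
      by (intro eventually_sequentiallyI[of m] le_less_trans[OF E_le])
  qed simp
  define J where "J n = (\<integral>\<^sup>+r. \<integral>\<^sup>+s. min 1 (ennreal (\<bar>r\<bar> powr (p / 2)) * E n s) \<partial>time_measure \<partial>\<rho>)" for n
  have J_swap: "J n = (\<integral>\<^sup>+s. \<integral>\<^sup>+r. min 1 (ennreal (\<bar>r\<bar> powr (p / 2)) * E n s) \<partial>\<rho> \<partial>time_measure)" for n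
    unfolding J_def by (rule PT.Fubini'[symmetric]) measurable
  define f where "f n z = min 1 (ennreal (\<bar>fst z\<bar> powr (p / 2)) * E n (snd z))" for n z
  have fm[measurable]: "f n \<in> borel_measurable (\<rho> \<Otimes>\<^sub>M time_measure)" for n unfolding f_def by measurable
  have J_f: "J n = (\<integral>\<^sup>+z. f n z \<partial>(\<rho> \<Otimes>\<^sub>M time_measure))" for n
    unfolding J_def by (subst Tm.nn_integral_fst[symmetric, OF fm]) (simp add: f_def)
  \<comment> \<open>Dominated convergence on the product of \<open>\<rho>\<close> and time; the
    majorant is the truncated error of candidate 0.\<close>
  have J_lim: "J \<longlonglongrightarrow> 0"
  proof -
    have "(\<lambda>n. \<integral>\<^sup>+z. f n z \<partial>(\<rho> \<Otimes>\<^sub>M time_measure)) \<longlonglongrightarrow> (\<integral>\<^sup>+z. 0 \<partial>(\<rho> \<Otimes>\<^sub>M time_measure))"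
    proof (rule nn_integral_dominated_convergence[where w="f 0"])
      show "AE z in \<rho> \<Otimes>\<^sub>M time_measure. f n z \<le> f 0 z" for n
        unfolding f_def using E_le[of 0 n] by (intro AE_I2 min.mono order_refl mult_left_mono) (auto simp: E_def \<kappa>_simps)
      show "(\<integral>\<^sup>+z. f 0 z \<partial>(\<rho> \<Otimes>\<^sub>M time_measure)) < \<infinity>"
        using fin unfolding J_f[symmetric] by (simp add: J_def E_def \<kappa>_simps)
      show "AE z in \<rho> \<Otimes>\<^sub>M time_measure. (\<lambda>n. f n z) \<longlonglongrightarrow> 0"
      proof (rule AE_I2)
        fix z assume "z \<in> space (\<rho> \<Otimes>\<^sub>M time_measure)"
        then have "snd z \<in> {0..T}" by (auto simp: space_pair_measure)
        then have "(\<lambda>n. f n z) \<longlonglongrightarrow> min 1 (ennreal (\<bar>fst z\<bar> powr (p / 2)) * 0)"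
          unfolding f_def by (intro tendsto_min tendsto_const ennreal_tendsto_cmult E_lim) auto
        then show "(\<lambda>n. f n z) \<longlonglongrightarrow> 0" by simp
      qed
    qed auto
    then show ?thesis by (simp add: J_f[abs_def])
  qed
  obtain B where B: "0 < B" and ex: "\<And>\<kappa> N K (q :: nat \<Rightarrow> nat \<Rightarrow> 'e).
    \<kappa> \<in> time_measure \<rightarrow>\<^sub>M count_space UNIV \<Longrightarrow> \<forall>s. \<kappa> s < N \<Longrightarrow> \<forall>a k. h k = 0 \<longrightarrow> q a k = 0 \<Longrightarrow>
    \<exists>Y. Y \<in> borel_measurable M \<and> (\<forall>v :: 'e \<Rightarrow>\<^sub>L real. stoch_int (\<lambda>s. \<Sum>k<K. v (q (\<kappa> s) k) *\<^sub>R h k) (\<lambda>w. v (Y w))) \<and>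
      (\<integral>\<^sup>+w. min 1 (ennreal (norm (Y w) powr p)) \<partial>M) \<le>
      ennreal B * (\<integral>\<^sup>+s. \<integral>\<^sup>+r. min 1 (ennreal (\<bar>r\<bar> powr (p / 2)) * gauss_norm p K (q (\<kappa> s))) \<partial>\<rho> \<partial>time_measure)"
    by (rule elementary_integral[OF type p]) (rule that; assumption)
  define K where "K n = (\<Sum>m\<le>n. supp m)" for n
  have suppK: "supp (\<kappa> n s) \<le> K n" for n s unfolding K_def using \<kappa>_le[of n s] by (intro member_le_sum) auto
  define g where "g v a = (\<Sum>k<supp a. blinfun_apply v (q a k) *\<^sub>R h k)" for v a
  have g_eq: "(\<Sum>k<k0. blinfun_apply v (q a k) *\<^sub>R h k) = g v a" if "supp a \<le> k0" for v a k0
    unfolding g_def using that supp[of a] by (intro sum.mono_neutral_right) (auto simp: blinfun.zero_right)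
  have "\<exists>Y. Y \<in> borel_measurable M \<and> (\<forall>v. stoch_int (\<lambda>s. g v (\<kappa> n s)) (\<lambda>w. blinfun_apply v (Y w)))" for n
  proof -
    have "\<forall>s. \<kappa> n s < Suc n" using \<kappa>_le[of n] by (simp add: less_Suc_eq_le)
    moreover have "\<forall>a k. h k = 0 \<longrightarrow> q a k = 0" using mask by simp
    ultimately show ?thesis using ex[OF \<kappa>m, of n "Suc n" q "K n"] by (auto simp: g_eq[OF suppK])
  qed
  then obtain Y where Ym[measurable]: "\<And>n. Y n \<in> borel_measurable M"
    and Y: "\<And>n v. stoch_int (\<lambda>s. g v (\<kappa> n s)) (\<lambda>w. blinfun_apply v (Y n w))" by metis
  \<comment> \<open>The difference of two step integrals is identified with the integral of the
    difference of the step functions, by uniqueness of scalar integrals along countably many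
    separating functionals; the moment bound then applies to it.\<close>
  have diff: "(\<integral>\<^sup>+w. min 1 (ennreal (norm (Y n w - Y m w) powr p)) \<partial>M) \<le> ennreal (4 * B) * (J n + J m)" for n m
  proof -
    \<comment> \<open>A pair of indices is coded as one, so that the difference is again a step
      function over a single index map.\<close>
    define \<kappa>' where "\<kappa>' s = prod_encode (\<kappa> n s, \<kappa> m s)" for s
    define q' where "q' c k = q (fst (prod_decode c)) k - q (snd (prod_decode c)) k" for c k
    have q'_eq: "q' (\<kappa>' s) = (\<lambda>k. q (\<kappa> n s) k - q (\<kappa> m s) k)" for s by (simp add: fun_eq_iff q'_def \<kappa>'_def)
    let ?K = "K n + K m"
    have "\<kappa>' \<in> time_measure \<rightarrow>\<^sub>M count_space UNIV"
      unfolding \<kappa>'_def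
    proof (rule measurable_compose_countable[where f="\<lambda>i s. prod_encode (i, \<kappa> m s)" and g="\<kappa> n", OF _ \<kappa>m])
      show "(\<lambda>s. prod_encode (i, \<kappa> m s)) \<in> time_measure \<rightarrow>\<^sub>M count_space UNIV" for i :: nat
        by (rule measurable_compose[OF \<kappa>m]) simp
    qed
    moreover obtain N where N: "\<forall>s. \<kappa>' s < N"
    proof -
      have "finite (prod_encode ` ({..n} \<times> {..m}))" by simp
      then obtain N where "\<forall>x\<in>prod_encode ` ({..n} \<times> {..m}). x < N" unfolding finite_nat_set_iff_bounded by blast
      then have "\<forall>s. \<kappa>' s < N" using \<kappa>_le unfolding \<kappa>'_def by auto
      then show thesis by (rule that)
    qed
    moreover have "\<forall>a k. h k = 0 \<longrightarrow> q' a k = 0" by (simp add: q'_def mask)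
    ultimately obtain Y' where Y'm[measurable]: "Y' \<in> borel_measurable M"
      and Y': "\<And>v :: 'e \<Rightarrow>\<^sub>L real. stoch_int (\<lambda>s. \<Sum>k<?K. v (q' (\<kappa>' s) k) *\<^sub>R h k) (\<lambda>w. v (Y' w))"
      and Y'le: "(\<integral>\<^sup>+w. min 1 (ennreal (norm (Y' w) powr p)) \<partial>M) \<le>
        ennreal B * (\<integral>\<^sup>+s. \<integral>\<^sup>+r. min 1 (ennreal (\<bar>r\<bar> powr (p / 2)) * gauss_norm p ?K (q' (\<kappa>' s))) \<partial>\<rho> \<partial>time_measure)"
      using ex[of \<kappa>' N q' ?K] by blast
    obtain vs :: "nat \<Rightarrow> 'e \<Rightarrow>\<^sub>L real" where vs: "\<And>x. (\<And>n. blinfun_apply (vs n) x = 0) \<Longrightarrow> x = 0"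
      using dual_separates_countable[where 'v='e] by blast
    have "AE w in M. blinfun_apply v (Y' w) = blinfun_apply v (Y n w) - blinfun_apply v (Y m w)" for v :: "'e \<Rightarrow>\<^sub>L real"
    proof -
      have b: "stoch_int (\<lambda>s. g v (\<kappa> n s) - g v (\<kappa> m s)) (\<lambda>w. blinfun_apply v (Y n w) - blinfun_apply v (Y m w))"
        by (intro stoch_int_diff Y)
      have "(\<Sum>k<?K. v (q' (\<kappa>' s) k) *\<^sub>R h k) = g v (\<kappa> n s) - g v (\<kappa> m s)" for s
      proof -
        have "supp (\<kappa> n s) \<le> ?K" "supp (\<kappa> m s) \<le> ?K" using suppK[of n s] suppK[of m s] by auto
        from this[THEN g_eq, symmetric] show ?thesis
          by (simp add: q'_eq blinfun.diff_right scaleR_left_diff_distrib sum_subtractf)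
      qed
      then have a: "stoch_int (\<lambda>s. g v (\<kappa> n s) - g v (\<kappa> m s)) (\<lambda>w. blinfun_apply v (Y' w))" using Y'[of v] by simp
      show ?thesis by (rule stoch_int_unique[OF a b])
    qed
    then have "AE w in M. \<forall>i. blinfun_apply (vs i) (Y' w) = blinfun_apply (vs i) (Y n w) - blinfun_apply (vs i) (Y m w)"
      by (simp add: AE_all_countable)
    then have eq: "AE w in M. Y' w = Y n w - Y m w"
    proof eventually_elim
      case (elim w)
      have "Y' w - (Y n w - Y m w) = 0" by (rule vs) (simp add: blinfun.diff_right elim)
      then show ?case by simp
    qed
    have "(\<integral>\<^sup>+s. \<integral>\<^sup>+r. min 1 (ennreal (\<bar>r\<bar> powr (p / 2)) * gauss_norm p ?K (q' (\<kappa>' s))) \<partial>\<rho> \<partial>time_measure) \<le>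
        (\<integral>\<^sup>+s. \<integral>\<^sup>+r. 4 * (min 1 (ennreal (\<bar>r\<bar> powr (p / 2)) * E n s) + min 1 (ennreal (\<bar>r\<bar> powr (p / 2)) * E m s)) \<partial>\<rho> \<partial>time_measure)"
    proof (intro nn_integral_mono)
      fix s r assume s: "s \<in> space time_measure"
      have "gauss_norm p ?K (q' (\<kappa>' s)) \<le> 4 * (E n s + E m s)"
        unfolding q'_eq E_def using s suppK[of n s] suppK[of m s] by (intro tri) auto
      then have "min 1 (ennreal (\<bar>r\<bar> powr (p / 2)) * gauss_norm p ?K (q' (\<kappa>' s))) \<le> min 1 (ennreal (\<bar>r\<bar> powr (p / 2)) * (4 * (E n s + E m s)))"
        by (intro min.mono order_refl mult_left_mono) auto
      also have "\<dots> \<le> 4 * (min 1 (ennreal (\<bar>r\<bar> powr (p / 2)) * E n s) + min 1 (ennreal (\<bar>r\<bar> powr (p / 2)) * E m s))"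
        by (rule min_one_four_add_le)
      finally show "min 1 (ennreal (\<bar>r\<bar> powr (p / 2)) * gauss_norm p ?K (q' (\<kappa>' s))) \<le>
        4 * (min 1 (ennreal (\<bar>r\<bar> powr (p / 2)) * E n s) + min 1 (ennreal (\<bar>r\<bar> powr (p / 2)) * E m s))" .
    qed
    also have "\<dots> = (\<integral>\<^sup>+s. 4 * ((\<integral>\<^sup>+r. min 1 (ennreal (\<bar>r\<bar> powr (p / 2)) * E n s) \<partial>\<rho>) +
        (\<integral>\<^sup>+r. min 1 (ennreal (\<bar>r\<bar> powr (p / 2)) * E m s) \<partial>\<rho>)) \<partial>time_measure)"
    proof (rule nn_integral_cong)
      fix s
      have [measurable]: "(\<lambda>r. min 1 (ennreal (\<bar>r\<bar> powr (p / 2)) * x)) \<in> borel_measurable \<rho>" for x by measurable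
      show "(\<integral>\<^sup>+r. 4 * (min 1 (ennreal (\<bar>r\<bar> powr (p / 2)) * E n s) + min 1 (ennreal (\<bar>r\<bar> powr (p / 2)) * E m s)) \<partial>\<rho>) =
        4 * ((\<integral>\<^sup>+r. min 1 (ennreal (\<bar>r\<bar> powr (p / 2)) * E n s) \<partial>\<rho>) + (\<integral>\<^sup>+r. min 1 (ennreal (\<bar>r\<bar> powr (p / 2)) * E m s) \<partial>\<rho>))"
        by (simp add: nn_integral_cmult nn_integral_add)
    qed
    also have "\<dots> = 4 * (J n + J m)"
    proof -
      have [measurable]: "(\<lambda>s. \<integral>\<^sup>+r. min 1 (ennreal (\<bar>r\<bar> powr (p / 2)) * E n s) \<partial>\<rho>) \<in> borel_measurable time_measure" for n
        by measurable
      show ?thesis unfolding J_swap by (simp add: nn_integral_cmult nn_integral_add)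
    qed
    finally have est: "(\<integral>\<^sup>+s. \<integral>\<^sup>+r. min 1 (ennreal (\<bar>r\<bar> powr (p / 2)) * gauss_norm p ?K (q' (\<kappa>' s))) \<partial>\<rho> \<partial>time_measure) \<le> 4 * (J n + J m)" .
    have "(\<integral>\<^sup>+w. min 1 (ennreal (norm (Y n w - Y m w) powr p)) \<partial>M) = (\<integral>\<^sup>+w. min 1 (ennreal (norm (Y' w) powr p)) \<partial>M)"
      using eq by (intro nn_integral_cong_AE) (auto elim!: eventually_mono)
    also have "\<dots> \<le> ennreal B * (4 * (J n + J m))" by (rule order_trans[OF Y'le mult_left_mono[OF est]]) simp
    also have "\<dots> = ennreal (4 * B) * (J n + J m)" using B by (simp add: ennreal_mult mult_ac)
    finally show ?thesis .
  qed
  \<comment> \<open>The square passes inside the expectation by nonnegativity of the variance, and p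
    <= 2 bounds the truncated square by the truncated p-th power.\<close>
  have L0: "ennreal ((L0norm M (\<lambda>w. Y n w - Y m w))\<^sup>2) \<le> ennreal (4 * B) * (J n + J m)" for n m
  proof -
    let ?X = "\<lambda>w. min 1 (norm (Y n w - Y m w))"
    have int: "integrable M ?X" "integrable M (\<lambda>w. (?X w)\<^sup>2)"
      by (intro integrable_const_bound[where B=1] AE_I2; simp add: power_le_one)+
    have "ennreal ((L0norm M (\<lambda>w. Y n w - Y m w))\<^sup>2) \<le> ennreal (\<integral>w. (?X w)\<^sup>2 \<partial>M)"
      unfolding L0norm_def by (intro ennreal_leI square_expectation_le int)
    also have "\<dots> = (\<integral>\<^sup>+w. ennreal ((?X w)\<^sup>2) \<partial>M)" by (rule nn_integral_eq_integral[symmetric, OF int(2)]) simp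
    also have "\<dots> \<le> (\<integral>\<^sup>+w. min 1 (ennreal (norm (Y n w - Y m w) powr p)) \<partial>M)"
      by (intro nn_integral_mono min_one_square_le_powr p) simp
    also note diff
    finally show ?thesis .
  qed
  \<comment> \<open>Two errors below \<delta> n give 4 B (2 \<delta> n) = 4^-n, the square of the
    rate 2^-n.\<close>
  define \<delta> where "\<delta> n = (1/4) ^ n / (8 * B)" for n :: nat
  have \<delta>: "0 < \<delta> n" for n using B by (simp add: \<delta>_def)
  have \<delta>_lim: "\<delta> \<longlonglongrightarrow> 0" unfolding \<delta>_def by (intro tendsto_divide_zero LIMSEQ_power_zero) simp
  have "\<exists>m. J m < ennreal (\<delta> n)" for n
  proof -
    have "0 < ennreal (\<delta> n)" using \<delta> by simp
    then show ?thesis using eventually_happens'[OF _ order_tendstoD(2)[OF J_lim]] by auto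
  qed
  then obtain \<sigma> where \<sigma>: "\<And>n. J (\<sigma> n) < ennreal (\<delta> n)" by metis
  have rate: "L0norm M (\<lambda>w. Y (\<sigma> (Suc n)) w - Y (\<sigma> n) w) \<le> (1/2) ^ n" for n
  proof (rule power2_le_imp_le)
    have "ennreal ((L0norm M (\<lambda>w. Y (\<sigma> (Suc n)) w - Y (\<sigma> n) w))\<^sup>2) \<le> ennreal (4 * B) * (J (\<sigma> (Suc n)) + J (\<sigma> n))"
      by (rule L0)
    also have "\<dots> \<le> ennreal (4 * B) * (ennreal (\<delta> n) + ennreal (\<delta> n))"
    proof (intro mult_left_mono add_mono)
      have "\<delta> (Suc n) \<le> \<delta> n" using B by (simp add: \<delta>_def frac_le)
      then show "J (\<sigma> (Suc n)) \<le> ennreal (\<delta> n)" using \<sigma>[of "Suc n"] by (meson ennreal_leI less_imp_le order_trans)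
    qed (auto intro: less_imp_le \<sigma>)
    also have "\<dots> = ennreal (4 * B * (\<delta> n + \<delta> n))"
    proof -
      have "ennreal (\<delta> n) + ennreal (\<delta> n) = ennreal (\<delta> n + \<delta> n)" using \<delta>[of n] by (intro ennreal_plus[symmetric]) auto
      then show ?thesis using B \<delta>[of n] by (simp only:) (intro ennreal_mult[symmetric], auto)
    qed
    also have "4 * B * (\<delta> n + \<delta> n) = ((1/2) ^ n)\<^sup>2"
    proof -
      have "((1/2::real) ^ n)\<^sup>2 = (1/4) ^ n" by (simp only: power2_eq_square power_mult_distrib[symmetric]) simp
      then show ?thesis using B by (simp add: \<delta>_def field_simps)
    qed
    finally show "(L0norm M (\<lambda>w. Y (\<sigma> (Suc n)) w - Y (\<sigma> n) w))\<^sup>2 \<le> ((1/2) ^ n)\<^sup>2" by simp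
  qed simp
  obtain Yl where Ylm[measurable]: "Yl \<in> borel_measurable M" and Yl: "(\<lambda>n. L0norm M (\<lambda>w. Y (\<sigma> n) w - Yl w)) \<longlonglongrightarrow> 0"
    by (rule L0norm_complete[of "\<lambda>n. Y (\<sigma> n)", OF Ym rate]) (rule that; assumption)
  show thesis
  proof (rule that[OF Ylm])
    fix v :: "'e \<Rightarrow>\<^sub>L real" and G c
    assume G: "wmeas G" and Gle: "\<And>s m. s \<in> {0..T} \<Longrightarrow>
        ennreal (norm (G s - (\<Sum>k<supp m. blinfun_apply v (q m k) *\<^sub>R h k)) powr p) \<le> ennreal c * D m s"
    \<comment> \<open>The constant has to be at least 1 to be pulled out of the truncation.\<close>
    define e where "e = max 1 c"
    have e: "1 \<le> e" "c \<le> e" by (auto simp: e_def)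
    \<comment> \<open>The energy of the error is bounded by a multiple of the same
      \<open>J n\<close> that controls the vector-valued integrals, so one index sequence gives
      convergence of integrands and of integrals.\<close>
    have en: "energy (\<lambda>s. G s - g v (\<kappa> n s)) \<le> ennreal e * J n" for n
    proof -
      have "energy (\<lambda>s. G s - g v (\<kappa> n s)) \<le> (\<integral>\<^sup>+s. \<integral>\<^sup>+r. ennreal e * min 1 (ennreal (\<bar>r\<bar> powr (p / 2)) * E n s) \<partial>\<rho> \<partial>time_measure)"
        unfolding energy_def
      proof (rule nn_integral_mono)
        fix s assume s: "s \<in> space time_measure"
        define d where "d = norm (G s - g v (\<kappa> n s))"
        have d: "0 \<le> d" by (simp add: d_def)
        have "ennreal (d powr p) \<le> ennreal c * E n s"
          unfolding d_def g_def E_def using s by (intro Gle) simp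
        also have "\<dots> \<le> ennreal e * E n s" using e by (intro mult_right_mono ennreal_leI) auto
        finally have dE: "ennreal (d powr p) \<le> ennreal e * E n s" .
        have "ennreal (laplace_exp (d\<^sup>2 / 2)) = (\<integral>\<^sup>+r. ennreal (1 - exp (- (d\<^sup>2 / 2) * r)) \<partial>\<rho>)"
          by (rule ennreal_laplace_exp) simp
        also have "\<dots> \<le> (\<integral>\<^sup>+r. ennreal e * min 1 (ennreal (\<bar>r\<bar> powr (p / 2)) * E n s) \<partial>\<rho>)"
        proof (rule nn_integral_mono_AE, use AE_rho_pos in eventually_elim)
          fix r :: real assume r: "0 < r"
          have "ennreal (1 - exp (- (d\<^sup>2 / 2) * r)) \<le> min 1 (ennreal (\<bar>r\<bar> powr (p / 2)) * ennreal (d powr p))"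
            by (rule one_minus_exp_le_powr[OF r d p])
          also have "\<dots> \<le> min 1 (ennreal e * (ennreal (\<bar>r\<bar> powr (p / 2)) * E n s))"
            unfolding mult.left_commute[of "ennreal e"] by (intro min.mono order_refl mult_left_mono dE) simp
          also have "\<dots> \<le> ennreal e * min 1 (ennreal (\<bar>r\<bar> powr (p / 2)) * E n s)"
            using e by (intro min_one_mult_le) (simp add: ennreal_ge_1)
          finally show "ennreal (1 - exp (- (d\<^sup>2 / 2) * r)) \<le> ennreal e * min 1 (ennreal (\<bar>r\<bar> powr (p / 2)) * E n s)" .
        qed
        finally show "ennreal (laplace_exp ((norm (G s - g v (\<kappa> n s)))\<^sup>2 / 2)) \<le>
            (\<integral>\<^sup>+r. ennreal e * min 1 (ennreal (\<bar>r\<bar> powr (p / 2)) * E n s) \<partial>\<rho>)" by (simp add: d_def)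
      qed
      also have "\<dots> = ennreal e * J n"
      proof -
        have [measurable]: "(\<lambda>s. \<integral>\<^sup>+r. min 1 (ennreal (\<bar>r\<bar> powr (p / 2)) * E n s) \<partial>\<rho>) \<in> borel_measurable time_measure"
          by measurable
        have "(\<lambda>r. min 1 (ennreal (\<bar>r\<bar> powr (p / 2)) * x)) \<in> borel_measurable \<rho>" for x by measurable
        then show ?thesis unfolding J_swap by (simp add: nn_integral_cmult)
      qed
      finally show ?thesis .
    qed
    define b where "b = max 1 (norm v)"
    have [measurable]: "blinfun_apply v \<in> borel_measurable borel"
      by (intro borel_measurable_continuous_onI linear_continuous_on blinfun.bounded_linear_right)
    have vL: "L0norm M (\<lambda>w. v (Y n w) - v (Yl w)) \<le> b * L0norm M (\<lambda>w. Y n w - Yl w)" for n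
    proof (rule L0norm_linear_le)
      show "norm (v (Y n w) - v (Yl w)) \<le> b * norm (Y n w - Yl w)" for w
        unfolding blinfun.diff_right[symmetric]
        by (rule order_trans[OF norm_blinfun]) (simp add: b_def mult_right_mono)
    qed (simp_all add: b_def, measurable)
    show "stoch_int G (\<lambda>w. v (Yl w))"
    proof (rule stoch_int_closure[OF G])
      fix \<epsilon> :: real assume \<epsilon>: "0 < \<epsilon>"
      have "(\<lambda>n. e * \<delta> n) \<longlonglongrightarrow> 0" using tendsto_mult_right_zero[OF \<delta>_lim] .
      then have "\<forall>\<^sub>F n in sequentially. e * \<delta> n < \<epsilon>" using \<epsilon> by (rule order_tendstoD)
      moreover have "(\<lambda>n. b * L0norm M (\<lambda>w. Y (\<sigma> n) w - Yl w)) \<longlonglongrightarrow> 0" using tendsto_mult_right_zero[OF Yl] .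
      then have "\<forall>\<^sub>F n in sequentially. b * L0norm M (\<lambda>w. Y (\<sigma> n) w - Yl w) < \<epsilon>" using \<epsilon> by (rule order_tendstoD)
      ultimately have "\<forall>\<^sub>F n in sequentially. e * \<delta> n < \<epsilon> \<and> b * L0norm M (\<lambda>w. Y (\<sigma> n) w - Yl w) < \<epsilon>" by (rule eventually_conj)
      then obtain n where n: "e * \<delta> n < \<epsilon>" "b * L0norm M (\<lambda>w. Y (\<sigma> n) w - Yl w) < \<epsilon>"
        using eventually_happens'[of sequentially] by auto
      have "energy (\<lambda>s. G s - g v (\<kappa> (\<sigma> n) s)) \<le> ennreal e * J (\<sigma> n)" by (rule en)
      also have "\<dots> \<le> ennreal e * ennreal (\<delta> n)" using \<sigma>[of n] by (intro mult_left_mono) auto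
      also have "\<dots> = ennreal (e * \<delta> n)" using e \<delta>[of n] by (simp add: ennreal_mult)
      also have "\<dots> < ennreal \<epsilon>" using n(1) \<epsilon> by (simp add: ennreal_lessI)
      finally have "energy (\<lambda>s. G s - g v (\<kappa> (\<sigma> n) s)) < ennreal \<epsilon>" .
      moreover have "L0norm M (\<lambda>w. v (Yl w) - v (Y (\<sigma> n) w)) < \<epsilon>"
        using vL[of "\<sigma> n"] n(2) by (subst L0norm_diff_commute) linarith
      ultimately show "\<exists>g' Z'. stoch_int g' Z' \<and> energy (\<lambda>s. G s - g' s) < ennreal \<epsilon> \<and> L0norm M (\<lambda>w. v (Yl w) - Z' w) < \<epsilon>"
        using Y by blast
    qed measurable
  qed
qed

end

subsection \<open>Approximation of Gaussian series\<close>

text \<open>A limsup is measurable in a parameter and makes sense without convergence of the series;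
  no chosen limit enters.\<close>

definition gauss_limsup :: "real \<Rightarrow> (nat \<Rightarrow> 'e::real_normed_vector) \<Rightarrow> ennreal" where
  "gauss_limsup p y = limsup (\<lambda>n. gauss_norm p n y)"

lemma ennreal_four_add: "0 \<le> a \<Longrightarrow> 0 \<le> b \<Longrightarrow> 4 * (ennreal a + ennreal b) = ennreal (4 * (a + b))"
  by (simp add: ennreal_mult' ennreal_plus distrib_left)

lemma gauss_partial_sum_measurable:
  fixes y :: "nat \<Rightarrow> 'e::{banach, second_countable_topology}"
  shows "(\<lambda>\<gamma>. \<Sum>k<n. \<gamma> k *\<^sub>R y k) \<in> borel_measurable gauss_space"
  by (intro borel_measurable_sum borel_measurable_scaleR borel_measurable_const gauss_component_measurable)

lemma gauss_second_moment: "(\<integral>\<^sup>+\<gamma>. ennreal ((\<gamma> k)\<^sup>2) \<partial>gauss_space) = 1"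
proof -
  interpret P: product_prob_space "\<lambda>_::nat. std_normal_distribution" UNIV
    by (intro product_prob_spaceI real_distribution.axioms(1)[OF real_dist_normal_dist])
  have d: "distr gauss_space std_normal_distribution (\<lambda>\<gamma>. \<gamma> k) = std_normal_distribution"
    unfolding gauss_space_def by (rule P.PiM_component) simp
  have m: "(\<lambda>\<gamma>. \<gamma> k) \<in> gauss_space \<rightarrow>\<^sub>M std_normal_distribution"
    using gauss_component_measurable[of k] by simp
  have "(\<integral>\<^sup>+\<gamma>. ennreal ((\<gamma> k)\<^sup>2) \<partial>gauss_space) = (\<integral>\<^sup>+x. ennreal (x\<^sup>2) \<partial>distr gauss_space std_normal_distribution (\<lambda>\<gamma>. \<gamma> k))"
    by (rule nn_integral_distr[OF m, symmetric]) simp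
  also have "\<dots> = (\<integral>\<^sup>+x. ennreal (std_normal_density x) * ennreal (x\<^sup>2) \<partial>lborel)"
    unfolding d by (rule nn_integral_density) auto
  also have "\<dots> = (\<integral>\<^sup>+x. ennreal (std_normal_density x * x\<^sup>2) \<partial>lborel)"
    by (simp add: ennreal_mult)
  also have "\<dots> = 1"
    using std_normal_moment_even[of 1] by (subst nn_integral_eq_integral) (auto simp: has_bochner_integral_iff)
  finally show ?thesis .
qed

lemma powr_le_one_plus_square: "0 \<le> x \<Longrightarrow> 1 \<le> p \<Longrightarrow> p \<le> 2 \<Longrightarrow> x powr p \<le> 1 + x\<^sup>2" for x :: real
proof (cases "x \<le> 1")
  case True
  assume "0 \<le> x" "1 \<le> p"
  then have "x powr p \<le> 1" using True by (intro powr_le1) auto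
  then show ?thesis using zero_le_power2[of x] by linarith
next
  case False
  assume "p \<le> 2"
  then have "x powr p \<le> x powr 2" using False by (intro powr_mono) auto
  then show ?thesis using False by simp
qed

text \<open>With s the sum of the |\<gamma> k|, the integrand is at most \<eta>^p s^p <= \<eta> (1 +
  s^2), and s^2 is at most K times the sum of squares. Unit variances then give \<eta> (1 +
  K^2).\<close>

lemma gauss_norm_small:
  assumes p: "1 \<le> p" "p \<le> 2" and \<epsilon>: "0 < \<epsilon>"
  obtains \<eta> :: real where "0 < \<eta>"
    "\<And>z :: nat \<Rightarrow> 'e::{banach, second_countable_topology}. \<forall>k<K. norm (z k) \<le> \<eta> \<Longrightarrow> gauss_norm p K z \<le> ennreal \<epsilon>"
proof -
  interpret G: prob_space gauss_space by (rule prob_space_gauss)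
  define \<eta> where "\<eta> = min 1 (\<epsilon> / (1 + real K * real K))"
  have den: "0 < 1 + real K * real K" by (simp add: add_pos_nonneg)
  have "\<eta> \<le> \<epsilon> / (1 + real K * real K)" by (simp add: \<eta>_def)
  then have "\<eta> * (1 + real K * real K) \<le> \<epsilon>" using den by (simp only: pos_le_divide_eq)
  moreover have "0 < \<eta>" using \<epsilon> den by (simp add: \<eta>_def)
  moreover have "\<eta> \<le> 1" by (simp add: \<eta>_def)
  ultimately have \<eta>: "0 < \<eta>" "\<eta> \<le> 1" "\<eta> * (1 + real K * real K) \<le> \<epsilon>" by blast+
  show thesis
  proof (rule that[OF \<eta>(1)])
    fix z :: "nat \<Rightarrow> 'e" assume z: "\<forall>k<K. norm (z k) \<le> \<eta>"
    have "gauss_norm p K z \<le> (\<integral>\<^sup>+\<gamma>. ennreal \<eta> * (1 + ennreal K * (\<Sum>k<K. ennreal ((\<gamma> k)\<^sup>2))) \<partial>gauss_space)"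
      unfolding gauss_norm_def
    proof (rule nn_integral_mono)
      fix \<gamma> :: "nat \<Rightarrow> real"
      define s where "s = (\<Sum>k<K. \<bar>\<gamma> k\<bar>)"
      have s: "0 \<le> s" by (simp add: s_def sum_nonneg)
      have "norm (\<Sum>k<K. \<gamma> k *\<^sub>R z k) \<le> (\<Sum>k<K. \<bar>\<gamma> k\<bar> * \<eta>)"
        by (rule sum_norm_le) (use z in \<open>auto intro: mult_left_mono\<close>)
      then have "norm (\<Sum>k<K. \<gamma> k *\<^sub>R z k) powr p \<le> (\<eta> * s) powr p"
        using p by (intro powr_mono2) (auto simp: s_def sum_distrib_left mult.commute)
      also have "\<dots> = \<eta> powr p * s powr p" using \<eta> s by (simp add: powr_mult)
      also have "\<dots> \<le> \<eta> * (1 + s\<^sup>2)"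
      proof (rule mult_mono)
        have "\<eta> powr p \<le> \<eta> powr 1" using \<eta> p by (intro powr_mono') auto
        then show "\<eta> powr p \<le> \<eta>" using \<eta> by simp
        show "s powr p \<le> 1 + s\<^sup>2" by (rule powr_le_one_plus_square[OF s p])
      qed (use \<eta> in auto)
      also have "\<dots> \<le> \<eta> * (1 + real K * (\<Sum>k<K. (\<gamma> k)\<^sup>2))"
        using sum_squared_le_sum_of_squares[of "\<lambda>k. \<bar>\<gamma> k\<bar>" "{..<K}"] \<eta>
        by (intro mult_left_mono) (auto simp: s_def mult.commute)
      finally have "ennreal (norm (\<Sum>k<K. \<gamma> k *\<^sub>R z k) powr p) \<le> ennreal (\<eta> * (1 + real K * (\<Sum>k<K. (\<gamma> k)\<^sup>2)))"
        by (rule ennreal_leI)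
      also have "\<dots> = ennreal \<eta> * (1 + ennreal K * (\<Sum>k<K. ennreal ((\<gamma> k)\<^sup>2)))"
        using \<eta> by (subst sum_ennreal) (auto simp: ennreal_mult sum_nonneg)
      finally show "ennreal (norm (\<Sum>k<K. \<gamma> k *\<^sub>R z k) powr p) \<le> ennreal \<eta> * (1 + ennreal K * (\<Sum>k<K. ennreal ((\<gamma> k)\<^sup>2)))" .
    qed
    also have "\<dots> = ennreal \<eta> * (1 + ennreal K * (\<Sum>k<K. 1))"
    proof -
      have [measurable]: "(\<lambda>\<gamma>. ennreal ((\<gamma> k)\<^sup>2)) \<in> borel_measurable gauss_space" for k
        using gauss_component_measurable[of k] by measurable
      have sI: "(\<integral>\<^sup>+\<gamma>. (\<Sum>k<K. ennreal ((\<gamma> k)\<^sup>2)) \<partial>gauss_space) = (\<Sum>k<K. 1)"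
      proof -
        have "(\<integral>\<^sup>+\<gamma>. (\<Sum>k<K. ennreal ((\<gamma> k)\<^sup>2)) \<partial>gauss_space) = (\<Sum>k<K. \<integral>\<^sup>+\<gamma>. ennreal ((\<gamma> k)\<^sup>2) \<partial>gauss_space)"
          by (rule nn_integral_sum) measurable
        then show ?thesis by (simp only: gauss_second_moment)
      qed
      have "(\<lambda>\<gamma>. (\<Sum>k<K. ennreal ((\<gamma> k)\<^sup>2))) \<in> borel_measurable gauss_space" by measurable
      then show ?thesis
        by (simp add: nn_integral_cmult nn_integral_add sI G.emeasure_space_1[unfolded space_gauss] del: sum_ennreal)
    qed
    also have "\<dots> = ennreal (\<eta> * (1 + real K * real K))"
      using \<eta> by (simp add: ennreal_mult ennreal_of_nat_eq_real_of_nat)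
    also have "\<dots> \<le> ennreal \<epsilon>" using \<eta> by (intro ennreal_leI)
    finally show "gauss_norm p K z \<le> ennreal \<epsilon>" .
  qed
qed

lemma powr_integral_add_le:
  fixes U V :: "'a \<Rightarrow> 'e::{banach, second_countable_topology}"
  assumes [measurable]: "U \<in> borel_measurable N" "V \<in> borel_measurable N" and p: "1 \<le> p" "p \<le> 2"
  shows "(\<integral>\<^sup>+x. ennreal (norm (U x + V x) powr p) \<partial>N) \<le>
    4 * ((\<integral>\<^sup>+x. ennreal (norm (U x) powr p) \<partial>N) + (\<integral>\<^sup>+x. ennreal (norm (V x) powr p) \<partial>N))"
proof -
  have "(\<integral>\<^sup>+x. ennreal (norm (U x + V x) powr p) \<partial>N) \<le>
      (\<integral>\<^sup>+x. 4 * (ennreal (norm (U x) powr p) + ennreal (norm (V x) powr p)) \<partial>N)"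
  proof (rule nn_integral_mono)
    fix x
    have "norm (U x + V x) powr p \<le> (norm (U x) + norm (V x)) powr p"
      using p by (intro powr_mono2 norm_triangle_ineq) auto
    also have "\<dots> \<le> 4 * (norm (U x) powr p + norm (V x) powr p)" using p by (intro powr_add_le) auto
    finally have "ennreal (norm (U x + V x) powr p) \<le> ennreal (4 * (norm (U x) powr p + norm (V x) powr p))" by (rule ennreal_leI)
    then show "ennreal (norm (U x + V x) powr p) \<le> 4 * (ennreal (norm (U x) powr p) + ennreal (norm (V x) powr p))"
      by (simp add: ennreal_mult' ennreal_plus)
  qed
  also have "\<dots> = 4 * ((\<integral>\<^sup>+x. ennreal (norm (U x) powr p) \<partial>N) + (\<integral>\<^sup>+x. ennreal (norm (V x) powr p) \<partial>N))"
    by (simp add: nn_integral_cmult nn_integral_add)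
  finally show ?thesis .
qed

lemma gauss_norm_add_le:
  fixes y z :: "nat \<Rightarrow> 'e::{banach, second_countable_topology}"
  assumes "1 \<le> p" "p \<le> 2"
  shows "gauss_norm p n (\<lambda>k. y k + z k) \<le> 4 * (gauss_norm p n y + gauss_norm p n z)"
  using powr_integral_add_le[OF gauss_partial_sum_measurable[where n=n and y=y] gauss_partial_sum_measurable[where n=n and y=z] assms]
  unfolding gauss_norm_def by (simp add: scaleR_add_right sum.distrib)

lemma gauss_norm_uminus: "gauss_norm p n (\<lambda>k. - y k) = gauss_norm p n y"
  by (simp add: gauss_norm_def sum_negf)

text \<open>Since a and b vanish beyond K, the left side is the norm of (y - b) - (y - a) at every
  level n >= K, and n can be chosen with both terms below their upper limits plus a small
  excess.\<close>

lemma gauss_norm_diff_le: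
  fixes y z :: "nat \<Rightarrow> 'e::{banach, second_countable_topology}"
  assumes p: "1 \<le> p" "p \<le> 2" and a: "\<And>k. K \<le> k \<Longrightarrow> a k = 0" and b: "\<And>k. K \<le> k \<Longrightarrow> b k = 0"
  shows "gauss_norm p K (\<lambda>k. a k - b k) \<le> 4 * (gauss_limsup p (\<lambda>k. y k - a k) + gauss_limsup p (\<lambda>k. y k - b k))"
proof (rule ennreal_le_epsilon)
  let ?U = "gauss_limsup p (\<lambda>k. y k - a k)" and ?V = "gauss_limsup p (\<lambda>k. y k - b k)"
  fix e :: real assume fin: "4 * (?U + ?V) < top" and e: "0 < e"
  have UV: "?U < top" "?V < top" using fin by (auto simp: ennreal_mult_less_top)
  have lt: "u < u + ennreal (e / 8)" if "u < top" for u
    using that e by (cases u) (auto simp: ennreal_lessI simp flip: ennreal_plus)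
  have "\<forall>\<^sub>F n in sequentially. gauss_norm p n (\<lambda>k. y k - a k) < ?U + ennreal (e / 8)"
    by (rule Limsup_lessD) (use lt[OF UV(1)] in \<open>simp add: gauss_limsup_def\<close>)
  moreover have "\<forall>\<^sub>F n in sequentially. gauss_norm p n (\<lambda>k. y k - b k) < ?V + ennreal (e / 8)"
    by (rule Limsup_lessD) (use lt[OF UV(2)] in \<open>simp add: gauss_limsup_def\<close>)
  moreover have "\<forall>\<^sub>F n in sequentially. K \<le> n" by (rule eventually_ge_at_top)
  ultimately have "\<forall>\<^sub>F n in sequentially. gauss_norm p n (\<lambda>k. y k - a k) < ?U + ennreal (e / 8) \<and>
      gauss_norm p n (\<lambda>k. y k - b k) < ?V + ennreal (e / 8) \<and> K \<le> n" by eventually_elim simp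
  then obtain n where n: "gauss_norm p n (\<lambda>k. y k - a k) < ?U + ennreal (e / 8)"
      "gauss_norm p n (\<lambda>k. y k - b k) < ?V + ennreal (e / 8)" "K \<le> n"
    using eventually_happens'[of sequentially] by auto
  have "(\<Sum>k<n. \<gamma> k *\<^sub>R (a k - b k)) = (\<Sum>k<K. \<gamma> k *\<^sub>R (a k - b k))" for \<gamma> :: "nat \<Rightarrow> real"
    using n(3) a b by (intro sum.mono_neutral_right) auto
  then have "gauss_norm p K (\<lambda>k. a k - b k) = gauss_norm p n (\<lambda>k. (y k - b k) + - (y k - a k))"
    by (simp add: gauss_norm_def)
  also have "\<dots> \<le> 4 * (gauss_norm p n (\<lambda>k. y k - b k) + gauss_norm p n (\<lambda>k. y k - a k))"
    using gauss_norm_add_le[OF p, of n "\<lambda>k. y k - b k" "\<lambda>k. - (y k - a k)"] unfolding gauss_norm_uminus .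
  also have "\<dots> \<le> 4 * ((?V + ennreal (e / 8)) + (?U + ennreal (e / 8)))"
    using n by (intro mult_left_mono add_mono) auto
  also have "\<dots> = 4 * (?U + ?V) + ennreal e"
  proof -
    obtain u v where uv: "?U = ennreal u" "0 \<le> u" "?V = ennreal v" "0 \<le> v"
      using UV by (cases ?U; cases ?V) auto
    have "ennreal v + ennreal (e / 8) = ennreal (v + e / 8)" "ennreal u + ennreal (e / 8) = ennreal (u + e / 8)"
      using uv e by (auto intro!: ennreal_plus[symmetric])
    then have "4 * ((ennreal v + ennreal (e / 8)) + (ennreal u + ennreal (e / 8))) = ennreal (4 * ((v + e / 8) + (u + e / 8)))"
      using uv e by (simp only:) (intro ennreal_four_add, auto)
    also have "4 * ((v + e / 8) + (u + e / 8)) = 4 * (u + v) + e" by simp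
    also have "ennreal \<dots> = ennreal (4 * (u + v)) + ennreal e" using uv e by (intro ennreal_plus) auto
    also have "ennreal (4 * (u + v)) = 4 * (ennreal u + ennreal v)" using uv by (intro ennreal_four_add[symmetric])
    finally show ?thesis unfolding uv .
  qed
  finally show "gauss_norm p K (\<lambda>k. a k - b k) \<le> 4 * (?U + ?V) + ennreal e" .
qed

text \<open>An elementary interpolation that turns mean square convergence into convergence of p-th
  moments: for f > \<delta> the ratio f/\<delta> exceeds 1 and its p-th power is at most its
  square.\<close>

lemma powr_le_square_plus:
  fixes f \<delta> p :: real
  assumes "0 \<le> f" "0 < \<delta>" "\<delta> \<le> 1" "1 \<le> p" "p \<le> 2" shows "f powr p \<le> \<delta> + f\<^sup>2 / \<delta>\<^sup>2"
proof (cases "f \<le> \<delta>")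
  case True
  have "f powr p \<le> \<delta> powr p" using assms True by (intro powr_mono2) auto
  also have "\<dots> \<le> \<delta> powr 1" using assms by (intro powr_mono') auto
  finally have "f powr p \<le> \<delta>" using assms by simp
  moreover have "0 \<le> f\<^sup>2 / \<delta>\<^sup>2" by simp
  ultimately show ?thesis by linarith
next
  case False
  have "f \<le> f / \<delta>" using assms mult_left_le[of \<delta> f] by (simp add: pos_le_divide_eq)
  then have "f powr p \<le> (f / \<delta>) powr p" using assms by (intro powr_mono2) auto
  also have "\<dots> \<le> (f / \<delta>) powr 2" using assms False by (intro powr_mono) auto
  also have "\<dots> = f\<^sup>2 / \<delta>\<^sup>2" using assms False by (simp add: power_divide)
  finally show ?thesis using assms by simp
qed

lemma ennreal_real_below: "0 < (a::ennreal) \<Longrightarrow> \<exists>b>0. ennreal b \<le> a"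
  by (cases a) (auto intro: exI[of _ 1])

lemma gaussian_series_powr:
  fixes g :: "'h::real_inner \<Rightarrow> 'e::{banach, second_countable_topology}"
  assumes X: "gaussian_series h g X" and p: "1 \<le> p" "p \<le> 2"
  shows "(\<lambda>n. \<integral>\<^sup>+\<gamma>. ennreal (norm ((\<Sum>k<n. \<gamma> k *\<^sub>R g (h k)) - X \<gamma>) powr p) \<partial>gauss_space) \<longlonglongrightarrow> 0"
proof (rule order_tendstoI)
  interpret G: prob_space gauss_space by (rule prob_space_gauss)
  fix a :: ennreal assume "0 < a"
  then obtain b where b: "0 < b" "ennreal b \<le> a" using ennreal_real_below by blast
  define \<delta> where "\<delta> = min 1 (b / 3)"
  have \<delta>: "0 < \<delta>" "\<delta> \<le> 1" "\<delta> \<le> b / 3" using b by (auto simp: \<delta>_def)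
  let ?d = "\<lambda>n \<gamma>. norm ((\<Sum>k<n. \<gamma> k *\<^sub>R g (h k)) - X \<gamma>)"
  have [measurable]: "X \<in> borel_measurable gauss_space" using X by (simp add: gaussian_series_def)
  have dm[measurable]: "?d n \<in> borel_measurable gauss_space" for n
    using gauss_partial_sum_measurable[where n=n and y="\<lambda>k. g (h k)"] by measurable
  have "(\<lambda>n. \<integral>\<^sup>+\<gamma>. ennreal ((?d n \<gamma>)\<^sup>2) \<partial>gauss_space) \<longlonglongrightarrow> 0" using X by (simp add: gaussian_series_def)
  then have "\<forall>\<^sub>F n in sequentially. (\<integral>\<^sup>+\<gamma>. ennreal ((?d n \<gamma>)\<^sup>2) \<partial>gauss_space) < ennreal (\<delta>\<^sup>2 * (b / 3))"
    by (rule order_tendstoD) (use \<delta> b in simp)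
  then show "\<forall>\<^sub>F n in sequentially. (\<integral>\<^sup>+\<gamma>. ennreal (?d n \<gamma> powr p) \<partial>gauss_space) < a"
  proof eventually_elim
    case (elim n)
    have "(\<integral>\<^sup>+\<gamma>. ennreal (?d n \<gamma> powr p) \<partial>gauss_space) \<le> (\<integral>\<^sup>+\<gamma>. ennreal \<delta> + ennreal (1 / \<delta>\<^sup>2) * ennreal ((?d n \<gamma>)\<^sup>2) \<partial>gauss_space)"
    proof (rule nn_integral_mono)
      fix \<gamma>
      have "ennreal (?d n \<gamma> powr p) \<le> ennreal (\<delta> + (?d n \<gamma>)\<^sup>2 / \<delta>\<^sup>2)"
        using \<delta> p by (intro ennreal_leI powr_le_square_plus) auto
      also have "\<dots> = ennreal \<delta> + ennreal (1 / \<delta>\<^sup>2 * (?d n \<gamma>)\<^sup>2)" using \<delta> by (subst ennreal_plus) auto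
      also have "ennreal (1 / \<delta>\<^sup>2 * (?d n \<gamma>)\<^sup>2) = ennreal (1 / \<delta>\<^sup>2) * ennreal ((?d n \<gamma>)\<^sup>2)" by (rule ennreal_mult) auto
      finally show "ennreal (?d n \<gamma> powr p) \<le> ennreal \<delta> + ennreal (1 / \<delta>\<^sup>2) * ennreal ((?d n \<gamma>)\<^sup>2)" .
    qed
    also have "\<dots> = ennreal \<delta> + ennreal (1 / \<delta>\<^sup>2) * (\<integral>\<^sup>+\<gamma>. ennreal ((?d n \<gamma>)\<^sup>2) \<partial>gauss_space)"
      by (simp add: nn_integral_add nn_integral_cmult G.emeasure_space_1[unfolded space_gauss])
    also have "\<dots> \<le> ennreal \<delta> + ennreal (1 / \<delta>\<^sup>2) * ennreal (\<delta>\<^sup>2 * (b / 3))"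
      using elim by (intro add_left_mono mult_left_mono) auto
    also have "ennreal (1 / \<delta>\<^sup>2) * ennreal (\<delta>\<^sup>2 * (b / 3)) = ennreal (b / 3)"
      using \<delta> b by (subst ennreal_mult[symmetric]) auto
    also have "ennreal \<delta> + ennreal (b / 3) = ennreal (\<delta> + b / 3)" using \<delta> b by (intro ennreal_plus[symmetric]) auto
    also have "\<dots> < ennreal b" using \<delta> b by (intro ennreal_lessI) auto
    finally show ?case using b(2) by (rule order_less_le_trans)
  qed
qed simp

lemma limsup_le_of_tendsto:
  fixes u v :: "nat \<Rightarrow> ennreal"
  assumes "\<forall>\<^sub>F n in sequentially. u n \<le> 4 * (v n + c)" "v \<longlonglongrightarrow> 0"
  shows "limsup u \<le> 4 * c"
proof -
  have "(\<lambda>n. 4 * (v n + c)) \<longlonglongrightarrow> 4 * (0 + c)"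
    using assms(2) by (intro ennreal_tendsto_cmult tendsto_add tendsto_const) auto
  then have "limsup (\<lambda>n. 4 * (v n + c)) = 4 * c" by (subst lim_imp_Limsup) auto
  then show ?thesis using Limsup_mono[OF assms(1)] by simp
qed

text \<open>Partial sums converge in p-th mean to any limit of the series, in particular to the one
  chosen in \<open>R_norm_pow\<close>; the factor 4 comes from splitting the partial sum at that
  limit.\<close>

lemma gauss_limsup_le_R_norm_pow:
  fixes g :: "'h::real_inner \<Rightarrow> 'e::{banach, second_countable_topology}"
  assumes X: "\<exists>X. gaussian_series h g X" and p: "1 \<le> p" "p \<le> 2"
  shows "gauss_limsup p (\<lambda>k. g (h k)) \<le> 4 * R_norm_pow p h g"
proof -
  define X where "X = (SOME X. gaussian_series h g X)"
  have X: "gaussian_series h g X" unfolding X_def using assms(1) by (rule someI_ex)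
  then have Xm: "X \<in> borel_measurable gauss_space" by (simp add: gaussian_series_def)
  have "gauss_norm p n (\<lambda>k. g (h k)) \<le>
      4 * ((\<integral>\<^sup>+\<gamma>. ennreal (norm ((\<Sum>k<n. \<gamma> k *\<^sub>R g (h k)) - X \<gamma>) powr p) \<partial>gauss_space) + R_norm_pow p h g)" for n
    using powr_integral_add_le[OF borel_measurable_diff[OF gauss_partial_sum_measurable[where n=n and y="\<lambda>k. g (h k)"] Xm] Xm p]
    unfolding gauss_norm_def R_norm_pow_def X_def[symmetric] by simp
  then show ?thesis unfolding gauss_limsup_def
    by (intro limsup_le_of_tendsto[OF always_eventually gaussian_series_powr[OF X p]]) simp
qed

text \<open>The difference splits into S_n - X, which tends to 0, and X - S_K plus a sum over k < K,
  which is small once K is large and the coefficients are close. Each of the two splittings costs a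
  factor 4, whence \<epsilon>/32.\<close>

lemma gauss_limsup_approx:
  fixes g :: "'h::real_inner \<Rightarrow> 'e::{banach, second_countable_topology}"
  assumes X: "gaussian_series h g X" and p: "1 \<le> p" "p \<le> 2" and \<epsilon>: "0 < \<epsilon>"
  obtains K \<eta> where "0 < \<eta>" "\<And>q. \<forall>k<K. norm (g (h k) - q k) \<le> \<eta> \<Longrightarrow> \<forall>k\<ge>K. q k = 0 \<Longrightarrow>
    gauss_limsup p (\<lambda>k. g (h k) - q k) \<le> ennreal \<epsilon>"
proof -
  let ?S = "\<lambda>n \<gamma>. \<Sum>k<n. \<gamma> k *\<^sub>R g (h k)"
  let ?a = "\<lambda>n. \<integral>\<^sup>+\<gamma>. ennreal (norm (?S n \<gamma> - X \<gamma>) powr p) \<partial>gauss_space"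
  have lim: "?a \<longlonglongrightarrow> 0" by (rule gaussian_series_powr[OF X p])
  have Xm: "X \<in> borel_measurable gauss_space" using X by (simp add: gaussian_series_def)
  have "\<forall>\<^sub>F n in sequentially. ?a n < ennreal (\<epsilon> / 32)" using lim by (rule order_tendstoD) (use \<epsilon> in simp)
  then obtain K where K: "?a K < ennreal (\<epsilon> / 32)" using eventually_happens'[of sequentially] by auto
  have e32: "0 < \<epsilon> / 32" using \<epsilon> by simp
  obtain \<eta> where \<eta>: "0 < \<eta>" "\<And>z :: nat \<Rightarrow> 'e. \<forall>k<K. norm (z k) \<le> \<eta> \<Longrightarrow> gauss_norm p K z \<le> ennreal (\<epsilon> / 32)"
    by (rule gauss_norm_small[OF p e32]) (rule that; assumption)
  show thesis
  proof (rule that[OF \<eta>(1)])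
    fix q assume q: "\<forall>k<K. norm (g (h k) - q k) \<le> \<eta>" "\<forall>k\<ge>K. q k = 0"
    let ?z = "\<lambda>k. g (h k) - q k"
    let ?R = "\<lambda>\<gamma>. \<Sum>k<K. \<gamma> k *\<^sub>R ?z k"
    let ?c = "\<integral>\<^sup>+\<gamma>. ennreal (norm (- (?S K \<gamma> - X \<gamma>) + ?R \<gamma>) powr p) \<partial>gauss_space"
    have m: "(\<lambda>\<gamma>. ?S n \<gamma> - X \<gamma>) \<in> borel_measurable gauss_space" for n
      by (intro borel_measurable_diff gauss_partial_sum_measurable Xm)
    have "?c \<le> 4 * ((\<integral>\<^sup>+\<gamma>. ennreal (norm (- (?S K \<gamma> - X \<gamma>)) powr p) \<partial>gauss_space) + (\<integral>\<^sup>+\<gamma>. ennreal (norm (?R \<gamma>) powr p) \<partial>gauss_space))"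
      by (rule powr_integral_add_le[OF borel_measurable_uminus[OF m] gauss_partial_sum_measurable p])
    also have "\<dots> \<le> 4 * (ennreal (\<epsilon> / 32) + ennreal (\<epsilon> / 32))"
      using K \<eta>(2)[of ?z] q(1) unfolding norm_minus_cancel gauss_norm_def by (intro mult_left_mono add_mono) auto
    also have "\<dots> = ennreal (4 * (\<epsilon> / 32 + \<epsilon> / 32))" using \<epsilon> by (intro ennreal_four_add) auto
    finally have c: "?c \<le> ennreal (\<epsilon> / 4)" by (rule order_trans) (simp add: ennreal_leI)
    have "gauss_norm p n ?z \<le> 4 * (?a n + ?c)" if "K \<le> n" for n
    proof -
      have "(\<Sum>k<n. \<gamma> k *\<^sub>R q k) = (\<Sum>k<K. \<gamma> k *\<^sub>R q k)" for \<gamma> :: "nat \<Rightarrow> real"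
        using that q(2) by (intro sum.mono_neutral_right) auto
      then have "(\<Sum>k<n. \<gamma> k *\<^sub>R ?z k) = (?S n \<gamma> - X \<gamma>) + (- (?S K \<gamma> - X \<gamma>) + ?R \<gamma>)" for \<gamma>
        by (simp add: scaleR_diff_right sum_subtractf)
      then show ?thesis unfolding gauss_norm_def
        using powr_integral_add_le[OF m[of n] borel_measurable_add[OF borel_measurable_uminus[OF m[of K]] gauss_partial_sum_measurable[where n=K and y="?z"]] p]
        by simp
    qed
    then have "\<forall>\<^sub>F n in sequentially. gauss_norm p n ?z \<le> 4 * (?a n + ?c)" by (intro eventually_sequentiallyI[of K])
    then have "gauss_limsup p ?z \<le> 4 * ?c" unfolding gauss_limsup_def by (rule limsup_le_of_tendsto[OF _ lim])
    also have "\<dots> \<le> 4 * ennreal (\<epsilon> / 4)" by (intro mult_left_mono c) simp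
    also have "\<dots> = ennreal (4 * (\<epsilon> / 4))" using \<epsilon> by (subst ennreal_mult) auto
    finally show "gauss_limsup p ?z \<le> ennreal \<epsilon>" by simp
  qed
qed

text \<open>Index 0 is reserved for the zero sequence, the candidate whose error the hypothesis
  dominates; the other indices decode finite lists of points of a countable dense set. Entries over
  zero basis vectors are set to 0 to meet the masking condition.\<close>

lemma dense_finite_sequences:
  fixes h :: "nat \<Rightarrow> 'h::zero"
  obtains q :: "nat \<Rightarrow> nat \<Rightarrow> 'e::{real_normed_vector, second_countable_topology}" and supp :: "nat \<Rightarrow> nat"
  where "\<And>k. q 0 k = 0" "\<And>m k. h k = 0 \<Longrightarrow> q m k = 0" "\<And>m k. supp m \<le> k \<Longrightarrow> q m k = 0"
    "\<And>y K \<eta>. \<forall>k. h k = 0 \<longrightarrow> y k = 0 \<Longrightarrow> 0 < \<eta> \<Longrightarrow> \<exists>m. (\<forall>k<K. norm (y k - q m k) \<le> \<eta>) \<and> (\<forall>k\<ge>K. q m k = 0)"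
proof -
  obtain D :: "'e set" where D: "countable D" "\<And>X. open X \<Longrightarrow> X \<noteq> {} \<Longrightarrow> \<exists>d\<in>D. d \<in> X"
    using countable_dense_setE by blast
  define d where "d = from_nat_into D"
  have D_ne: "D \<noteq> {}" using D(2)[of UNIV] by auto
  have dense: "\<exists>n. norm (x - d n) \<le> \<eta>" if \<eta>: "0 < \<eta>" for x and \<eta> :: real
  proof -
    obtain e where e: "e \<in> D" "e \<in> ball x \<eta>" using D(2)[of "ball x \<eta>"] \<eta> by auto
    then obtain n where "d n = e" using D(1) from_nat_into_surj[OF D(1) e(1)] unfolding d_def by auto
    then show ?thesis using e(2) by (auto simp: dist_norm intro!: exI[of _ n])
  qed
  define l where "l m = (from_nat (m - 1) :: nat list)" for m
  define q where "q m k = (if 0 < m \<and> k < length (l m) \<and> h k \<noteq> 0 then d (l m ! k) else 0)" for m k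
  show thesis
  proof (rule that[of q "\<lambda>m. length (l m)"])
    fix y :: "nat \<Rightarrow> 'e" and K and \<eta> :: real assume y: "\<forall>k. h k = 0 \<longrightarrow> y k = 0" and \<eta>: "0 < \<eta>"
    have "\<forall>k. \<exists>n. norm (y k - d n) \<le> \<eta>" using dense[OF \<eta>] by blast
    then obtain e where e: "\<And>k. norm (y k - d (e k)) \<le> \<eta>" by metis
    define m where "m = Suc (to_nat (map e [0..<K]))"
    have "l m = map e [0..<K]" by (simp add: l_def m_def)
    then have "(\<forall>k<K. norm (y k - q m k) \<le> \<eta>) \<and> (\<forall>k\<ge>K. q m k = 0)"
      using e y \<eta> by (auto simp: q_def m_def)
    then show "\<exists>m. (\<forall>k<K. norm (y k - q m k) \<le> \<eta>) \<and> (\<forall>k\<ge>K. q m k = 0)" by blast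
  qed (auto simp: q_def)
qed

context subordinated_wiener_basis begin

text \<open>By Parseval the basis coefficients of d are v (y k - q k), so its norm is the limit of
  the standard deviations of v applied to the Gaussian partial sums. The p-th moment of a scalar
  Gaussian is a fixed multiple of the p-th power of its deviation and at most |v|^p times the
  vector-valued one.\<close>

lemma norm_le_gauss_limsup:
  fixes y q :: "nat \<Rightarrow> 'e::{banach, second_countable_topology}" and v :: "'e \<Rightarrow>\<^sub>L real"
  assumes p: "1 \<le> p" and c: "0 < c" "ennreal c \<le> (\<integral>\<^sup>+\<gamma>. ennreal (\<bar>\<gamma> 0\<bar> powr p) \<partial>gauss_space)"
    and x: "\<And>k. inner x (h k) = v (y k)" and mask: "\<And>k. h k = 0 \<Longrightarrow> q k = 0" and supp: "\<And>k. K \<le> k \<Longrightarrow> q k = 0"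
  shows "ennreal (norm (x - (\<Sum>k<K. v (q k) *\<^sub>R h k)) powr p) \<le>
    ennreal ((norm v powr p + 1) / c) * gauss_limsup p (\<lambda>k. y k - q k)"
proof -
  define d where "d = x - (\<Sum>k<K. v (q k) *\<^sub>R h k)"
  \<comment> \<open>The added 1 allows division also when v = 0.\<close>
  define V where "V = norm v powr p + 1"
  have V: "0 < V" by (simp add: V_def add_nonneg_pos)
  have inn: "inner d (h k) = v (y k - q k)" for k
  proof -
    have orth: "inner (h i) (h k) = (if i = k \<and> h k \<noteq> 0 then 1 else 0)" for i
      using basis unfolding orthonormal_basis_def by (auto simp: dot_square_norm)
    have "inner (\<Sum>i<K. v (q i) *\<^sub>R h i) (h k) = (\<Sum>i<K. if i = k then (if h k \<noteq> 0 then v (q k) else 0) else 0)"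
      unfolding inner_sum_left by (intro sum.cong refl) (auto simp: orth)
    also have "\<dots> = v (q k)" using mask[of k] supp[of k] by (auto simp: blinfun.zero_right)
    finally show ?thesis by (simp add: d_def inner_diff_left x blinfun.diff_right)
  qed
  have "(\<lambda>n. \<Sum>k<n. (v (y k - q k))\<^sup>2) \<longlonglongrightarrow> (norm d)\<^sup>2"
    using orthonormal_basis_parseval[OF basis, of d] unfolding sums_def inn .
  then have "(\<lambda>n. sqrt (\<Sum>k<n. (v (y k - q k))\<^sup>2)) \<longlonglongrightarrow> sqrt ((norm d)\<^sup>2)" by (rule tendsto_real_sqrt)
  then have "(\<lambda>n. sqrt (\<Sum>k<n. (v (y k - q k))\<^sup>2) powr p) \<longlonglongrightarrow> norm d powr p"
    using p by (intro tendsto_powr2 tendsto_const) (auto intro!: always_eventually sum_nonneg)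
  then have lim: "(\<lambda>n. ennreal (c / V * sqrt (\<Sum>k<n. (v (y k - q k))\<^sup>2) powr p)) \<longlonglongrightarrow> ennreal (c / V * norm d powr p)"
    by (intro tendsto_ennrealI tendsto_mult tendsto_const)
  have le: "ennreal (c / V * sqrt (\<Sum>k<n. (v (y k - q k))\<^sup>2) powr p) \<le> gauss_norm p n (\<lambda>k. y k - q k)" for n
  proof -
    let ?t = "sqrt (\<Sum>k<n. (v (y k - q k))\<^sup>2) powr p"
    have "ennreal c * ennreal ?t \<le> (\<integral>\<^sup>+\<gamma>. ennreal (\<bar>\<gamma> 0\<bar> powr p) \<partial>gauss_space) * ennreal ?t"
      by (rule mult_right_mono[OF c(2)]) simp
    also have "\<dots> = (\<integral>\<^sup>+\<gamma>. ennreal (\<bar>\<Sum>k<n. \<gamma> k * v (y k - q k)\<bar> powr p) \<partial>gauss_space)"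
      by (simp only: gauss_sum_moment mult.commute)
    also have "\<dots> \<le> (\<integral>\<^sup>+\<gamma>. ennreal V * ennreal (norm (\<Sum>k<n. \<gamma> k *\<^sub>R (y k - q k)) powr p) \<partial>gauss_space)"
    proof (rule nn_integral_mono)
      fix \<gamma> :: "nat \<Rightarrow> real"
      let ?s = "\<Sum>k<n. \<gamma> k *\<^sub>R (y k - q k)"
      have "(\<Sum>k<n. \<gamma> k * v (y k - q k)) = v ?s" by (simp add: blinfun.sum_right blinfun.scaleR_right)
      then have "\<bar>\<Sum>k<n. \<gamma> k * v (y k - q k)\<bar> powr p \<le> (norm v * norm ?s) powr p"
        using p norm_blinfun[of v ?s] by (intro powr_mono2) auto
      also have "\<dots> = norm v powr p * norm ?s powr p" by (simp add: powr_mult)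
      also have "\<dots> \<le> V * norm ?s powr p" by (intro mult_right_mono) (auto simp: V_def)
      finally have "ennreal (\<bar>\<Sum>k<n. \<gamma> k * v (y k - q k)\<bar> powr p) \<le> ennreal (V * norm ?s powr p)" by (rule ennreal_leI)
      also have "\<dots> = ennreal V * ennreal (norm ?s powr p)" using V by (intro ennreal_mult) auto
      finally show "ennreal (\<bar>\<Sum>k<n. \<gamma> k * v (y k - q k)\<bar> powr p) \<le> ennreal V * ennreal (norm ?s powr p)" .
    qed
    also have "\<dots> = ennreal V * gauss_norm p n (\<lambda>k. y k - q k)"
      unfolding gauss_norm_def
    proof (rule nn_integral_cmult)
      show "(\<lambda>\<gamma>. ennreal (norm (\<Sum>k<n. \<gamma> k *\<^sub>R (y k - q k)) powr p)) \<in> borel_measurable gauss_space"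
        using gauss_partial_sum_measurable[where n=n and y="\<lambda>k. y k - q k"] by measurable
    qed
    finally have le: "ennreal c * ennreal ?t \<le> ennreal V * gauss_norm p n (\<lambda>k. y k - q k)" .
    show ?thesis
    proof (cases "gauss_norm p n (\<lambda>k. y k - q k)")
      case (real r)
      then have "ennreal (c * ?t) \<le> ennreal (V * r)" using le c(1) V by (simp add: ennreal_mult)
      then have "c * ?t \<le> V * r" using real V by (simp add: ennreal_le_iff)
      then have "c / V * ?t \<le> r" using V by (simp add: field_simps)
      then show ?thesis unfolding real by (rule ennreal_leI)
    qed simp
  qed
  have "ennreal (c / V * norm d powr p) = limsup (\<lambda>n. ennreal (c / V * sqrt (\<Sum>k<n. (v (y k - q k))\<^sup>2) powr p))"
    by (rule lim_imp_Limsup[OF _ lim, symmetric]) simp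
  also have "\<dots> \<le> gauss_limsup p (\<lambda>k. y k - q k)"
    unfolding gauss_limsup_def by (intro Limsup_mono always_eventually allI le)
  finally have "ennreal (V / c) * ennreal (c / V * norm d powr p) \<le> ennreal (V / c) * gauss_limsup p (\<lambda>k. y k - q k)"
    by (rule mult_left_mono) simp
  also have "ennreal (V / c) * ennreal (c / V * norm d powr p) = ennreal (norm d powr p)"
    using V c(1) by (subst ennreal_mult[symmetric]) auto
  finally show ?thesis unfolding d_def V_def .
qed

lemma gauss_limsup_measurable:
  fixes x :: "nat \<Rightarrow> real \<Rightarrow> 'e::{banach, second_countable_topology}"
  assumes [measurable]: "\<And>k. x k \<in> borel_measurable time_measure"
  shows "(\<lambda>s. gauss_limsup p (\<lambda>k. x k s - q k)) \<in> borel_measurable time_measure"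
  unfolding gauss_limsup_def
proof (rule borel_measurable_limsup)
  interpret G: prob_space gauss_space by (rule prob_space_gauss)
  fix n
  note gauss_component_measurable[measurable]
  show "(\<lambda>s. gauss_norm p n (\<lambda>k. x k s - q k)) \<in> borel_measurable time_measure"
    unfolding gauss_norm_def by measurable
qed

section \<open>Integrals of the semigroup\<close>

text \<open>At almost every time in A the operator is represented by the coefficients x k s = T(s) i
  h_k in E, and \<open>D m s\<close> is the Gaussian distance of this sequence from candidate m.
  What remains is to supply measurability and the domination of \<open>D 0\<close>.\<close>

lemma semigroup_integral:
  fixes S :: "real \<Rightarrow> 'v \<Rightarrow>\<^sub>L 'v" and i :: "'h \<Rightarrow>\<^sub>L 'v" and j :: "'e::{banach, second_countable_topology} \<Rightarrow>\<^sub>L 'v"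
  assumes type: "rademacher_type TYPE('e) p" and p: "1 \<le> p" "p \<le> 2"
    and inj: "inj (blinfun_apply j)" and adj: "\<And>v x. inner (istar v) x = blinfun_apply v (blinfun_apply i x)"
    and S: "c0_semigroup_on T S" "weakly_regulated T S"
    and range: "AE t in lborel. 0 < t \<and> t \<le> T \<longrightarrow> range (blinfun_apply (S t)) \<subseteq> range (blinfun_apply j)"
    and rad: "AE t in lborel. t \<in> {0..T} \<longrightarrow> gamma_radonifying h (into_subspace j (S t) i)"
    and fin: "(\<integral>\<^sup>+r\<in>{0<..}. (\<integral>\<^sup>+s\<in>{0..T}. min (ennreal (\<bar>r\<bar> powr (p / 2)) *
      R_norm_pow p h (into_subspace j (S s) i)) 1 \<partial>lborel) \<partial>\<rho>) < \<infinity>"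
    and A: "A \<in> sets borel"
  obtains Y where "Y \<in> borel_measurable M" "\<And>v. is_cyl_integral M L T S A v (\<lambda>w. blinfun_apply v (blinfun_apply j (Y w)))"
proof -
  have Sm: "(\<lambda>s. S s x) \<in> borel_measurable time_measure" for x
  proof -
    have "continuous_on {0..T} (\<lambda>s. S s x)" using S(1) by (simp add: c0_semigroup_on_def)
    then have "(\<lambda>s. S s x) \<in> borel_measurable (restrict_space borel {0..T})" by (rule borel_measurable_continuous_on_restrict)
    moreover have "sets (restrict_space borel {0..T}) = sets time_measure"
      unfolding time_measure_def by (simp add: sets_restrict_space)
    ultimately show ?thesis by (simp cong: measurable_cong_sets)
  qed
  \<comment> \<open>The range condition speaks of positive times; the time 0 is a null set.\<close>
  have "AE s in lborel. s \<in> {0..T} \<longrightarrow> range (blinfun_apply (S s)) \<subseteq> range (blinfun_apply j) \<and> gamma_radonifying h (into_subspace j (S s) i)"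
    using range rad AE_lborel_singleton[of 0] by eventually_elim auto
  then have good_AE: "AE s in time_measure. range (blinfun_apply (S s)) \<subseteq> range (blinfun_apply j) \<and> gamma_radonifying h (into_subspace j (S s) i)"
    unfolding AE_time .
  then obtain N where N: "{s \<in> space time_measure. \<not> (range (blinfun_apply (S s)) \<subseteq> range (blinfun_apply j) \<and> gamma_radonifying h (into_subspace j (S s) i))} \<subseteq> N"
      "emeasure time_measure N = 0" "N \<in> sets time_measure" by (rule AE_E)
  have At: "A \<inter> {0..T} \<in> sets time_measure" unfolding time_measure_def using A by (auto simp: sets_restrict_space)
  \<comment> \<open>Times of A at which both pointwise conditions hold, outside a measurable null
    set. The integrand is replaced by 0 elsewhere, which makes inverse images under \<open>j\<close>
    and Gaussian series available for every s.\<close>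
  define P where "P = A \<inter> {0..T} - N"
  have P[measurable]: "P \<in> sets time_measure" unfolding P_def using At N(3) by (rule sets.Diff)
  have good: "range (blinfun_apply (S s)) \<subseteq> range (blinfun_apply j)" "gamma_radonifying h (into_subspace j (S s) i)" if "s \<in> P" for s
    using that N(1) unfolding P_def by auto
  define F where "F k s = (if s \<in> P then S s (i (h k)) else 0)" for k s
  have Fm: "F k \<in> borel_measurable time_measure" for k
    unfolding F_def by (rule measurable_If_set[OF Sm]) (use sets.Int[OF P sets.top] in simp_all)
  have j0: "blinfun_apply j 0 = 0" by (rule blinfun.zero_right)
  have Fr: "F k s \<in> range (blinfun_apply j)" for k s
  proof (cases "s \<in> P")
    case False
    then show ?thesis using rangeI[of "blinfun_apply j" 0] by (simp add: F_def j0)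
  next
    case True
    have "S s (i (h k)) \<in> range (blinfun_apply j)" by (rule subsetD[OF good(1)[OF True] rangeI])
    then show ?thesis using True by (simp add: F_def)
  qed
  define x where "x k s = inv (blinfun_apply j) (F k s)" for k s
  have jx: "blinfun_apply j (x k s) = F k s" for k s unfolding x_def by (rule f_inv_into_f[OF Fr])
  \<comment> \<open>Continuity of orbits holds in V only; measurability as a map into E comes from
    \<open>borel_measurable_inv\<close>.\<close>
  have xm: "x k \<in> borel_measurable time_measure" for k
    unfolding x_def
    by (rule borel_measurable_inv[OF linear_continuous_on[OF blinfun.bounded_linear_right] inj Fm Fr])
  have inv0: "inv (blinfun_apply j) 0 = 0" using inv_f_f[OF inj, of 0] by (simp add: j0)
  define g where "g s u = (if s \<in> P then into_subspace j (S s) i u else 0)" for s u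
  have xg: "x k s = g s (h k)" for k s by (simp add: x_def g_def F_def into_subspace_def inv0)
  have series: "\<exists>X. gaussian_series h (g s) X" for s
  proof (cases "s \<in> P")
    case True
    then have "g s = into_subspace j (S s) i" by (simp add: g_def fun_eq_iff)
    then show ?thesis using good(2)[OF True] by (simp add: gamma_radonifying_def)
  next
    case False
    then have "gaussian_series h (g s) (\<lambda>_. 0)" by (simp add: g_def gaussian_series_def)
    then show ?thesis by blast
  qed
  have x_mask: "\<forall>k. h k = 0 \<longrightarrow> x k s = 0" for s by (simp add: x_def F_def blinfun.zero_right inv0)
  obtain q :: "nat \<Rightarrow> nat \<Rightarrow> 'e" and supp :: "nat \<Rightarrow> nat" where q0: "\<And>k. q 0 k = 0"
    and mask: "\<And>m k. h k = 0 \<Longrightarrow> q m k = 0" and supp: "\<And>m k. supp m \<le> k \<Longrightarrow> q m k = 0"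
    and dense_q: "\<And>y K \<eta>. \<forall>k. h k = 0 \<longrightarrow> y k = 0 \<Longrightarrow> 0 < \<eta> \<Longrightarrow> \<exists>m. (\<forall>k<K. norm (y k - q m k) \<le> \<eta>) \<and> (\<forall>k\<ge>K. q m k = 0)"
    using dense_finite_sequences[of h, where 'e='e] by blast
  define D where "D m s = gauss_limsup p (\<lambda>k. x k s - q m k)" for m s
  have Dm: "D m \<in> borel_measurable time_measure" for m unfolding D_def by (rule gauss_limsup_measurable[OF xm])
  have approx: "\<exists>m. D m s < \<epsilon>" if \<epsilon>: "0 < \<epsilon>" for s and \<epsilon> :: ennreal
  proof -
    obtain b where b: "0 < b" "ennreal b \<le> \<epsilon>" using ennreal_real_below[OF \<epsilon>] by blast
    obtain X where X: "gaussian_series h (g s) X" using series by blast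
    have b2: "0 < b / 2" using b by simp
    obtain K \<eta> where "0 < \<eta>" and K: "\<And>q. \<forall>k<K. norm (g s (h k) - q k) \<le> \<eta> \<Longrightarrow> \<forall>k\<ge>K. q k = 0 \<Longrightarrow>
        gauss_limsup p (\<lambda>k. g s (h k) - q k) \<le> ennreal (b / 2)"
      by (rule gauss_limsup_approx[OF X p b2]) (rule that; assumption)
    obtain m where m: "\<forall>k<K. norm (x k s - q m k) \<le> \<eta>" "\<forall>k\<ge>K. q m k = 0"
      using dense_q[OF x_mask \<open>0 < \<eta>\<close>] by blast
    have "D m s \<le> ennreal (b / 2)" unfolding D_def xg by (rule K) (use m in \<open>simp_all add: xg\<close>)
    also have "\<dots> < ennreal b" using b by (intro ennreal_lessI) auto
    also note b(2)
    finally show ?thesis by blast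
  qed
  have tri: "gauss_norm p K (\<lambda>k. q a k - q b k) \<le> 4 * (D a s + D b s)" if "supp a \<le> K" "supp b \<le> K" for a b s K
    unfolding D_def using that by (intro gauss_norm_diff_le[OF p] supp) auto
  have D0: "D 0 s \<le> 4 * R_norm_pow p h (into_subspace j (S s) i)" for s
  proof (cases "s \<in> P")
    case True
    then have "g s = into_subspace j (S s) i" by (simp add: g_def fun_eq_iff)
    then show ?thesis using gauss_limsup_le_R_norm_pow[OF series[of s] p] by (simp add: D_def q0 xg)
  next
    case False
    then have "D 0 s = 0" by (simp add: D_def q0 xg g_def gauss_limsup_def gauss_norm_def Limsup_const)
    then show ?thesis by simp
  qed
  interpret Tm: sigma_finite_measure time_measure by (rule sigma_finite_time)
  note Dm[measurable]
  \<comment> \<open>Only \<open>D 0\<close>, which is measurable, is moved in and out of integrals;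
    the R_p norm, of unknown measurability in s, enters through monotonicity alone.\<close>
  have fin': "(\<integral>\<^sup>+r. \<integral>\<^sup>+s. min 1 (ennreal (\<bar>r\<bar> powr (p / 2)) * D 0 s) \<partial>time_measure \<partial>\<rho>) < \<infinity>"
  proof -
    let ?u = "\<lambda>r s. min 1 (ennreal (\<bar>r\<bar> powr (p / 2)) * D 0 s)"
    have um: "(\<lambda>s. ?u r s) \<in> borel_measurable time_measure" for r by measurable
    have um2: "(\<lambda>r. \<integral>\<^sup>+s. ?u r s \<partial>time_measure) \<in> borel_measurable \<rho>" by measurable
    have "ennreal (1/4) * (\<integral>\<^sup>+r. \<integral>\<^sup>+s. ?u r s \<partial>time_measure \<partial>\<rho>) = (\<integral>\<^sup>+r. \<integral>\<^sup>+s. ennreal (1/4) * ?u r s \<partial>time_measure \<partial>\<rho>)"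
      by (simp only: nn_integral_cmult[OF um] nn_integral_cmult[OF um2])
    also have "\<dots> \<le> (\<integral>\<^sup>+r\<in>{0<..}. (\<integral>\<^sup>+s\<in>{0..T}. min (ennreal (\<bar>r\<bar> powr (p / 2)) *
      R_norm_pow p h (into_subspace j (S s) i)) 1 \<partial>lborel) \<partial>\<rho>)"
    proof (rule nn_integral_mono_AE, use AE_rho_pos in eventually_elim)
      fix r :: real assume r: "0 < r"
      have "(\<integral>\<^sup>+s. ennreal (1/4) * ?u r s \<partial>time_measure) \<le> (\<integral>\<^sup>+s. min (ennreal (\<bar>r\<bar> powr (p / 2)) *
          R_norm_pow p h (into_subspace j (S s) i)) 1 \<partial>time_measure)"
      proof (rule nn_integral_mono)
        fix s
        let ?R = "R_norm_pow p h (into_subspace j (S s) i)" and ?r = "ennreal (\<bar>r\<bar> powr (p / 2))"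
        have "?u r s \<le> min 1 (4 * (?r * ?R))"
          unfolding mult.left_commute[of 4] by (intro min.mono order_refl mult_left_mono D0) simp
        also have "\<dots> \<le> 4 * min 1 (?r * ?R)" by (rule min_one_mult_le) simp
        finally have "ennreal (1/4) * ?u r s \<le> ennreal (1/4) * (4 * min 1 (?r * ?R))" by (rule mult_left_mono) simp
        also have "\<dots> = (ennreal (1/4) * ennreal 4) * min 1 (?r * ?R)" by (simp add: mult.assoc)
        also have "ennreal (1/4) * ennreal 4 = 1" by (subst ennreal_mult[symmetric]) auto
        finally show "ennreal (1/4) * ?u r s \<le> min (?r * ?R) 1" by (simp add: min.commute)
      qed
      then show "(\<integral>\<^sup>+s. ennreal (1/4) * ?u r s \<partial>time_measure) \<le> (\<integral>\<^sup>+s\<in>{0..T}. min (ennreal (\<bar>r\<bar> powr (p / 2)) *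
          R_norm_pow p h (into_subspace j (S s) i)) 1 \<partial>lborel) * indicator {0<..} r"
        using r by (simp add: nn_integral_time)
    qed
    also note fin
    finally have "ennreal (1/4) * (\<integral>\<^sup>+r. \<integral>\<^sup>+s. ?u r s \<partial>time_measure \<partial>\<rho>) < \<infinity>" .
    then show ?thesis by (auto simp: ennreal_mult_less_top)
  qed
  obtain Y where Ym: "Y \<in> borel_measurable M" and Y: "\<And>v G c. wmeas G \<Longrightarrow> (\<And>s m. s \<in> {0..T} \<Longrightarrow>
        ennreal (norm (G s - (\<Sum>k<supp m. blinfun_apply v (q m k) *\<^sub>R h k)) powr p) \<le> ennreal c * D m s) \<Longrightarrow>
      stoch_int G (\<lambda>w. blinfun_apply v (Y w))"
    using approximate_integral[where q=q and D=D and supp=supp and p=p, OF type p Dm mask supp approx tri fin'] by blast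
  obtain c where c: "0 < c" "ennreal c \<le> (\<integral>\<^sup>+\<gamma>. ennreal (\<bar>\<gamma> 0\<bar> powr p) \<partial>gauss_space)"
    using gauss_moment_pos by blast
  show thesis
  proof (rule that[OF Ym])
    fix v :: "'v \<Rightarrow>\<^sub>L real"
    define G where "G s = istar (indicator A s *\<^sub>R adjoint_apply (S s) v)" for s
    define G' where "G' s = (if s \<in> P then G s else 0)" for s
    have innG: "inner (G s) u = indicator A s * v (S s (i u))" for s u
      by (simp add: G_def adj adjoint_apply_def blinfun.scaleR_left)
    have [measurable]: "blinfun_apply v \<in> borel_measurable borel"
      by (intro borel_measurable_continuous_onI linear_continuous_on blinfun.bounded_linear_right)
    have G: "wmeas G"
    proof (rule wmeasI)
      fix u
      have [measurable]: "(\<lambda>s. S s (i u)) \<in> borel_measurable time_measure" by (rule Sm)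
      have [measurable]: "(\<lambda>s. indicator A s :: real) \<in> borel_measurable time_measure" using A by (intro time_measurable) simp
      show "(\<lambda>s. inner (G s) u) \<in> borel_measurable time_measure" unfolding innG by measurable
    qed
    have G': "wmeas G'"
    proof (rule wmeasI)
      fix u
      have "(\<lambda>s. indicator P s * inner (G s) u) \<in> borel_measurable time_measure"
        using wmeas_inner[OF G, of u] P by measurable
      also have "(\<lambda>s. indicator P s * inner (G s) u) = (\<lambda>s. inner (G' s) u)" by (auto simp: G'_def)
      finally show "(\<lambda>s. inner (G' s) u) \<in> borel_measurable time_measure" .
    qed
    \<comment> \<open>The functional v on V acts on E as the composition with \<open>j\<close>; the
      result transfers from G' to G, which agree outside the null set N.\<close>
    have "stoch_int G' (\<lambda>w. (v o\<^sub>L j) (Y w))"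
    proof (rule Y[OF G'])
      fix s m
      show "ennreal (norm (G' s - (\<Sum>k<supp m. (v o\<^sub>L j) (q m k) *\<^sub>R h k)) powr p) \<le>
          ennreal ((norm (v o\<^sub>L j) powr p + 1) / c) * D m s"
        unfolding D_def
      proof (rule norm_le_gauss_limsup[OF p(1) c])
        show "inner (G' s) (h k) = (v o\<^sub>L j) (x k s)" for k
          by (simp add: jx F_def G'_def innG P_def blinfun.zero_right)
      qed (auto intro: mask supp)
    qed
    then have "stoch_int G (\<lambda>w. (v o\<^sub>L j) (Y w))"
    proof (rule stoch_int_AE_fun[OF _ G])
      have "AE s in time_measure. s \<notin> N" using N(2,3) by (intro AE_not_in) (auto simp: null_sets_def)
      then show "AE s in time_measure. G' s = G s"
      proof (rule AE_mp[OF _ AE_I2])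
        fix s assume "s \<in> space time_measure"
        then show "s \<notin> N \<longrightarrow> G' s = G s" by (auto simp: G'_def P_def G_def istar_linear)
      qed
    qed
    then have "stoch_int (\<lambda>s. istar (indicator A s *\<^sub>R adjoint_apply (S s) v)) (\<lambda>w. v (j (Y w)))"
      unfolding G_def by simp
    then show "is_cyl_integral M L T S A v (\<lambda>w. v (j (Y w)))" by (rule is_cyl_integralI[OF S(2) A])
  qed
qed

end

section \<open>Existence of the integrals and their values in E\<close>

theorem corollary6p5:
  fixes M :: "'w measure"
    and C :: "'v::{banach, second_countable_topology} dual \<Rightarrow> 'v"
    and i :: "'h::{real_inner, complete_space} \<Rightarrow>\<^sub>L 'v"
    and h :: "nat \<Rightarrow> 'h"
    and j :: "'e::{banach, second_countable_topology} \<Rightarrow>\<^sub>L 'v"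
    and W L :: "real \<Rightarrow> 'v dual \<Rightarrow> 'w \<Rightarrow> real"
    and l :: "real \<Rightarrow> 'w \<Rightarrow> real"
    and \<rho> :: "real measure"
    and S :: "real \<Rightarrow> 'v \<Rightarrow>\<^sub>L 'v"
    and T p :: real
  assumes "prob_space M"
    and "0 < T"
    and "is_rkhs C i"
    and "orthonormal_basis h"
    and "cylindrical_wiener M C W"
    and "subordinator M \<rho> l"
    and "prob_space.indep_set M
           (generated_sigma M ({0..} \<times> UNIV) (\<lambda>(t, v). W t v))
           (generated_sigma M {0..} l)"
    and "\<And>t v. 0 \<le> t \<Longrightarrow> L t v \<in> borel_measurable M"
    and "\<And>t v. 0 \<le> t \<Longrightarrow> AE w in M. L t v w = W (l t w) v w"
    and "inj (blinfun_apply j)"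
    and "1 \<le> p" and "p \<le> 2"
    and "rademacher_type TYPE('e) p"
    and "c0_semigroup_on T S"
    and "AE t in lborel. 0 < t \<and> t \<le> T \<longrightarrow> range (blinfun_apply (S t)) \<subseteq> range (blinfun_apply j)"
    and "weakly_regulated T S"
    and "AE t in lborel. t \<in> {0..T} \<longrightarrow> gamma_radonifying h (into_subspace j (S t) i)"
    and "(\<integral>\<^sup>+r\<in>{0<..}. (\<integral>\<^sup>+s\<in>{0..T}.
            min (ennreal (\<bar>r\<bar> powr (p / 2)) * R_norm_pow p h (into_subspace j (S s) i)) 1
          \<partial>lborel) \<partial>\<rho>) < \<infinity>"
  shows "stochastically_integrable M L T S \<and>
         (\<forall>A\<in>sets borel. \<forall>I. A \<subseteq> {0..T} \<and> has_stoch_integral M L T S A I \<longrightarrow>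
            (\<exists>Y :: 'w \<Rightarrow> 'e. Y \<in> borel_measurable M \<and>
               (AE w in M. I w = blinfun_apply j (Y w))))"
proof -
  obtain istar where adj: "bounded_linear istar" "\<And>v x. inner (istar v) x = blinfun_apply v (blinfun_apply i x)"
    "\<And>v. blinfun_apply v (C v) = (norm (istar v))\<^sup>2" "closure (range istar) = UNIV"
    by (rule rkhs_adjoint[OF assms(3)]) (rule that; assumption)
  interpret subordinated_wiener_basis M C istar W L l \<rho> T h
    by (intro subordinated_wiener_basis.intro subordinated_wiener.intro subordinated_wiener_axioms.intro
        subordinated_wiener_basis_axioms.intro assms adj)
  have ex: "\<exists>Y :: 'w \<Rightarrow> 'e. Y \<in> borel_measurable M \<and>
      (\<forall>v. is_cyl_integral M L T S A v (\<lambda>w. blinfun_apply v (blinfun_apply j (Y w))))" if A: "A \<in> sets borel" for A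
    using semigroup_integral[OF assms(13,11,12,10) adj(2) assms(14,16,15,17,18) A] by blast
  have jm: "blinfun_apply j \<in> borel_measurable borel"
    by (intro borel_measurable_continuous_onI linear_continuous_on blinfun.bounded_linear_right)
  obtain vs :: "nat \<Rightarrow> 'v \<Rightarrow>\<^sub>L real" where vs: "\<And>x. (\<And>n. blinfun_apply (vs n) x = 0) \<Longrightarrow> x = 0"
    using dual_separates_countable[where 'v='v] by blast
  show ?thesis
  proof (intro conjI ballI allI impI)
    show "stochastically_integrable M L T S"
      unfolding stochastically_integrable_def
    proof (intro conjI ballI impI assms(16))
      fix A :: "real set" assume "A \<in> sets borel"
      then obtain Y :: "'w \<Rightarrow> 'e" where "Y \<in> borel_measurable M"
        "\<forall>v. is_cyl_integral M L T S A v (\<lambda>w. blinfun_apply v (blinfun_apply j (Y w)))" using ex by blast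
      then show "\<exists>I. has_stoch_integral M L T S A I" unfolding has_stoch_integral_def
        by (intro exI[of _ "\<lambda>w. blinfun_apply j (Y w)"] conjI measurable_compose[OF _ jm]) auto
    qed
  next
    fix A :: "real set" and I assume A: "A \<in> sets borel" and I: "A \<subseteq> {0..T} \<and> has_stoch_integral M L T S A I"
    obtain Y :: "'w \<Rightarrow> 'e" where Y: "Y \<in> borel_measurable M"
      "\<And>v. is_cyl_integral M L T S A v (\<lambda>w. blinfun_apply v (blinfun_apply j (Y w)))" using ex[OF A] by blast
    have Iv: "is_cyl_integral M L T S A v (\<lambda>w. blinfun_apply v (I w))" for v
      using I by (simp add: has_stoch_integral_def)
    \<comment> \<open>An arbitrary integral over A and the constructed E-valued one agree almost
      surely when tested with each functional; a countable separating family makes the exceptional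
      set common.\<close>
    have "AE w in M. \<forall>n. blinfun_apply (vs n) (I w) = blinfun_apply (vs n) (blinfun_apply j (Y w))"
      unfolding AE_all_countable by (intro allI is_cyl_integral_unique[OF Iv Y(2)])
    then have "AE w in M. I w = blinfun_apply j (Y w)"
    proof eventually_elim
      case (elim w)
      have "I w - blinfun_apply j (Y w) = 0" by (rule vs) (simp add: blinfun.diff_right elim)
      then show ?case by simp
    qed
    then show "\<exists>Y :: 'w \<Rightarrow> 'e. Y \<in> borel_measurable M \<and> (AE w in M. I w = blinfun_apply j (Y w))"
      using Y(1) by blast
  qed
qed

end
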